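(* Let $d\ge 2$ be an integer and let $0<\epsilon<1$ be a (arbitrarily small) constant. There exist constants $c>0$ and $N_0$, depending only on $d$ and $\epsilon$, such that the following holds for every integer $N\ge N_0$. Let $m,n$ be positive integers such that $mn$ is a multiple of $N$ and $$n\le\frac{(1-\epsilon)N\ln\frac{d+1}{2}}{2\ln d}$$ (in particular $n\le N/2$). Let $A_1,\ldots,A_m\subset\{1,\ldots,N\}$ be (possibly overlapping) subsystems, each consisting of exactly $n$ spins, such that each spin belongs to exactly $mn/N$ of these $m$ subsystems, and let $\bar A_j$ denote the complement of $A_j$. Let $H$ be any Hamiltonian (Hermitian operator) on $(\mathbb C^d)^{\otimes N}$ whose spectrum has non-degenerate gaps. Let $|\Psi\rangle$ be a Haar-random product state, and let $$\rho(t):=e^{-iHt}|\Psi\rangle\langle\Psi|e^{iHt},\qquad \rho_{A_j}(t):=\operatorname{tr}_{\bar A_j}\rho(t).$$ Then $$\Pr_\Psi\left(\Pr_{t\in\mathbb R}\left(\frac1m\sum_{j=1}^m S\big(\rho_{A_j}(t)\big)\ge(1-\epsilon)\,n\sum_{k=2}^d\frac1k\right)\ge 1-e^{-cN}\right)\ge 1-e^{-cN}.$$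
   Context: The system consists of $N$ spins (qudits) labeled $1,\ldots,N$, each with Hilbert space $\mathbb C^d$; the total Hilbert space is $(\mathbb C^d)^{\otimes N}$. Haar-random product state: $|\Psi\rangle=\bigotimes_{j=1}^N|\Psi_j\rangle$, where the unit vectors $|\Psi_j\rangle\in\mathbb C^d$ are independent and each is distributed uniformly (Haar measure) on the unit sphere of $\mathbb C^d$. $\Pr_\Psi$ is probability with respect to this choice. Non-degenerate gaps: the spectrum $\{E_j\}_{j=1}^{d^N}$ of $H$ (eigenvalues listed with multiplicity) has non-degenerate gaps if the differences $\{E_j-E_k\}_{j\ne k}$ are all distinct, i.e. for any $j\neq k$, $E_j-E_k=E_{j'}-E_{k'}$ implies $j=j'$ and $k=k'$. (This implies that all eigenvalues are distinct.) Von Neumann entropy: $S(\rho)=-\operatorname{tr}(\rho\ln\rho)$. $\Pr_{t\in\mathbb R}(\mathcal E(t))$ is the long-time fraction of times at which the event holds: $\lim_{\tau\to+\infty}\frac1\tau\,|\{t\in[0,\tau]:\mathcal E(t)\}|$ with $|\cdot|$ Lebesgue measure (read as $\liminf$ in case the limit is not known to exist). *)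

theory Defs
  imports "HOL-Probability.Probability" "Jordan_Normal_Form.Schur_Decomposition"
begin

text \<open>The space of \<open>N\<close> qudits has dimension \<open>d ^ N\<close>.  Spins are labelled \<open>0, \<dots>, N - 1\<close>; the index
  \<open>x < d ^ N\<close> stands for the product basis vector in which spin \<open>s\<close> is in the local basis state
  \<open>digit d x s < d\<close>, the \<open>s\<close>-th base-\<open>d\<close> digit of \<open>x\<close>.\<close>

definition digit :: "nat \<Rightarrow> nat \<Rightarrow> nat \<Rightarrow> nat" where
  "digit d x s = x div d ^ s mod d"

definition product_state :: "nat \<Rightarrow> nat \<Rightarrow> (nat \<Rightarrow> nat \<Rightarrow> complex) \<Rightarrow> complex Matrix.vec" where
  "product_state d N \<Psi> = Matrix.vec (d ^ N) (\<lambda>x. \<Prod>s<N. \<Psi> s (digit d x s))"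

text \<open>The uniform distribution on the unit sphere of \<open>\<complex>\<^sup>d\<close>, as the radial projection of the uniform
  (Lebesgue) distribution on the unit ball.  A vector is an extensional function on \<open>{..<d}\<close>.\<close>

definition sphere_measure :: "nat \<Rightarrow> (nat \<Rightarrow> complex) measure" where
  "sphere_measure d =
     distr
       (uniform_measure (\<Pi>\<^sub>M i\<in>{..<d}. lborel)
         {z \<in> space (\<Pi>\<^sub>M i\<in>{..<d}. lborel). (\<Sum>i<d. (cmod (z i))\<^sup>2) \<le> 1})
       (\<Pi>\<^sub>M i\<in>{..<d}. borel)
       (\<lambda>z. \<lambda>i\<in>{..<d}. z i / complex_of_real (sqrt (\<Sum>k<d. (cmod (z k))\<^sup>2)))"

definition product_state_measure :: "nat \<Rightarrow> nat \<Rightarrow> (nat \<Rightarrow> nat \<Rightarrow> complex) measure" where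
  "product_state_measure d N = (\<Pi>\<^sub>M s\<in>{..<N}. sphere_measure d)"

definition hermitian_mat :: "complex mat \<Rightarrow> bool" where
  "hermitian_mat A \<longleftrightarrow> mat_adjoint A = A"

definition unitary_mat :: "complex mat \<Rightarrow> bool" where
  "unitary_mat U \<longleftrightarrow>
     U * mat_adjoint U = 1\<^sub>m (dim_row U) \<and> mat_adjoint U * U = 1\<^sub>m (dim_col U)"

definition mat_trace :: "complex mat \<Rightarrow> complex" where
  "mat_trace A = (\<Sum>i<dim_row A. A $$ (i, i))"

text \<open>The list \<open>Es\<close> enumerates the eigenvalues with multiplicity.  Since \<open>j' = k'\<close> is allowed,
  the condition makes them pairwise distinct.\<close>

definition nondegenerate_gaps :: "complex mat \<Rightarrow> bool" where
  "nondegenerate_gaps H \<longleftrightarrow>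
     (\<exists>Es. char_poly H = (\<Prod>E\<leftarrow>Es. [:- E, 1:]) \<and>
        (\<forall>j k j' k'. j < length Es \<and> k < length Es \<and> j' < length Es \<and> k' < length Es \<and>
           j \<noteq> k \<and> Es ! j - Es ! k = Es ! j' - Es ! k' \<longrightarrow> j = j' \<and> k = k'))"

definition mat_exp :: "complex mat \<Rightarrow> complex mat" where
  "mat_exp A = mat (dim_row A) (dim_row A) (\<lambda>(i, j). \<Sum>k. (A ^\<^sub>m k) $$ (i, j) / fact k)"

definition ket_bra :: "complex Matrix.vec \<Rightarrow> complex mat" where
  "ket_bra v = mat (dim_vec v) (dim_vec v) (\<lambda>(i, j). vec_index v i * cnj (vec_index v j))"

definition evolved_state :: "complex mat \<Rightarrow> complex Matrix.vec \<Rightarrow> real \<Rightarrow> complex mat" where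
  "evolved_state H v t =
     mat_exp ((- \<i> * complex_of_real t) \<cdot>\<^sub>m H) * ket_bra v * mat_exp ((\<i> * complex_of_real t) \<cdot>\<^sub>m H)"

text \<open>The reduced density matrix on the subsystem \<open>A \<subseteq> {..<N}\<close>: digit \<open>k\<close> of an index of the result
  is the state of the \<open>k\<close>-th smallest spin of \<open>A\<close>, and the spins outside \<open>A\<close> are traced out.\<close>

definition restricts_to :: "nat \<Rightarrow> nat set \<Rightarrow> nat \<Rightarrow> nat \<Rightarrow> bool" where
  "restricts_to d A x a \<longleftrightarrow>
     (\<forall>k<card A. digit d x (sorted_list_of_set A ! k) = digit d a k)"

definition reduced_state :: "nat \<Rightarrow> nat \<Rightarrow> nat set \<Rightarrow> complex mat \<Rightarrow> complex mat" where
  "reduced_state d N A \<rho> = mat (d ^ card A) (d ^ card A) (\<lambda>(a, b).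
     \<Sum>(x, y) \<in> {(x, y). x < d ^ N \<and> y < d ^ N \<and> restricts_to d A x a \<and> restricts_to d A y b \<and>
                    (\<forall>s\<in>{..<N} - A. digit d x s = digit d y s)}. \<rho> $$ (x, y))"

text \<open>Functional calculus for a Hermitian matrix; the result does not depend on the
  diagonalization chosen.\<close>

definition hermitian_fun :: "(real \<Rightarrow> real) \<Rightarrow> complex mat \<Rightarrow> complex mat" where
  "hermitian_fun f A = (SOME B. \<exists>U e.
     U \<in> carrier_mat (dim_row A) (dim_row A) \<and> unitary_mat U \<and>
     A = U * mat_diag (dim_row A) (\<lambda>i. complex_of_real (e i)) * mat_adjoint U \<and>
     B = U * mat_diag (dim_row A) (\<lambda>i. complex_of_real (f (e i))) * mat_adjoint U)"

text \<open>As \<open>ln 0 = 0\<close> in HOL, zero eigenvalues contribute \<open>0 ln 0 = 0\<close>.\<close>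

definition von_neumann_entropy :: "complex mat \<Rightarrow> real" where
  "von_neumann_entropy \<rho> = - Re (mat_trace (\<rho> * hermitian_fun ln \<rho>))"

definition long_time_prob :: "(real \<Rightarrow> bool) \<Rightarrow> ereal" where
  "long_time_prob P =
     Liminf at_top (\<lambda>\<tau>::real. ereal (measure lebesgue {t \<in> {0..\<tau>}. P t} / \<tau>))"

end

theory Submission
  imports Defs "Jordan_Normal_Form.Spectral_Radius" "HOL-Real_Asymp.Real_Asymp"
begin

text \<open>Let \<open>p\<^sub>j\<close> be the squared overlap of the initial state with the \<open>j\<close>-th eigenvector of the Hamiltonian.
  A spin-by-spin Jensen argument bounds the expectation of \<open>\<Sum>\<^sub>j p\<^sub>j\<^sup>\<alpha>\<close> by \<open>(d C\<^sub>\<alpha>) ^ N\<close>, where \<open>C\<^sub>\<alpha>\<close> is the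
  \<open>\<alpha>\<close>-th moment of the squared overlap of a single random spin with a fixed unit vector.

  For \<open>\<alpha> = 2\<close> this is \<open>(2 / (d + 1)) ^ N\<close>.  Non-degenerate gaps bound the time-averaged squared
  Hilbert-Schmidt distance of a reduced state from the reduced dephased state \<open>\<sigma>\<close> by \<open>d ^ n \<Sum>\<^sub>j p\<^sub>j\<^sup>2\<close>, so
  that for almost all times the subsystems are exponentially close to those of \<open>\<sigma>\<close>.

  For \<open>\<alpha> = 1 + \<delta>\<close> it bounds a Renyi entropy, and hence the entropy of \<open>\<sigma>\<close>, from below by nearly
  \<open>N \<Sum>\<^sub>k 1 / k\<close>, since \<open>d C\<^sub>\<alpha>\<close> telescopes in \<open>d\<close>.  By strong subadditivity, Shearer's inequality holds for the
  entropy, and the average entropy of the reductions of \<open>\<sigma>\<close> is at least \<open>n / N\<close> times that of \<open>\<sigma>\<close>.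

  States are mixed with a small multiple \<open>\<eta>\<close> of the maximally mixed one: this makes them positive definite
  and gives a Lipschitz control of the entropy.\<close>

section \<open>Orthonormal bases, spectral decompositions and entropy\<close>

text \<open>The bound on \<open>n\<close> reflects two factors \<open>d ^ n\<close>: one from the
  fluctuation estimate, one from turning a squared Hilbert-Schmidt distance into a loss of entropy.
  Against the decay \<open>(2 / (d + 1)) ^ N\<close> of the second moment this is exponentially
  small once \<open>2 * n * ln d\<close> stays below \<open>N * ln ((d + 1) / 2)\<close> by a fixed
  fraction. Randomness of the state enters only through two moment sums and the almost sure
  normalisation.

  Strong subadditivity comes from monotonicity of relative entropy, and that from a quadratic
  variational formula in which a partial trace merely restricts the test matrices. The sphere is
  given as a projected ball, so its moments are found by comparing ball and Gaussian integrals of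
  functions of the direction alone. Entropy is defined through a choice of diagonalisation, while
  \<open>measure\<close> is 0 on non-measurable sets, so measurability of the event must be proved
  separately.

  States are kernels on arbitrary finite index sets, with eigenbases indexed by a set of another
  type: tensor products and subsystems then become changes of index set.\<close>

definition onb :: "'a set \<Rightarrow> 'b set \<Rightarrow> ('b \<Rightarrow> 'a \<Rightarrow> complex) \<Rightarrow> bool" where
  "onb I K u \<longleftrightarrow> finite I \<and> finite K \<and>
     (\<forall>i\<in>K. \<forall>j\<in>K. (\<Sum>x\<in>I. cnj (u i x) * u j x) = of_bool (i = j)) \<and>
     (\<forall>x\<in>I. \<forall>y\<in>I. (\<Sum>i\<in>K. u i x * cnj (u i y)) = of_bool (x = y))"

definition eigensys ::
  "'a set \<Rightarrow> 'b set \<Rightarrow> ('b \<Rightarrow> 'a \<Rightarrow> complex) \<Rightarrow> ('b \<Rightarrow> real) \<Rightarrow> ('a \<Rightarrow> 'a \<Rightarrow> complex) \<Rightarrow> bool" where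
  "eigensys I K u p M \<longleftrightarrow> onb I K u \<and>
     (\<forall>x\<in>I. \<forall>y\<in>I. M x y = (\<Sum>i\<in>K. of_real (p i) * u i x * cnj (u i y)))"

definition overlap :: "'a set \<Rightarrow> ('b \<Rightarrow> 'a \<Rightarrow> complex) \<Rightarrow> ('c \<Rightarrow> 'a \<Rightarrow> complex) \<Rightarrow> 'b \<Rightarrow> 'c \<Rightarrow> complex" where
  "overlap I u v i j = (\<Sum>x\<in>I. cnj (u i x) * v j x)"

lemma onb_finite: "onb I K u \<Longrightarrow> finite I" "onb I K u \<Longrightarrow> finite K"
  by (auto simp: onb_def)

lemma onb_ortho: "onb I K u \<Longrightarrow> i \<in> K \<Longrightarrow> j \<in> K \<Longrightarrow> (\<Sum>x\<in>I. cnj (u i x) * u j x) = of_bool (i = j)"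
  by (auto simp: onb_def)

lemma onb_complete: "onb I K u \<Longrightarrow> x \<in> I \<Longrightarrow> y \<in> I \<Longrightarrow> (\<Sum>i\<in>K. u i x * cnj (u i y)) = of_bool (x = y)"
  by (auto simp: onb_def)

lemma eigensys_onb: "eigensys I K u p M \<Longrightarrow> onb I K u"
  by (auto simp: eigensys_def)

lemma eigensys_entry:
  "eigensys I K u p M \<Longrightarrow> x \<in> I \<Longrightarrow> y \<in> I \<Longrightarrow> M x y = (\<Sum>i\<in>K. of_real (p i) * u i x * cnj (u i y))"
  by (auto simp: eigensys_def)

lemma sum_delta_mult:
  fixes f :: "'a \<Rightarrow> 'b::semiring_1"
  assumes "finite I" "y \<in> I"
  shows "(\<Sum>x\<in>I. of_bool (x = y) * f x) = f y" "(\<Sum>x\<in>I. of_bool (y = x) * f x) = f y"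
    "(\<Sum>x\<in>I. f x * of_bool (x = y)) = f y" "(\<Sum>x\<in>I. f x * of_bool (y = x)) = f y"
proof -
  have "(\<Sum>x\<in>I. of_bool (x = y) * f x) = (\<Sum>x\<in>I. if x = y then f x else 0)"
    by (rule sum.cong) auto
  then show 1: "(\<Sum>x\<in>I. of_bool (x = y) * f x) = f y" using assms by simp
  have "(\<Sum>x\<in>I. f x * of_bool (x = y)) = (\<Sum>x\<in>I. if x = y then f x else 0)"
    by (rule sum.cong) auto
  then show 2: "(\<Sum>x\<in>I. f x * of_bool (x = y)) = f y" using assms by simp
  show "(\<Sum>x\<in>I. of_bool (y = x) * f x) = f y" "(\<Sum>x\<in>I. f x * of_bool (y = x)) = f y"
    using 1 2 by (simp_all only: eq_commute[of y])
qed

lemma onb_expand: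
  assumes u: "onb I K u" and x: "x \<in> I"
  shows "(\<Sum>i\<in>K. u i x * (\<Sum>y\<in>I. cnj (u i y) * f y)) = f x"
proof -
  have "(\<Sum>i\<in>K. u i x * (\<Sum>y\<in>I. cnj (u i y) * f y)) = (\<Sum>i\<in>K. \<Sum>y\<in>I. (u i x * cnj (u i y)) * f y)"
    by (simp add: sum_distrib_left mult.assoc)
  also have "\<dots> = (\<Sum>y\<in>I. (\<Sum>i\<in>K. u i x * cnj (u i y)) * f y)"
    by (subst sum.swap) (simp add: sum_distrib_right)
  also have "\<dots> = (\<Sum>y\<in>I. of_bool (x = y) * f y)"
    by (rule sum.cong) (auto simp: onb_complete[OF u x])
  also have "\<dots> = f x" using onb_finite[OF u] x by (simp add: sum_delta_mult)
  finally show ?thesis .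
qed

lemma onb_parseval_ip:
  assumes u: "onb I K u"
  shows "(\<Sum>i\<in>K. cnj (\<Sum>x\<in>I. cnj (u i x) * f x) * (\<Sum>x\<in>I. cnj (u i x) * g x)) = (\<Sum>x\<in>I. cnj (f x) * g x)"
proof -
  have "(\<Sum>i\<in>K. cnj (\<Sum>x\<in>I. cnj (u i x) * f x) * (\<Sum>x\<in>I. cnj (u i x) * g x))
     = (\<Sum>i\<in>K. \<Sum>x\<in>I. cnj (f x) * (u i x * (\<Sum>y\<in>I. cnj (u i y) * g y)))"
  proof (rule sum.cong[OF refl])
    fix i
    have "cnj (\<Sum>x\<in>I. cnj (u i x) * f x) * G = (\<Sum>x\<in>I. cnj (f x) * (u i x * G))" for G
      by (simp add: sum_distrib_right sum_distrib_left mult_ac)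
    then show "cnj (\<Sum>x\<in>I. cnj (u i x) * f x) * (\<Sum>x\<in>I. cnj (u i x) * g x)
       = (\<Sum>x\<in>I. cnj (f x) * (u i x * (\<Sum>y\<in>I. cnj (u i y) * g y)))" .
  qed
  also have "\<dots> = (\<Sum>x\<in>I. cnj (f x) * (\<Sum>i\<in>K. u i x * (\<Sum>y\<in>I. cnj (u i y) * g y)))"
    by (subst sum.swap) (simp add: sum_distrib_left)
  also have "\<dots> = (\<Sum>x\<in>I. cnj (f x) * g x)"
    by (rule sum.cong) (auto simp: onb_expand[OF u])
  finally show ?thesis .
qed

lemma cmod_sq_eq: "complex_of_real ((cmod z)\<^sup>2) = cnj z * z"
  by (simp add: complex_norm_square mult.commute del: of_real_power)

lemma onb_parseval:
  assumes u: "onb I K u"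
  shows "(\<Sum>i\<in>K. (cmod (\<Sum>x\<in>I. cnj (u i x) * f x))\<^sup>2) = (\<Sum>x\<in>I. (cmod (f x))\<^sup>2)"
proof -
  have "complex_of_real (\<Sum>i\<in>K. (cmod (\<Sum>x\<in>I. cnj (u i x) * f x))\<^sup>2) = complex_of_real (\<Sum>x\<in>I. (cmod (f x))\<^sup>2)"
    unfolding of_real_sum cmod_sq_eq using onb_parseval_ip[OF u, of f f] .
  then show ?thesis using of_real_eq_iff by blast
qed

lemma onb_swap: "onb I K u \<Longrightarrow> onb K I (\<lambda>x i. cnj (u i x))"
  by (simp add: onb_def)

lemma onb_norm:
  assumes "onb I K u" "i \<in> K" shows "(\<Sum>x\<in>I. (cmod (u i x))\<^sup>2) = 1"
proof -
  have "complex_of_real (\<Sum>x\<in>I. (cmod (u i x))\<^sup>2) = complex_of_real 1"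
    unfolding of_real_sum cmod_sq_eq using onb_ortho[OF assms(1) assms(2) assms(2)] by simp
  then show ?thesis using of_real_eq_iff by blast
qed

lemma onb_col_norm:
  assumes "onb I K u" "x \<in> I" shows "(\<Sum>i\<in>K. (cmod (u i x))\<^sup>2) = 1"
  using onb_norm[OF onb_swap[OF assms(1)] assms(2)] by simp

lemma cmod_overlap_commute: "cmod (overlap I u v i j) = cmod (overlap I v u j i)"
proof -
  have "overlap I u v i j = cnj (overlap I v u j i)" by (simp add: overlap_def mult.commute)
  then show ?thesis by (metis complex_mod_cnj)
qed

text \<open>Parseval applied to a vector of one basis expanded in the other. Together with
  \<open>overlap_sum_right\<close> this makes the squared overlaps a doubly stochastic coupling,
  through which sums over two spectra are compared term by term.\<close>

lemma overlap_sum_left: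
  assumes "onb I K u" "onb I L v" "j \<in> L" shows "(\<Sum>i\<in>K. (cmod (overlap I u v i j))\<^sup>2) = 1"
  unfolding overlap_def by (simp add: onb_parseval[OF assms(1)] onb_norm[OF assms(2,3)])

lemma overlap_sum_right:
  assumes "onb I K u" "onb I L v" "i \<in> K" shows "(\<Sum>j\<in>L. (cmod (overlap I u v i j))\<^sup>2) = 1"
  using overlap_sum_left[OF assms(2,1,3)] by (simp only: cmod_overlap_commute[of I u v])

text \<open>Invariance of the Hilbert-Schmidt norm under independent changes of basis on the two
  sides: Parseval in \<open>x\<close> for each fixed \<open>j\<close>, then, after conjugation,
  Parseval in \<open>y\<close>.\<close>

lemma onb_parseval2:
  assumes u: "onb I K u" and v: "onb J L v"
  shows "(\<Sum>i\<in>K. \<Sum>j\<in>L. (cmod (\<Sum>x\<in>I. cnj (u i x) * (\<Sum>y\<in>J. X x y * v j y)))\<^sup>2) = (\<Sum>x\<in>I. \<Sum>y\<in>J. (cmod (X x y))\<^sup>2)"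
proof -
  have "(\<Sum>i\<in>K. \<Sum>j\<in>L. (cmod (\<Sum>x\<in>I. cnj (u i x) * (\<Sum>y\<in>J. X x y * v j y)))\<^sup>2)
    = (\<Sum>j\<in>L. \<Sum>x\<in>I. (cmod (\<Sum>y\<in>J. X x y * v j y))\<^sup>2)"
    by (subst sum.swap) (simp add: onb_parseval[OF u])
  also have "\<dots> = (\<Sum>x\<in>I. \<Sum>j\<in>L. (cmod (\<Sum>y\<in>J. cnj (v j y) * cnj (X x y)))\<^sup>2)"
  proof (subst sum.swap, intro sum.cong refl)
    fix x j
    have "cnj (\<Sum>y\<in>J. X x y * v j y) = (\<Sum>y\<in>J. cnj (v j y) * cnj (X x y))"
      by (simp add: mult.commute)
    then show "(cmod (\<Sum>y\<in>J. X x y * v j y))\<^sup>2 = (cmod (\<Sum>y\<in>J. cnj (v j y) * cnj (X x y)))\<^sup>2"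
      by (metis complex_mod_cnj)
  qed
  also have "\<dots> = (\<Sum>x\<in>I. \<Sum>y\<in>J. (cmod (X x y))\<^sup>2)"
    by (simp add: onb_parseval[OF v])
  finally show ?thesis .
qed

section \<open>Spectral decompositions and their matrix elements\<close>

lemma eigensys_apply:
  assumes e: "eigensys I K u p M" and j: "j \<in> K" and x: "x \<in> I"
  shows "(\<Sum>y\<in>I. M x y * u j y) = of_real (p j) * u j x"
proof -
  have u: "onb I K u" using e by (rule eigensys_onb)
  have "(\<Sum>y\<in>I. M x y * u j y) = (\<Sum>y\<in>I. \<Sum>i\<in>K. of_real (p i) * u i x * (cnj (u i y) * u j y))"
    by (intro sum.cong refl) (simp add: eigensys_entry[OF e x] sum_distrib_right mult.assoc)
  also have "\<dots> = (\<Sum>i\<in>K. of_real (p i) * u i x * (\<Sum>y\<in>I. cnj (u i y) * u j y))"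
    by (subst sum.swap) (simp add: sum_distrib_left)
  also have "\<dots> = (\<Sum>i\<in>K. of_real (p i) * u i x * of_bool (i = j))"
    by (rule sum.cong) (auto simp: onb_ortho[OF u _ j])
  also have "\<dots> = of_real (p j) * u j x" using onb_finite[OF u] j by (simp add: sum_delta_mult)
  finally show ?thesis .
qed

lemma eigensys_hermitian:
  assumes e: "eigensys I K u p M" and "x \<in> I" "y \<in> I"
  shows "cnj (M x y) = M y x"
  using assms by (simp add: eigensys_entry[OF e] mult_ac)

lemma eigensys_apply_left:
  assumes e: "eigensys I K u p M" and j: "j \<in> K" and y: "y \<in> I"
  shows "(\<Sum>x\<in>I. cnj (u j x) * M x y) = of_real (p j) * cnj (u j y)"
proof -
  have "(\<Sum>x\<in>I. cnj (u j x) * M x y) = cnj (\<Sum>x\<in>I. M y x * u j x)"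
    using y by (simp add: eigensys_hermitian[OF e] mult.commute)
  also have "\<dots> = of_real (p j) * cnj (u j y)"
    by (simp add: eigensys_apply[OF e j y])
  finally show ?thesis .
qed

lemma eigensys_melem_right:
  assumes e: "eigensys I L v q N" and j: "j \<in> L"
  shows "(\<Sum>x\<in>I. cnj (u i x) * (\<Sum>y\<in>I. N x y * v j y)) = of_real (q j) * overlap I u v i j"
  by (simp add: eigensys_apply[OF e j] overlap_def sum_distrib_left mult_ac)

lemma eigensys_melem_left:
  assumes e: "eigensys I K u p M" and i: "i \<in> K"
  shows "(\<Sum>x\<in>I. cnj (u i x) * (\<Sum>y\<in>I. M x y * v j y)) = of_real (p i) * overlap I u v i j"
proof -
  have "(\<Sum>x\<in>I. cnj (u i x) * (\<Sum>y\<in>I. M x y * v j y)) = (\<Sum>y\<in>I. (\<Sum>x\<in>I. cnj (u i x) * M x y) * v j y)"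
    by (simp add: sum_distrib_left sum_distrib_right mult.assoc) (rule sum.swap)
  also have "\<dots> = (\<Sum>y\<in>I. (of_real (p i) * cnj (u i y)) * v j y)"
    by (intro sum.cong refl) (simp only: eigensys_apply_left[OF e i])
  also have "\<dots> = of_real (p i) * overlap I u v i j"
    by (simp add: overlap_def sum_distrib_left mult.assoc)
  finally show ?thesis .
qed

text \<open>Between an eigenvector of \<open>M\<close> and one of \<open>N\<close> the difference
  has matrix element \<open>(p i - q j)\<close> times the overlap; invariance of the Hilbert-Schmidt
  norm does the rest. This is the bridge from distances of states to eigenvalues, used for
  uniqueness of the spectrum and for continuity of the entropy.\<close>

lemma eigensys_hs_dist:
  assumes M: "eigensys I K u p M" and N: "eigensys I L v q N"
  shows "(\<Sum>i\<in>K. \<Sum>j\<in>L. (cmod (overlap I u v i j))\<^sup>2 * (p i - q j)\<^sup>2) = (\<Sum>x\<in>I. \<Sum>y\<in>I. (cmod (M x y - N x y))\<^sup>2)"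
proof -
  have "(\<Sum>x\<in>I. cnj (u i x) * (\<Sum>y\<in>I. (M x y - N x y) * v j y)) = of_real (p i - q j) * overlap I u v i j"
    if "i \<in> K" "j \<in> L" for i j
    using eigensys_melem_left[OF M that(1), of v j] eigensys_melem_right[OF N that(2), of u i]
    by (simp add: left_diff_distrib right_diff_distrib sum_subtractf)
  then have "(\<Sum>i\<in>K. \<Sum>j\<in>L. (cmod (overlap I u v i j))\<^sup>2 * (p i - q j)\<^sup>2)
    = (\<Sum>i\<in>K. \<Sum>j\<in>L. (cmod (\<Sum>x\<in>I. cnj (u i x) * (\<Sum>y\<in>I. (M x y - N x y) * v j y)))\<^sup>2)"
    by (intro sum.cong refl) (simp add: norm_mult power_mult_distrib mult.commute del: of_real_diff)
  also have "\<dots> = (\<Sum>x\<in>I. \<Sum>y\<in>I. (cmod (M x y - N x y))\<^sup>2)"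
    using onb_parseval2[OF eigensys_onb[OF M] eigensys_onb[OF N]] by simp
  finally show ?thesis .
qed

text \<open>Functions of the spectrum do not depend on the diagonalization: a non-zero overlap forces equal
  eigenvalues.\<close>

lemma eigensys_fun_unique:
  fixes f :: "real \<Rightarrow> real"
  assumes M: "eigensys I K u p M" and N: "eigensys I L v q M"
  shows "(\<Sum>i\<in>K. f (p i)) = (\<Sum>j\<in>L. f (q j))"
proof -
  note fin = onb_finite[OF eigensys_onb[OF M]] onb_finite[OF eigensys_onb[OF N]]
  have "(\<Sum>i\<in>K. \<Sum>j\<in>L. (cmod (overlap I u v i j))\<^sup>2 * (p i - q j)\<^sup>2) = 0"
    unfolding eigensys_hs_dist[OF M N] by simp
  then have "(cmod (overlap I u v i j))\<^sup>2 * (p i - q j)\<^sup>2 = 0" if "i \<in> K" "j \<in> L" for i j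
    using that fin by (simp add: sum_nonneg_eq_0_iff sum_nonneg)
  then have *: "(cmod (overlap I u v i j))\<^sup>2 * f (p i) = (cmod (overlap I u v i j))\<^sup>2 * f (q j)" if "i \<in> K" "j \<in> L" for i j
    using that by fastforce
  have "(\<Sum>i\<in>K. f (p i)) = (\<Sum>i\<in>K. (\<Sum>j\<in>L. (cmod (overlap I u v i j))\<^sup>2) * f (p i))"
    using overlap_sum_right[OF eigensys_onb[OF M] eigensys_onb[OF N]] by simp
  also have "\<dots> = (\<Sum>i\<in>K. \<Sum>j\<in>L. (cmod (overlap I u v i j))\<^sup>2 * f (q j))"
    unfolding sum_distrib_right using * by (intro sum.cong refl) auto
  also have "\<dots> = (\<Sum>j\<in>L. (\<Sum>i\<in>K. (cmod (overlap I u v i j))\<^sup>2) * f (q j))"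
    by (subst sum.swap) (simp add: sum_distrib_right)
  also have "\<dots> = (\<Sum>j\<in>L. f (q j))"
    using overlap_sum_left[OF eigensys_onb[OF M] eigensys_onb[OF N]] by simp
  finally show ?thesis .
qed

lemma eigensys_reindex:
  assumes e: "eigensys I K u p M" and f: "bij_betw f J I" and g: "bij_betw g L K"
    and N: "\<And>x y. x \<in> J \<Longrightarrow> y \<in> J \<Longrightarrow> N x y = M (f x) (f y)"
  shows "eigensys J L (\<lambda>i x. u (g i) (f x)) (\<lambda>i. p (g i)) N"
proof -
  have u: "onb I K u" using e by (rule eigensys_onb)
  have fin: "finite J" "finite L" using onb_finite[OF u] bij_betw_finite[OF f] bij_betw_finite[OF g] by simp_all
  have fI: "f x \<in> I" if "x \<in> J" for x using f that by (auto dest: bij_betwE)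
  have gK: "g x \<in> K" if "x \<in> L" for x using g that by (auto dest: bij_betwE)
  have S: "(\<Sum>x\<in>J. h (f x)) = sum h I" for h :: "'a \<Rightarrow> complex"
    using f by (rule sum.reindex_bij_betw)
  have T: "(\<Sum>x\<in>L. h (g x)) = sum h K" for h :: "'b \<Rightarrow> complex"
    using g by (rule sum.reindex_bij_betw)
  have inj: "f x = f y \<longleftrightarrow> x = y" if "x \<in> J" "y \<in> J" for x y
    using f that by (auto simp: bij_betw_def inj_on_def)
  have inj': "g x = g y \<longleftrightarrow> x = y" if "x \<in> L" "y \<in> L" for x y
    using g that by (auto simp: bij_betw_def inj_on_def)
  show ?thesis
    unfolding eigensys_def onb_def
  proof (intro conjI ballI fin)
    fix i j assume "i \<in> L" "j \<in> L"
    then show "(\<Sum>x\<in>J. cnj (u (g i) (f x)) * u (g j) (f x)) = of_bool (i = j)"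
      unfolding S[of "\<lambda>x. cnj (u (g i) x) * u (g j) x"] by (simp only: onb_ortho[OF u] gK inj')
  next
    fix x y assume xy: "x \<in> J" "y \<in> J"
    show "(\<Sum>i\<in>L. u (g i) (f x) * cnj (u (g i) (f y))) = of_bool (x = y)"
      unfolding T[of "\<lambda>i. u i (f x) * cnj (u i (f y))"] using xy by (simp only: onb_complete[OF u] fI inj)
    show "N x y = (\<Sum>i\<in>L. of_real (p (g i)) * u (g i) (f x) * cnj (u (g i) (f y)))"
      unfolding T[of "\<lambda>i. of_real (p i) * u i (f x) * cnj (u i (f y))"] using xy
      by (simp only: N eigensys_entry[OF e] fI)
  qed
qed

lemma eigensys_quadratic_form:
  assumes e: "eigensys I K u p M"
  shows "(\<Sum>x\<in>I. \<Sum>y\<in>I. cnj (f x) * M x y * f y) = of_real (\<Sum>i\<in>K. p i * (cmod (\<Sum>x\<in>I. cnj (u i x) * f x))\<^sup>2)"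
proof -
  have "(\<Sum>x\<in>I. \<Sum>y\<in>I. cnj (f x) * M x y * f y)
      = (\<Sum>x\<in>I. \<Sum>y\<in>I. \<Sum>i\<in>K. of_real (p i) * ((cnj (f x) * u i x) * (cnj (u i y) * f y)))"
    by (intro sum.cong refl) (simp add: eigensys_entry[OF e] sum_distrib_left sum_distrib_right mult_ac)
  also have "\<dots> = (\<Sum>i\<in>K. \<Sum>x\<in>I. \<Sum>y\<in>I. of_real (p i) * ((cnj (f x) * u i x) * (cnj (u i y) * f y)))"
    by (subst sum.swap[of _ I K]) (intro sum.cong refl sum.swap)
  also have "\<dots> = (\<Sum>i\<in>K. of_real (p i) * (cnj (\<Sum>x\<in>I. cnj (u i x) * f x) * (\<Sum>x\<in>I. cnj (u i x) * f x)))"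
    by (simp add: sum_product sum_distrib_left mult_ac)
  also have "\<dots> = of_real (\<Sum>i\<in>K. p i * (cmod (\<Sum>x\<in>I. cnj (u i x) * f x))\<^sup>2)"
    unfolding of_real_sum of_real_mult cmod_sq_eq ..
  finally show ?thesis .
qed

lemma eigensys_eigenvalue:
  assumes e: "eigensys I K u p M" and i: "i \<in> K"
  shows "(\<Sum>x\<in>I. \<Sum>y\<in>I. cnj (u i x) * M x y * u i y) = of_real (p i)"
proof -
  have "(\<Sum>x\<in>I. \<Sum>y\<in>I. cnj (u i x) * M x y * u i y) = (\<Sum>x\<in>I. cnj (u i x) * (\<Sum>y\<in>I. M x y * u i y))"
    by (simp add: sum_distrib_left mult.assoc)
  also have "\<dots> = of_real (p i)"
    unfolding eigensys_melem_right[OF e i, of u i] overlap_def onb_ortho[OF eigensys_onb[OF e] i i] by simp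
  finally show ?thesis .
qed

lemma eigensys_trace:
  assumes e: "eigensys I K u p M"
  shows "(\<Sum>x\<in>I. M x x) = of_real (\<Sum>i\<in>K. p i)"
proof -
  have u: "onb I K u" using e by (rule eigensys_onb)
  have "(\<Sum>x\<in>I. M x x) = (\<Sum>x\<in>I. \<Sum>i\<in>K. of_real (p i) * (cnj (u i x) * u i x))"
    by (intro sum.cong refl) (simp add: eigensys_entry[OF e] mult_ac)
  also have "\<dots> = (\<Sum>i\<in>K. of_real (p i) * (\<Sum>x\<in>I. cnj (u i x) * u i x))"
    by (subst sum.swap) (simp add: sum_distrib_left)
  also have "\<dots> = of_real (\<Sum>i\<in>K. p i)" by (simp add: onb_ortho[OF u])
  finally show ?thesis .
qed

text \<open>The eigenbasis is indexed by natural numbers, so that the type of the index set does not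
  occur in the type of the entropy.\<close>

definition ent :: "'a set \<Rightarrow> ('a \<Rightarrow> 'a \<Rightarrow> complex) \<Rightarrow> real" where
  "ent I M = (SOME s. \<exists>(K::nat set) u p. eigensys I K u p M \<and> s = - (\<Sum>i\<in>K. p i * ln (p i)))"

lemma ent_eq:
  assumes e: "eigensys I K u p M"
  shows "ent I M = - (\<Sum>i\<in>K. p i * ln (p i))"
proof -
  have "finite K" by (rule onb_finite(2)[OF eigensys_onb[OF e]])
  \<comment> \<open>The choice in \<open>ent\<close> ranges over index sets of naturals, so
    \<open>K\<close> is enumerated first to show that the choice has a witness.\<close>
  then obtain g where g: "bij_betw g {0..<card K} K" using ex_bij_betw_nat_finite by blast
  have "eigensys I {0..<card K} (\<lambda>i x. u (g i) x) (\<lambda>i. p (g i)) M"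
    using eigensys_reindex[OF e bij_betw_id g, of M] by simp
  then have "\<exists>s. \<exists>(K::nat set) u p. eigensys I K u p M \<and> s = - (\<Sum>i\<in>K. p i * ln (p i))" by blast
  then have "\<exists>(K::nat set) u p. eigensys I K u p M \<and> ent I M = - (\<Sum>i\<in>K. p i * ln (p i))"
    unfolding ent_def by (rule someI_ex)
  then obtain L :: "nat set" and v q where e': "eigensys I L v q M" and s: "ent I M = - (\<Sum>i\<in>L. q i * ln (q i))"
    by blast
  show ?thesis unfolding s by (simp only: eigensys_fun_unique[OF e e', where f = "\<lambda>x. x * ln x"])
qed

lemma ent_reindex:
  assumes e: "eigensys I K u p M" and f: "bij_betw f J I"
    and N: "\<And>x y. x \<in> J \<Longrightarrow> y \<in> J \<Longrightarrow> N x y = M (f x) (f y)"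
  shows "ent J N = ent I M"
proof -
  have "eigensys J K (\<lambda>i x. u (id i) (f x)) (\<lambda>i. p (id i)) N"
    by (rule eigensys_reindex[OF e f bij_betw_id]) (rule N)
  from ent_eq[OF this] show ?thesis by (simp add: ent_eq[OF e])
qed

section \<open>Variational formula for the entropy\<close>

text \<open>In matrix notation, with X' the adjoint of \<open>X\<close>, this is 2 Re tr(X' \<rho>)
  - tr(X' \<sigma> X) - s tr(X \<rho> X'). For positive states it is a concave quadratic in
  \<open>X\<close>, maximised by inverting L + s R, where L is left multiplication by
  \<open>\<sigma>\<close> and R is right multiplication by \<open>\<rho>\<close>. The double
  conjugation puts the last term into the shape of \<open>eigensys_quadratic_form\<close>.\<close>

definition re_form :: "'a set \<Rightarrow> ('a \<Rightarrow> 'a \<Rightarrow> complex) \<Rightarrow> ('a \<Rightarrow> 'a \<Rightarrow> complex) \<Rightarrow> real \<Rightarrow> ('a \<Rightarrow> 'a \<Rightarrow> complex) \<Rightarrow> real" where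
  "re_form I \<rho> \<sigma> s X =
     2 * Re (\<Sum>x\<in>I. \<Sum>y\<in>I. cnj (X x y) * \<rho> x y)
     - Re (\<Sum>y\<in>I. \<Sum>x\<in>I. \<Sum>z\<in>I. cnj (X x y) * \<sigma> x z * X z y)
     - s * Re (\<Sum>x\<in>I. \<Sum>y\<in>I. \<Sum>z\<in>I. cnj (cnj (X x y)) * \<rho> y z * cnj (X x z))"

text \<open>Left multiplication by \<open>\<sigma>\<close> is diagonal in the basis \<open>v\<close>
  and right multiplication by \<open>\<rho>\<close> in the basis \<open>u\<close>. In the
  coordinates \<open>Y i j\<close> of \<open>X\<close> between these bases the form therefore
  decouples into one scalar quadratic for each pair.\<close>

lemma re_form_eigensys:
  fixes X :: "'a \<Rightarrow> 'a \<Rightarrow> complex"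
  assumes r: "eigensys I K u p \<rho>" and t: "eigensys I L v q \<sigma>"
  defines "Y \<equiv> \<lambda>i j. \<Sum>x\<in>I. cnj (v j x) * (\<Sum>y\<in>I. X x y * u i y)"
  shows "re_form I \<rho> \<sigma> s X = (\<Sum>i\<in>K. \<Sum>j\<in>L.
           2 * Re (of_real (p i) * overlap I v u j i * cnj (Y i j)) - (q j + s * p i) * (cmod (Y i j))\<^sup>2)"
proof -
  have u: "onb I K u" and v: "onb I L v" using r t by (auto dest: eigensys_onb)
  have "(\<Sum>x\<in>I. \<Sum>y\<in>I. cnj (X x y) * \<rho> x y)
     = (\<Sum>x\<in>I. \<Sum>y\<in>I. \<Sum>i\<in>K. of_real (p i) * (u i x * cnj (X x y * u i y)))"
    by (intro sum.cong refl) (simp add: eigensys_entry[OF r] sum_distrib_left mult_ac)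
  also have "\<dots> = (\<Sum>x\<in>I. \<Sum>i\<in>K. \<Sum>y\<in>I. of_real (p i) * (u i x * cnj (X x y * u i y)))"
    by (intro sum.cong refl sum.swap)
  also have "\<dots> = (\<Sum>i\<in>K. \<Sum>x\<in>I. \<Sum>y\<in>I. of_real (p i) * (u i x * cnj (X x y * u i y)))"
    by (rule sum.swap)
  also have "\<dots> = (\<Sum>i\<in>K. of_real (p i) * cnj (\<Sum>x\<in>I. cnj (u i x) * (\<Sum>y\<in>I. X x y * u i y)))"
    by (simp add: sum_distrib_left)
  also have "\<dots> = (\<Sum>i\<in>K. \<Sum>j\<in>L. of_real (p i) * overlap I v u j i * cnj (Y i j))"
  proof (intro sum.cong refl)
    fix i assume "i \<in> K"
    have "(\<Sum>x\<in>I. cnj (u i x) * (\<Sum>y\<in>I. X x y * u i y)) = (\<Sum>j\<in>L. cnj (overlap I v u j i) * Y i j)"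
      unfolding Y_def overlap_def
      using onb_parseval_ip[OF v, of "u i" "\<lambda>x. \<Sum>y\<in>I. X x y * u i y"] by simp
    then show "of_real (p i) * cnj (\<Sum>x\<in>I. cnj (u i x) * (\<Sum>y\<in>I. X x y * u i y))
       = (\<Sum>j\<in>L. of_real (p i) * overlap I v u j i * cnj (Y i j))"
      by (simp add: sum_distrib_left mult.assoc)
  qed
  finally have 1: "(\<Sum>x\<in>I. \<Sum>y\<in>I. cnj (X x y) * \<rho> x y)
     = (\<Sum>i\<in>K. \<Sum>j\<in>L. of_real (p i) * overlap I v u j i * cnj (Y i j))" .
  have "(\<Sum>y\<in>I. \<Sum>x\<in>I. \<Sum>z\<in>I. cnj (X x y) * \<sigma> x z * X z y)
      = of_real (\<Sum>y\<in>I. \<Sum>j\<in>L. q j * (cmod (\<Sum>x\<in>I. cnj (v j x) * X x y))\<^sup>2)"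
    using eigensys_quadratic_form[OF t, of "\<lambda>x. X x _"] by simp
  also have "(\<Sum>y\<in>I. \<Sum>j\<in>L. q j * (cmod (\<Sum>x\<in>I. cnj (v j x) * X x y))\<^sup>2)
      = (\<Sum>j\<in>L. q j * (\<Sum>y\<in>I. (cmod (cnj (\<Sum>x\<in>I. cnj (v j x) * X x y)))\<^sup>2))"
    by (subst sum.swap) (simp only: sum_distrib_left complex_mod_cnj)
  also have "\<dots> = (\<Sum>j\<in>L. q j * (\<Sum>i\<in>K. (cmod (Y i j))\<^sup>2))"
  proof (intro sum.cong refl arg_cong2[where f = "(*)"])
    fix j
    have "(\<Sum>y\<in>I. cnj (u i y) * cnj (\<Sum>x\<in>I. cnj (v j x) * X x y)) = cnj (Y i j)" for i
    proof -
      have "(\<Sum>y\<in>I. cnj (u i y) * cnj (\<Sum>x\<in>I. cnj (v j x) * X x y))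
          = cnj (\<Sum>y\<in>I. \<Sum>x\<in>I. cnj (v j x) * (X x y * u i y))"
        by (simp add: sum_distrib_left mult_ac)
      also have "\<dots> = cnj (Y i j)"
        unfolding Y_def by (subst sum.swap) (simp add: sum_distrib_left)
      finally show ?thesis .
    qed
    then show "(\<Sum>y\<in>I. (cmod (cnj (\<Sum>x\<in>I. cnj (v j x) * X x y)))\<^sup>2) = (\<Sum>i\<in>K. (cmod (Y i j))\<^sup>2)"
      unfolding onb_parseval[OF u, of "\<lambda>y. cnj (\<Sum>x\<in>I. cnj (v j x) * X x y)", symmetric] by simp
  qed
  finally have 2: "(\<Sum>y\<in>I. \<Sum>x\<in>I. \<Sum>z\<in>I. cnj (X x y) * \<sigma> x z * X z y)
      = of_real (\<Sum>j\<in>L. q j * (\<Sum>i\<in>K. (cmod (Y i j))\<^sup>2))" .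
  have "(\<Sum>x\<in>I. \<Sum>y\<in>I. \<Sum>z\<in>I. cnj (cnj (X x y)) * \<rho> y z * cnj (X x z))
      = of_real (\<Sum>x\<in>I. \<Sum>i\<in>K. p i * (cmod (\<Sum>y\<in>I. cnj (u i y) * cnj (X x y)))\<^sup>2)"
    unfolding eigensys_quadratic_form[OF r, of "\<lambda>y. cnj (X _ y)"] by simp
  also have "(\<Sum>x\<in>I. \<Sum>i\<in>K. p i * (cmod (\<Sum>y\<in>I. cnj (u i y) * cnj (X x y)))\<^sup>2)
      = (\<Sum>x\<in>I. \<Sum>i\<in>K. p i * (cmod (\<Sum>y\<in>I. X x y * u i y))\<^sup>2)"
  proof (intro sum.cong refl)
    fix x i
    have "(\<Sum>y\<in>I. cnj (u i y) * cnj (X x y)) = cnj (\<Sum>y\<in>I. X x y * u i y)"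
      by (simp add: mult.commute)
    then show "p i * (cmod (\<Sum>y\<in>I. cnj (u i y) * cnj (X x y)))\<^sup>2 = p i * (cmod (\<Sum>y\<in>I. X x y * u i y))\<^sup>2"
      by (simp only: complex_mod_cnj)
  qed
  also have "\<dots> = (\<Sum>i\<in>K. p i * (\<Sum>x\<in>I. (cmod (\<Sum>y\<in>I. X x y * u i y))\<^sup>2))"
    by (subst sum.swap) (simp add: sum_distrib_left)
  also have "\<dots> = (\<Sum>i\<in>K. p i * (\<Sum>j\<in>L. (cmod (Y i j))\<^sup>2))"
    unfolding Y_def by (simp add: onb_parseval[OF v])
  finally have 3: "(\<Sum>x\<in>I. \<Sum>y\<in>I. \<Sum>z\<in>I. cnj (cnj (X x y)) * \<rho> y z * cnj (X x z))
      = of_real (\<Sum>i\<in>K. p i * (\<Sum>j\<in>L. (cmod (Y i j))\<^sup>2))" .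
  have "(\<Sum>j\<in>L. q j * (\<Sum>i\<in>K. (cmod (Y i j))\<^sup>2)) = (\<Sum>i\<in>K. \<Sum>j\<in>L. q j * (cmod (Y i j))\<^sup>2)"
    by (subst sum.swap) (simp add: sum_distrib_left)
  then show ?thesis
    unfolding re_form_def 1 2 3
    by (simp add: sum_distrib_left sum_subtractf ring_distribs sum.distrib mult_ac del: of_real_sum)
qed

text \<open>With \<open>w\<close> the squared overlaps this is the maximum of
  \<open>re_form\<close>, that is, the pairing of \<open>\<rho>\<close> with the inverse of L + s R
  applied to \<open>\<rho>\<close>.\<close>

definition rel_quad :: "'b set \<Rightarrow> 'c set \<Rightarrow> ('b \<Rightarrow> 'c \<Rightarrow> real) \<Rightarrow> ('b \<Rightarrow> real) \<Rightarrow> ('c \<Rightarrow> real) \<Rightarrow> real \<Rightarrow> real" where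
  "rel_quad K L w p q s = (\<Sum>i\<in>K. \<Sum>j\<in>L. w i j * (p i)\<^sup>2 / (q j + s * p i))"

text \<open>Completing the square in the modulus of \<open>Y\<close>. Equality holds at
  \<open>Y = b / a\<close>, which is what \<open>re_form_attained\<close> exploits.\<close>

lemma re_cnj_le:
  assumes "a > 0"
  shows "2 * Re (b * cnj Y) - a * (cmod Y)\<^sup>2 \<le> (cmod b)\<^sup>2 / a"
proof -
  have "2 * Re (b * cnj Y) \<le> 2 * (cmod b * cmod Y)"
    using complex_Re_le_cmod[of "b * cnj Y"] by (simp add: norm_mult)
  moreover have "0 \<le> (cmod b - a * cmod Y)\<^sup>2 / a" using assms by simp
  then have "2 * (cmod b * cmod Y) - a * (cmod Y)\<^sup>2 \<le> (cmod b)\<^sup>2 / a"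
    using assms by (simp add: power2_diff field_simps power2_eq_square)
  ultimately show ?thesis by linarith
qed

lemma re_form_le:
  assumes r: "eigensys I K u p \<rho>" and t: "eigensys I L v q \<sigma>"
    and pos: "\<And>i. i \<in> K \<Longrightarrow> p i \<ge> 0" "\<And>j. j \<in> L \<Longrightarrow> q j > 0" and s: "s \<ge> 0"
  shows "re_form I \<rho> \<sigma> s X \<le> rel_quad K L (\<lambda>i j. (cmod (overlap I u v i j))\<^sup>2) p q s"
proof -
  have *: "2 * Re (of_real (p i) * overlap I v u j i * cnj Y) - (q j + s * p i) * (cmod Y)\<^sup>2
     \<le> (cmod (overlap I u v i j))\<^sup>2 * (p i)\<^sup>2 / (q j + s * p i)" if ij: "i \<in> K" "j \<in> L" for i j Y
  proof -
    have "q j + s * p i > 0" using pos(1)[OF ij(1)] pos(2)[OF ij(2)] s by (simp add: add_pos_nonneg)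
    from re_cnj_le[OF this, of "of_real (p i) * overlap I v u j i" Y]
    show ?thesis by (simp add: norm_mult power_mult_distrib cmod_overlap_commute[of I v u] mult_ac)
  qed
  show ?thesis
    unfolding re_form_eigensys[OF r t] rel_quad_def by (intro sum_mono *)
qed

lemma re_form_attained:
  assumes r: "eigensys I K u p \<rho>" and t: "eigensys I L v q \<sigma>"
    and pos: "\<And>i. i \<in> K \<Longrightarrow> p i \<ge> 0" "\<And>j. j \<in> L \<Longrightarrow> q j > 0" and s: "s \<ge> 0"
  shows "\<exists>X. re_form I \<rho> \<sigma> s X = rel_quad K L (\<lambda>i j. (cmod (overlap I u v i j))\<^sup>2) p q s"
proof
  have u: "onb I K u" and v: "onb I L v" using r t by (auto dest: eigensys_onb)
  \<comment> \<open>Every coordinate is set to the maximiser from \<open>re_cnj_le\<close>;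
    \<open>X\<close> is then assembled from its coordinates in the two eigenbases.\<close>
  define Z where "Z i j = of_real (p i) * overlap I v u j i / of_real (q j + s * p i)" for i j
  define X where "X x y = (\<Sum>j\<in>L. v j x * (\<Sum>i\<in>K. Z i j * cnj (u i y)))" for x y
  have Y: "(\<Sum>x\<in>I. cnj (v j x) * (\<Sum>y\<in>I. X x y * u i y)) = Z i j" if ij: "i \<in> K" "j \<in> L" for i j
  proof -
    have "(\<Sum>y\<in>I. X x y * u i y) = (\<Sum>y\<in>I. \<Sum>j\<in>L. v j x * ((\<Sum>i\<in>K. Z i j * cnj (u i y)) * u i y))" for x
      unfolding X_def by (simp add: sum_distrib_right mult.assoc)
    also have "\<And>x. \<dots> x = (\<Sum>j\<in>L. v j x * (\<Sum>y\<in>I. (\<Sum>i\<in>K. Z i j * cnj (u i y)) * u i y))"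
      by (subst sum.swap) (simp add: sum_distrib_left)
    also have "\<And>x. \<dots> x = (\<Sum>j\<in>L. v j x * (\<Sum>k\<in>K. Z k j * (\<Sum>y\<in>I. cnj (u k y) * u i y)))"
    proof -
      fix x
      have "(\<Sum>y\<in>I. (\<Sum>k\<in>K. Z k j * cnj (u k y)) * u i y) = (\<Sum>k\<in>K. Z k j * (\<Sum>y\<in>I. cnj (u k y) * u i y))" for j
        unfolding sum_distrib_right sum_distrib_left mult.assoc by (rule sum.swap)
      then show "(\<Sum>j\<in>L. v j x * (\<Sum>y\<in>I. (\<Sum>i\<in>K. Z i j * cnj (u i y)) * u i y))
        = (\<Sum>j\<in>L. v j x * (\<Sum>k\<in>K. Z k j * (\<Sum>y\<in>I. cnj (u k y) * u i y)))" by simp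
    qed
    also have "\<And>x. \<dots> x = (\<Sum>j\<in>L. v j x * Z i j)"
      using onb_ortho[OF u _ ij(1)] onb_finite[OF u] ij by (simp add: sum_delta_mult)
    finally have Xu: "(\<Sum>y\<in>I. X x y * u i y) = (\<Sum>j\<in>L. v j x * Z i j)" for x .
    have "(\<Sum>x\<in>I. cnj (v j x) * (\<Sum>y\<in>I. X x y * u i y)) = (\<Sum>k\<in>L. (\<Sum>x\<in>I. cnj (v j x) * v k x) * Z i k)"
      unfolding Xu sum_distrib_left sum_distrib_right mult.assoc[symmetric] by (rule sum.swap)
    also have "\<dots> = Z i j"
      using onb_ortho[OF v ij(2)] onb_finite[OF v] ij by (simp add: sum_delta_mult)
    finally show ?thesis .
  qed
  have "2 * Re (of_real (p i) * overlap I v u j i * cnj (Z i j)) - (q j + s * p i) * (cmod (Z i j))\<^sup>2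
     = (cmod (overlap I u v i j))\<^sup>2 * (p i)\<^sup>2 / (q j + s * p i)" if ij: "i \<in> K" "j \<in> L" for i j
  proof -
    let ?a = "q j + s * p i" and ?b = "of_real (p i) * overlap I v u j i"
    have a: "?a > 0" using pos(1)[OF ij(1)] pos(2)[OF ij(2)] s by (simp add: add_pos_nonneg)
    have "?b * cnj (Z i j) = of_real ((cmod ?b)\<^sup>2 / ?a)"
      unfolding Z_def of_real_divide cmod_sq_eq by (simp add: mult_ac)
    then have "Re (?b * cnj (Z i j)) = (cmod ?b)\<^sup>2 / ?a" by simp
    moreover have "?a * (cmod (Z i j))\<^sup>2 = (cmod ?b)\<^sup>2 / ?a"
      unfolding Z_def using a by (simp add: norm_divide norm_of_real power_divide power2_eq_square del: of_real_add)
    ultimately show ?thesis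
      by (simp add: norm_mult power_mult_distrib cmod_overlap_commute[of I v u] mult_ac)
  qed
  then show "re_form I \<rho> \<sigma> s X = rel_quad K L (\<lambda>i j. (cmod (overlap I u v i j))\<^sup>2) p q s"
    unfolding re_form_eigensys[OF r t] rel_quad_def by (intro sum.cong refl) (simp add: Y)
qed

lemma sum_if_eq:
  fixes f :: "'a \<Rightarrow> 'b::comm_monoid_add"
  assumes "finite C" "c \<in> C"
  shows "(\<Sum>d\<in>C. if c = d then f d else 0) = f c" "(\<Sum>d\<in>C. if d = c then f d else 0) = f c"
  using assms by simp_all

text \<open>The test matrix on the composite system is \<open>X\<close> tensored with the identity
  on \<open>C\<close>. In each of the three terms the identity contracts the state over
  \<open>C\<close>, so only the partial traces survive.\<close>

lemma re_form_partial_trace: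
  assumes fin: "finite C"
    and r: "\<And>x y. x \<in> I \<Longrightarrow> y \<in> I \<Longrightarrow> \<rho>1 x y = (\<Sum>c\<in>C. \<rho> (x, c) (y, c))"
    and t: "\<And>x y. x \<in> I \<Longrightarrow> y \<in> I \<Longrightarrow> \<sigma>1 x y = (\<Sum>c\<in>C. \<sigma> (x, c) (y, c))"
  shows "re_form (I \<times> C) \<rho> \<sigma> s (\<lambda>a b. if snd a = snd b then X (fst a) (fst b) else 0) = re_form I \<rho>1 \<sigma>1 s X"
proof -
  have sw: "(\<Sum>c\<in>C. \<Sum>y\<in>I. g c y) = (\<Sum>y\<in>I. \<Sum>c\<in>C. g c y)" for g :: "'a \<Rightarrow> 'b \<Rightarrow> complex"
    by (rule sum.swap)
  have S: "(\<Sum>a\<in>I \<times> C. g a) = (\<Sum>x\<in>I. \<Sum>c\<in>C. g (x, c))" for g :: "'b \<times> 'a \<Rightarrow> complex"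
    by (simp add: sum.cartesian_product)
  have if1: "cnj (if P then z else 0) * w = (if P then cnj z * w else 0)"
    "(if P then z else 0) * w = (if P then z * w else 0)" "w * (if P then z else 0) = (if P then w * z else 0)"
    "cnj (if P then z else 0) = (if P then cnj z else 0)" for P z w by auto
  have ifs: "(\<Sum>x\<in>I. if P then g x else 0) = (if P then (\<Sum>x\<in>I. g x) else 0)" for P and g :: "'b \<Rightarrow> complex" by auto
  have 1: "(\<Sum>a\<in>I \<times> C. \<Sum>b\<in>I \<times> C. cnj (if snd a = snd b then X (fst a) (fst b) else 0) * \<rho> a b)
     = (\<Sum>x\<in>I. \<Sum>y\<in>I. cnj (X x y) * \<rho>1 x y)"
  proof -
    have "(\<Sum>a\<in>I \<times> C. \<Sum>b\<in>I \<times> C. cnj (if snd a = snd b then X (fst a) (fst b) else 0) * \<rho> a b)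
      = (\<Sum>x\<in>I. \<Sum>c\<in>C. \<Sum>y\<in>I. cnj (X x y) * \<rho> (x, c) (y, c))"
      unfolding S by (intro sum.cong refl) (simp add: if1 fin sum_if_eq)
    also have "\<dots> = (\<Sum>x\<in>I. \<Sum>y\<in>I. cnj (X x y) * \<rho>1 x y)"
      by (intro sum.cong refl, subst sum.swap) (simp add: r sum_distrib_left)
    finally show ?thesis .
  qed
  have 2: "(\<Sum>b\<in>I \<times> C. \<Sum>a\<in>I \<times> C. \<Sum>e\<in>I \<times> C. cnj (if snd a = snd b then X (fst a) (fst b) else 0)
        * \<sigma> a e * (if snd e = snd b then X (fst e) (fst b) else 0))
     = (\<Sum>y\<in>I. \<Sum>x\<in>I. \<Sum>z\<in>I. cnj (X x y) * \<sigma>1 x z * X z y)"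
  proof -
    have "(\<Sum>b\<in>I \<times> C. \<Sum>a\<in>I \<times> C. \<Sum>e\<in>I \<times> C. cnj (if snd a = snd b then X (fst a) (fst b) else 0)
        * \<sigma> a e * (if snd e = snd b then X (fst e) (fst b) else 0))
      = (\<Sum>y\<in>I. \<Sum>c\<in>C. \<Sum>x\<in>I. \<Sum>z\<in>I. cnj (X x y) * \<sigma> (x, c) (z, c) * X z y)"
      unfolding S by (intro sum.cong refl) (simp add: if1 fin sum_if_eq ifs)
    also have "\<dots> = (\<Sum>y\<in>I. \<Sum>x\<in>I. \<Sum>z\<in>I. \<Sum>c\<in>C. cnj (X x y) * \<sigma> (x, c) (z, c) * X z y)"
      unfolding sw by simp
    also have "\<dots> = (\<Sum>y\<in>I. \<Sum>x\<in>I. \<Sum>z\<in>I. cnj (X x y) * \<sigma>1 x z * X z y)"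
      by (intro sum.cong refl) (simp add: t sum_distrib_left sum_distrib_right)
    finally show ?thesis .
  qed
  have 3: "(\<Sum>a\<in>I \<times> C. \<Sum>b\<in>I \<times> C. \<Sum>e\<in>I \<times> C. cnj (cnj (if snd a = snd b then X (fst a) (fst b) else 0))
        * \<rho> b e * cnj (if snd a = snd e then X (fst a) (fst e) else 0))
     = (\<Sum>x\<in>I. \<Sum>y\<in>I. \<Sum>z\<in>I. cnj (cnj (X x y)) * \<rho>1 y z * cnj (X x z))"
  proof -
    have "(\<Sum>a\<in>I \<times> C. \<Sum>b\<in>I \<times> C. \<Sum>e\<in>I \<times> C. cnj (cnj (if snd a = snd b then X (fst a) (fst b) else 0))
        * \<rho> b e * cnj (if snd a = snd e then X (fst a) (fst e) else 0))
      = (\<Sum>x\<in>I. \<Sum>c\<in>C. \<Sum>y\<in>I. \<Sum>z\<in>I. X x y * \<rho> (y, c) (z, c) * cnj (X x z))"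
      unfolding S by (intro sum.cong refl) (simp add: if1 fin sum_if_eq ifs)
    also have "\<dots> = (\<Sum>x\<in>I. \<Sum>y\<in>I. \<Sum>z\<in>I. \<Sum>c\<in>C. X x y * \<rho> (y, c) (z, c) * cnj (X x z))"
      unfolding sw by simp
    also have "\<dots> = (\<Sum>x\<in>I. \<Sum>y\<in>I. \<Sum>z\<in>I. cnj (cnj (X x y)) * \<rho>1 y z * cnj (X x z))"
      by (intro sum.cong refl) (simp add: r sum_distrib_left sum_distrib_right)
    finally show ?thesis .
  qed
  show ?thesis unfolding re_form_def 1 2 3 ..
qed

text \<open>An optimal \<open>X\<close> on the subsystem, tensored with the identity, is one
  competitor among all test matrices on the composite system and attains the same value there. The
  larger maximum can only be bigger.\<close>

lemma rel_quad_partial_trace: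
  assumes r: "eigensys (I \<times> C) K u p \<rho>" and t: "eigensys (I \<times> C) L v q \<sigma>"
    and r1: "eigensys I K1 u1 p1 \<rho>1" and t1: "eigensys I L1 v1 q1 \<sigma>1"
    and "\<And>i. i \<in> K \<Longrightarrow> p i \<ge> 0" "\<And>j. j \<in> L \<Longrightarrow> q j > 0"
    and "\<And>i. i \<in> K1 \<Longrightarrow> p1 i \<ge> 0" "\<And>j. j \<in> L1 \<Longrightarrow> q1 j > 0"
    and fin: "finite C"
    and R: "\<And>x y. x \<in> I \<Longrightarrow> y \<in> I \<Longrightarrow> \<rho>1 x y = (\<Sum>c\<in>C. \<rho> (x, c) (y, c))"
    and T: "\<And>x y. x \<in> I \<Longrightarrow> y \<in> I \<Longrightarrow> \<sigma>1 x y = (\<Sum>c\<in>C. \<sigma> (x, c) (y, c))"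
    and s: "s \<ge> 0"
  shows "rel_quad K1 L1 (\<lambda>i j. (cmod (overlap I u1 v1 i j))\<^sup>2) p1 q1 s
       \<le> rel_quad K L (\<lambda>i j. (cmod (overlap (I \<times> C) u v i j))\<^sup>2) p q s"
proof -
  obtain X where X: "re_form I \<rho>1 \<sigma>1 s X = rel_quad K1 L1 (\<lambda>i j. (cmod (overlap I u1 v1 i j))\<^sup>2) p1 q1 s"
    using re_form_attained[OF r1 t1 assms(7,8) s] by blast
  have "re_form (I \<times> C) \<rho> \<sigma> s (\<lambda>a b. if snd a = snd b then X (fst a) (fst b) else 0) = re_form I \<rho>1 \<sigma>1 s X"
    by (rule re_form_partial_trace[OF fin]) (fact R, fact T)
  then show ?thesis
    using re_form_le[OF r t assms(5,6) s, of "\<lambda>a b. if snd a = snd b then X (fst a) (fst b) else 0"] unfolding X by simp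
qed

section \<open>Strong subadditivity\<close>

text \<open>After subtraction of the divergence \<open>p * ln s\<close> the logarithm becomes that
  of \<open>q / s + p\<close>, which forgets \<open>q\<close>. This isolates the
  \<open>p ln p\<close> part of the relative entropy as behaviour at infinity; for
  \<open>p = 0\<close> both sides vanish.\<close>

lemma log_shift_limit:
  fixes p q :: real
  assumes p: "p \<ge> 0"
  shows "((\<lambda>s. p * ln (q + s * p) - p * ln s) \<longlongrightarrow> p * ln p) at_top"
proof (cases "p = 0")
  case False
  then have p: "p > 0" using p by simp
  have "((\<lambda>s. q / s + p) \<longlongrightarrow> 0 + p) at_top"
    by (intro tendsto_intros tendsto_divide_0[OF tendsto_const] filterlim_at_top_imp_at_infinity filterlim_ident)
  then have "((\<lambda>s. p * ln (q / s + p)) \<longlongrightarrow> p * ln p) at_top"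
    using p by (intro tendsto_intros) auto
  moreover have "\<forall>\<^sub>F s in at_top. p * ln (q / s + p) = p * ln (q + s * p) - p * ln s"
    using eventually_gt_at_top[of 0] eventually_gt_at_top[of "\<bar>q\<bar> / p"]
  proof eventually_elim
    case (elim s)
    then have "\<bar>q\<bar> < s * p" using p by (simp add: field_simps)
    then have "q + s * p > 0" by linarith
    moreover have "q / s + p = (q + s * p) / s" using elim by (simp add: field_simps)
    ultimately show ?case using elim by (simp add: ln_div right_diff_distrib)
  qed
  ultimately show ?thesis by (rule Lim_transform_eventually)
qed simp

text \<open>The quadratic quantity is the derivative of \<open>s \<mapsto> \<Sum> w p ln (q + s p)\<close>, whose value at \<open>0\<close> and
  asymptotics at infinity are the two terms of the relative entropy; hence the monotonicity of the
  former under partial traces is inherited by the latter.\<close>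

lemma relative_entropy_partial_trace:
  assumes r: "eigensys (I \<times> C) K u p \<rho>" and t: "eigensys (I \<times> C) L v q \<sigma>"
    and r1: "eigensys I K1 u1 p1 \<rho>1" and t1: "eigensys I L1 v1 q1 \<sigma>1"
    and pos: "\<And>i. i \<in> K \<Longrightarrow> p i \<ge> 0" "\<And>j. j \<in> L \<Longrightarrow> q j > 0"
      "\<And>i. i \<in> K1 \<Longrightarrow> p1 i \<ge> 0" "\<And>j. j \<in> L1 \<Longrightarrow> q1 j > 0"
    and fin: "finite C"
    and R: "\<And>x y. x \<in> I \<Longrightarrow> y \<in> I \<Longrightarrow> \<rho>1 x y = (\<Sum>c\<in>C. \<rho> (x, c) (y, c))"
    and T: "\<And>x y. x \<in> I \<Longrightarrow> y \<in> I \<Longrightarrow> \<sigma>1 x y = (\<Sum>c\<in>C. \<sigma> (x, c) (y, c))"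
  shows "(\<Sum>i\<in>K1. p1 i * ln (p1 i)) - (\<Sum>i\<in>K1. \<Sum>j\<in>L1. (cmod (overlap I u1 v1 i j))\<^sup>2 * (p1 i * ln (q1 j)))
       \<le> (\<Sum>i\<in>K. p i * ln (p i)) - (\<Sum>i\<in>K. \<Sum>j\<in>L. (cmod (overlap (I \<times> C) u v i j))\<^sup>2 * (p i * ln (q j)))"
proof -
  define w where "w i j = (cmod (overlap (I \<times> C) u v i j))\<^sup>2" for i j
  define w1 where "w1 i j = (cmod (overlap I u1 v1 i j))\<^sup>2" for i j
  define G where "G s = (\<Sum>i\<in>K. \<Sum>j\<in>L. w i j * (p i * ln (q j + s * p i)))" for s
  define G1 where "G1 s = (\<Sum>i\<in>K1. \<Sum>j\<in>L1. w1 i j * (p1 i * ln (q1 j + s * p1 i)))" for s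
  define h where "h s = G s - G1 s" for s
  have wsum: "(\<Sum>j\<in>L. w i j) = 1" if "i \<in> K" for i
    unfolding w_def by (rule overlap_sum_right[OF eigensys_onb[OF r] eigensys_onb[OF t] that])
  have w1sum: "(\<Sum>j\<in>L1. w1 i j) = 1" if "i \<in> K1" for i
    unfolding w1_def by (rule overlap_sum_right[OF eigensys_onb[OF r1] eigensys_onb[OF t1] that])
  have dG: "(G has_real_derivative rel_quad K L w p q s) (at s)" if "s \<ge> 0" for s
    unfolding G_def rel_quad_def
  proof (intro DERIV_sum)
    fix i j assume ij: "i \<in> K" "j \<in> L"
    have "q j + s * p i > 0" using pos(1)[OF ij(1)] pos(2)[OF ij(2)] that by (simp add: add_pos_nonneg)
    then show "((\<lambda>s. w i j * (p i * ln (q j + s * p i))) has_real_derivative w i j * (p i)\<^sup>2 / (q j + s * p i)) (at s)"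
      by (auto intro!: derivative_eq_intros simp: power2_eq_square field_simps)
  qed
  have dG1: "(G1 has_real_derivative rel_quad K1 L1 w1 p1 q1 s) (at s)" if "s \<ge> 0" for s
    unfolding G1_def rel_quad_def
  proof (intro DERIV_sum)
    fix i j assume ij: "i \<in> K1" "j \<in> L1"
    have "q1 j + s * p1 i > 0" using pos(3)[OF ij(1)] pos(4)[OF ij(2)] that by (simp add: add_pos_nonneg)
    then show "((\<lambda>s. w1 i j * (p1 i * ln (q1 j + s * p1 i))) has_real_derivative w1 i j * (p1 i)\<^sup>2 / (q1 j + s * p1 i)) (at s)"
      by (auto intro!: derivative_eq_intros simp: power2_eq_square field_simps)
  qed
  have mono: "h 0 \<le> h s" if "s \<ge> 0" for s
  proof (rule DERIV_nonneg_imp_nondecreasing[OF that])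
    fix x :: real assume x: "0 \<le> x" "x \<le> s"
    have "rel_quad K1 L1 w1 p1 q1 x \<le> rel_quad K L w p q x"
      unfolding w_def w1_def by (rule rel_quad_partial_trace[OF r t r1 t1 pos fin _ _ x(1)]) (auto intro: R T)
    then show "\<exists>y. (h has_real_derivative y) (at x) \<and> 0 \<le> y"
      unfolding h_def using DERIV_diff[OF dG[OF x(1)] dG1[OF x(1)]]
      by (intro exI[of _ "rel_quad K L w p q x - rel_quad K1 L1 w1 p1 q1 x"]) auto
  qed
  have limG: "((\<lambda>s. G s - (\<Sum>i\<in>K. p i) * ln s) \<longlongrightarrow> (\<Sum>i\<in>K. p i * ln (p i))) at_top"
  proof -
    have "((\<lambda>s. \<Sum>i\<in>K. \<Sum>j\<in>L. w i j * (p i * ln (q j + s * p i) - p i * ln s)) \<longlongrightarrow> (\<Sum>i\<in>K. \<Sum>j\<in>L. w i j * (p i * ln (p i)))) at_top"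
      by (intro tendsto_intros log_shift_limit pos(1))
    moreover have "(\<Sum>i\<in>K. \<Sum>j\<in>L. w i j * (p i * ln (q j + s * p i) - p i * ln s)) = G s - (\<Sum>i\<in>K. p i) * ln s" for s
      using wsum by (simp add: G_def right_diff_distrib sum_subtractf sum_distrib_right[symmetric])
    moreover have "(\<Sum>i\<in>K. \<Sum>j\<in>L. w i j * (p i * ln (p i))) = (\<Sum>i\<in>K. p i * ln (p i))"
      using wsum by (simp add: sum_distrib_right[symmetric])
    ultimately show ?thesis by simp
  qed
  have limG1: "((\<lambda>s. G1 s - (\<Sum>i\<in>K1. p1 i) * ln s) \<longlongrightarrow> (\<Sum>i\<in>K1. p1 i * ln (p1 i))) at_top"
  proof -
    have "((\<lambda>s. \<Sum>i\<in>K1. \<Sum>j\<in>L1. w1 i j * (p1 i * ln (q1 j + s * p1 i) - p1 i * ln s)) \<longlongrightarrow> (\<Sum>i\<in>K1. \<Sum>j\<in>L1. w1 i j * (p1 i * ln (p1 i)))) at_top"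
      by (intro tendsto_intros log_shift_limit pos(3))
    moreover have "(\<Sum>i\<in>K1. \<Sum>j\<in>L1. w1 i j * (p1 i * ln (q1 j + s * p1 i) - p1 i * ln s)) = G1 s - (\<Sum>i\<in>K1. p1 i) * ln s" for s
      using w1sum by (simp add: G1_def right_diff_distrib sum_subtractf sum_distrib_right[symmetric])
    moreover have "(\<Sum>i\<in>K1. \<Sum>j\<in>L1. w1 i j * (p1 i * ln (p1 i))) = (\<Sum>i\<in>K1. p1 i * ln (p1 i))"
      using w1sum by (simp add: sum_distrib_right[symmetric])
    ultimately show ?thesis by simp
  qed
  \<comment> \<open>A partial trace preserves the trace, so the divergent multiples of
    \<open>ln s\<close> in \<open>G\<close> and \<open>G1\<close> cancel and \<open>h\<close> has a
    finite limit.\<close>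
  have "(\<Sum>x\<in>I. \<rho>1 x x) = (\<Sum>a\<in>I \<times> C. \<rho> a a)"
    by (simp add: R sum.cartesian_product)
  then have "complex_of_real (\<Sum>i\<in>K1. p1 i) = complex_of_real (\<Sum>i\<in>K. p i)"
    unfolding eigensys_trace[OF r1] eigensys_trace[OF r] .
  then have tr: "(\<Sum>i\<in>K1. p1 i) = (\<Sum>i\<in>K. p i)" using of_real_eq_iff by blast
  have "(h \<longlongrightarrow> (\<Sum>i\<in>K. p i * ln (p i)) - (\<Sum>i\<in>K1. p1 i * ln (p1 i))) at_top"
    using tendsto_diff[OF limG limG1] unfolding h_def tr by simp
  then have "h 0 \<le> (\<Sum>i\<in>K. p i * ln (p i)) - (\<Sum>i\<in>K1. p1 i * ln (p1 i))"
    by (rule tendsto_lowerbound) (auto intro: eventually_mono[OF eventually_ge_at_top[of 0]] mono)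
  then show ?thesis unfolding h_def G_def G1_def w_def w1_def by simp
qed

lemma cnj_of_bool [simp]: "cnj (of_bool P) = of_bool P"
  by (cases P) auto

text \<open>Product eigenvectors diagonalise the identity on \<open>K\<close> tensored with
  \<open>M\<close>; each eigenvalue is repeated once for every element of \<open>K\<close>. The
  identity is left unnormalised, so that relative entropy to this operator is a plain difference of
  entropies.\<close>

lemma eigensys_tensor_id:
  assumes M: "eigensys I L v q M" and K: "finite K"
  shows "eigensys (K \<times> I) (K \<times> L) (\<lambda>kj lx. of_bool (fst lx = fst kj) * v (snd kj) (snd lx)) (\<lambda>kj. q (snd kj))
    (\<lambda>kx ly. of_bool (fst kx = fst ly) * M (snd kx) (snd ly))"
proof -
  have v: "onb I L v" using M by (rule eigensys_onb)
  have S: "(\<Sum>a\<in>K \<times> J. g a) = (\<Sum>k\<in>K. \<Sum>x\<in>J. g (k, x))" for g :: "'c \<times> 'd \<Rightarrow> complex" and J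
    by (simp add: sum.cartesian_product)
  have S': "(\<Sum>a\<in>K \<times> J. g a) = (\<Sum>k\<in>K. \<Sum>x\<in>J. g (k, x))" for g :: "'c \<times> 'b \<Rightarrow> complex" and J
    by (simp add: sum.cartesian_product)
  have S'': "(\<Sum>a\<in>K \<times> J. g a) = (\<Sum>k\<in>K. \<Sum>x\<in>J. g (k, x))" for g :: "'c \<times> 'a \<Rightarrow> complex" and J
    by (simp add: sum.cartesian_product)
  have d: "(\<Sum>k\<in>K. of_bool (k = a) * (of_bool (k = b) * g k)) = of_bool (a = b) * g a"
    "(\<Sum>k\<in>K. of_bool (a = k) * (of_bool (b = k) * g k)) = of_bool (a = b) * g a" if "a \<in> K" for a b and g :: "'c \<Rightarrow> complex"
    using sum_delta_mult(1)[OF K that, of "\<lambda>k. of_bool (k = b) * g k"]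
      sum_delta_mult(2)[OF K that, of "\<lambda>k. of_bool (b = k) * g k"] by (simp_all only: eq_commute[of b a])
  show ?thesis
    unfolding eigensys_def onb_def
  proof (intro conjI ballI)
    show "finite (K \<times> I)" "finite (K \<times> L)" using K onb_finite[OF v] by auto
  next
    fix a b assume ab: "a \<in> K \<times> L" "b \<in> K \<times> L"
    have "(\<Sum>x\<in>K \<times> I. cnj (of_bool (fst x = fst a) * v (snd a) (snd x)) * (of_bool (fst x = fst b) * v (snd b) (snd x)))
       = (\<Sum>k\<in>K. of_bool (k = fst a) * (of_bool (k = fst b) * (\<Sum>x\<in>I. cnj (v (snd a) x) * v (snd b) x)))"
      unfolding S'' by (simp add: sum_distrib_left mult_ac)
    also have "\<dots> = of_bool (a = b)"
      using ab onb_ortho[OF v, of "snd a" "snd b"] by (subst d) (auto simp: prod_eq_iff)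
    finally show "(\<Sum>x\<in>K \<times> I. cnj (of_bool (fst x = fst a) * v (snd a) (snd x)) * (of_bool (fst x = fst b) * v (snd b) (snd x)))
       = of_bool (a = b)" .
  next
    fix x y assume xy: "x \<in> K \<times> I" "y \<in> K \<times> I"
    have "(\<Sum>i\<in>K \<times> L. of_bool (fst x = fst i) * v (snd i) (snd x) * cnj (of_bool (fst y = fst i) * v (snd i) (snd y)))
       = (\<Sum>k\<in>K. of_bool (fst x = k) * (of_bool (fst y = k) * (\<Sum>j\<in>L. v j (snd x) * cnj (v j (snd y)))))"
      unfolding S' by (simp add: sum_distrib_left mult_ac)
    also have "\<dots> = of_bool (x = y)"
      using xy onb_complete[OF v, of "snd x" "snd y"] by (subst d) (auto simp: prod_eq_iff)
    finally show "(\<Sum>i\<in>K \<times> L. of_bool (fst x = fst i) * v (snd i) (snd x) * cnj (of_bool (fst y = fst i) * v (snd i) (snd y)))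
       = of_bool (x = y)" .
    have "(\<Sum>i\<in>K \<times> L. of_real (q (snd i)) * (of_bool (fst x = fst i) * v (snd i) (snd x)) * cnj (of_bool (fst y = fst i) * v (snd i) (snd y)))
       = (\<Sum>k\<in>K. of_bool (fst x = k) * (of_bool (fst y = k) * (\<Sum>j\<in>L. of_real (q j) * v j (snd x) * cnj (v j (snd y)))))"
      unfolding S' by (simp add: sum_distrib_left mult_ac)
    also have "\<dots> = of_bool (fst x = fst y) * M (snd x) (snd y)"
      using xy by (subst d) (auto simp: eigensys_entry[OF M])
    finally show "of_bool (fst x = fst y) * M (snd x) (snd y)
      = (\<Sum>i\<in>K \<times> L. of_real (q (snd i)) * (of_bool (fst x = fst i) * v (snd i) (snd x)) * cnj (of_bool (fst y = fst i) * v (snd i) (snd y)))"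
      by simp
  qed
qed

text \<open>Pairing \<open>\<rho>\<close> with the identity tensored with a function of
  \<open>\<sigma>\<close> only sees the partial trace of \<open>\<rho>\<close>, which is
  \<open>\<sigma>\<close> itself. For \<open>g = ln\<close> the cross term of the relative entropy
  thus becomes minus the entropy of \<open>\<sigma>\<close>.\<close>

lemma cross_entropy_tensor_id:
  assumes r: "eigensys (K \<times> I) A u p \<rho>" and t: "eigensys I L v q \<sigma>" and K: "finite K"
    and T: "\<And>x y. x \<in> I \<Longrightarrow> y \<in> I \<Longrightarrow> \<sigma> x y = (\<Sum>k\<in>K. \<rho> (k, x) (k, y))"
  shows "(\<Sum>i\<in>A. \<Sum>kj\<in>K \<times> L. (cmod (overlap (K \<times> I) u (\<lambda>kj lx. of_bool (fst lx = fst kj) * v (snd kj) (snd lx)) i kj))\<^sup>2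
      * (p i * g (q (snd kj)))) = (\<Sum>j\<in>L. q j * g (q j))"
proof -
  define V where "V kj lx = of_bool (fst lx = (fst kj :: 'a)) * v (snd kj) (snd lx)" for kj lx
  have v: "onb I L v" using t by (rule eigensys_onb)
  have S: "(\<Sum>a\<in>K \<times> I. h a) = (\<Sum>k\<in>K. \<Sum>x\<in>I. h (k, x))" for h :: "'a \<times> 'b \<Rightarrow> complex"
    by (simp add: sum.cartesian_product)
  have qf: "complex_of_real (\<Sum>i\<in>A. p i * (cmod (overlap (K \<times> I) u V i (k, j)))\<^sup>2)
      = (\<Sum>x\<in>I. \<Sum>y\<in>I. cnj (v j x) * \<rho> (k, x) (k, y) * v j y)" if k: "k \<in> K" for k j
  proof -
    have "complex_of_real (\<Sum>i\<in>A. p i * (cmod (overlap (K \<times> I) u V i (k, j)))\<^sup>2)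
      = (\<Sum>a\<in>K \<times> I. \<Sum>b\<in>K \<times> I. cnj (V (k, j) a) * \<rho> a b * V (k, j) b)"
      unfolding overlap_def by (rule eigensys_quadratic_form[OF r, symmetric])
    also have "\<dots> = (\<Sum>l\<in>K. \<Sum>x\<in>I. \<Sum>m\<in>K. \<Sum>y\<in>I. of_bool (l = k) * (of_bool (m = k) * (cnj (v j x) * \<rho> (l, x) (m, y) * v j y)))"
      unfolding S V_def by (simp add: mult_ac)
    also have "\<dots> = (\<Sum>l\<in>K. of_bool (l = k) * (\<Sum>x\<in>I. \<Sum>m\<in>K. of_bool (m = k) * (\<Sum>y\<in>I. cnj (v j x) * \<rho> (l, x) (m, y) * v j y)))"
      by (simp add: sum_distrib_left mult_ac)
    also have "\<dots> = (\<Sum>x\<in>I. \<Sum>y\<in>I. cnj (v j x) * \<rho> (k, x) (k, y) * v j y)"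
      using K k by (simp only: sum_delta_mult)
    finally show ?thesis .
  qed
  have qj: "(\<Sum>k\<in>K. \<Sum>i\<in>A. p i * (cmod (overlap (K \<times> I) u V i (k, j)))\<^sup>2) = q j" if j: "j \<in> L" for j
  proof -
    have "complex_of_real (\<Sum>k\<in>K. \<Sum>i\<in>A. p i * (cmod (overlap (K \<times> I) u V i (k, j)))\<^sup>2)
      = (\<Sum>k\<in>K. complex_of_real (\<Sum>i\<in>A. p i * (cmod (overlap (K \<times> I) u V i (k, j)))\<^sup>2))"
      by (rule of_real_sum)
    also have "\<dots> = (\<Sum>k\<in>K. \<Sum>x\<in>I. \<Sum>y\<in>I. cnj (v j x) * \<rho> (k, x) (k, y) * v j y)"
      by (intro sum.cong refl qf)
    also have "\<dots> = (\<Sum>x\<in>I. \<Sum>k\<in>K. \<Sum>y\<in>I. cnj (v j x) * \<rho> (k, x) (k, y) * v j y)"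
      by (rule sum.swap)
    also have "\<dots> = (\<Sum>x\<in>I. \<Sum>y\<in>I. \<Sum>k\<in>K. cnj (v j x) * \<rho> (k, x) (k, y) * v j y)"
      by (intro sum.cong refl sum.swap)
    also have "\<dots> = (\<Sum>x\<in>I. \<Sum>y\<in>I. cnj (v j x) * \<sigma> x y * v j y)"
      by (intro sum.cong refl) (simp add: T sum_distrib_left sum_distrib_right)
    also have "\<dots> = of_real (q j)" by (rule eigensys_eigenvalue[OF t j])
    finally show ?thesis using of_real_eq_iff by blast
  qed
  have "(\<Sum>i\<in>A. \<Sum>kj\<in>K \<times> L. (cmod (overlap (K \<times> I) u V i kj))\<^sup>2 * (p i * g (q (snd kj))))
      = (\<Sum>kj\<in>K \<times> L. (\<Sum>i\<in>A. p i * (cmod (overlap (K \<times> I) u V i kj))\<^sup>2) * g (q (snd kj)))"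
    by (subst sum.swap) (simp add: sum_distrib_right sum_distrib_left mult_ac)
  also have "\<dots> = (\<Sum>k\<in>K. \<Sum>j\<in>L. (\<Sum>i\<in>A. p i * (cmod (overlap (K \<times> I) u V i (k, j)))\<^sup>2) * g (q j))"
    by (simp add: sum.cartesian_product split_def)
  also have "\<dots> = (\<Sum>j\<in>L. (\<Sum>k\<in>K. \<Sum>i\<in>A. p i * (cmod (overlap (K \<times> I) u V i (k, j)))\<^sup>2) * g (q j))"
    by (subst sum.swap) (simp add: sum_distrib_right)
  also have "\<dots> = (\<Sum>j\<in>L. q j * g (q j))" by (simp add: qj)
  finally show ?thesis unfolding V_def .
qed

lemma overlap_reindex:
  assumes "bij_betw f J I"
  shows "overlap J (\<lambda>i x. u i (f x)) (\<lambda>j x. v j (f x)) i j = overlap I u v i j"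
  unfolding overlap_def using assms by (rule sum.reindex_bij_betw)

text \<open>The relative entropy of \<open>\<rho>\<close> to the identity on \<open>K\<close>
  tensored with its own marginal equals the entropy of the marginal minus that of
  \<open>\<rho>\<close>. Tracing out \<open>C\<close> turns this into the same expression for
  \<open>\<rho>1\<close> and \<open>\<sigma>1\<close> and cannot increase it.\<close>

theorem strong_subadditivity:
  assumes r: "eigensys (K \<times> (I \<times> C)) A u p \<rho>" and t: "eigensys (I \<times> C) B v q \<sigma>"
    and r1: "eigensys (K \<times> I) A1 u1 p1 \<rho>1" and t1: "eigensys I B1 v1 q1 \<sigma>1"
    and pos: "\<And>i. i \<in> A \<Longrightarrow> p i \<ge> 0" "\<And>j. j \<in> B \<Longrightarrow> q j > 0"
      "\<And>i. i \<in> A1 \<Longrightarrow> p1 i \<ge> 0" "\<And>j. j \<in> B1 \<Longrightarrow> q1 j > 0"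
    and fin: "finite K" "finite C"
    and T: "\<And>a b. a \<in> I \<times> C \<Longrightarrow> b \<in> I \<times> C \<Longrightarrow> \<sigma> a b = (\<Sum>k\<in>K. \<rho> (k, a) (k, b))"
    and R: "\<And>k x l y. k \<in> K \<Longrightarrow> x \<in> I \<Longrightarrow> l \<in> K \<Longrightarrow> y \<in> I \<Longrightarrow>
              \<rho>1 (k, x) (l, y) = (\<Sum>c\<in>C. \<rho> (k, (x, c)) (l, (y, c)))"
    and T1: "\<And>x y. x \<in> I \<Longrightarrow> y \<in> I \<Longrightarrow> \<sigma>1 x y = (\<Sum>k\<in>K. \<rho>1 (k, x) (k, y))"
  shows "ent (K \<times> (I \<times> C)) \<rho> - ent (I \<times> C) \<sigma> \<le> ent (K \<times> I) \<rho>1 - ent I \<sigma>1"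
proof -
  \<comment> \<open>Reassociation of the three factors, so that the system \<open>C\<close> to be
    traced out is the right component of a pair.\<close>
  define f :: "('a \<times> 'b) \<times> 'c \<Rightarrow> 'a \<times> 'b \<times> 'c" where "f = (\<lambda>((k, x), c). (k, (x, c)))"
  let ?V = "\<lambda>kj lx. of_bool (fst lx = fst kj) * v (snd kj) (snd lx)"
  let ?V1 = "\<lambda>kj lx. of_bool (fst lx = fst kj) * v1 (snd kj) (snd lx)"
  have f: "bij_betw f ((K \<times> I) \<times> C) (K \<times> (I \<times> C))"
    unfolding f_def by (rule bij_betw_byWitness[where f' = "\<lambda>(k, (x, c)). ((k, x), c)"]) auto
  have r': "eigensys ((K \<times> I) \<times> C) A (\<lambda>i x. u i (f x)) (\<lambda>i. p i) (\<lambda>a b. \<rho> (f a) (f b))"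
    using eigensys_reindex[OF r f bij_betw_id, of "\<lambda>a b. \<rho> (f a) (f b)"] unfolding id_apply by blast
  have t': "eigensys ((K \<times> I) \<times> C) (K \<times> B) (\<lambda>i x. ?V i (f x)) (\<lambda>kj. q (snd kj))
      (\<lambda>a b. of_bool (fst (f a) = fst (f b)) * \<sigma> (snd (f a)) (snd (f b)))"
    using eigensys_reindex[OF eigensys_tensor_id[OF t fin(1)] f bij_betw_id, of "\<lambda>a b. of_bool (fst (f a) = fst (f b)) * \<sigma> (snd (f a)) (snd (f b))"]
    unfolding id_apply by blast
  have main: "(\<Sum>i\<in>A1. p1 i * ln (p1 i)) - (\<Sum>i\<in>A1. \<Sum>j\<in>K \<times> B1. (cmod (overlap (K \<times> I) u1 ?V1 i j))\<^sup>2 * (p1 i * ln (q1 (snd j))))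
     \<le> (\<Sum>i\<in>A. p i * ln (p i)) - (\<Sum>i\<in>A. \<Sum>j\<in>K \<times> B.
         (cmod (overlap ((K \<times> I) \<times> C) (\<lambda>i x. u i (f x)) (\<lambda>i x. ?V i (f x)) i j))\<^sup>2 * (p i * ln (q (snd j))))"
  proof (rule relative_entropy_partial_trace[OF r' t' r1 eigensys_tensor_id[OF t1 fin(1)]])
    fix x y assume xy: "x \<in> K \<times> I" "y \<in> K \<times> I"
    show "\<rho>1 x y = (\<Sum>c\<in>C. \<rho> (f (x, c)) (f (y, c)))"
      using xy R by (cases x; cases y) (auto simp: f_def)
    have "\<sigma>1 (snd x) (snd y) = (\<Sum>k\<in>K. \<Sum>c\<in>C. \<rho> (k, (snd x, c)) (k, (snd y, c)))"
      using xy T1[of "snd x" "snd y"] R by auto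
    also have "\<dots> = (\<Sum>c\<in>C. \<Sum>k\<in>K. \<rho> (k, (snd x, c)) (k, (snd y, c)))" by (rule sum.swap)
    also have "\<dots> = (\<Sum>c\<in>C. \<sigma> (snd x, c) (snd y, c))" using xy T by auto
    finally show "of_bool (fst x = fst y) * \<sigma>1 (snd x) (snd y) =
       (\<Sum>c\<in>C. of_bool (fst (f (x, c)) = fst (f (y, c))) * \<sigma> (snd (f (x, c))) (snd (f (y, c))))"
      by (cases x; cases y) (auto simp: f_def sum_distrib_left)
  qed (use pos fin in auto)
  have ov: "overlap ((K \<times> I) \<times> C) (\<lambda>i x. u i (f x)) (\<lambda>i x. ?V i (f x)) i j
      = overlap (K \<times> (I \<times> C)) u ?V i j" for i j
    using overlap_reindex[OF f, of u ?V i j] by simp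
  have c: "(\<Sum>i\<in>A. \<Sum>j\<in>K \<times> B. (cmod (overlap (K \<times> (I \<times> C)) u ?V i j))\<^sup>2 * (p i * ln (q (snd j)))) = (\<Sum>j\<in>B. q j * ln (q j))"
    by (rule cross_entropy_tensor_id[OF r t fin(1) T])
  have c1: "(\<Sum>i\<in>A1. \<Sum>j\<in>K \<times> B1. (cmod (overlap (K \<times> I) u1 ?V1 i j))\<^sup>2 * (p1 i * ln (q1 (snd j)))) = (\<Sum>j\<in>B1. q1 j * ln (q1 j))"
    by (rule cross_entropy_tensor_id[OF r1 t1 fin(1) T1])
  show ?thesis
    using main unfolding ov c c1 ent_eq[OF r] ent_eq[OF t] ent_eq[OF r1] ent_eq[OF t1] by simp
qed

section \<open>The spectral theorem\<close>

definition hermitian_on :: "'a set \<Rightarrow> ('a \<Rightarrow> 'a \<Rightarrow> complex) \<Rightarrow> bool" where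
  "hermitian_on I M \<longleftrightarrow> (\<forall>x\<in>I. \<forall>y\<in>I. cnj (M x y) = M y x)"

definition mmul :: "'a set \<Rightarrow> ('a \<Rightarrow> 'a \<Rightarrow> complex) \<Rightarrow> ('a \<Rightarrow> 'a \<Rightarrow> complex) \<Rightarrow> 'a \<Rightarrow> 'a \<Rightarrow> complex" where
  "mmul I A B x y = (\<Sum>z\<in>I. A x z * B z y)"

lemma mmul_assoc: "mmul I (mmul I A B) C x y = mmul I A (mmul I B C) x y"
proof -
  have "mmul I (mmul I A B) C x y = (\<Sum>z\<in>I. \<Sum>w\<in>I. A x w * (B w z * C z y))"
    by (simp add: mmul_def sum_distrib_right mult.assoc)
  also have "\<dots> = mmul I A (mmul I B C) x y"
    by (subst sum.swap) (simp add: mmul_def sum_distrib_left)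
  finally show ?thesis .
qed

lemma mmul_cong:
  "(\<And>z. z \<in> I \<Longrightarrow> A x z = A' x z) \<Longrightarrow> (\<And>z. z \<in> I \<Longrightarrow> B z y = B' z y) \<Longrightarrow> mmul I A B x y = mmul I A' B' x y"
  by (simp add: mmul_def)

lemma mmul_id:
  assumes "finite I" "x \<in> I" "y \<in> I"
  shows "mmul I (\<lambda>x z. of_bool (x = z)) B x y = B x y" "mmul I A (\<lambda>x z. of_bool (x = z)) x y = A x y"
  using assms by (simp_all add: mmul_def sum_delta_mult)

lemma unitary_conj_entries:
  assumes N: "\<And>x y. x \<in> I \<Longrightarrow> y \<in> I \<Longrightarrow> N x y = (\<Sum>i\<in>K. of_real (p i) * U i x * cnj (U i y))"
  shows "(\<Sum>i\<in>K. of_real (p i) * (\<Sum>z\<in>I. R x z * U i z) * cnj (\<Sum>z\<in>I. R y z * U i z))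
     = mmul I R (mmul I N (\<lambda>a b. cnj (R b a))) x y"
proof -
  have "(\<Sum>i\<in>K. of_real (p i) * (\<Sum>z\<in>I. R x z * U i z) * cnj (\<Sum>z\<in>I. R y z * U i z))
    = (\<Sum>i\<in>K. \<Sum>z\<in>I. \<Sum>w\<in>I. R x z * (of_real (p i) * U i z * cnj (U i w)) * cnj (R y w))"
    by (simp add: sum_distrib_left sum_distrib_right mult_ac)
  also have "\<dots> = (\<Sum>z\<in>I. \<Sum>i\<in>K. \<Sum>w\<in>I. R x z * (of_real (p i) * U i z * cnj (U i w)) * cnj (R y w))"
    by (rule sum.swap)
  also have "\<dots> = (\<Sum>z\<in>I. \<Sum>w\<in>I. \<Sum>i\<in>K. R x z * (of_real (p i) * U i z * cnj (U i w)) * cnj (R y w))"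
    by (intro sum.cong refl sum.swap)
  also have "\<dots> = (\<Sum>z\<in>I. \<Sum>w\<in>I. R x z * N z w * cnj (R y w))"
    by (intro sum.cong refl) (simp add: N sum_distrib_left sum_distrib_right)
  also have "\<dots> = mmul I R (mmul I N (\<lambda>a b. cnj (R b a))) x y"
    by (simp add: mmul_def sum_distrib_left mult.assoc)
  finally show ?thesis .
qed

lemma eigensys_unitary_conj:
  assumes N: "eigensys I K U p N" and R: "onb I I (\<lambda>x z. cnj (R x z))"
    and M: "\<And>x y. x \<in> I \<Longrightarrow> y \<in> I \<Longrightarrow> M x y = mmul I R (mmul I N (\<lambda>a b. cnj (R b a))) x y"
  shows "eigensys I K (\<lambda>i x. \<Sum>z\<in>I. R x z * U i z) p M"
proof -
  have U: "onb I K U" using N by (rule eigensys_onb)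
  note fin = onb_finite[OF U]
  show ?thesis
    unfolding eigensys_def onb_def
  proof (intro conjI ballI fin)
    fix i j assume ij: "i \<in> K" "j \<in> K"
    show "(\<Sum>x\<in>I. cnj (\<Sum>z\<in>I. R x z * U i z) * (\<Sum>z\<in>I. R x z * U j z)) = of_bool (i = j)"
      using onb_parseval_ip[OF R, of "U i" "U j"] onb_ortho[OF U ij] by simp
  next
    fix x y assume xy: "x \<in> I" "y \<in> I"
    show "M x y = (\<Sum>i\<in>K. of_real (p i) * (\<Sum>z\<in>I. R x z * U i z) * cnj (\<Sum>z\<in>I. R y z * U i z))"
      unfolding M[OF xy] by (rule unitary_conj_entries[symmetric]) (rule eigensys_entry[OF N])
    have "(\<Sum>i\<in>K. of_real 1 * (\<Sum>z\<in>I. R x z * U i z) * cnj (\<Sum>z\<in>I. R y z * U i z))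
      = mmul I R (mmul I (\<lambda>x y. of_bool (x = y)) (\<lambda>a b. cnj (R b a))) x y"
      by (rule unitary_conj_entries[where p = "\<lambda>_. 1"]) (simp add: onb_complete[OF U])
    also have "\<dots> = mmul I R (\<lambda>a b. cnj (R b a)) x y"
      by (rule mmul_cong) (use fin xy in \<open>auto simp: mmul_def sum_delta_mult\<close>)
    also have "\<dots> = of_bool (x = y)"
      using onb_ortho[OF R xy] by (simp add: mmul_def)
    finally show "(\<Sum>i\<in>K. (\<Sum>z\<in>I. R x z * U i z) * cnj (\<Sum>z\<in>I. R y z * U i z)) = of_bool (x = y)" by simp
  qed
qed

lemma eigenvector_exists:
  fixes M :: "nat \<Rightarrow> nat \<Rightarrow> complex"
  assumes "n > 0"
  shows "\<exists>e f. (\<exists>x<n. f x \<noteq> 0) \<and> (\<forall>x<n. (\<Sum>y<n. M x y * f y) = e * f x)"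
proof -
  let ?A = "mat n n (\<lambda>(x, y). M x y)"
  have A: "?A \<in> carrier_mat n n" by simp
  from spectrum_non_empty[OF A] assms obtain e where "eigenvalue ?A e" unfolding spectrum_def by auto
  then obtain v where "eigenvector ?A v e" unfolding eigenvalue_def by blast
  then have v: "v \<in> carrier_vec n" "v \<noteq> 0\<^sub>v n" and e: "?A *\<^sub>v v = e \<cdot>\<^sub>v v" by (auto simp: eigenvector_def)
  have "\<exists>x<n. vec_index v x \<noteq> 0"
  proof (rule ccontr)
    assume "\<not> ?thesis"
    then have "v = 0\<^sub>v n" using v(1) by (intro eq_vecI) auto
    then show False using v(2) by simp
  qed
  moreover have "(\<Sum>y<n. M x y * vec_index v y) = e * vec_index v x" if "x < n" for x
  proof -
    have "vec_index (?A *\<^sub>v v) x = vec_index (e \<cdot>\<^sub>v v) x" by (simp add: e)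
    then show ?thesis using that v(1) by (simp add: scalar_prod_def atLeast0LessThan)
  qed
  ultimately show ?thesis by (intro exI[of _ e] exI[of _ "\<lambda>x. vec_index v x"]) auto
qed

text \<open>The quadratic form at the eigenvector equals its own conjugate, which makes the
  eigenvalue real. The remaining phase freedom is spent on making the entry at \<open>k\<close>
  real, as \<open>householder\<close> requires.\<close>

lemma hermitian_eigenvector:
  fixes n k :: nat
  assumes n: "n > 0" and M: "hermitian_on {..<n} M" and k: "k < n"
  shows "\<exists>(e::real) (a::real) f. (\<Sum>x<n. cnj (f x) * f x) = 1 \<and> f k = of_real a \<and>
    (\<forall>x<n. (\<Sum>y<n. M x y * f y) = of_real e * f x)"
proof -
  obtain e g where g: "\<exists>x<n. g x \<noteq> 0" and eg: "\<And>x. x < n \<Longrightarrow> (\<Sum>y<n. M x y * g y) = e * g x"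
    using eigenvector_exists[OF n, of M] by blast
  define s where "s = (\<Sum>x<n. (cmod (g x))\<^sup>2)"
  have s: "s > 0"
  proof -
    obtain x where "x < n" "g x \<noteq> 0" using g by blast
    then have "0 < (cmod (g x))\<^sup>2" "(cmod (g x))\<^sup>2 \<le> s"
      unfolding s_def by (auto intro!: member_le_sum[where A = "{..<n}"])
    then show ?thesis by linarith
  qed
  have ss: "(\<Sum>x<n. cnj (g x) * g x) = of_real s" unfolding s_def of_real_sum cmod_sq_eq ..
  have "e * of_real s = (\<Sum>x<n. cnj (g x) * (e * g x))"
    unfolding ss[symmetric] sum_distrib_left by (simp add: mult_ac)
  also have "\<dots> = (\<Sum>x<n. \<Sum>y<n. cnj (g x) * M x y * g y)"
    by (intro sum.cong refl) (simp add: eg[symmetric] sum_distrib_left mult_ac)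
  finally have q: "e * of_real s = (\<Sum>x<n. \<Sum>y<n. cnj (g x) * M x y * g y)" .
  have "cnj (\<Sum>x<n. \<Sum>y<n. cnj (g x) * M x y * g y) = (\<Sum>x<n. \<Sum>y<n. cnj (g y) * M y x * g x)"
    using M by (simp add: hermitian_on_def mult_ac)
  also have "\<dots> = (\<Sum>x<n. \<Sum>y<n. cnj (g x) * M x y * g y)" by (rule sum.swap)
  finally have "cnj (e * of_real s) = e * of_real s" unfolding q .
  then have "cnj e = e" using s by simp
  then have e: "e = of_real (Re e)" by (simp add: complex_eq_iff)
  define c where "c = (if g k = 0 then 1 else cnj (g k) / of_real (cmod (g k))) / of_real (sqrt s)"
  have c: "cnj c * c = 1 / of_real s"
  proof -
    have "(cmod c)\<^sup>2 = 1 / s"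
      unfolding c_def using s by (auto simp: norm_divide power_divide)
    then have "complex_of_real ((cmod c)\<^sup>2) = of_real (1 / s)" by simp
    then show ?thesis unfolding cmod_sq_eq by simp
  qed
  have gk: "c * g k = of_real (cmod (g k) / sqrt s)"
  proof (cases "g k = 0")
    case False
    have "cnj (g k) * g k = of_real (cmod (g k)) * of_real (cmod (g k))"
      using cmod_sq_eq[of "g k"] by (simp add: power2_eq_square)
    then show ?thesis unfolding c_def using False by (simp add: field_simps)
  qed simp
  show ?thesis
  proof (intro exI conjI allI impI)
    have "(\<Sum>x<n. cnj (c * g x) * (c * g x)) = (cnj c * c) * (\<Sum>x<n. cnj (g x) * g x)"
      by (simp add: sum_distrib_left mult_ac)
    then show "(\<Sum>x<n. cnj (c * g x) * (c * g x)) = 1" unfolding ss c using s by simp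
    show "c * g k = of_real (cmod (g k) / sqrt s)" by (rule gk)
    fix x assume x: "x < n"
    have "(\<Sum>y<n. M x y * (c * g y)) = c * (\<Sum>y<n. M x y * g y)" by (simp add: sum_distrib_left mult_ac)
    also have "\<dots> = of_real (Re e) * (c * g x)" unfolding eg[OF x] using e by (simp add: mult_ac)
    finally show "(\<Sum>y<n. M x y * (c * g y)) = of_real (Re e) * (c * g x)" .
  qed
qed

text \<open>A Householder reflection maps the last basis vector to a unit vector \<open>v\<close> whose last entry is real.\<close>

lemma householder:
  fixes v :: "nat \<Rightarrow> complex"
  assumes v1: "(\<Sum>x<Suc n. cnj (v x) * v x) = 1" and vn: "v n = of_real a"
  shows "\<exists>R. hermitian_on {..<Suc n} R \<and> (\<forall>x<Suc n. \<forall>y<Suc n. mmul {..<Suc n} R R x y = of_bool (x = y)) \<and>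
     (\<forall>x<Suc n. R x n = v x)"
proof -
  \<comment> \<open>The reflection along \<open>w\<close> needs the coefficient 2 divided by the
    squared norm of \<open>w\<close>, and that norm squared is \<open>2 * (1 - a)\<close>. For
    \<open>a = 1\<close> the vector \<open>w\<close> vanishes, \<open>g\<close> is 0 by division by
    zero, and \<open>R\<close> is the identity, as it should be.\<close>
  define g where "g = 1 / (1 - a)"
  define w where "w x = v x - of_bool (x = n)" for x
  define R where "R x y = of_bool (x = y) - of_real g * w x * cnj (w y)" for x y
  have vv: "(\<Sum>x<n. cnj (v x) * v x) + of_real (a * a) = 1" using v1 vn by simp
  have ww: "(\<Sum>x<Suc n. cnj (w x) * w x) = of_real (2 * (1 - a))"
  proof -
    have "(\<Sum>x<Suc n. cnj (w x) * w x) = (\<Sum>x<n. cnj (w x) * w x) + cnj (w n) * w n" by simp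
    also have "(\<Sum>x<n. cnj (w x) * w x) = (\<Sum>x<n. cnj (v x) * v x)"
      by (rule sum.cong) (auto simp: w_def)
    also have "\<dots> = 1 - of_real (a * a)" using vv by (simp add: algebra_simps)
    also have "cnj (w n) * w n = of_real ((a - 1) * (a - 1))" by (simp add: w_def vn)
    finally show ?thesis by (simp add: algebra_simps)
  qed
  have w0: "w x = 0" if "a = 1" "x < Suc n" for x
  proof -
    have "complex_of_real (\<Sum>x<Suc n. (cmod (w x))\<^sup>2) = of_real 0"
      using ww that unfolding of_real_sum cmod_sq_eq by simp
    then have "(\<Sum>x<Suc n. (cmod (w x))\<^sup>2) = 0" unfolding of_real_eq_iff .
    then show ?thesis using that(2) by (subst (asm) sum_nonneg_eq_0_iff) auto
  qed
  have "cnj (R x y) = R y x" for x y by (simp add: R_def mult_ac eq_commute)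
  then have "hermitian_on {..<Suc n} R" by (simp add: hermitian_on_def)
  moreover have "mmul {..<Suc n} R R x y = of_bool (x = y)" if "x < Suc n" "y < Suc n" for x y
  proof -
    have fin: "finite {..<Suc n}" "x \<in> {..<Suc n}" "y \<in> {..<Suc n}" using that by auto
    have "mmul {..<Suc n} R R x y = (\<Sum>z\<in>{..<Suc n}. of_bool (x = z) * of_bool (z = y)
       - of_real g * w x * (of_bool (z = y) * cnj (w z)) - of_real g * cnj (w y) * (of_bool (x = z) * w z)
       + of_real (g * g) * w x * cnj (w y) * (cnj (w z) * w z))"
      unfolding mmul_def R_def by (intro sum.cong refl) (simp add: algebra_simps)
    also have "\<dots> = of_bool (x = y) - 2 * of_real g * w x * cnj (w y)
        + of_real (g * g) * w x * cnj (w y) * of_real (2 * (1 - a))"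
      unfolding sum.distrib sum_subtractf sum_distrib_left[symmetric] ww
      using fin by (simp only: sum_delta_mult) (simp add: algebra_simps)
    also have "of_real (g * g) * w x * cnj (w y) * of_real (2 * (1 - a)) = of_real (g * g * (2 * (1 - a))) * w x * cnj (w y)"
      by (simp add: mult_ac)
    also have "g * g * (2 * (1 - a)) = 2 * g" 
    proof (cases "a = 1")
      case False
      then have "g * (1 - a) = 1" by (simp add: g_def)
      moreover have "g * g * (2 * (1 - a)) = 2 * g * (g * (1 - a))" by simp
      ultimately show ?thesis by simp
    qed (simp add: g_def)
    finally show ?thesis by simp
  qed
  moreover have "R x n = v x" if "x < Suc n" for x
  proof (cases "a = 1")
    case True
    then show ?thesis using w0[OF True that] vn by (auto simp: R_def w_def)
  next
    case False
    have "cnj (w n) = of_real (a - 1)" by (simp add: w_def vn)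
    then have "R x n = of_bool (x = n) - of_real (g * (a - 1)) * w x" by (simp add: R_def mult_ac)
    also have "g * (a - 1) = - 1" using False by (simp add: g_def field_simps)
    finally show ?thesis by (simp add: w_def)
  qed
  ultimately show ?thesis by blast
qed

text \<open>Deflation: a reflection \<open>R\<close> sends the last basis vector to an eigenvector,
  so \<open>R M R\<close> is block diagonal with a one-dimensional last block. The induction
  hypothesis diagonalises the other block, and \<open>R\<close> carries the basis back.\<close>

theorem hermitian_eigensys_lessThan:
  fixes n :: nat
  shows "hermitian_on {..<n} M \<Longrightarrow> \<exists>(u :: nat \<Rightarrow> nat \<Rightarrow> complex) p. eigensys {..<n} {..<n} u p M"
proof (induction n arbitrary: M)
  case 0
  then show ?case by (simp add: eigensys_def onb_def)
next
  case (Suc n)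
  let ?I = "{..<Suc n}"
  obtain e a v where v1: "(\<Sum>x<Suc n. cnj (v x) * v x) = 1" and vn: "v n = complex_of_real a"
    and ev: "\<And>x. x < Suc n \<Longrightarrow> (\<Sum>y<Suc n. M x y * v y) = of_real e * v x"
    using hermitian_eigenvector[OF _ Suc.prems, of n] by (auto simp del: sum.lessThan_Suc)
  obtain R where Rh: "hermitian_on ?I R" and RR: "\<And>x y. x \<in> ?I \<Longrightarrow> y \<in> ?I \<Longrightarrow> mmul ?I R R x y = of_bool (x = y)"
    and Rn: "\<And>x. x \<in> ?I \<Longrightarrow> R x n = v x"
    using householder[OF v1 vn] by auto
  define N where "N = mmul ?I R (mmul ?I M R)"
  have cR: "cnj (R x y) = R y x" if "x \<in> ?I" "y \<in> ?I" for x y using Rh that by (simp add: hermitian_on_def)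
  have cM: "cnj (M x y) = M y x" if "x \<in> ?I" "y \<in> ?I" for x y using Suc.prems that by (simp add: hermitian_on_def)
  have Nh: "cnj (N x y) = N y x" if xy: "x \<in> ?I" "y \<in> ?I" for x y
  proof -
    have "cnj (N x y) = (\<Sum>z\<in>?I. \<Sum>w\<in>?I. R z x * (M w z * R y w))"
      unfolding N_def mmul_def using xy by (simp add: sum_distrib_left cR cM del: sum.lessThan_Suc)
    also have "\<dots> = (\<Sum>w\<in>?I. \<Sum>z\<in>?I. R z x * (M w z * R y w))" by (rule sum.swap)
    also have "\<dots> = N y x" unfolding N_def mmul_def by (simp add: sum_distrib_left mult_ac del: sum.lessThan_Suc)
    finally show ?thesis .
  qed
  have Nn: "N x n = of_real e * of_bool (x = n)" if x: "x \<in> ?I" for x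
  proof -
    have "N x n = mmul ?I R (\<lambda>z _. of_real e * R z n) x n"
      unfolding N_def by (rule mmul_cong) (use ev Rn in \<open>auto simp: mmul_def simp del: sum.lessThan_Suc\<close>)
    also have "\<dots> = of_real e * mmul ?I R R x n" by (simp add: mmul_def sum_distrib_left mult_ac del: sum.lessThan_Suc)
    also have "\<dots> = of_real e * of_bool (x = n)" using x by (simp add: RR)
    finally show ?thesis .
  qed
  have nN: "N n x = of_real e * of_bool (x = n)" if x: "x \<in> ?I" for x
    using Nh[OF x, of n] Nn[OF x] by simp
  have "hermitian_on {..<n} N" using Nh by (simp add: hermitian_on_def)
  then obtain u p where up: "eigensys {..<n} {..<n} u p N" using Suc.IH by blast
  then have u: "onb {..<n} {..<n} u" by (rule eigensys_onb)
  define U where "U i x = (if i < n \<and> x < n then u i x else of_bool (i = x))" for i x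
  define P where "P i = (if i < n then p i else e)" for i
  have Ui: "U i x = u i x" "U i n = 0" "U n x = 0" "U n n = 1" if "i < n" "x < n" for i x
    using that by (auto simp: U_def)
  have "U n n = 1" by (simp add: U_def)
  have "eigensys ?I ?I U P N"
    unfolding eigensys_def onb_def
  proof (intro conjI ballI)
    fix i j assume "i \<in> ?I" "j \<in> ?I"
    then consider "i < n" "j < n" | "i < n" "j = n" | "i = n" "j < n" | "i = n" "j = n" by fastforce
    then show "(\<Sum>x\<in>?I. cnj (U i x) * U j x) = of_bool (i = j)"
      by cases (use onb_ortho[OF u, of i j] \<open>U n n = 1\<close> in \<open>simp_all add: Ui\<close>)
  next
    fix i j assume ij: "i \<in> ?I" "j \<in> ?I"
    then consider "i < n" "j < n" | "i < n" "j = n" | "i = n" "j < n" | "i = n" "j = n" by fastforce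
    then show "(\<Sum>x\<in>?I. U x i * cnj (U x j)) = of_bool (i = j)"
      by cases (use onb_complete[OF u, of i j] \<open>U n n = 1\<close> in \<open>simp_all add: Ui\<close>)
    have [simp]: "P n = e" "\<And>i. i < n \<Longrightarrow> P i = p i" by (auto simp: P_def)
    consider "i < n" "j < n" | "i < n" "j = n" | "i = n" "j < n" | "i = n" "j = n" using ij by fastforce
    then show "N i j = (\<Sum>x\<in>?I. of_real (P x) * U x i * cnj (U x j))"
      by cases (use eigensys_entry[OF up, of i j] \<open>U n n = 1\<close> in \<open>simp_all add: Ui Nn nN\<close>)
  qed auto
  moreover have "onb ?I ?I (\<lambda>x z. cnj (R x z))"
    unfolding onb_def
  proof (intro conjI ballI)
    fix x y assume xy: "x \<in> ?I" "y \<in> ?I"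
    have "(\<Sum>z\<in>?I. cnj (cnj (R x z)) * cnj (R y z)) = mmul ?I R R x y"
      unfolding mmul_def using xy by (intro sum.cong refl) (simp add: cR)
    then show "(\<Sum>z\<in>?I. cnj (cnj (R x z)) * cnj (R y z)) = of_bool (x = y)" using RR xy by simp
    have "(\<Sum>z\<in>?I. cnj (R z x) * cnj (cnj (R z y))) = mmul ?I R R x y"
      unfolding mmul_def using xy by (intro sum.cong refl) (simp add: cR)
    then show "(\<Sum>z\<in>?I. cnj (R z x) * cnj (cnj (R z y))) = of_bool (x = y)" using RR xy by simp
  qed auto
  moreover have "M x y = mmul ?I R (mmul ?I N (\<lambda>a b. cnj (R b a))) x y" if xy: "x \<in> ?I" "y \<in> ?I" for x y
  proof -
    have fin: "finite ?I" by simp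
    have A: "mmul ?I N (\<lambda>a b. cnj (R b a)) z y = mmul ?I R M z y" if "z \<in> ?I" for z
    proof -
      have "mmul ?I N (\<lambda>a b. cnj (R b a)) z y = mmul ?I N R z y"
        by (rule mmul_cong) (use xy cR in auto)
      also have "\<dots> = mmul ?I R (mmul ?I M (mmul ?I R R)) z y"
        unfolding N_def mmul_assoc by (rule mmul_cong) (auto simp: mmul_assoc)
      also have "\<dots> = mmul ?I R M z y"
      proof (rule mmul_cong[OF refl])
        fix w assume w: "w \<in> ?I"
        have "mmul ?I M (mmul ?I R R) w y = mmul ?I M (\<lambda>x z. of_bool (x = z)) w y"
          by (rule mmul_cong) (use RR xy in auto)
        then show "mmul ?I M (mmul ?I R R) w y = M w y" using mmul_id(2)[OF fin w xy(2)] by simp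
      qed
      finally show ?thesis .
    qed
    have "mmul ?I R (mmul ?I N (\<lambda>a b. cnj (R b a))) x y = mmul ?I R (mmul ?I R M) x y"
      by (rule mmul_cong) (use A in auto)
    also have "\<dots> = mmul ?I (mmul ?I R R) M x y" by (rule mmul_assoc[symmetric])
    also have "\<dots> = mmul ?I (\<lambda>x z. of_bool (x = z)) M x y" by (rule mmul_cong) (use RR xy in auto)
    also have "\<dots> = M x y" by (rule mmul_id(1)[OF fin xy])
    finally show ?thesis by simp
  qed
  ultimately show ?case using eigensys_unitary_conj by blast
qed

corollary hermitian_eigensys:
  assumes "finite I" "hermitian_on I M"
  shows "\<exists>(K::nat set) u p. eigensys I K u p M"
proof -
  obtain h where h: "bij_betw h {..<card I} I" using ex_bij_betw_nat_finite[OF assms(1)] atLeast0LessThan by metis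
  have h': "bij_betw (inv_into {..<card I} h) I {..<card I}" using h by (rule bij_betw_inv_into)
  have "hermitian_on {..<card I} (\<lambda>x y. M (h x) (h y))"
    using assms(2) bij_betwE[OF h] by (auto simp: hermitian_on_def)
  then obtain u p where e: "eigensys {..<card I} {..<card I} u p (\<lambda>x y. M (h x) (h y))"
    using hermitian_eigensys_lessThan by blast
  have "eigensys I {..<card I} (\<lambda>i x. u (id i) (inv_into {..<card I} h x)) (\<lambda>i. p (id i)) M"
    by (rule eigensys_reindex[OF e h' bij_betw_id]) (use h in \<open>simp add: bij_betw_inv_into_right\<close>)
  then show ?thesis by blast
qed

section \<open>Matrices and time evolution\<close>

lemma mat_adjoint_index:
  fixes A :: "complex mat"
  assumes "i < dim_col A" "j < dim_row A"
  shows "mat_adjoint A $$ (i, j) = cnj (A $$ (j, i))"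
  using assms by (simp add: mat_adjoint_def mat_of_rows_index)

lemma mat_adjoint_carrier:
  fixes A :: "complex mat"
  shows "A \<in> carrier_mat n m \<Longrightarrow> mat_adjoint A \<in> carrier_mat m n"
  by (auto simp: mat_adjoint_def mat_of_rows_def)

lemma mult_mat_index_sum:
  assumes "A \<in> carrier_mat n m" "B \<in> carrier_mat m l" "i < n" "j < l"
  shows "(A * B) $$ (i, j) = (\<Sum>k<m. A $$ (i, k) * B $$ (k, j))"
  using assms by (simp add: scalar_prod_def atLeast0LessThan)

lemma diag_conj_index:
  fixes U :: "complex mat"
  assumes U: "U \<in> carrier_mat n n" and xy: "x < n" "y < n"
  shows "(U * mat_diag n f * mat_adjoint U) $$ (x, y) = (\<Sum>i<n. f i * U $$ (x, i) * cnj (U $$ (y, i)))"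
proof -
  have D: "mat_diag n f \<in> carrier_mat n n" by (simp add: mat_diag_def)
  have UD: "(U * mat_diag n f) $$ (x, i) = f i * U $$ (x, i)" if i: "i < n" for i
  proof -
    have "(U * mat_diag n f) $$ (x, i) = (\<Sum>k<n. U $$ (x, k) * mat_diag n f $$ (k, i))"
      by (rule mult_mat_index_sum[OF U D xy(1) i])
    also have "\<dots> = (\<Sum>k<n. if k = i then U $$ (x, i) * f i else 0)"
      by (rule sum.cong) (use i in \<open>auto simp: mat_diag_def\<close>)
    finally show ?thesis using i by (simp add: mult.commute)
  qed
  have "(U * mat_diag n f * mat_adjoint U) $$ (x, y) = (\<Sum>i<n. (U * mat_diag n f) $$ (x, i) * mat_adjoint U $$ (i, y))"
    by (rule mult_mat_index_sum[OF mult_carrier_mat[OF U D] mat_adjoint_carrier[OF U] xy])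
  also have "\<dots> = (\<Sum>i<n. f i * U $$ (x, i) * cnj (U $$ (y, i)))"
    using U xy by (intro sum.cong refl) (simp add: UD mat_adjoint_index)
  finally show ?thesis .
qed

lemma unitary_mat_onb:
  assumes U: "U \<in> carrier_mat n n"
  shows "unitary_mat U \<longleftrightarrow> onb {..<n} {..<n} (\<lambda>i x. U $$ (x, i))"
proof -
  note A = mat_adjoint_carrier[OF U]
  have 1: "(U * mat_adjoint U) $$ (x, y) = (\<Sum>i<n. U $$ (x, i) * cnj (U $$ (y, i)))" if "x < n" "y < n" for x y
    unfolding mult_mat_index_sum[OF U A that] using U that by (intro sum.cong refl) (simp add: mat_adjoint_index)
  have 2: "(mat_adjoint U * U) $$ (x, y) = (\<Sum>i<n. cnj (U $$ (i, x)) * U $$ (i, y))" if "x < n" "y < n" for x y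
    unfolding mult_mat_index_sum[OF A U that] using U that by (intro sum.cong refl) (simp add: mat_adjoint_index)
  have "U * mat_adjoint U = 1\<^sub>m n \<longleftrightarrow> (\<forall>x<n. \<forall>y<n. (\<Sum>i<n. U $$ (x, i) * cnj (U $$ (y, i))) = of_bool (x = y))"
  proof
    assume "U * mat_adjoint U = 1\<^sub>m n"
    then show "\<forall>x<n. \<forall>y<n. (\<Sum>i<n. U $$ (x, i) * cnj (U $$ (y, i))) = of_bool (x = y)"
      using 1 by (auto simp flip: 1)
  qed (use U A in \<open>auto intro!: eq_matI simp: 1\<close>)
  moreover have "mat_adjoint U * U = 1\<^sub>m n \<longleftrightarrow> (\<forall>x<n. \<forall>y<n. (\<Sum>i<n. cnj (U $$ (i, x)) * U $$ (i, y)) = of_bool (x = y))"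
  proof
    assume "mat_adjoint U * U = 1\<^sub>m n"
    then show "\<forall>x<n. \<forall>y<n. (\<Sum>i<n. cnj (U $$ (i, x)) * U $$ (i, y)) = of_bool (x = y)"
      using 2 by (auto simp flip: 2)
  qed (use U A in \<open>auto intro!: eq_matI simp: 2\<close>)
  ultimately show ?thesis
    unfolding unitary_mat_def onb_def using U by (auto simp: Ball_def)
qed

lemma eigensys_trace_mult:
  assumes M: "eigensys I K u p M" and N: "eigensys I K u q N"
  shows "(\<Sum>x\<in>I. \<Sum>y\<in>I. M x y * N y x) = of_real (\<Sum>i\<in>K. p i * q i)"
proof -
  have u: "onb I K u" using M by (rule eigensys_onb)
  have "(\<Sum>x\<in>I. \<Sum>y\<in>I. M x y * N y x) = (\<Sum>x\<in>I. \<Sum>y\<in>I. \<Sum>i\<in>K. of_real (q i) * cnj (u i x) * (M x y * u i y))"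
    by (intro sum.cong refl) (simp add: eigensys_entry[OF N] sum_distrib_left mult_ac)
  also have "\<dots> = (\<Sum>x\<in>I. \<Sum>i\<in>K. \<Sum>y\<in>I. of_real (q i) * cnj (u i x) * (M x y * u i y))"
    by (intro sum.cong refl sum.swap)
  also have "\<dots> = (\<Sum>i\<in>K. \<Sum>x\<in>I. \<Sum>y\<in>I. of_real (q i) * cnj (u i x) * (M x y * u i y))"
    by (rule sum.swap)
  also have "\<dots> = (\<Sum>i\<in>K. \<Sum>x\<in>I. of_real (q i) * cnj (u i x) * (of_real (p i) * u i x))"
    by (intro sum.cong refl) (simp add: sum_distrib_left[symmetric] eigensys_apply[OF M])
  also have "\<dots> = (\<Sum>i\<in>K. of_real (p i * q i) * (\<Sum>x\<in>I. cnj (u i x) * u i x))"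
    by (simp add: sum_distrib_left mult_ac)
  also have "\<dots> = of_real (\<Sum>i\<in>K. p i * q i)" by (simp add: onb_ortho[OF u])
  finally show ?thesis .
qed

text \<open>Whatever diagonalisation the choice in \<open>hermitian_fun\<close> picks, the matrix
  and its logarithm share the eigenbasis, so the trace of their product is the spectral sum that
  \<open>ent\<close> computes from any eigensystem.\<close>

lemma von_neumann_entropy_eq_ent:
  assumes M: "M \<in> carrier_mat n n" and herm: "hermitian_on {..<n} (\<lambda>x y. M $$ (x, y))"
  shows "von_neumann_entropy M = ent {..<n} (\<lambda>x y. M $$ (x, y))"
proof -
  have dim: "dim_row M = n" using M by simp
  let ?P = "\<lambda>B. \<exists>U e. U \<in> carrier_mat n n \<and> unitary_mat U \<and>
     M = U * mat_diag n (\<lambda>i. complex_of_real (e i)) * mat_adjoint U \<and>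
     B = U * mat_diag n (\<lambda>i. complex_of_real (ln (e i))) * mat_adjoint U"
  obtain u p where up: "eigensys {..<n} {..<n} u p (\<lambda>x y. M $$ (x, y))"
    using hermitian_eigensys_lessThan[OF herm] by blast
  define V where "V = mat n n (\<lambda>(x, i). u i x)"
  have V: "V \<in> carrier_mat n n" by (simp add: V_def)
  have "onb {..<n} {..<n} (\<lambda>i x. V $$ (x, i))"
    using eigensys_onb[OF up] by (simp add: onb_def V_def)
  then have "unitary_mat V" using unitary_mat_onb[OF V] by simp
  moreover have "M = V * mat_diag n (\<lambda>i. complex_of_real (p i)) * mat_adjoint V"
  proof (rule eq_matI)
    fix x y assume "x < dim_row (V * mat_diag n (\<lambda>i. complex_of_real (p i)) * mat_adjoint V)"
      "y < dim_col (V * mat_diag n (\<lambda>i. complex_of_real (p i)) * mat_adjoint V)"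
    then have xy: "x < n" "y < n" using V mat_adjoint_carrier[OF V] by auto
    have "M $$ (x, y) = (\<Sum>i<n. of_real (p i) * u i x * cnj (u i y))" using eigensys_entry[OF up, of x y] xy by simp
    also have "\<dots> = (\<Sum>i<n. of_real (p i) * V $$ (x, i) * cnj (V $$ (y, i)))"
      using xy by (intro sum.cong refl) (simp add: V_def)
    finally show "M $$ (x, y) = (V * mat_diag n (\<lambda>i. complex_of_real (p i)) * mat_adjoint V) $$ (x, y)"
      using diag_conj_index[OF V xy] by simp
  qed (use M V mat_adjoint_carrier[OF V] in auto)
  ultimately have "\<exists>B. ?P B" using V by blast
  then have "?P (SOME B. ?P B)" by (rule someI_ex)
  then have "?P (hermitian_fun ln M)" unfolding hermitian_fun_def dim .
  then obtain U e where U: "U \<in> carrier_mat n n" "unitary_mat U"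
    and MU: "M = U * mat_diag n (\<lambda>i. complex_of_real (e i)) * mat_adjoint U"
    and BU: "hermitian_fun ln M = U * mat_diag n (\<lambda>i. complex_of_real (ln (e i))) * mat_adjoint U"
    by blast
  have onbU: "onb {..<n} {..<n} (\<lambda>i x. U $$ (x, i))" using unitary_mat_onb[OF U(1)] U(2) by simp
  have eM: "eigensys {..<n} {..<n} (\<lambda>i x. U $$ (x, i)) e (\<lambda>x y. M $$ (x, y))"
    unfolding eigensys_def using onbU by (subst MU) (simp add: diag_conj_index[OF U(1)])
  have eB: "eigensys {..<n} {..<n} (\<lambda>i x. U $$ (x, i)) (\<lambda>i. ln (e i)) (\<lambda>x y. hermitian_fun ln M $$ (x, y))"
    unfolding eigensys_def using onbU by (subst BU) (simp add: diag_conj_index[OF U(1)])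
  have B: "hermitian_fun ln M \<in> carrier_mat n n"
    unfolding BU using U(1) mat_adjoint_carrier[OF U(1)] by (auto simp: mat_diag_def)
  have "mat_trace (M * hermitian_fun ln M) = (\<Sum>x<n. \<Sum>y<n. M $$ (x, y) * hermitian_fun ln M $$ (y, x))"
    unfolding mat_trace_def using M B by (intro sum.cong) (auto simp: mult_mat_index_sum[OF M B] simp del: index_mult_mat(1))
  also have "\<dots> = of_real (\<Sum>i<n. e i * ln (e i))" by (rule eigensys_trace_mult[OF eM eB])
  finally show ?thesis unfolding von_neumann_entropy_def ent_eq[OF eM] by simp
qed

lemma mat_power_eigensys:
  assumes H: "H \<in> carrier_mat n n" and e: "eigensys {..<n} K u E (\<lambda>x y. H $$ (x, y))"
    and xy: "x < n" "y < n"
  shows "((c \<cdot>\<^sub>m H) ^\<^sub>m k) $$ (x, y) = (\<Sum>j\<in>K. (c * of_real (E j)) ^ k * u j x * cnj (u j y))"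
  using xy
proof (induction k arbitrary: x y)
  case 0
  then show ?case using onb_complete[OF eigensys_onb[OF e], of x y] H by simp
next
  case (Suc k)
  have cH: "c \<cdot>\<^sub>m H \<in> carrier_mat n n" using H by simp
  have "((c \<cdot>\<^sub>m H) ^\<^sub>m Suc k) $$ (x, y) = (\<Sum>z<n. ((c \<cdot>\<^sub>m H) ^\<^sub>m k) $$ (x, z) * (c \<cdot>\<^sub>m H) $$ (z, y))"
    using mult_mat_index_sum[OF pow_carrier_mat[OF cH] cH Suc.prems] by simp
  also have "\<dots> = (\<Sum>z<n. \<Sum>j\<in>K. (c * of_real (E j)) ^ k * u j x * c * (cnj (u j z) * H $$ (z, y)))"
    using H Suc.prems by (intro sum.cong refl) (simp add: Suc.IH sum_distrib_right sum_distrib_left mult_ac)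
  also have "\<dots> = (\<Sum>j\<in>K. (c * of_real (E j)) ^ k * u j x * c * (\<Sum>z<n. cnj (u j z) * H $$ (z, y)))"
    by (subst sum.swap) (simp add: sum_distrib_left)
  also have "\<dots> = (\<Sum>j\<in>K. (c * of_real (E j)) ^ Suc k * u j x * cnj (u j y))"
    using Suc.prems by (intro sum.cong refl) (simp add: eigensys_apply_left[OF e] mult_ac)
  finally show ?case .
qed

lemma mat_exp_eigensys:
  assumes H: "H \<in> carrier_mat n n" and e: "eigensys {..<n} K u E (\<lambda>x y. H $$ (x, y))"
    and xy: "x < n" "y < n"
  shows "mat_exp (c \<cdot>\<^sub>m H) $$ (x, y) = (\<Sum>j\<in>K. exp (c * of_real (E j)) * u j x * cnj (u j y))"
proof -
  have "(\<lambda>k. (z ^ k /\<^sub>R fact k) * w) sums (exp z * w)" for z w :: complex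
    by (intro sums_mult2 exp_converges)
  then have "(\<lambda>k. \<Sum>j\<in>K. ((c * of_real (E j)) ^ k /\<^sub>R fact k) * (u j x * cnj (u j y))) sums
      (\<Sum>j\<in>K. exp (c * of_real (E j)) * (u j x * cnj (u j y)))"
    by (intro sums_sum)
  moreover have "(\<Sum>j\<in>K. ((c * of_real (E j)) ^ k /\<^sub>R fact k) * (u j x * cnj (u j y)))
      = ((c \<cdot>\<^sub>m H) ^\<^sub>m k) $$ (x, y) / fact k" for k
    unfolding mat_power_eigensys[OF H e xy]
    by (simp add: sum_divide_distrib scaleR_conv_of_real divide_inverse sum_distrib_left mult_ac)
  ultimately have "(\<lambda>k. ((c \<cdot>\<^sub>m H) ^\<^sub>m k) $$ (x, y) / fact k) sums
      (\<Sum>j\<in>K. exp (c * of_real (E j)) * (u j x * cnj (u j y)))" by simp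
  then show ?thesis
    using H xy by (simp add: mat_exp_def sums_unique[symmetric] mult.assoc)
qed

definition evolved_amp :: "nat \<Rightarrow> 'b set \<Rightarrow> ('b \<Rightarrow> nat \<Rightarrow> complex) \<Rightarrow> ('b \<Rightarrow> real) \<Rightarrow> (nat \<Rightarrow> complex) \<Rightarrow> real \<Rightarrow> nat \<Rightarrow> complex" where
  "evolved_amp n K u E f t x = (\<Sum>j\<in>K. exp (- \<i> * of_real (t * E j)) * (\<Sum>y<n. cnj (u j y) * f y) * u j x)"

lemma evolved_state_index:
  assumes H: "H \<in> carrier_mat n n" and e: "eigensys {..<n} K u E (\<lambda>x y. H $$ (x, y))"
    and v: "v \<in> carrier_vec n" and xy: "x < n" "y < n"
  shows "evolved_state H v t $$ (x, y) =
     evolved_amp n K u E (vec_index v) t x * cnj (evolved_amp n K u E (vec_index v) t y)"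
proof -
  let ?W = "mat_exp ((- \<i> * complex_of_real t) \<cdot>\<^sub>m H)"
  let ?W' = "mat_exp ((\<i> * complex_of_real t) \<cdot>\<^sub>m H)"
  have W: "?W \<in> carrier_mat n n" "?W' \<in> carrier_mat n n" using H by (auto simp: mat_exp_def)
  have k: "ket_bra v \<in> carrier_mat n n" using v by (simp add: ket_bra_def)
  have amp: "(\<Sum>a<n. ?W $$ (x, a) * vec_index v a) = evolved_amp n K u E (vec_index v) t x" if "x < n" for x
  proof -
    have "(\<Sum>a<n. ?W $$ (x, a) * vec_index v a)
      = (\<Sum>a<n. \<Sum>j\<in>K. exp (- \<i> * of_real (t * E j)) * (cnj (u j a) * vec_index v a) * u j x)"
      using that by (intro sum.cong refl) (simp add: mat_exp_eigensys[OF H e] sum_distrib_left sum_distrib_right mult_ac)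
    also have "\<dots> = evolved_amp n K u E (vec_index v) t x"
      unfolding evolved_amp_def by (subst sum.swap) (simp add: sum_distrib_left sum_distrib_right)
    finally show ?thesis .
  qed
  have W'W: "?W' $$ (b, y) = cnj (?W $$ (y, b))" if "b < n" "y < n" for b y
    using that by (simp add: mat_exp_eigensys[OF H e] exp_cnj mult_ac)
  have "evolved_state H v t $$ (x, y) = (\<Sum>b<n. (?W * ket_bra v) $$ (x, b) * ?W' $$ (b, y))"
    unfolding evolved_state_def by (rule mult_mat_index_sum[OF mult_carrier_mat[OF W(1) k] W(2) xy])
  also have "\<dots> = (\<Sum>b<n. (\<Sum>a<n. ?W $$ (x, a) * vec_index v a) * cnj (?W $$ (y, b) * vec_index v b))"
  proof (intro sum.cong refl)
    fix b assume "b \<in> {..<n}"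
    then have b: "b < n" by simp
    have "(?W * ket_bra v) $$ (x, b) = (\<Sum>a<n. ?W $$ (x, a) * vec_index v a) * cnj (vec_index v b)"
      unfolding mult_mat_index_sum[OF W(1) k xy(1) b] sum_distrib_right
      using v b by (intro sum.cong refl) (simp add: ket_bra_def)
    then show "(?W * ket_bra v) $$ (x, b) * ?W' $$ (b, y)
      = (\<Sum>a<n. ?W $$ (x, a) * vec_index v a) * cnj (?W $$ (y, b) * vec_index v b)"
      using W'W[OF b xy(2)] by (simp add: mult_ac)
  qed
  also have "\<dots> = evolved_amp n K u E (vec_index v) t x * cnj (evolved_amp n K u E (vec_index v) t y)"
    unfolding sum_distrib_left[symmetric] cnj_sum[symmetric] using xy by (simp only: amp)
  finally show ?thesis .
qed

section \<open>Quantum Shearer inequality\<close>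

definition conf :: "nat \<Rightarrow> nat set \<Rightarrow> (nat \<Rightarrow> nat) set" where
  "conf d R = (R \<rightarrow>\<^sub>E {..<d})"

definition glue :: "nat set \<Rightarrow> (nat \<Rightarrow> nat) \<Rightarrow> (nat \<Rightarrow> nat) \<Rightarrow> nat \<Rightarrow> nat" where
  "glue R a c = (\<lambda>s. if s \<in> R then a s else c s)"

text \<open>The partial trace over \<open>S - R\<close>. Configurations keep the names of the spins,
  so that nested partial traces compose without renumbering digits.\<close>

definition marg :: "nat \<Rightarrow> nat set \<Rightarrow> nat set \<Rightarrow> ((nat \<Rightarrow> nat) \<Rightarrow> (nat \<Rightarrow> nat) \<Rightarrow> complex) \<Rightarrow> (nat \<Rightarrow> nat) \<Rightarrow> (nat \<Rightarrow> nat) \<Rightarrow> complex" where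
  "marg d S R \<rho> a b = (\<Sum>c\<in>conf d (S - R). \<rho> (glue R a c) (glue R b c))"

lemma finite_conf [simp]: "finite R \<Longrightarrow> finite (conf d R)"
  by (simp add: conf_def finite_PiE)

lemma card_conf: "finite R \<Longrightarrow> card (conf d R) = d ^ card R"
  by (simp add: conf_def card_PiE)

lemma conf_ext: "a \<in> conf d R \<Longrightarrow> s \<notin> R \<Longrightarrow> a s = undefined"
  by (auto simp: conf_def)

lemma glue_conf: "R \<subseteq> S \<Longrightarrow> a \<in> conf d R \<Longrightarrow> c \<in> conf d (S - R) \<Longrightarrow> glue R a c \<in> conf d S"
  by (auto simp: conf_def glue_def PiE_def Pi_def extensional_def)

lemma glue_bij:
  assumes "R \<subseteq> S"
  shows "bij_betw (\<lambda>(a, c). glue R a c) (conf d R \<times> conf d (S - R)) (conf d S)"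
proof (rule bij_betw_byWitness[where f' = "\<lambda>y. (restrict y R, restrict y (S - R))"])
  show "\<forall>a\<in>conf d R \<times> conf d (S - R). (\<lambda>y. (restrict y R, restrict y (S - R))) ((\<lambda>(a, c). glue R a c) a) = a"
    by (auto simp: conf_def glue_def restrict_def PiE_def extensional_def fun_eq_iff)
  show "\<forall>a'\<in>conf d S. (\<lambda>(a, c). glue R a c) ((\<lambda>y. (restrict y R, restrict y (S - R))) a') = a'"
    using assms by (auto simp: conf_def glue_def restrict_def PiE_def extensional_def fun_eq_iff)
  show "(\<lambda>(a, c). glue R a c) ` (conf d R \<times> conf d (S - R)) \<subseteq> conf d S"
    using glue_conf[OF assms] by auto
  show "(\<lambda>y. (restrict y R, restrict y (S - R))) ` conf d S \<subseteq> conf d R \<times> conf d (S - R)"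
    using assms by (auto simp: conf_def restrict_def PiE_def Pi_def extensional_def)
qed

lemma sum_glue:
  fixes h :: "(nat \<Rightarrow> nat) \<Rightarrow> 'a::comm_monoid_add"
  assumes "R \<subseteq> S"
  shows "(\<Sum>y\<in>conf d S. h y) = (\<Sum>a\<in>conf d R. \<Sum>c\<in>conf d (S - R). h (glue R a c))"
proof -
  have "(\<Sum>y\<in>conf d S. h y) = (\<Sum>ac\<in>conf d R \<times> conf d (S - R). h ((\<lambda>(a, c). glue R a c) ac))"
    by (rule sum.reindex_bij_betw[OF glue_bij[OF assms], symmetric])
  then show ?thesis by (simp add: sum.cartesian_product split_def)
qed

lemma glue_glue:
  assumes "R \<subseteq> R'" shows "glue R a (glue (R' - R) c e) = glue R' (glue R a c) e"
  using assms by (auto simp: glue_def fun_eq_iff)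

lemma marg_marg:
  assumes "R \<subseteq> R'" "R' \<subseteq> S"
  shows "marg d S R \<rho> a b = (\<Sum>c\<in>conf d (R' - R). marg d S R' \<rho> (glue R a c) (glue R b c))"
proof -
  have *: "R' - R \<subseteq> S - R" "S - R - (R' - R) = S - R'" using assms by auto
  show ?thesis
    unfolding marg_def sum_glue[OF *(1)] *(2) glue_glue[OF assms(1)] ..
qed

lemma conf_single: "bij_betw (\<lambda>k. (\<lambda>_. undefined)(i := k)) {..<d} (conf d {i})"
proof (rule bij_betw_byWitness[where f' = "\<lambda>c. c i"])
  show "\<forall>c\<in>conf d {i}. (\<lambda>_. undefined)(i := c i) = c"
    by (auto simp: conf_def PiE_def extensional_def fun_eq_iff)
qed (auto simp: conf_def PiE_def extensional_def)

lemma marg_insert: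
  assumes "i \<in> S" "i \<notin> R" "R \<subseteq> S" "a \<in> conf d R" "b \<in> conf d R"
  shows "marg d S R \<rho> a b = (\<Sum>k<d. marg d S (insert i R) \<rho> (a(i := k)) (b(i := k)))"
proof -
  have "insert i R - R = {i}" using assms by auto
  then have "marg d S R \<rho> a b = (\<Sum>c\<in>conf d {i}. marg d S (insert i R) \<rho> (glue R a c) (glue R b c))"
    using marg_marg[of R "insert i R" S d \<rho> a b] assms by auto
  also have "\<dots> = (\<Sum>k<d. marg d S (insert i R) \<rho> (glue R a ((\<lambda>_. undefined)(i := k))) (glue R b ((\<lambda>_. undefined)(i := k))))"
    by (rule sum.reindex_bij_betw[OF conf_single, symmetric])
  also have "\<dots> = (\<Sum>k<d. marg d S (insert i R) \<rho> (a(i := k)) (b(i := k)))"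
  proof (intro sum.cong refl)
    fix k
    have "glue R a ((\<lambda>_. undefined)(i := k)) = a(i := k)" if "a \<in> conf d R" for a
      using that assms(2) by (auto simp: glue_def fun_eq_iff conf_ext)
    then show "marg d S (insert i R) \<rho> (glue R a ((\<lambda>_. undefined)(i := k))) (glue R b ((\<lambda>_. undefined)(i := k)))
      = marg d S (insert i R) \<rho> (a(i := k)) (b(i := k))" using assms by simp
  qed
  finally show ?thesis .
qed

text \<open>The vector on the right is \<open>f\<close> tensored with the basis vector
  \<open>c\<close> of the traced-out spins. The form of the partial trace is thus a sum of values of
  the original form, which is how positivity is inherited.\<close>

lemma marg_form:
  assumes R: "R \<subseteq> S" and S: "finite S"
  shows "(\<Sum>a\<in>conf d R. \<Sum>b\<in>conf d R. cnj (f a) * marg d S R \<rho> a b * f b)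
    = (\<Sum>c\<in>conf d (S - R). \<Sum>x\<in>conf d S. \<Sum>y\<in>conf d S.
        cnj (if restrict x (S - R) = c then f (restrict x R) else 0) * \<rho> x y * (if restrict y (S - R) = c then f (restrict y R) else 0))"
proof -
  have g: "restrict (glue R a e) (S - R) = e" "restrict (glue R a e) R = a" if "a \<in> conf d R" "e \<in> conf d (S - R)" for a e
    using that R by (auto simp: conf_def glue_def restrict_def PiE_def extensional_def fun_eq_iff)
  have fin: "finite (conf d (S - R))" using S by simp
  have cif: "cnj (if P then z else 0) = (if P then cnj z else 0)" for P z by simp
  have in_sum: "(\<Sum>e\<in>conf d (S - R). (if restrict (glue R a e) (S - R) = c then f (restrict (glue R a e) R) else 0) * h (glue R a e))
     = f a * h (glue R a c)" if "a \<in> conf d R" "c \<in> conf d (S - R)" for a c and h :: "_ \<Rightarrow> complex" and f :: "_ \<Rightarrow> complex"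
  proof -
    have "(\<Sum>e\<in>conf d (S - R). (if restrict (glue R a e) (S - R) = c then f (restrict (glue R a e) R) else 0) * h (glue R a e))
      = (\<Sum>e\<in>conf d (S - R). if e = c then f a * h (glue R a c) else 0)"
      by (intro sum.cong refl) (use that g in auto)
    then show ?thesis using fin that by simp
  qed
  have form: "(\<Sum>x\<in>conf d S. \<Sum>y\<in>conf d S.
        cnj (if restrict x (S - R) = c then f (restrict x R) else 0) * \<rho> x y * (if restrict y (S - R) = c then f (restrict y R) else 0))
     = (\<Sum>a\<in>conf d R. \<Sum>b\<in>conf d R. cnj (f a) * \<rho> (glue R a c) (glue R b c) * f b)"
    if c: "c \<in> conf d (S - R)" for c
  proof -
    have "(\<Sum>x\<in>conf d S. \<Sum>y\<in>conf d S.
        cnj (if restrict x (S - R) = c then f (restrict x R) else 0) * \<rho> x y * (if restrict y (S - R) = c then f (restrict y R) else 0))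
      = (\<Sum>x\<in>conf d S. (if restrict x (S - R) = c then cnj (f (restrict x R)) else 0) *
          (\<Sum>y\<in>conf d S. (if restrict y (S - R) = c then f (restrict y R) else 0) * \<rho> x y))"
      by (simp add: sum_distrib_left mult_ac cif)
    also have "\<dots> = (\<Sum>a\<in>conf d R. cnj (f a) * (\<Sum>b\<in>conf d R. f b * \<rho> (glue R a c) (glue R b c)))"
    proof -
      have inner: "(\<Sum>y\<in>conf d S. (if restrict y (S - R) = c then f (restrict y R) else 0) * \<rho> x y)
        = (\<Sum>b\<in>conf d R. f b * \<rho> x (glue R b c))" for x
        unfolding sum_glue[OF R, where h = "\<lambda>y. (if restrict y (S - R) = c then f (restrict y R) else 0) * \<rho> x y"]
        by (intro sum.cong refl) (rule in_sum[OF _ c])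
      show ?thesis
        unfolding inner
          sum_glue[OF R, where h = "\<lambda>x. (if restrict x (S - R) = c then cnj (f (restrict x R)) else 0) * (\<Sum>b\<in>conf d R. f b * \<rho> x (glue R b c))"]
        by (intro sum.cong refl) (rule in_sum[OF _ c, where f = "\<lambda>x. cnj (f x)"])
    qed
    finally show ?thesis by (simp add: sum_distrib_left mult_ac)
  qed
  have "(\<Sum>c\<in>conf d (S - R). \<Sum>x\<in>conf d S. \<Sum>y\<in>conf d S.
        cnj (if restrict x (S - R) = c then f (restrict x R) else 0) * \<rho> x y * (if restrict y (S - R) = c then f (restrict y R) else 0))
     = (\<Sum>c\<in>conf d (S - R). \<Sum>a\<in>conf d R. \<Sum>b\<in>conf d R. cnj (f a) * \<rho> (glue R a c) (glue R b c) * f b)"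
    by (rule sum.cong[OF refl]) (rule form)
  also have "\<dots> = (\<Sum>a\<in>conf d R. \<Sum>c\<in>conf d (S - R). \<Sum>b\<in>conf d R. cnj (f a) * \<rho> (glue R a c) (glue R b c) * f b)"
    by (rule sum.swap)
  also have "\<dots> = (\<Sum>a\<in>conf d R. \<Sum>b\<in>conf d R. \<Sum>c\<in>conf d (S - R). cnj (f a) * \<rho> (glue R a c) (glue R b c) * f b)"
    by (intro sum.cong refl sum.swap)
  finally show ?thesis by (simp add: marg_def sum_distrib_left sum_distrib_right)
qed

section \<open>Positivity of states and of their partial traces\<close>

definition psd_on :: "'a set \<Rightarrow> ('a \<Rightarrow> 'a \<Rightarrow> complex) \<Rightarrow> bool" where
  "psd_on I M \<longleftrightarrow> (\<forall>f. 0 \<le> Re (\<Sum>x\<in>I. \<Sum>y\<in>I. cnj (f x) * M x y * f y))"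

definition pd_on :: "'a set \<Rightarrow> ('a \<Rightarrow> 'a \<Rightarrow> complex) \<Rightarrow> bool" where
  "pd_on I M \<longleftrightarrow> (\<forall>f. (\<exists>x\<in>I. f x \<noteq> 0) \<longrightarrow> 0 < Re (\<Sum>x\<in>I. \<Sum>y\<in>I. cnj (f x) * M x y * f y))"

lemma psd_on_eigenvalue:
  assumes "psd_on I M" "eigensys I K u p M" "i \<in> K" shows "p i \<ge> 0"
proof -
  have "0 \<le> Re (\<Sum>x\<in>I. \<Sum>y\<in>I. cnj (u i x) * M x y * u i y)"
    using assms(1) unfolding psd_on_def by (rule spec)
  then show ?thesis unfolding eigensys_eigenvalue[OF assms(2,3)] by simp
qed

lemma pd_on_eigenvalue:
  assumes "pd_on I M" "eigensys I K u p M" "i \<in> K" shows "p i > 0"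
proof -
  have "\<exists>x\<in>I. u i x \<noteq> 0"
  proof (rule ccontr)
    assume "\<not> ?thesis"
    then show False using onb_ortho[OF eigensys_onb[OF assms(2)] assms(3,3)] by simp
  qed
  moreover have "(\<exists>x\<in>I. u i x \<noteq> 0) \<longrightarrow> 0 < Re (\<Sum>x\<in>I. \<Sum>y\<in>I. cnj (u i x) * M x y * u i y)"
    using assms(1) unfolding pd_on_def by (rule spec)
  ultimately show ?thesis unfolding eigensys_eigenvalue[OF assms(2,3)] by simp
qed

lemma eigensys_pd_on:
  assumes e: "eigensys I K u p M" and p: "\<And>i. i \<in> K \<Longrightarrow> p i > 0"
  shows "pd_on I M"
  unfolding pd_on_def
proof (intro allI impI)
  fix f :: "'a \<Rightarrow> complex" assume f: "\<exists>x\<in>I. f x \<noteq> 0"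
  note u = eigensys_onb[OF e]
  note fin = onb_finite[OF u]
  obtain x where x: "x \<in> I" "f x \<noteq> 0" using f by blast
  have "0 < (\<Sum>x\<in>I. (cmod (f x))\<^sup>2)"
    by (rule sum_pos2[OF fin(1) x(1)]) (use x in auto)
  then have "0 < (\<Sum>i\<in>K. (cmod (\<Sum>x\<in>I. cnj (u i x) * f x))\<^sup>2)" using onb_parseval[OF u] by simp
  then have "(\<Sum>i\<in>K. (cmod (\<Sum>x\<in>I. cnj (u i x) * f x))\<^sup>2) \<noteq> 0" by simp
  then obtain i where i: "i \<in> K" "(cmod (\<Sum>x\<in>I. cnj (u i x) * f x))\<^sup>2 \<noteq> 0"
    by (rule sum.not_neutral_contains_not_neutral)
  have "0 < (\<Sum>i\<in>K. p i * (cmod (\<Sum>x\<in>I. cnj (u i x) * f x))\<^sup>2)"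
    by (rule sum_pos2[OF fin(2) i(1)]) (use i p[OF i(1)] less_imp_le[OF p] in auto)
  then show "0 < Re (\<Sum>x\<in>I. \<Sum>y\<in>I. cnj (f x) * M x y * f y)"
    unfolding eigensys_quadratic_form[OF e] by simp
qed

lemma marg_psd:
  assumes R: "R \<subseteq> S" and S: "finite S" and p: "psd_on (conf d S) \<rho>"
  shows "psd_on (conf d R) (marg d S R \<rho>)"
  unfolding psd_on_def marg_form[OF R S]
proof
  fix f
  have *: "0 \<le> Re (\<Sum>x\<in>conf d S. \<Sum>y\<in>conf d S. cnj (F x) * \<rho> x y * F y)" for F
    using p unfolding psd_on_def by (rule spec)
  show "0 \<le> Re (\<Sum>c\<in>conf d (S - R). \<Sum>x\<in>conf d S. \<Sum>y\<in>conf d S.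
        cnj (if restrict x (S - R) = c then f (restrict x R) else 0) * \<rho> x y * (if restrict y (S - R) = c then f (restrict y R) else 0))"
    unfolding Re_sum[of _ "conf d (S - R)"]
    by (intro sum_nonneg) (rule *)
qed

lemma conf_nonempty: "d > 0 \<Longrightarrow> conf d R \<noteq> {}"
  by (auto simp: conf_def PiE_eq_empty_iff)

lemma marg_pd:
  assumes R: "R \<subseteq> S" and S: "finite S" and p: "pd_on (conf d S) \<rho>" and d: "d > 0"
  shows "pd_on (conf d R) (marg d S R \<rho>)"
  unfolding pd_on_def marg_form[OF R S]
proof (intro allI impI)
  fix f :: "_ \<Rightarrow> complex" assume "\<exists>x\<in>conf d R. f x \<noteq> 0"
  then obtain a where a: "a \<in> conf d R" "f a \<noteq> 0" by blast
  define F where "F c x = (if restrict x (S - R) = c then f (restrict x R) else 0)" for c x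
  have "0 < Re (\<Sum>x\<in>conf d S. \<Sum>y\<in>conf d S. cnj (F c x) * \<rho> x y * F c y)" if c: "c \<in> conf d (S - R)" for c
  proof -
    have "F c (glue R a c) \<noteq> 0"
    proof -
      have "restrict (glue R a c) (S - R) = c" "restrict (glue R a c) R = a"
        using a c R by (auto simp: conf_def glue_def restrict_def PiE_def extensional_def fun_eq_iff)
      then show ?thesis using a by (simp add: F_def)
    qed
    then have "\<exists>x\<in>conf d S. F c x \<noteq> 0" using glue_conf[OF R a(1) c] by (rule bexI)
    moreover have "(\<exists>x\<in>conf d S. F c x \<noteq> 0) \<longrightarrow> 0 < Re (\<Sum>x\<in>conf d S. \<Sum>y\<in>conf d S. cnj (F c x) * \<rho> x y * F c y)"
      using p unfolding pd_on_def by (rule spec)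
    ultimately show ?thesis by (rule rev_mp)
  qed
  then have "0 < (\<Sum>c\<in>conf d (S - R). Re (\<Sum>x\<in>conf d S. \<Sum>y\<in>conf d S. cnj (F c x) * \<rho> x y * F c y))"
    using S conf_nonempty[OF d] by (intro sum_pos) auto
  then show "0 < Re (\<Sum>c\<in>conf d (S - R). \<Sum>x\<in>conf d S. \<Sum>y\<in>conf d S.
        cnj (if restrict x (S - R) = c then f (restrict x R) else 0) * \<rho> x y * (if restrict y (S - R) = c then f (restrict y R) else 0))"
    by (simp add: F_def)
qed

lemma marg_hermitian:
  assumes R: "R \<subseteq> S" and h: "hermitian_on (conf d S) \<rho>"
  shows "hermitian_on (conf d R) (marg d S R \<rho>)"
  using h glue_conf[OF R] unfolding hermitian_on_def marg_def by (auto intro!: sum.cong)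

lemma marg_self:
  assumes "a \<in> conf d S" "b \<in> conf d S" shows "marg d S S \<rho> a b = \<rho> a b"
proof -
  have "conf d (S - S) = {\<lambda>_. undefined}" by (simp add: conf_def)
  moreover have "glue S a (\<lambda>_. undefined) = a" if "a \<in> conf d S" for a
    using that by (auto simp: glue_def fun_eq_iff conf_ext)
  ultimately show ?thesis using assms by (simp add: marg_def)
qed

lemma marg_trace:
  assumes R: "R \<subseteq> S"
  shows "(\<Sum>a\<in>conf d R. marg d S R \<rho> a a) = (\<Sum>x\<in>conf d S. \<rho> x x)"
  unfolding marg_def sum_glue[OF R] ..

text \<open>Strong subadditivity for the three parties \<open>{i}\<close>, \<open>R\<close> and
  \<open>R' - R\<close>, stated as diminishing increments: adding spin \<open>i\<close> to a larger
  set raises the entropy by no more than adding it to a smaller one.\<close>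

lemma marg_ent_submodular:
  assumes h: "hermitian_on (conf d S) \<rho>" and p: "pd_on (conf d S) \<rho>" and S: "finite S" and d: "d > 0"
    and R: "R \<subseteq> R'" "insert i R' \<subseteq> S" "i \<notin> R'"
  shows "ent (conf d (insert i R')) (marg d S (insert i R') \<rho>) - ent (conf d R') (marg d S R' \<rho>)
     \<le> ent (conf d (insert i R)) (marg d S (insert i R) \<rho>) - ent (conf d R) (marg d S R \<rho>)"
proof -
  let ?K = "{..<d}" and ?I = "conf d R" and ?C = "conf d (R' - R)"
  let ?m = "\<lambda>Q. marg d S Q \<rho>"
  \<comment> \<open>These bijections split a configuration of a union of spins into a tuple, turning
    marginals on sets of spins into states on the product index sets of
    \<open>strong_subadditivity\<close>.\<close>
  define f where "f = (\<lambda>(k, a, c). (glue R a c)(i := k))"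
  define g where "g = (\<lambda>(a, c). glue R a c)"
  define f1 where "f1 = (\<lambda>(k, a). a(i := k :: nat))"
  have sub: "R' \<subseteq> S" "insert i R \<subseteq> S" "R \<subseteq> S" "i \<in> S" "i \<notin> R" using R by auto
  have fin: "finite ?C" "finite ?K" using finite_subset[OF sub(1) S] by auto
  have es: "\<exists>(K::nat set) u q. eigensys (conf d Q) K u q (?m Q)" if "Q \<subseteq> S" for Q
    by (intro hermitian_eigensys marg_hermitian h finite_conf finite_subset[OF that S] that)
  have pos: "q j > 0" if "Q \<subseteq> S" "eigensys (conf d Q) K u q (?m Q)" "j \<in> K" for Q K u q and j :: nat
    by (rule pd_on_eigenvalue[OF marg_pd[OF that(1) S p d] that(2,3)])
  have ins_bij: "bij_betw (\<lambda>(k, y). y(i := k)) (?K \<times> conf d Q) (conf d (insert i Q))" if "i \<notin> Q" for Q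
  proof (rule bij_betw_byWitness[where f' = "\<lambda>y. (y i, restrict y Q)"])
    show "\<forall>ky\<in>?K \<times> conf d Q. (\<lambda>y. (y i, restrict y Q)) ((\<lambda>(k, y). y(i := k)) ky) = ky"
      using that by (auto simp: conf_def restrict_def PiE_def extensional_def fun_eq_iff)
    show "\<forall>y\<in>conf d (insert i Q). (\<lambda>(k, y). y(i := k)) ((\<lambda>y. (y i, restrict y Q)) y) = y"
      by (auto simp: conf_def restrict_def PiE_def extensional_def fun_eq_iff)
  qed (use that in \<open>auto simp: conf_def PiE_def Pi_def extensional_def\<close>)
  have g: "bij_betw g (?I \<times> ?C) (conf d R')" unfolding g_def by (rule glue_bij[OF R(1)])
  have f1: "bij_betw f1 (?K \<times> ?I) (conf d (insert i R))" unfolding f1_def by (rule ins_bij[OF sub(5)])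
  have f: "bij_betw f (?K \<times> (?I \<times> ?C)) (conf d (insert i R'))"
  proof -
    have "bij_betw (map_prod id g) (?K \<times> (?I \<times> ?C)) (?K \<times> conf d R')"
      using bij_betw_map_prod[OF bij_betw_id g] .
    from bij_betw_trans[OF this ins_bij[OF R(3)]] show ?thesis
      unfolding f_def g_def by (simp add: comp_def split_def map_prod_def)
  qed
  obtain K1 :: "nat set" and u1 q1 where e1: "eigensys (conf d (insert i R')) K1 u1 q1 (?m (insert i R'))" using es[OF R(2)] by blast
  obtain K2 :: "nat set" and u2 q2 where e2: "eigensys (conf d R') K2 u2 q2 (?m R')" using es[OF sub(1)] by blast
  obtain K3 :: "nat set" and u3 q3 where e3: "eigensys (conf d (insert i R)) K3 u3 q3 (?m (insert i R))" using es[OF sub(2)] by blast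
  obtain K4 :: "nat set" and u4 q4 where e4: "eigensys (conf d R) K4 u4 q4 (?m R)" using es[OF sub(3)] by blast
  have E1: "eigensys (?K \<times> (?I \<times> ?C)) K1 (\<lambda>j x. u1 j (f x)) q1 (\<lambda>x y. ?m (insert i R') (f x) (f y))"
    using eigensys_reindex[OF e1 f bij_betw_id, of "\<lambda>x y. ?m (insert i R') (f x) (f y)"] unfolding id_apply by blast
  have E2: "eigensys (?I \<times> ?C) K2 (\<lambda>j x. u2 j (g x)) q2 (\<lambda>x y. ?m R' (g x) (g y))"
    using eigensys_reindex[OF e2 g bij_betw_id, of "\<lambda>x y. ?m R' (g x) (g y)"] unfolding id_apply by blast
  have E3: "eigensys (?K \<times> ?I) K3 (\<lambda>j x. u3 j (f1 x)) q3 (\<lambda>x y. ?m (insert i R) (f1 x) (f1 y))"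
    using eigensys_reindex[OF e3 f1 bij_betw_id, of "\<lambda>x y. ?m (insert i R) (f1 x) (f1 y)"] unfolding id_apply by blast
  have "ent (?K \<times> (?I \<times> ?C)) (\<lambda>x y. ?m (insert i R') (f x) (f y)) - ent (?I \<times> ?C) (\<lambda>x y. ?m R' (g x) (g y))
     \<le> ent (?K \<times> ?I) (\<lambda>x y. ?m (insert i R) (f1 x) (f1 y)) - ent ?I (?m R)"
  proof (rule strong_subadditivity[OF E1 E2 E3 e4])
    show "0 \<le> q1 j" if "j \<in> K1" for j using pos[OF R(2) e1 that] by simp
    show "0 < q2 j" if "j \<in> K2" for j using pos[OF sub(1) e2 that] by simp
    show "0 \<le> q3 j" if "j \<in> K3" for j using pos[OF sub(2) e3 that] by simp
    show "0 < q4 j" if "j \<in> K4" for j using pos[OF sub(3) e4 that] by simp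
  next
    fix x y assume "x \<in> ?I \<times> ?C" "y \<in> ?I \<times> ?C"
    then have "g x \<in> conf d R'" "g y \<in> conf d R'" using bij_betwE[OF g] by auto
    from marg_insert[OF sub(4) R(3) sub(1) this, of \<rho>]
    show "?m R' (g x) (g y) = (\<Sum>k\<in>?K. ?m (insert i R') (f (k, x)) (f (k, y)))"
      by (simp add: f_def g_def split_def)
  next
    fix k x l y assume kx: "k \<in> ?K" "x \<in> ?I" "l \<in> ?K" "y \<in> ?I"
    have eq: "glue (insert i R) (a(i := k)) c = (glue R a c)(i := k)" for a c k by (auto simp: glue_def fun_eq_iff)
    have df: "insert i R' - insert i R = R' - R" using R by auto
    show "?m (insert i R) (f1 (k, x)) (f1 (l, y)) = (\<Sum>c\<in>?C. ?m (insert i R') (f (k, x, c)) (f (l, y, c)))"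
      using marg_marg[of "insert i R" "insert i R'" S d \<rho> "x(i := k)" "y(i := l)"] R
      by (auto simp: f_def f1_def eq df)
  next
    fix x y assume "x \<in> ?I" "y \<in> ?I"
    from marg_insert[OF sub(4,5,3) this, of \<rho>]
    show "?m R x y = (\<Sum>k\<in>?K. ?m (insert i R) (f1 (k, x)) (f1 (k, y)))" by (simp add: f1_def)
  qed (use fin in auto)
  moreover have "ent (?K \<times> (?I \<times> ?C)) (\<lambda>x y. ?m (insert i R') (f x) (f y)) = ent (conf d (insert i R')) (?m (insert i R'))"
    by (rule ent_reindex[OF e1 f refl])
  moreover have "ent (?I \<times> ?C) (\<lambda>x y. ?m R' (g x) (g y)) = ent (conf d R') (?m R')"
    by (rule ent_reindex[OF e2 g refl])
  moreover have "ent (?K \<times> ?I) (\<lambda>x y. ?m (insert i R) (f1 x) (f1 y)) = ent (conf d (insert i R)) (?m (insert i R))"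
    by (rule ent_reindex[OF e3 f1 refl])
  ultimately show ?thesis by simp
qed

text \<open>The value on the whole is telescoped along the order of the spins. By submodularity each
  \<open>F (A j)\<close> is at least the sum of the full increments \<open>?D i\<close> over
  \<open>i\<close> in \<open>A j\<close>, and every spin is counted \<open>r\<close> times.
  Increments may be negative, which is why the cover has to be exactly uniform.\<close>

lemma submodular_shearer:
  fixes F :: "nat set \<Rightarrow> real" and m :: nat
  assumes sub: "\<And>R R' i. R \<subseteq> R' \<Longrightarrow> insert i R' \<subseteq> {..<N} \<Longrightarrow> i \<notin> R' \<Longrightarrow> F (insert i R') - F R' \<le> F (insert i R) - F R"
    and F0: "F {} = 0"
    and A: "\<And>j. j < m \<Longrightarrow> A j \<subseteq> {..<N}" and r: "\<And>s. s < N \<Longrightarrow> card {j. j < m \<and> s \<in> A j} = r"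
  shows "real r * F {..<N} \<le> (\<Sum>j<m. F (A j))"
proof -
  let ?D = "\<lambda>i. F {..<Suc i} - F {..<i}"
  have le: "(\<Sum>i\<in>B \<inter> {..<k}. ?D i) \<le> F (B \<inter> {..<k})" if "k \<le> N" for B k
    using that
  proof (induction k)
    case 0
    then show ?case by (simp add: F0)
  next
    case (Suc k)
    show ?case
    proof (cases "k \<in> B")
      case True
      have eq: "B \<inter> {..<Suc k} = insert k (B \<inter> {..<k})" using True by auto
      have "?D k \<le> F (insert k (B \<inter> {..<k})) - F (B \<inter> {..<k})"
        using sub[of "B \<inter> {..<k}" "{..<k}" k] Suc.prems by (auto simp: lessThan_Suc)
      then show ?thesis unfolding eq using Suc by simp
    next
      case False
      then have "B \<inter> {..<Suc k} = B \<inter> {..<k}" by (auto simp: less_Suc_eq)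
      then show ?thesis using Suc by simp
    qed
  qed
  have tel: "(\<Sum>i<N. ?D i) = F {..<N}" by (subst sum_lessThan_telescope) (simp add: F0)
  have "real r * F {..<N} = (\<Sum>i<N. real r * ?D i)" by (simp only: tel[symmetric] sum_distrib_left)
  also have "\<dots> = (\<Sum>i<N. \<Sum>j<m. if i \<in> A j then ?D i else 0)"
  proof (intro sum.cong refl)
    fix i assume "i \<in> {..<N}"
    then have "r = card {j. j < m \<and> i \<in> A j}" using r by simp
    moreover have "(\<Sum>j<m. if i \<in> A j then ?D i else 0) = (\<Sum>j\<in>{j. j < m \<and> i \<in> A j}. ?D i)"
      using sum.inter_filter[of "{..<m}" "\<lambda>_. ?D i" "\<lambda>j. i \<in> A j", OF finite_lessThan] by (simp only: lessThan_iff)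
    ultimately show "real r * ?D i = (\<Sum>j<m. if i \<in> A j then ?D i else 0)" by simp
  qed
  also have "\<dots> = (\<Sum>j<m. \<Sum>i<N. if i \<in> A j then ?D i else 0)" by (rule sum.swap)
  also have "\<dots> = (\<Sum>j<m. \<Sum>i\<in>A j \<inter> {..<N}. ?D i)"
  proof (rule sum.cong[OF refl])
    fix j
    show "(\<Sum>i<N. if i \<in> A j then ?D i else 0) = (\<Sum>i\<in>A j \<inter> {..<N}. ?D i)"
      using sum.inter_restrict[of "{..<N}" ?D "A j"] by (simp only: finite_lessThan Int_commute[of "A j"])
  qed
  also have "\<dots> \<le> (\<Sum>j<m. F (A j \<inter> {..<N}))" by (intro sum_mono le) simp
  also have "\<dots> = (\<Sum>j<m. F (A j))" using A by (intro sum.cong refl arg_cong[where f = F]) auto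
  finally show ?thesis .
qed

theorem quantum_shearer:
  fixes m :: nat
  assumes h: "hermitian_on (conf d {..<N}) \<rho>" and p: "pd_on (conf d {..<N}) \<rho>"
    and tr: "(\<Sum>x\<in>conf d {..<N}. \<rho> x x) = 1" and d: "d > 0"
    and A: "\<And>j. j < m \<Longrightarrow> A j \<subseteq> {..<N}" and r: "\<And>s. s < N \<Longrightarrow> card {j. j < m \<and> s \<in> A j} = r"
  shows "real r * ent (conf d {..<N}) \<rho> \<le> (\<Sum>j<m. ent (conf d (A j)) (marg d {..<N} (A j) \<rho>))"
proof -
  let ?F = "\<lambda>R. ent (conf d R) (marg d {..<N} R \<rho>)"
  have c0: "conf d {} = {\<lambda>_. undefined}" by (simp add: conf_def)
  \<comment> \<open>The marginal on no spins is a one by one matrix whose entry is the total trace,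
    so normalisation gives it entropy zero.\<close>
  have "(\<Sum>a\<in>conf d {}. marg d {..<N} {} \<rho> a a) = 1" unfolding tr[symmetric] by (rule marg_trace) simp
  then have "eigensys (conf d {}) {0::nat} (\<lambda>_ _. 1) (\<lambda>_. 1) (marg d {..<N} {} \<rho>)"
    unfolding eigensys_def onb_def c0 by simp
  from ent_eq[OF this] have F0: "?F {} = 0" by simp
  have "real r * ?F {..<N} \<le> (\<Sum>j<m. ?F (A j))"
  proof (rule submodular_shearer[where F = "?F"])
    show "?F (insert i R') - ?F R' \<le> ?F (insert i R) - ?F R"
      if "R \<subseteq> R'" "insert i R' \<subseteq> {..<N}" "i \<notin> R'" for R R' i
      by (rule marg_ent_submodular[OF h p _ d that]) simp
  qed (fact F0 A r)+
  moreover obtain K :: "nat set" and u q where e: "eigensys (conf d {..<N}) K u q \<rho>"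
    using hermitian_eigensys[OF _ h] by auto
  have "?F {..<N} = ent (conf d {..<N}) \<rho>"
    by (rule ent_reindex[OF e bij_betw_id]) (simp add: marg_self)
  ultimately show ?thesis by simp
qed

section \<open>Continuity of the entropy\<close>

definition mix :: "'a set \<Rightarrow> real \<Rightarrow> ('a \<Rightarrow> 'a \<Rightarrow> complex) \<Rightarrow> 'a \<Rightarrow> 'a \<Rightarrow> complex" where
  "mix I \<eta> M x y = of_real (1 - \<eta>) * M x y + of_real (\<eta> / card I) * of_bool (x = y)"

lemma eigensys_mix:
  assumes e: "eigensys I K u p M"
  shows "eigensys I K u (\<lambda>i. (1 - \<eta>) * p i + \<eta> / card I) (mix I \<eta> M)"
  unfolding eigensys_def
proof (intro conjI ballI)
  show u: "onb I K u" using e by (rule eigensys_onb)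
  fix x y assume xy: "x \<in> I" "y \<in> I"
  have "(\<Sum>i\<in>K. of_real ((1 - \<eta>) * p i + \<eta> / card I) * u i x * cnj (u i y))
    = of_real (1 - \<eta>) * (\<Sum>i\<in>K. of_real (p i) * u i x * cnj (u i y)) + of_real (\<eta> / card I) * (\<Sum>i\<in>K. u i x * cnj (u i y))"
    unfolding sum_distrib_left sum.distrib[symmetric] by (intro sum.cong refl) (simp add: algebra_simps)
  then show "mix I \<eta> M x y = (\<Sum>i\<in>K. of_real ((1 - \<eta>) * p i + \<eta> / card I) * u i x * cnj (u i y))"
    unfolding mix_def eigensys_entry[OF e xy] onb_complete[OF u xy] by simp
qed

lemma onb_card:
  assumes u: "onb I K u" shows "card K = card I"
proof -
  have "real (card K) = (\<Sum>i\<in>K. \<Sum>x\<in>I. (cmod (u i x))\<^sup>2)" using onb_norm[OF u] by simp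
  also have "\<dots> = (\<Sum>x\<in>I. \<Sum>i\<in>K. (cmod (u i x))\<^sup>2)" by (rule sum.swap)
  also have "\<dots> = real (card I)" using onb_col_norm[OF u] by simp
  finally show ?thesis by simp
qed

lemma ln_mult_le:
  fixes p q :: real
  assumes "p \<ge> 0" "q > 0" shows "p * ln p - p * ln q \<le> p * (p / q - 1)"
proof (cases "p = 0")
  case False
  then have p: "p > 0" using assms by simp
  have "ln (p / q) \<le> p / q - 1" using p assms by (intro ln_le_minus_one) simp
  then have "p * ln (p / q) \<le> p * (p / q - 1)" using p by simp
  then show ?thesis using p assms by (simp add: ln_div right_diff_distrib)
qed simp

text \<open>Jensen for the logarithm: with X the sum of the powers, \<open>ln y \<le> y - 1\<close>
  is taken at \<open>y = p i powr \<delta> / X\<close> and averaged with weights \<open>p i\<close>,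
  which makes the right side vanish. The bound is the Renyi entropy of order
  \<open>1 + \<delta>\<close>.\<close>

lemma shannon_ge_renyi:
  fixes p :: "'a \<Rightarrow> real"
  assumes fin: "finite K" and p: "\<And>i. i \<in> K \<Longrightarrow> p i \<ge> 0" and sum1: "(\<Sum>i\<in>K. p i) = 1" and \<delta>: "\<delta> > 0"
  shows "- (\<Sum>i\<in>K. p i * ln (p i)) \<ge> - ln (\<Sum>i\<in>K. p i powr (1 + \<delta>)) / \<delta>"
proof -
  define X where "X = (\<Sum>i\<in>K. p i powr (1 + \<delta>))"
  have "(\<Sum>i\<in>K. p i) \<noteq> 0" using sum1 by simp
  then obtain i where i: "i \<in> K" "p i \<noteq> 0" by (rule sum.not_neutral_contains_not_neutral)
  have X: "X > 0" unfolding X_def by (rule sum_pos2[OF fin i(1)]) (use i p in auto)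
  have "\<delta> * (p i * ln (p i)) - p i * ln X \<le> p i powr (1 + \<delta>) / X - p i" if "i \<in> K" for i
  proof (cases "p i = 0")
    case False
    then have pi: "p i > 0" using p[OF that] by simp
    have "ln (p i powr \<delta> / X) \<le> p i powr \<delta> / X - 1" using pi X by (intro ln_le_minus_one) simp
    then have "p i * (\<delta> * ln (p i) - ln X) \<le> p i * (p i powr \<delta> / X - 1)"
      using pi X by (simp add: ln_div ln_powr)
    then show ?thesis using pi by (simp add: powr_add algebra_simps)
  qed simp
  then have "(\<Sum>i\<in>K. \<delta> * (p i * ln (p i)) - p i * ln X) \<le> (\<Sum>i\<in>K. p i powr (1 + \<delta>) / X - p i)" by (rule sum_mono)
  then have "\<delta> * (\<Sum>i\<in>K. p i * ln (p i)) - ln X \<le> X / X - 1"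
    by (simp add: sum_subtractf sum_distrib_left sum_distrib_right[symmetric] sum1 sum_divide_distrib[symmetric] X_def)
  then have "\<delta> * (\<Sum>i\<in>K. p i * ln (p i)) \<le> ln X" using X by simp
  then show ?thesis unfolding X_def[symmetric] using \<delta> by (simp add: field_simps)
qed

text \<open>Concavity of -x ln x, through the inequality \<open>ln y \<le> y - 1\<close> at
  \<open>y = s / x\<close> for both mixed values. The contribution of \<open>r\<close> is
  non-negative because \<open>r \<le> 1\<close>, and is dropped.\<close>

lemma mix_entropy_ge:
  fixes p r \<eta> :: real
  assumes "p \<ge> 0" "r > 0" "r \<le> 1" "0 < \<eta>" "\<eta> < 1"
  shows "- (((1 - \<eta>) * p + \<eta> * r) * ln ((1 - \<eta>) * p + \<eta> * r)) \<ge> (1 - \<eta>) * - (p * ln p)"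
proof -
  define s where "s = (1 - \<eta>) * p + \<eta> * r"
  have s: "s > 0" unfolding s_def using assms by (simp add: add_nonneg_pos)
  have *: "x * ln s - x * ln x \<le> s - x" if "x \<ge> 0" for x
  proof (cases "x = 0")
    case False
    then have "ln (s / x) \<le> s / x - 1" using that s by (intro ln_le_minus_one) simp
    then have "x * ln (s / x) \<le> x * (s / x - 1)" using that by (rule mult_left_mono)
    then show ?thesis using False that s by (simp add: ln_div algebra_simps)
  qed (use s in simp)
  have "(1 - \<eta>) * (p * ln s - p * ln p) + \<eta> * (r * ln s - r * ln r) \<le> (1 - \<eta>) * (s - p) + \<eta> * (s - r)"
    using *[of p] *[of r] assms by (intro add_mono mult_left_mono) auto
  also have "\<dots> = 0" by (simp add: s_def algebra_simps)
  finally have "s * ln s \<le> (1 - \<eta>) * (p * ln p) + \<eta> * (r * ln r)" by (simp add: s_def algebra_simps)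
  moreover have "\<eta> * (r * ln r) \<le> 0" using assms by (simp add: mult_nonneg_nonpos)
  ultimately show ?thesis unfolding s_def[symmetric] by simp
qed

text \<open>The mixture dominates each of its two parts, so the logarithm of the sum may be replaced
  by that of either part. Summed over a spectrum this costs the binary entropy of
  \<open>\<eta>\<close>.\<close>

lemma mix_entropy_le:
  fixes p r \<eta> :: real
  assumes "p \<ge> 0" "r > 0" "0 < \<eta>" "\<eta> < 1"
  shows "- (((1 - \<eta>) * p + \<eta> * r) * ln ((1 - \<eta>) * p + \<eta> * r))
     \<le> (1 - \<eta>) * - (p * ln p) - (1 - \<eta>) * ln (1 - \<eta>) * p - \<eta> * r * (ln \<eta> + ln r)"
proof -
  define s where "s = (1 - \<eta>) * p + \<eta> * r"
  have sr: "s \<ge> \<eta> * r" "s \<ge> (1 - \<eta>) * p" unfolding s_def using assms by auto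
  have er: "\<eta> * r > 0" using assms by simp
  have 1: "\<eta> * r * (ln \<eta> + ln r) \<le> \<eta> * r * ln s"
  proof (rule mult_left_mono)
    have "ln (\<eta> * r) \<le> ln s" using sr(1) er by simp
    then show "ln \<eta> + ln r \<le> ln s" using assms by (simp add: ln_mult)
  qed (use er in simp)
  have 2: "(1 - \<eta>) * p * (ln (1 - \<eta>) + ln p) \<le> (1 - \<eta>) * p * ln s"
  proof (cases "p = 0")
    case False
    then have pp: "(1 - \<eta>) * p > 0" using assms by simp
    show ?thesis
    proof (rule mult_left_mono)
      have "ln ((1 - \<eta>) * p) \<le> ln s" using sr(2) pp by simp
      then show "ln (1 - \<eta>) + ln p \<le> ln s" using assms False by (simp add: ln_mult)
    qed (use pp in simp)
  qed simp
  have "s * ln s = (1 - \<eta>) * p * ln s + \<eta> * r * ln s" by (simp add: s_def algebra_simps)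
  then show ?thesis using 1 2 unfolding s_def[symmetric] by (simp add: algebra_simps)
qed

lemma ent_mix_ge:
  assumes e: "eigensys I K u p M" and p: "\<And>i. i \<in> K \<Longrightarrow> p i \<ge> 0" and I: "I \<noteq> {}" and \<eta>: "0 < \<eta>" "\<eta> < 1"
  shows "ent I (mix I \<eta> M) \<ge> (1 - \<eta>) * ent I M"
proof -
  have "card I > 0" using I onb_finite[OF eigensys_onb[OF e]] by (simp add: card_gt_0_iff)
  then have r: "1 / real (card I) > 0" "1 / real (card I) \<le> 1" by auto
  have "(1 - \<eta>) * ent I M = (\<Sum>i\<in>K. (1 - \<eta>) * - (p i * ln (p i)))"
    unfolding ent_eq[OF e] by (simp add: sum_distrib_left sum_negf)
  also have "\<dots> \<le> (\<Sum>i\<in>K. - (((1 - \<eta>) * p i + \<eta> * (1 / card I)) * ln ((1 - \<eta>) * p i + \<eta> * (1 / card I))))"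
    by (intro sum_mono mix_entropy_ge p r \<eta>)
  also have "\<dots> = ent I (mix I \<eta> M)"
    unfolding ent_eq[OF eigensys_mix[OF e]] by (simp add: sum_negf)
  finally show ?thesis .
qed

lemma ent_mix_le:
  assumes e: "eigensys I K u p M" and p: "\<And>i. i \<in> K \<Longrightarrow> p i \<ge> 0" and sum1: "(\<Sum>i\<in>K. p i) = 1"
    and I: "I \<noteq> {}" and \<eta>: "0 < \<eta>" "\<eta> < 1"
  shows "ent I (mix I \<eta> M) \<le> (1 - \<eta>) * ent I M - (1 - \<eta>) * ln (1 - \<eta>) - \<eta> * ln \<eta> + \<eta> * ln (card I)"
proof -
  have c: "card I > 0" using I onb_finite[OF eigensys_onb[OF e]] by (simp add: card_gt_0_iff)
  then have r: "1 / real (card I) > 0" by simp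
  have "ent I (mix I \<eta> M) = (\<Sum>i\<in>K. - (((1 - \<eta>) * p i + \<eta> * (1 / card I)) * ln ((1 - \<eta>) * p i + \<eta> * (1 / card I))))"
    unfolding ent_eq[OF eigensys_mix[OF e]] by (simp add: sum_negf)
  also have "\<dots> \<le> (\<Sum>i\<in>K. (1 - \<eta>) * - (p i * ln (p i)) - (1 - \<eta>) * ln (1 - \<eta>) * p i - \<eta> * (1 / card I) * (ln \<eta> + ln (1 / card I)))"
    by (intro sum_mono mix_entropy_le p r \<eta>)
  also have "\<dots> = (1 - \<eta>) * ent I M - (1 - \<eta>) * ln (1 - \<eta>) - real (card K) * (\<eta> * (1 / card I) * (ln \<eta> + ln (1 / card I)))"
    unfolding ent_eq[OF e] sum_subtractf sum_distrib_left[symmetric] sum1 by (simp add: sum_negf)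
  also have "real (card K) * (\<eta> * (1 / card I) * (ln \<eta> + ln (1 / card I))) = \<eta> * ln \<eta> - \<eta> * ln (card I)"
    using c unfolding onb_card[OF eigensys_onb[OF e]] by (simp add: ln_div algebra_simps)
  finally show ?thesis by simp
qed

lemma ent_nonneg:
  assumes e: "eigensys I K u p M" and p: "\<And>i. i \<in> K \<Longrightarrow> p i \<ge> 0" and sum1: "(\<Sum>i\<in>K. p i) = 1"
  shows "ent I M \<ge> 0"
proof -
  have "p i \<le> 1" if "i \<in> K" for i
    using member_le_sum[OF that, of p] p onb_finite[OF eigensys_onb[OF e]] sum1 by auto
  then have "p i * ln (p i) \<le> 0" if "i \<in> K" for i
    using that p[OF that] by (cases "p i = 0") (auto intro!: mult_nonneg_nonpos)
  then have "(\<Sum>i\<in>K. p i * ln (p i)) \<le> 0" by (rule sum_nonpos)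
  then show ?thesis unfolding ent_eq[OF e] by simp
qed

text \<open>The spectra are coupled by squared overlaps, and p ln p - q ln q is split as (p ln p - p
  ln q) + (p - q) ln q. The first part is at most (p - q)^2 / l + (p - q) because q is at least
  \<open>l\<close>; the second is bounded by the arithmetic-geometric mean inequality with free
  weight \<open>a\<close>, since ln q lies between ln l and 0. The linear terms cancel because both
  traces are 1, so only the squared distance \<open>D\<close> remains.\<close>

lemma ent_full_rank_continuity:
  assumes r: "eigensys I K u p \<rho>" and t: "eigensys I L v q \<tau>"
    and p: "\<And>i. i \<in> K \<Longrightarrow> p i \<ge> 0" "(\<Sum>i\<in>K. p i) = 1"
    and q: "\<And>j. j \<in> L \<Longrightarrow> q j \<ge> l" "l > 0" "(\<Sum>j\<in>L. q j) = 1" and a: "a > 0"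
  defines "D \<equiv> (\<Sum>x\<in>I. \<Sum>y\<in>I. (cmod (\<rho> x y - \<tau> x y))\<^sup>2)"
  shows "ent I \<rho> \<ge> ent I \<tau> - (a * D + real (card I) * (ln l)\<^sup>2 / a) / 2 - D / l"
proof -
  define w where "w i j = (cmod (overlap I u v i j))\<^sup>2" for i j
  have w0: "w i j \<ge> 0" for i j by (simp add: w_def)
  note oo = eigensys_onb[OF r] eigensys_onb[OF t]
  note fin = onb_finite[OF oo(1)] onb_finite[OF oo(2)]
  have row: "(\<Sum>j\<in>L. w i j) = 1" if "i \<in> K" for i unfolding w_def by (rule overlap_sum_right[OF oo that])
  have col: "(\<Sum>i\<in>K. w i j) = 1" if "j \<in> L" for j unfolding w_def by (rule overlap_sum_left[OF oo that])
  have D: "(\<Sum>i\<in>K. \<Sum>j\<in>L. w i j * (p i - q j)\<^sup>2) = D" unfolding D_def w_def by (rule eigensys_hs_dist[OF r t])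
  have rows: "(\<Sum>i\<in>K. \<Sum>j\<in>L. w i j * f i) = (\<Sum>i\<in>K. f i)" for f
    using row by (simp add: sum_distrib_right[symmetric])
  have cols: "(\<Sum>i\<in>K. \<Sum>j\<in>L. w i j * f j) = (\<Sum>j\<in>L. f j)" for f
    using col by (subst sum.swap) (simp add: sum_distrib_right[symmetric])
  have qpos: "q j > 0" if "j \<in> L" for j using q(1)[OF that] q(2) by simp
  have q1: "q j \<le> 1" if "j \<in> L" for j
    using member_le_sum[OF that, of q] less_imp_le[OF qpos] fin q(3) by auto
  have pt: "w i j * (p i * ln (p i)) - w i j * (q j * ln (q j))
     \<le> w i j * ((a * (p i - q j)\<^sup>2 + (ln l)\<^sup>2 / a) / 2) + w i j * ((p i - q j)\<^sup>2 / l) + w i j * p i - w i j * q j"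
    if i: "i \<in> K" and j: "j \<in> L" for i j
  proof -
    let ?x = "p i - q j" and ?y = "ln (q j)"
    have "p i * ln (p i) - p i * ?y \<le> p i * (p i / q j - 1)" by (rule ln_mult_le[OF p(1)[OF i] qpos[OF j]])
    also have "\<dots> = ?x\<^sup>2 / q j + ?x" using qpos[OF j] by (simp add: power2_eq_square field_simps)
    also have "?x\<^sup>2 / q j \<le> ?x\<^sup>2 / l" using q(1)[OF j] q(2) by (intro divide_left_mono) auto
    finally have 1: "p i * ln (p i) - p i * ?y \<le> ?x\<^sup>2 / l + ?x" by simp
    have "ln l \<le> ?y" "?y \<le> 0" using q(1)[OF j] q(2) q1[OF j] qpos[OF j] by auto
    then have y2: "?y\<^sup>2 \<le> (ln l)\<^sup>2" by (intro abs_le_square_iff[THEN iffD1]) linarith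
    have "0 \<le> (a * ?x - ?y)\<^sup>2 / a" using a by simp
    then have "2 * (?x * ?y) \<le> a * ?x\<^sup>2 + ?y\<^sup>2 / a" using a by (simp add: power2_diff field_simps power2_eq_square)
    also have "?y\<^sup>2 / a \<le> (ln l)\<^sup>2 / a" using y2 a by (intro divide_right_mono) auto
    finally have 2: "?x * ?y \<le> (a * ?x\<^sup>2 + (ln l)\<^sup>2 / a) / 2" by simp
    have "p i * ln (p i) - q j * ?y = (p i * ln (p i) - p i * ?y) + ?x * ?y" by (simp add: algebra_simps)
    also have "\<dots> \<le> (?x\<^sup>2 / l + ?x) + (a * ?x\<^sup>2 + (ln l)\<^sup>2 / a) / 2" using 1 2 by (rule add_mono)
    finally have "w i j * (p i * ln (p i) - q j * ?y) \<le> w i j * ((?x\<^sup>2 / l + ?x) + (a * ?x\<^sup>2 + (ln l)\<^sup>2 / a) / 2)"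
      using w0 by (rule mult_left_mono)
    then show ?thesis by (simp add: algebra_simps)
  qed
  have "(\<Sum>i\<in>K. p i * ln (p i)) - (\<Sum>j\<in>L. q j * ln (q j))
     = (\<Sum>i\<in>K. \<Sum>j\<in>L. w i j * (p i * ln (p i)) - w i j * (q j * ln (q j)))"
    unfolding sum_subtractf rows cols ..
  also have "\<dots> \<le> (\<Sum>i\<in>K. \<Sum>j\<in>L. w i j * ((a * (p i - q j)\<^sup>2 + (ln l)\<^sup>2 / a) / 2) + w i j * ((p i - q j)\<^sup>2 / l) + w i j * p i - w i j * q j)"
    by (intro sum_mono pt)
  also have "\<dots> = (\<Sum>i\<in>K. \<Sum>j\<in>L. (a / 2 + 1 / l) * (w i j * (p i - q j)\<^sup>2)) + (\<Sum>i\<in>K. \<Sum>j\<in>L. w i j * ((ln l)\<^sup>2 / a / 2))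
      + (\<Sum>i\<in>K. \<Sum>j\<in>L. w i j * p i) - (\<Sum>i\<in>K. \<Sum>j\<in>L. w i j * q j)"
    unfolding sum_subtractf sum.distrib[symmetric]
    by (intro arg_cong2[where f = minus] sum.cong refl) (simp add: algebra_simps add_divide_distrib)
  also have "\<dots> = (a / 2 + 1 / l) * D + real (card K) * ((ln l)\<^sup>2 / a / 2)"
    unfolding rows cols p q D[symmetric] by (simp add: sum_distrib_left)
  finally show ?thesis
    unfolding ent_eq[OF r] ent_eq[OF t] onb_card[OF oo(1)] by (simp add: field_simps)
qed

lemma eigensys_sum_mix:
  assumes e: "eigensys I K u p M" and "(\<Sum>i\<in>K. p i) = 1" and "I \<noteq> {}"
  shows "(\<Sum>i\<in>K. (1 - \<eta>) * p i + \<eta> / card I) = 1"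
proof -
  have "card I > 0" using assms(3) onb_finite[OF eigensys_onb[OF e]] by (simp add: card_gt_0_iff)
  then show ?thesis
    using assms(2) onb_card[OF eigensys_onb[OF e]] by (simp add: sum.distrib sum_distrib_left[symmetric])
qed

text \<open>Both states are mixed before they are compared, which gives the smallest eigenvalue
  \<open>l = \<eta> / card I\<close>; \<open>ent_mix_le\<close> then returns from the mixture of
  \<open>\<rho>\<close> to \<open>\<rho>\<close>. The choice \<open>a = b * card I\<close> cancels
  the dimension in front of the squared logarithm, so that the dimension survives only in
  \<open>\<Delta>\<close> and inside logarithms.\<close>

lemma ent_mix_continuity:
  assumes r: "eigensys I K u p \<rho>" and t: "eigensys I L v q \<sigma>"
    and p: "\<And>i. i \<in> K \<Longrightarrow> p i \<ge> 0" "(\<Sum>i\<in>K. p i) = 1"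
    and q: "\<And>j. j \<in> L \<Longrightarrow> q j \<ge> 0" "(\<Sum>j\<in>L. q j) = 1"
    and I: "I \<noteq> {}" and \<eta>: "0 < \<eta>" "\<eta> < 1" and b: "b > 0"
  defines "\<Delta> \<equiv> real (card I) * (\<Sum>x\<in>I. \<Sum>y\<in>I. (cmod (\<rho> x y - \<sigma> x y))\<^sup>2)"
  shows "ent I \<rho> \<ge> ent I (mix I \<eta> \<sigma>) - (b * \<Delta> + (ln (card I / \<eta>))\<^sup>2 / b) / 2 - \<Delta> / \<eta>
      + (1 - \<eta>) * ln (1 - \<eta>) + \<eta> * ln \<eta> - \<eta> * ln (card I)"
proof -
  have c: "real (card I) > 0" using I onb_finite[OF eigensys_onb[OF r]] by (simp add: card_gt_0_iff)
  define D where "D = (\<Sum>x\<in>I. \<Sum>y\<in>I. (cmod (\<rho> x y - \<sigma> x y))\<^sup>2)"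
  define D' where "D' = (\<Sum>x\<in>I. \<Sum>y\<in>I. (cmod (mix I \<eta> \<rho> x y - mix I \<eta> \<sigma> x y))\<^sup>2)"
  have "mix I \<eta> \<rho> x y - mix I \<eta> \<sigma> x y = of_real (1 - \<eta>) * (\<rho> x y - \<sigma> x y)" for x y
    by (simp add: mix_def algebra_simps)
  then have "D' = (1 - \<eta>)\<^sup>2 * D"
    unfolding D_def D'_def sum_distrib_left by (simp add: norm_mult power_mult_distrib del: of_real_diff)
  moreover have D0: "D \<ge> 0" unfolding D_def by (intro sum_nonneg) auto
  moreover have "(1 - \<eta>)\<^sup>2 \<le> 1" using \<eta> by (simp add: power_le_one)
  ultimately have D': "D' \<le> D" by (simp add: mult_left_le_one_le)
  let ?l = "\<eta> / card I"
  have l: "?l > 0" using c \<eta> by simp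
  have e1: "ent I (mix I \<eta> \<rho>) \<ge> ent I (mix I \<eta> \<sigma>) - ((b * card I) * D' + real (card I) * (ln ?l)\<^sup>2 / (b * card I)) / 2 - D' / ?l"
    unfolding D'_def
  proof (rule ent_full_rank_continuity[OF eigensys_mix[OF r] eigensys_mix[OF t]])
    show "0 \<le> (1 - \<eta>) * p i + \<eta> / real (card I)" if "i \<in> K" for i using p(1)[OF that] \<eta> by simp
    show "(\<Sum>i\<in>K. (1 - \<eta>) * p i + \<eta> / real (card I)) = 1" by (rule eigensys_sum_mix[OF r p(2) I])
    show "\<eta> / real (card I) \<le> (1 - \<eta>) * q j + \<eta> / real (card I)" if "j \<in> L" for j using q(1)[OF that] \<eta> by simp
    show "(\<Sum>i\<in>L. (1 - \<eta>) * q i + \<eta> / real (card I)) = 1" by (rule eigensys_sum_mix[OF t q(2) I])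
  qed (use l b c in auto)
  have d1: "(b * card I) * D' \<le> b * \<Delta>"
    unfolding \<Delta>_def D_def[symmetric] using D' b c by (simp add: mult_left_mono)
  have d2: "D' / ?l \<le> \<Delta> / \<eta>"
    unfolding \<Delta>_def D_def[symmetric] using D' \<eta> c by (simp add: divide_right_mono mult_left_mono mult.commute)
  have d3: "real (card I) * (ln ?l)\<^sup>2 / (b * card I) = (ln (card I / \<eta>))\<^sup>2 / b"
  proof -
    have "ln ?l = - ln (card I / \<eta>)" using c \<eta> by (simp add: ln_div)
    then show ?thesis using c b by simp
  qed
  have 1: "ent I (mix I \<eta> \<rho>) \<ge> ent I (mix I \<eta> \<sigma>) - (b * \<Delta> + (ln (card I / \<eta>))\<^sup>2 / b) / 2 - \<Delta> / \<eta>"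
    by (rule order_trans[OF _ e1], unfold d3, intro diff_mono divide_right_mono add_mono order_refl d1 d2) simp
  have "(1 - \<eta>) * ent I \<rho> \<le> ent I \<rho>" using ent_nonneg[OF r p] \<eta> by (simp add: mult_left_le_one_le)
  then show ?thesis using 1 ent_mix_le[OF r p I \<eta>] by linarith
qed

lemma marg_mix:
  assumes R: "R \<subseteq> S" and S: "finite S" and d: "d > 0" and ab: "a \<in> conf d R" "b \<in> conf d R"
  shows "marg d S R (mix (conf d S) \<eta> \<rho>) a b = mix (conf d R) \<eta> (marg d S R \<rho>) a b"
proof -
  have gl: "glue R a c = glue R b c \<longleftrightarrow> a = b" for c
  proof
    assume eq: "glue R a c = glue R b c"
    show "a = b"
    proof
      fix s show "a s = b s" using ab fun_cong[OF eq, of s] by (cases "s \<in> R") (auto simp: glue_def conf_ext)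
    qed
  qed simp
  have "card S = card R + card (S - R)" using R S by (simp add: card_Diff_subset finite_subset card_mono)
  then have "real (card (conf d (S - R))) * (\<eta> / card (conf d S)) = \<eta> / card (conf d R)"
    using S R d finite_subset[OF R S] by (simp add: card_conf power_add)
  then have c: "of_nat (card (conf d (S - R))) * complex_of_real (\<eta> / card (conf d S)) = of_real (\<eta> / card (conf d R))"
    by (metis of_real_mult of_real_of_nat_eq)
  have "marg d S R (mix (conf d S) \<eta> \<rho>) a b = of_real (1 - \<eta>) * marg d S R \<rho> a b
      + of_nat (card (conf d (S - R))) * of_real (\<eta> / card (conf d S)) * of_bool (a = b)"
    unfolding marg_def mix_def gl sum.distrib sum_distrib_left[symmetric] by simp
  then show ?thesis unfolding c mix_def .
qed

section \<open>Reduced states\<close>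

definition digits :: "nat \<Rightarrow> nat \<Rightarrow> nat \<Rightarrow> nat \<Rightarrow> nat" where
  "digits d N x = (\<lambda>s\<in>{..<N}. digit d x s)"

lemma digit_less: "d > 0 \<Longrightarrow> digit d x s < d"
  by (simp add: digit_def)

lemma mod_power_digits: "x mod d ^ N = (\<Sum>s<N. digit d x s * d ^ s)"
proof (induction N)
  case (Suc N)
  have "x mod d ^ Suc N = x mod (d ^ N * d)" by (simp add: mult.commute)
  also have "\<dots> = d ^ N * (x div d ^ N mod d) + x mod d ^ N" by (rule mod_mult2_eq)
  finally show ?case using Suc by (simp add: digit_def mult.commute)
qed simp

lemma digits_bij:
  assumes d: "d > 0"
  shows "bij_betw (digits d N) {..<d ^ N} (conf d {..<N})"
proof -
  have inj: "inj_on (digits d N) {..<d ^ N}"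
  proof (rule inj_onI)
    fix x y assume xy: "x \<in> {..<d ^ N}" "y \<in> {..<d ^ N}" and eq: "digits d N x = digits d N y"
    have "digit d x s = digit d y s" if "s < N" for s
      using fun_cong[OF eq, of s] that by (simp add: digits_def)
    then have "x mod d ^ N = y mod d ^ N" unfolding mod_power_digits by simp
    then show "x = y" using xy by simp
  qed
  have sub: "digits d N ` {..<d ^ N} \<subseteq> conf d {..<N}"
    by (rule image_subsetI) (simp add: digits_def conf_def restrict_PiE_iff digit_less[OF d])
  have "card (conf d {..<N}) = card {..<d ^ N}" by (simp add: card_conf)
  then have "card (digits d N ` {..<d ^ N}) = card (conf d {..<N})" using card_image[OF inj] by (simp only:)
  then have "digits d N ` {..<d ^ N} = conf d {..<N}" using sub by (intro card_subset_eq finite_conf) auto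
  with inj show ?thesis unfolding bij_betw_def by (rule conjI)
qed

definition enc :: "nat \<Rightarrow> nat \<Rightarrow> (nat \<Rightarrow> nat) \<Rightarrow> nat" where
  "enc d N = inv_into {..<d ^ N} (digits d N)"

lemma enc_bij: "d > 0 \<Longrightarrow> bij_betw (enc d N) (conf d {..<N}) {..<d ^ N}"
  unfolding enc_def by (rule bij_betw_inv_into[OF digits_bij])

lemma digits_enc: "d > 0 \<Longrightarrow> y \<in> conf d {..<N} \<Longrightarrow> digits d N (enc d N y) = y"
  unfolding enc_def by (rule bij_betw_inv_into_right[OF digits_bij])

lemma enc_digits: "d > 0 \<Longrightarrow> x < d ^ N \<Longrightarrow> enc d N (digits d N x) = x"
  unfolding enc_def by (simp add: bij_betw_inv_into_left[OF digits_bij])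

lemma digit_enc: "d > 0 \<Longrightarrow> y \<in> conf d {..<N} \<Longrightarrow> s < N \<Longrightarrow> digit d (enc d N y) s = y s"
  using fun_cong[OF digits_enc, of d y N s] by (simp add: digits_def)

text \<open>The configuration of the spins in \<open>A\<close> that the index \<open>a\<close> of a reduced density matrix stands for.\<close>

definition sub_digits :: "nat \<Rightarrow> nat set \<Rightarrow> nat \<Rightarrow> nat \<Rightarrow> nat" where
  "sub_digits d A a = (\<lambda>s\<in>A. digit d a (inv_into {..<card A} ((!) (sorted_list_of_set A)) s))"

lemma sorted_nth_bij: "finite A \<Longrightarrow> bij_betw ((!) (sorted_list_of_set A)) {..<card A} A"
  using bij_betw_nth[of "sorted_list_of_set A" "{..<card A}" A] by simp

lemma sub_digits_nth:
  assumes "finite A" "k < card A"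
  shows "sub_digits d A a (sorted_list_of_set A ! k) = digit d a k"
  using bij_betw_inv_into_left[OF sorted_nth_bij[OF assms(1)], of k] bij_betwE[OF sorted_nth_bij[OF assms(1)]] assms(2)
  by (simp add: sub_digits_def)

lemma sub_digits_bij:
  assumes A: "finite A" and d: "d > 0"
  shows "bij_betw (sub_digits d A) {..<d ^ card A} (conf d A)"
proof -
  note b = sorted_nth_bij[OF A]
  have inj: "inj_on (sub_digits d A) {..<d ^ card A}"
  proof (rule inj_onI)
    fix x y assume xy: "x \<in> {..<d ^ card A}" "y \<in> {..<d ^ card A}" and eq: "sub_digits d A x = sub_digits d A y"
    have "digit d x k = digit d y k" if "k < card A" for k
      using fun_cong[OF eq, of "sorted_list_of_set A ! k"] sub_digits_nth[OF A that] by simp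
    then have "x mod d ^ card A = y mod d ^ card A" unfolding mod_power_digits by simp
    then show "x = y" using xy by simp
  qed
  have sub: "sub_digits d A ` {..<d ^ card A} \<subseteq> conf d A"
    by (rule image_subsetI) (simp add: sub_digits_def conf_def restrict_PiE_iff digit_less[OF d])
  have "card (conf d A) = card {..<d ^ card A}" using A by (simp add: card_conf)
  then have "card (sub_digits d A ` {..<d ^ card A}) = card (conf d A)" using card_image[OF inj] by (simp only:)
  then have "sub_digits d A ` {..<d ^ card A} = conf d A" using sub A by (intro card_subset_eq finite_conf) auto
  with inj show ?thesis unfolding bij_betw_def by (rule conjI)
qed

lemma restricts_to_iff:
  assumes A: "A \<subseteq> {..<N}"
  shows "restricts_to d A x a \<longleftrightarrow> restrict (digits d N x) A = sub_digits d A a"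
proof -
  have fin: "finite A" by (rule finite_subset[OF A]) simp
  note b = sorted_nth_bij[OF fin]
  have in_A: "sorted_list_of_set A ! k \<in> A" if "k < card A" for k using bij_betwE[OF b] that by simp
  have dig: "restrict (digits d N x) A s = digit d x s" if "s \<in> A" for s
    using that A by (auto simp: digits_def)
  show ?thesis
  proof
    assume r: "restricts_to d A x a"
    show "restrict (digits d N x) A = sub_digits d A a"
    proof
      fix s
      show "restrict (digits d N x) A s = sub_digits d A a s"
      proof (cases "s \<in> A")
        case True
        then obtain k where k: "k < card A" "s = sorted_list_of_set A ! k"
          using b by (auto simp: bij_betw_def image_iff)
        then show ?thesis using r dig[OF True] sub_digits_nth[OF fin k(1)] by (simp add: restricts_to_def)
      qed (simp add: sub_digits_def)
    qed
  next
    assume eq: "restrict (digits d N x) A = sub_digits d A a"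
    show "restricts_to d A x a"
      unfolding restricts_to_def
    proof (intro allI impI)
      fix k assume k: "k < card A"
      show "digit d x (sorted_list_of_set A ! k) = digit d a k"
        using dig[OF in_A[OF k]] fun_cong[OF eq, of "sorted_list_of_set A ! k"] sub_digits_nth[OF fin k] by simp
    qed
  qed
qed

text \<open>The pairs summed over in \<open>reduced_state\<close> agree outside \<open>A\<close> and
  are prescribed on \<open>A\<close>, so each pair is determined by the common configuration of the
  traced-out spins. That configuration is the summation variable of \<open>marg\<close>.\<close>

lemma reduced_state_index:
  assumes A: "A \<subseteq> {..<N}" and d: "d > 0" and a: "a < d ^ card A" and b: "b < d ^ card A"
  shows "reduced_state d N A M $$ (a, b)
     = marg d {..<N} A (\<lambda>x y. M $$ (enc d N x, enc d N y)) (sub_digits d A a) (sub_digits d A b)"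
proof -
  let ?S = "{(x, y). x < d ^ N \<and> y < d ^ N \<and> restricts_to d A x a \<and> restricts_to d A y b \<and>
                    (\<forall>s\<in>{..<N} - A. digit d x s = digit d y s)}"
  let ?a = "sub_digits d A a" and ?b = "sub_digits d A b"
  have fin: "finite A" by (rule finite_subset[OF A]) simp
  have ab: "?a \<in> conf d A" "?b \<in> conf d A" using bij_betwE[OF sub_digits_bij[OF fin d]] a b by auto
  have "(\<Sum>(x, y)\<in>?S. M $$ (x, y)) = (\<Sum>c\<in>conf d ({..<N} - A). M $$ (enc d N (glue A ?a c), enc d N (glue A ?b c)))"
  proof (rule sum.reindex_bij_witness[where i = "\<lambda>c. (enc d N (glue A ?a c), enc d N (glue A ?b c))"
        and j = "\<lambda>(x, y). restrict (digits d N x) ({..<N} - A)"])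
    fix xy assume "xy \<in> ?S"
    then obtain x y where xy: "xy = (x, y)" and x: "x < d ^ N" "restrict (digits d N x) A = ?a"
      and y: "y < d ^ N" "restrict (digits d N y) A = ?b"
      and eq: "\<forall>s\<in>{..<N} - A. digit d x s = digit d y s"
      using restricts_to_iff[OF A] by auto
    have e: "restrict (digits d N x) ({..<N} - A) = restrict (digits d N y) ({..<N} - A)"
      using eq by (auto simp: digits_def restrict_def fun_eq_iff)
    have g: "glue A (restrict (digits d N z) A) (restrict (digits d N z) ({..<N} - A)) = digits d N z" for z
      using A by (auto simp: glue_def digits_def restrict_def fun_eq_iff)
    have gx: "glue A ?a (restrict (digits d N x) ({..<N} - A)) = digits d N x"
      unfolding x(2)[symmetric] by (rule g)
    have gy: "glue A ?b (restrict (digits d N x) ({..<N} - A)) = digits d N y"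
      unfolding y(2)[symmetric] e by (rule g)
    show "(enc d N (glue A ?a (case xy of (x, y) \<Rightarrow> restrict (digits d N x) ({..<N} - A))),
        enc d N (glue A ?b (case xy of (x, y) \<Rightarrow> restrict (digits d N x) ({..<N} - A)))) = xy"
      unfolding xy prod.case gx gy enc_digits[OF d x(1)] enc_digits[OF d y(1)] ..
    show "(case xy of (x, y) \<Rightarrow> restrict (digits d N x) ({..<N} - A)) \<in> conf d ({..<N} - A)"
      unfolding xy prod.case conf_def restrict_PiE_iff by (simp add: digits_def digit_less[OF d])
    show "M $$ (enc d N (glue A ?a (case xy of (x, y) \<Rightarrow> restrict (digits d N x) ({..<N} - A))),
        enc d N (glue A ?b (case xy of (x, y) \<Rightarrow> restrict (digits d N x) ({..<N} - A)))) = (case xy of (x, y) \<Rightarrow> M $$ (x, y))"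
      unfolding xy prod.case gx gy enc_digits[OF d x(1)] enc_digits[OF d y(1)] ..
  next
    fix c assume c: "c \<in> conf d ({..<N} - A)"
    note gc = glue_conf[OF A ab(1) c] glue_conf[OF A ab(2) c]
    have r: "restrict (glue A e c) A = e" "restrict (glue A e c) ({..<N} - A) = c" if "e \<in> conf d A" for e
      using that c A by (auto simp: conf_def glue_def restrict_def PiE_def extensional_def fun_eq_iff)
    show "(case (enc d N (glue A ?a c), enc d N (glue A ?b c)) of (x, y) \<Rightarrow> restrict (digits d N x) ({..<N} - A)) = c"
      by (simp add: digits_enc[OF d gc(1)] r ab)
    have "enc d N (glue A ?a c) < d ^ N" "enc d N (glue A ?b c) < d ^ N"
      using bij_betwE[OF enc_bij[OF d]] gc by auto
    moreover have "digit d (enc d N (glue A ?a c)) s = digit d (enc d N (glue A ?b c)) s" if "s \<in> {..<N} - A" for s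
      using that digit_enc[OF d gc(1), of s] digit_enc[OF d gc(2), of s] by (simp add: glue_def)
    ultimately show "(enc d N (glue A ?a c), enc d N (glue A ?b c)) \<in> ?S"
      using restricts_to_iff[OF A] by (simp add: digits_enc[OF d] gc r ab)
  qed
  then show ?thesis using a b by (simp add: reduced_state_def marg_def)
qed

lemma reduced_state_entropy:
  assumes A: "A \<subseteq> {..<N}" and d: "d > 0"
    and h: "hermitian_on {..<d ^ N} (\<lambda>x y. M $$ (x, y))"
  shows "von_neumann_entropy (reduced_state d N A M) = ent (conf d A) (marg d {..<N} A (\<lambda>x y. M $$ (enc d N x, enc d N y)))"
proof -
  let ?n = "d ^ card A" and ?M = "\<lambda>x y. M $$ (enc d N x, enc d N y)"
  have fin: "finite A" by (rule finite_subset[OF A]) simp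
  note b = sub_digits_bij[OF fin d]
  have "hermitian_on (conf d {..<N}) ?M"
    using h bij_betwE[OF enc_bij[OF d]] by (auto simp: hermitian_on_def)
  then have hm: "hermitian_on (conf d A) (marg d {..<N} A ?M)" by (rule marg_hermitian[OF A])
  then obtain K :: "nat set" and u p where e: "eigensys (conf d A) K u p (marg d {..<N} A ?M)"
    using hermitian_eigensys[OF finite_conf[OF fin]] by blast
  have "hermitian_on {..<?n} (\<lambda>x y. reduced_state d N A M $$ (x, y))"
    using hm bij_betwE[OF b] by (auto simp: hermitian_on_def reduced_state_index[OF A d])
  moreover have "reduced_state d N A M \<in> carrier_mat ?n ?n" by (simp add: reduced_state_def)
  ultimately have "von_neumann_entropy (reduced_state d N A M) = ent {..<?n} (\<lambda>x y. reduced_state d N A M $$ (x, y))"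
    by (intro von_neumann_entropy_eq_ent)
  also have "\<dots> = ent (conf d A) (marg d {..<N} A ?M)"
    by (rule ent_reindex[OF e b]) (simp add: reduced_state_index[OF A d])
  finally show ?thesis .
qed

section \<open>Gaussian integrals and moments of the sphere\<close>

text \<open>Radial integration: \<open>F\<close> and \<open>f\<close> enter only through the growth of their integrals over
  sublevel sets of \<open>q\<close>.\<close>

lemma nn_integral_exp_sublevel:
  fixes q :: "'a \<Rightarrow> real" and F :: "'a \<Rightarrow> ennreal"
  assumes M: "sigma_finite_measure M" and [measurable]: "q \<in> borel_measurable M" "F \<in> borel_measurable M"
    and q0: "\<And>z. z \<in> space M \<Longrightarrow> q z \<ge> 0"
    and scale: "\<And>r. r > 0 \<Longrightarrow> (\<integral>\<^sup>+z. F z * indicator {z. q z \<le> r} z \<partial>M) = ennreal (r powr k) * I"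
    and k: "k > -1"
  shows "(\<integral>\<^sup>+z. F z * ennreal (exp (- q z)) \<partial>M) = ennreal (Gamma (k + 1)) * I"
proof -
  interpret M: sigma_finite_measure M by fact
  interpret P: pair_sigma_finite M lborel by standard
  \<comment> \<open>The exponential is written as an integral over levels \<open>r \<ge> s\<close>,
    so that exchanging the integrals leaves an inner integral over a sublevel set of
    \<open>q\<close>.\<close>
  have ex: "ennreal (exp (- s)) = (\<integral>\<^sup>+r. ennreal (exp (- r)) * indicator {s..} r \<partial>lborel)" for s :: real
  proof -
    have "((\<lambda>x::real. - exp (- x)) \<longlongrightarrow> - 0) at_top"
      by (intro tendsto_minus filterlim_compose[OF exp_at_bot filterlim_uminus_at_bot_at_top])
    then have "(\<integral>\<^sup>+r. ennreal (exp (- r)) * indicator {s..} r \<partial>lborel) = 0 - (- exp (- s))"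
      by (intro nn_integral_FTC_atLeast) (auto intro!: derivative_eq_intros)
    then show ?thesis by simp
  qed
  have "(\<integral>\<^sup>+z. F z * ennreal (exp (- q z)) \<partial>M) = (\<integral>\<^sup>+z. \<integral>\<^sup>+r. F z * (ennreal (exp (- r)) * indicator {q z..} r) \<partial>lborel \<partial>M)"
  proof (rule nn_integral_cong)
    fix z
    show "F z * ennreal (exp (- q z)) = (\<integral>\<^sup>+r. F z * (ennreal (exp (- r)) * indicator {q z..} r) \<partial>lborel)"
      by (simp only: ex[of "q z"]) (rule nn_integral_cmult[symmetric], simp)
  qed
  also have "\<dots> = (\<integral>\<^sup>+z. \<integral>\<^sup>+r. F z * (ennreal (exp (- r)) * indicator {x. q (fst x) \<le> snd x} (z, r)) \<partial>lborel \<partial>M)"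
    by (intro nn_integral_cong) (auto simp: indicator_def)
  also have "\<dots> = (\<integral>\<^sup>+r. \<integral>\<^sup>+z. F z * (ennreal (exp (- r)) * indicator {x. q (fst x) \<le> snd x} (z, r)) \<partial>M \<partial>lborel)"
    by (rule P.Fubini'[symmetric]) measurable
  also have "\<dots> = (\<integral>\<^sup>+r. ennreal (exp (- r)) * (\<integral>\<^sup>+z. F z * indicator {z. q z \<le> r} z \<partial>M) \<partial>lborel)"
    by (intro nn_integral_cong, subst nn_integral_cmult[symmetric]) (auto intro!: nn_integral_cong simp: indicator_def mult_ac)
  \<comment> \<open>The exponent is kept in the form \<open>k + 1 - 1\<close> to match Euler's
    integral for the Gamma function at \<open>k + 1\<close>.\<close>
  also have "\<dots> = (\<integral>\<^sup>+r. ennreal (r powr (k + 1 - 1) / exp r) * indicator {0..} r * I \<partial>lborel)"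
  proof (rule nn_integral_cong_AE, use AE_lborel_singleton[of "0::real"] in eventually_elim)
    case (elim r)
    show ?case
    proof (cases "r > 0")
      case True
      then show ?thesis by (simp add: scale exp_minus divide_inverse ennreal_mult' mult_ac)
    next
      case False
      then have "r < 0" using elim by simp
      then have "(\<integral>\<^sup>+z. F z * indicator {z. q z \<le> r} z \<partial>M) = (\<integral>\<^sup>+z. 0 \<partial>M)"
        using q0 by (intro nn_integral_cong) (force simp: indicator_def)
      then show ?thesis using \<open>r < 0\<close> by simp
    qed
  qed
  also have "\<dots> = (\<integral>\<^sup>+r. ennreal (r powr (k + 1 - 1) / exp r) * indicator {0..} r \<partial>lborel) * I"
    by (rule nn_integral_multc) measurable
  also have "(\<integral>\<^sup>+r. ennreal (r powr (k + 1 - 1) / exp r) * indicator {0..} r \<partial>lborel) = ennreal (Gamma (k + 1))"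
    using k by (intro nn_integral_has_integral_lebesgue' Gamma_integral_real) auto
  finally show ?thesis .
qed

text \<open>On the sublevel set, 1 is \<open>q z powr \<alpha>\<close> plus the integral of \<alpha>
  r^(\<alpha> - 1) over r from \<open>q z\<close> to 1. Integrated against \<open>f\<close> this
  splits \<open>I\<close> into the wanted integral and a remainder, which Fubini and the scaling law
  evaluate as the fraction \<alpha> / (k + \<alpha>) of \<open>I\<close>. Finiteness of
  \<open>I\<close> permits cancelling the remainder in \<open>ennreal\<close>.\<close>

lemma nn_integral_powr_sublevel:
  fixes q :: "'a \<Rightarrow> real" and f :: "'a \<Rightarrow> ennreal"
  assumes M: "sigma_finite_measure M" and [measurable]: "q \<in> borel_measurable M" "f \<in> borel_measurable M"
    and q0: "\<And>z. z \<in> space M \<Longrightarrow> q z \<ge> 0"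
    and scale: "\<And>r. r > 0 \<Longrightarrow> (\<integral>\<^sup>+z. f z * indicator {z. q z \<le> r} z \<partial>M) = ennreal (r powr k) * I"
    and k: "k > 0" and a: "\<alpha> > 0" and I: "I < \<infinity>"
  shows "(\<integral>\<^sup>+z. f z * ennreal (q z powr \<alpha>) * indicator {z. q z \<le> 1} z \<partial>M) = ennreal (k / (k + \<alpha>)) * I"
    (is "?J = _")
proof -
  interpret M: sigma_finite_measure M by fact
  interpret P: pair_sigma_finite M lborel by standard
  have pw: "((\<lambda>r. c * r powr (c - 1)) has_integral 1 - s powr c) {s..1}" if "0 \<le> s" "s \<le> 1" "c > 0" for s c :: real
  proof -
    have "((\<lambda>r. c * r powr (c - 1)) has_integral 1 powr c - s powr c) {s..1}"
    proof (rule fundamental_theorem_of_calculus_interior[OF that(2)])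
      show "continuous_on {s..1} (\<lambda>x. x powr c)" using that by (intro continuous_on_powr' continuous_intros) auto
      show "((\<lambda>x. x powr c) has_vector_derivative c * x powr (c - 1)) (at x)" if "x \<in> {s<..<1}" for x
        using that \<open>0 \<le> s\<close> by (auto intro!: derivative_eq_intros simp: has_real_derivative_iff_has_vector_derivative[symmetric])
    qed
    then show ?thesis by simp
  qed
  have one: "ennreal (s powr \<alpha>) + (\<integral>\<^sup>+r. ennreal (\<alpha> * r powr (\<alpha> - 1)) * indicator {s..1} r \<partial>lborel) = 1"
    if "0 \<le> s" "s \<le> 1" for s
  proof -
    have "(\<integral>\<^sup>+r. ennreal (\<alpha> * r powr (\<alpha> - 1)) * indicator {s..1} r \<partial>lborel) = ennreal (1 - s powr \<alpha>)"
      using a that by (intro nn_integral_has_integral_lebesgue' pw) auto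
    moreover have "s powr \<alpha> \<le> 1" using that a by (simp add: powr_le1)
    ultimately show ?thesis by (simp add: ennreal_plus[symmetric] del: ennreal_plus)
  qed
  define R where "R = (\<integral>\<^sup>+z. \<integral>\<^sup>+r. f z * (ennreal (\<alpha> * r powr (\<alpha> - 1)) * indicator {q z..1} r) \<partial>lborel \<partial>M)"
  have "I = (\<integral>\<^sup>+z. f z * indicator {z. q z \<le> 1} z \<partial>M)" using scale[of 1] by simp
  also have "\<dots> = (\<integral>\<^sup>+z. f z * ennreal (q z powr \<alpha>) * indicator {z. q z \<le> 1} z
      + (\<integral>\<^sup>+r. f z * (ennreal (\<alpha> * r powr (\<alpha> - 1)) * indicator {q z..1} r) \<partial>lborel) \<partial>M)"
  proof (rule nn_integral_cong)
    fix z assume z: "z \<in> space M"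
    show "f z * indicator {z. q z \<le> 1} z = f z * ennreal (q z powr \<alpha>) * indicator {z. q z \<le> 1} z
      + (\<integral>\<^sup>+r. f z * (ennreal (\<alpha> * r powr (\<alpha> - 1)) * indicator {q z..1} r) \<partial>lborel)"
    proof (cases "q z \<le> 1")
      case True
      have "f z = f z * (ennreal (q z powr \<alpha>) + (\<integral>\<^sup>+r. ennreal (\<alpha> * r powr (\<alpha> - 1)) * indicator {q z..1} r \<partial>lborel))"
        using one[OF q0[OF z] True] by simp
      then show ?thesis using True by (simp add: nn_integral_cmult distrib_left)
    qed simp
  qed
  also have "\<dots> = ?J + R"
  proof -
    have m2: "(\<lambda>z. \<integral>\<^sup>+r. f z * (ennreal (\<alpha> * r powr (\<alpha> - 1)) * indicator {q z..1} r) \<partial>lborel) \<in> borel_measurable M"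
    proof -
      have "(\<lambda>z. \<integral>\<^sup>+r. f z * (ennreal (\<alpha> * r powr (\<alpha> - 1)) * indicator {x. q (fst x) \<le> snd x \<and> snd x \<le> 1} (z, r)) \<partial>lborel) \<in> borel_measurable M"
        by measurable
      moreover have "indicator {x. q (fst x) \<le> snd x \<and> snd x \<le> 1} (z, r) = (indicator {q z..1} r :: ennreal)" for z r
        by (auto simp: indicator_def)
      ultimately show ?thesis by simp
    qed
    have m1: "(\<lambda>z. f z * ennreal (q z powr \<alpha>) * indicator {z. q z \<le> 1} z) \<in> borel_measurable M"
      by measurable
    show ?thesis unfolding R_def by (rule nn_integral_add[OF m1 m2])
  qed
  finally have IJ: "I = ?J + R" .
  have "R = (\<integral>\<^sup>+z. \<integral>\<^sup>+r. f z * (ennreal (\<alpha> * r powr (\<alpha> - 1)) * indicator {x. q (fst x) \<le> snd x \<and> snd x \<le> 1} (z, r)) \<partial>lborel \<partial>M)"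
    unfolding R_def by (intro nn_integral_cong) (auto simp: indicator_def)
  also have "\<dots> = (\<integral>\<^sup>+r. \<integral>\<^sup>+z. f z * (ennreal (\<alpha> * r powr (\<alpha> - 1)) * indicator {x. q (fst x) \<le> snd x \<and> snd x \<le> 1} (z, r)) \<partial>M \<partial>lborel)"
    by (rule P.Fubini'[symmetric]) measurable
  also have "\<dots> = (\<integral>\<^sup>+r. ennreal (\<alpha> * r powr (\<alpha> - 1)) * indicator {..1} r * (\<integral>\<^sup>+z. f z * indicator {z. q z \<le> r} z \<partial>M) \<partial>lborel)"
    by (intro nn_integral_cong, subst nn_integral_cmult[symmetric]) (auto intro!: nn_integral_cong simp: indicator_def mult_ac)
  also have "\<dots> = (\<integral>\<^sup>+r. ennreal (\<alpha> * r powr (k + \<alpha> - 1)) * indicator {0..1} r * I \<partial>lborel)"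
  proof (rule nn_integral_cong_AE, use AE_lborel_singleton[of "0::real"] in eventually_elim)
    case (elim r)
    show ?case
    proof (cases "r > 0")
      case True
      have "r powr (\<alpha> - 1) * r powr k = r powr (k + \<alpha> - 1)" by (simp add: powr_add[symmetric] algebra_simps)
      then have "ennreal (\<alpha> * r powr (\<alpha> - 1)) * ennreal (r powr k) = ennreal (\<alpha> * r powr (k + \<alpha> - 1))"
        using a by (simp add: ennreal_mult'[symmetric] mult.assoc)
      then show ?thesis unfolding scale[OF True] using True
        by (cases "r \<le> 1") (simp_all add: mult.assoc[symmetric])
    next
      case False
      then have "r < 0" using elim by simp
      then have "(\<integral>\<^sup>+z. f z * indicator {z. q z \<le> r} z \<partial>M) = (\<integral>\<^sup>+z. 0 \<partial>M)"
        using q0 by (intro nn_integral_cong) (force simp: indicator_def)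
      then show ?thesis using \<open>r < 0\<close> by simp
    qed
  qed
  also have "\<dots> = (\<integral>\<^sup>+r. ennreal (\<alpha> * r powr (k + \<alpha> - 1)) * indicator {0..1} r \<partial>lborel) * I"
    by (rule nn_integral_multc) measurable
  also have "(\<integral>\<^sup>+r. ennreal (\<alpha> * r powr (k + \<alpha> - 1)) * indicator {0..1} r \<partial>lborel) = ennreal (\<alpha> / (k + \<alpha>))"
  proof (rule nn_integral_has_integral_lebesgue')
    have "((\<lambda>r. \<alpha> / (k + \<alpha>) * ((k + \<alpha>) * r powr (k + \<alpha> - 1))) has_integral \<alpha> / (k + \<alpha>) * (1 - 0 powr (k + \<alpha>))) {0..1}"
      using k a by (intro has_integral_mult_right pw) auto
    then show "((\<lambda>r. \<alpha> * r powr (k + \<alpha> - 1)) has_integral \<alpha> / (k + \<alpha>)) {0..1}" using k a by simp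
  qed (use a in auto)
  finally have R: "R = ennreal (\<alpha> / (k + \<alpha>)) * I" .
  have "ennreal (k / (k + \<alpha>)) * I + R = (ennreal (k / (k + \<alpha>)) + ennreal (\<alpha> / (k + \<alpha>))) * I"
    unfolding R by (simp add: distrib_right)
  also have "ennreal (k / (k + \<alpha>)) + ennreal (\<alpha> / (k + \<alpha>)) = 1"
    using k a by (simp add: ennreal_plus[symmetric] add_divide_distrib[symmetric] del: ennreal_plus)
  finally have "ennreal (k / (k + \<alpha>)) * I + R = 1 * I" .
  then have B: "R + ennreal (k / (k + \<alpha>)) * I = I" unfolding mult_1 add.commute[of R] .
  have A: "R + ?J = I" unfolding add.commute[of R] by (rule IJ[symmetric])
  have "R \<noteq> \<infinity>" unfolding R using I by (auto simp: ennreal_mult_eq_top_iff)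
  then show ?thesis
    using trans[OF A B[symmetric]] ennreal_add_left_cancel[of R ?J "ennreal (k / (k + \<alpha>)) * I"] by blast
qed

text \<open>\<open>f\<close> depends only on the direction, as it is invariant under the dilations
  \<open>T\<close>, while \<open>q\<close> scales linearly and the measure by
  \<open>r powr k\<close>. All sublevel integrals then follow from the one at level 1, and the
  Gaussian weight contributes just a Gamma factor. This converts averages over a ball into Gaussian
  integrals.\<close>

lemma radial_gaussian_moment:
  fixes q :: "'a \<Rightarrow> real" and f :: "'a \<Rightarrow> ennreal" and T :: "real \<Rightarrow> 'a \<Rightarrow> 'a"
  assumes M: "sigma_finite_measure M" and q[measurable]: "q \<in> borel_measurable M" and f[measurable]: "f \<in> borel_measurable M"
    and q0: "\<And>z. z \<in> space M \<Longrightarrow> q z \<ge> 0"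
    and scale: "\<And>r h. r > 0 \<Longrightarrow> h \<in> borel_measurable M \<Longrightarrow> (\<integral>\<^sup>+z. h z \<partial>M) = ennreal (r powr k) * (\<integral>\<^sup>+z. h (T r z) \<partial>M)"
    and qT: "\<And>r z. r > 0 \<Longrightarrow> z \<in> space M \<Longrightarrow> q (T r z) = r * q z"
    and fT: "\<And>r z. r > 0 \<Longrightarrow> z \<in> space M \<Longrightarrow> f (T r z) = f z"
    and k: "k > 0"
  shows "(\<integral>\<^sup>+z. f z * ennreal (exp (- q z)) \<partial>M) = ennreal (Gamma (k + 1)) * (\<integral>\<^sup>+z. f z * indicator {z. q z \<le> 1} z \<partial>M)"
    and "\<alpha> > 0 \<Longrightarrow> (\<integral>\<^sup>+z. f z * indicator {z. q z \<le> 1} z \<partial>M) < \<infinity> \<Longrightarrow>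
      (\<integral>\<^sup>+z. f z * ennreal (q z powr \<alpha>) * ennreal (exp (- q z)) \<partial>M)
      = ennreal (k * Gamma (k + \<alpha>)) * (\<integral>\<^sup>+z. f z * indicator {z. q z \<le> 1} z \<partial>M)"
proof -
  have s1: "(\<integral>\<^sup>+z. f z * indicator {z. q z \<le> r} z \<partial>M) = ennreal (r powr k) * (\<integral>\<^sup>+z. f z * indicator {z. q z \<le> 1} z \<partial>M)"
    if r: "r > 0" for r
  proof -
    have "(\<integral>\<^sup>+z. f z * indicator {z. q z \<le> r} z \<partial>M)
        = ennreal (r powr k) * (\<integral>\<^sup>+z. f (T r z) * indicator {z. q z \<le> r} (T r z) \<partial>M)"
      by (rule scale[OF r]) measurable
    also have "(\<integral>\<^sup>+z. f (T r z) * indicator {z. q z \<le> r} (T r z) \<partial>M) = (\<integral>\<^sup>+z. f z * indicator {z. q z \<le> 1} z \<partial>M)"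
      by (intro nn_integral_cong) (use r in \<open>simp add: fT qT indicator_def\<close>)
    finally show ?thesis .
  qed
  show "(\<integral>\<^sup>+z. f z * ennreal (exp (- q z)) \<partial>M) = ennreal (Gamma (k + 1)) * (\<integral>\<^sup>+z. f z * indicator {z. q z \<le> 1} z \<partial>M)"
    by (rule nn_integral_exp_sublevel[OF M q f q0 s1]) (use k in auto)
  assume a: "\<alpha> > 0" and I: "(\<integral>\<^sup>+z. f z * indicator {z. q z \<le> 1} z \<partial>M) < \<infinity>"
  have Fm: "(\<lambda>z. f z * ennreal (q z powr \<alpha>)) \<in> borel_measurable M" by measurable
  have s2: "(\<integral>\<^sup>+z. f z * ennreal (q z powr \<alpha>) * indicator {z. q z \<le> r} z \<partial>M)
     = ennreal (r powr (k + \<alpha>)) * (\<integral>\<^sup>+z. f z * ennreal (q z powr \<alpha>) * indicator {z. q z \<le> 1} z \<partial>M)" if r: "r > 0" for r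
  proof -
    have "(\<integral>\<^sup>+z. f z * ennreal (q z powr \<alpha>) * indicator {z. q z \<le> r} z \<partial>M)
      = ennreal (r powr k) * (\<integral>\<^sup>+z. f (T r z) * ennreal (q (T r z) powr \<alpha>) * indicator {z. q z \<le> r} (T r z) \<partial>M)"
      by (rule scale[OF r]) measurable
    also have "(\<integral>\<^sup>+z. f (T r z) * ennreal (q (T r z) powr \<alpha>) * indicator {z. q z \<le> r} (T r z) \<partial>M)
      = (\<integral>\<^sup>+z. ennreal (r powr \<alpha>) * (f z * ennreal (q z powr \<alpha>) * indicator {z. q z \<le> 1} z) \<partial>M)"
      using r by (intro nn_integral_cong) (simp add: fT qT q0 powr_mult ennreal_mult indicator_def mult_ac)
    also have "\<dots> = ennreal (r powr \<alpha>) * (\<integral>\<^sup>+z. f z * ennreal (q z powr \<alpha>) * indicator {z. q z \<le> 1} z \<partial>M)"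
      by (rule nn_integral_cmult) measurable
    finally show ?thesis by (simp add: powr_add ennreal_mult mult_ac)
  qed
  have "(\<integral>\<^sup>+z. f z * ennreal (q z powr \<alpha>) * ennreal (exp (- q z)) \<partial>M)
      = ennreal (Gamma (k + \<alpha> + 1)) * (\<integral>\<^sup>+z. f z * ennreal (q z powr \<alpha>) * indicator {z. q z \<le> 1} z \<partial>M)"
    by (rule nn_integral_exp_sublevel[OF M q Fm q0 s2]) (use k a in auto)
  also have "(\<integral>\<^sup>+z. f z * ennreal (q z powr \<alpha>) * indicator {z. q z \<le> 1} z \<partial>M) = ennreal (k / (k + \<alpha>)) * (\<integral>\<^sup>+z. f z * indicator {z. q z \<le> 1} z \<partial>M)"
    by (rule nn_integral_powr_sublevel[OF M q f q0 s1 k a I])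
  also have "ennreal (Gamma (k + \<alpha> + 1)) * (ennreal (k / (k + \<alpha>)) * (\<integral>\<^sup>+z. f z * indicator {z. q z \<le> 1} z \<partial>M))
     = ennreal (Gamma (k + \<alpha> + 1) * (k / (k + \<alpha>))) * (\<integral>\<^sup>+z. f z * indicator {z. q z \<le> 1} z \<partial>M)"
    using k a Gamma_real_pos[of "k + \<alpha> + 1"]
    by (subst ennreal_mult) (auto simp only: mult.assoc add_pos_pos divide_nonneg_nonneg less_imp_le zero_less_one)
  also have "Gamma (k + \<alpha> + 1) * (k / (k + \<alpha>)) = k * Gamma (k + \<alpha>)"
    using Gamma_plus1[of "k + \<alpha>"] k a by (auto simp: field_simps nonpos_Ints_def)
  finally show "(\<integral>\<^sup>+z. f z * ennreal (q z powr \<alpha>) * ennreal (exp (- q z)) \<partial>M)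
      = ennreal (k * Gamma (k + \<alpha>)) * (\<integral>\<^sup>+z. f z * indicator {z. q z \<le> 1} z \<partial>M)" .
qed

section \<open>Gaussian integrals over powers of the complex plane\<close>

lemma nn_integral_complex_affine:
  fixes h :: "complex \<Rightarrow> ennreal" and c :: real
  assumes [measurable]: "h \<in> borel_measurable borel" and c: "c \<noteq> 0"
  shows "(\<integral>\<^sup>+z. h z \<partial>lborel) = ennreal (c\<^sup>2) * (\<integral>\<^sup>+z. h (t + c *\<^sub>R z) \<partial>lborel)"
  by (subst lborel_affine[OF c, of t]) (simp add: nn_integral_density nn_integral_distr nn_integral_cmult)

abbreviation cborel :: "nat set \<Rightarrow> (nat \<Rightarrow> complex) measure" where
  "cborel I \<equiv> \<Pi>\<^sub>M i\<in>I. lborel"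

interpretation cborel: product_sigma_finite "\<lambda>_::nat. lborel :: complex measure"
  by standard

lemma sigma_finite_cborel: "finite I \<Longrightarrow> sigma_finite_measure (cborel I)"
  by (rule cborel.sigma_finite)

text \<open>Fubini peels off one coordinate at a time; each is a plane of real dimension two, whence
  the exponent.\<close>

lemma nn_integral_cborel_scale:
  assumes "finite I" "c > 0" "f \<in> borel_measurable (cborel I)"
  shows "(\<integral>\<^sup>+z. f z \<partial>cborel I) = ennreal (c ^ (2 * card I)) * (\<integral>\<^sup>+z. f (\<lambda>i\<in>I. c *\<^sub>R z i) \<partial>cborel I)"
  using assms(1,3)
proof (induction arbitrary: f)
  case empty
  then show ?case by (simp add: PiM_empty nn_integral_count_space_finite)
next
  case (insert j I)
  note [measurable] = insert.prems
  have [measurable]: "(\<lambda>x. \<integral>\<^sup>+y. f (x(j := c *\<^sub>R y)) \<partial>lborel) \<in> borel_measurable (cborel I)"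
    by measurable
  have "(\<integral>\<^sup>+z. f z \<partial>cborel (insert j I)) = (\<integral>\<^sup>+x. \<integral>\<^sup>+y. f (x(j := y)) \<partial>lborel \<partial>cborel I)"
    by (rule cborel.product_nn_integral_insert[OF insert.hyps insert.prems])
  also have "\<dots> = (\<integral>\<^sup>+x. ennreal (c\<^sup>2) * (\<integral>\<^sup>+y. f (x(j := c *\<^sub>R y)) \<partial>lborel) \<partial>cborel I)"
  proof (rule nn_integral_cong)
    fix x assume x: "x \<in> space (cborel I)"
    have "(\<lambda>y. f (x(j := y))) \<in> borel_measurable borel" using x insert.hyps by measurable
    from nn_integral_complex_affine[OF this, of c 0] assms(2)
    show "(\<integral>\<^sup>+y. f (x(j := y)) \<partial>lborel) = ennreal (c\<^sup>2) * (\<integral>\<^sup>+y. f (x(j := c *\<^sub>R y)) \<partial>lborel)" by simp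
  qed
  also have "\<dots> = ennreal (c\<^sup>2) * (\<integral>\<^sup>+x. \<integral>\<^sup>+y. f (x(j := c *\<^sub>R y)) \<partial>lborel \<partial>cborel I)"
    by (rule nn_integral_cmult) measurable
  also have "(\<integral>\<^sup>+x. \<integral>\<^sup>+y. f (x(j := c *\<^sub>R y)) \<partial>lborel \<partial>cborel I)
     = ennreal (c ^ (2 * card I)) * (\<integral>\<^sup>+x. \<integral>\<^sup>+y. f ((\<lambda>i\<in>I. c *\<^sub>R x i)(j := c *\<^sub>R y)) \<partial>lborel \<partial>cborel I)"
    by (rule insert.IH) measurable
  also have "(\<integral>\<^sup>+x. \<integral>\<^sup>+y. f ((\<lambda>i\<in>I. c *\<^sub>R x i)(j := c *\<^sub>R y)) \<partial>lborel \<partial>cborel I)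
     = (\<integral>\<^sup>+x. \<integral>\<^sup>+y. f (\<lambda>i\<in>insert j I. c *\<^sub>R (x(j := y)) i) \<partial>lborel \<partial>cborel I)"
  proof -
    have "(\<lambda>i\<in>I. c *\<^sub>R x i)(j := c *\<^sub>R y) = (\<lambda>i\<in>insert j I. c *\<^sub>R (x(j := y)) i)" for x and y :: complex
      using insert.hyps by (auto simp: fun_eq_iff restrict_def)
    then show ?thesis by (simp only:)
  qed
  also have "\<dots> = (\<integral>\<^sup>+z. f (\<lambda>i\<in>insert j I. c *\<^sub>R z i) \<partial>cborel (insert j I))"
    by (rule cborel.product_nn_integral_insert[OF insert.hyps, symmetric]) measurable
  finally have *: "(\<integral>\<^sup>+z. f z \<partial>cborel (insert j I)) = ennreal (c\<^sup>2) * (ennreal (c ^ (2 * card I)) *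
      (\<integral>\<^sup>+z. f (\<lambda>i\<in>insert j I. c *\<^sub>R z i) \<partial>cborel (insert j I)))" .
  have "ennreal (c\<^sup>2) * (ennreal (c ^ (2 * card I)) * X) = ennreal (c ^ (2 * card (insert j I))) * X" for X
    using insert.hyps assms(2) by (simp add: ennreal_mult[symmetric] mult.assoc[symmetric] power2_eq_square)
  then show ?case unfolding * .
qed

text \<open>Kept symbolic: both the Gaussian moments and the ball volume carry the factor
  \<open>gauss_mass ^ d\<close>, which cancels in the moments of the sphere.\<close>

definition gauss_mass :: ennreal where
  "gauss_mass = (\<integral>\<^sup>+z. ennreal (exp (- (cmod z)\<^sup>2)) \<partial>lborel)"

lemma complex_gaussian:
  shows "0 < gauss_mass" "gauss_mass < \<infinity>"
    "\<alpha> > 0 \<Longrightarrow> (\<integral>\<^sup>+z. ennreal (((cmod z)\<^sup>2) powr \<alpha>) * ennreal (exp (- (cmod z)\<^sup>2)) \<partial>lborel) = ennreal (Gamma (1 + \<alpha>)) * gauss_mass"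
proof -
  define V where "V = emeasure lborel (cball (0::complex) 1)"
  have V: "(\<integral>\<^sup>+z. 1 * indicator {z. (cmod z)\<^sup>2 \<le> 1} z \<partial>lborel) = V"
  proof -
    have "{z. (cmod z)\<^sup>2 \<le> 1} = cball 0 1" by (auto simp: power_le_one_iff abs_square_le_1)
    then show ?thesis by (simp add: V_def)
  qed
  have V2: "V = ennreal (unit_ball_vol 2)" unfolding V_def by (subst emeasure_cball) auto
  have Vp: "0 < V" "V < \<infinity>" unfolding V2 by auto
  have sc: "(\<integral>\<^sup>+z. h z \<partial>lborel) = ennreal (r powr 1) * (\<integral>\<^sup>+z. h (sqrt r *\<^sub>R z) \<partial>lborel)"
    if "r > 0" "h \<in> borel_measurable lborel" for r and h :: "complex \<Rightarrow> ennreal"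
    using nn_integral_complex_affine[of h "sqrt r" 0] that by simp
  note R = radial_gaussian_moment[where M = lborel and q = "\<lambda>z::complex. (cmod z)\<^sup>2" and f = "\<lambda>_. 1"
      and T = "\<lambda>r z. sqrt r *\<^sub>R z" and k = 1, OF lborel.sigma_finite_measure_axioms _ _ _ sc]
  have "(\<integral>\<^sup>+z. 1 * ennreal (exp (- (cmod z)\<^sup>2)) \<partial>lborel) = ennreal (Gamma (1 + 1)) * V"
    unfolding V[symmetric] by (rule R(1)) (auto simp: power_mult_distrib)
  then have Z: "gauss_mass = V" by (simp add: gauss_mass_def Gamma_fact[of 1, simplified])
  show "0 < gauss_mass" "gauss_mass < \<infinity>" unfolding Z using Vp by auto
  assume a: "\<alpha> > 0"
  have "(\<integral>\<^sup>+z. 1 * ennreal (((cmod z)\<^sup>2) powr \<alpha>) * ennreal (exp (- (cmod z)\<^sup>2)) \<partial>lborel) = ennreal (1 * Gamma (1 + \<alpha>)) * V"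
    unfolding V[symmetric] by (rule R(2)) (use a V Vp in \<open>auto simp: power_mult_distrib\<close>)
  then show "(\<integral>\<^sup>+z. ennreal (((cmod z)\<^sup>2) powr \<alpha>) * ennreal (exp (- (cmod z)\<^sup>2)) \<partial>lborel) = ennreal (Gamma (1 + \<alpha>)) * gauss_mass"
    unfolding Z by simp
qed

text \<open>Stability of the Gaussian: completing the square in \<open>y\<close> after substituting \<open>v = A w + b y\<close>.  The
  coefficient \<open>A\<close> is real, so that only translations and real dilations of the plane are needed.\<close>

lemma gaussian_stable2:
  fixes u :: "complex \<Rightarrow> ennreal" and A :: real and b :: complex
  assumes [measurable]: "u \<in> borel_measurable borel" and A: "A > 0"
  defines "B \<equiv> sqrt (A\<^sup>2 + (cmod b)\<^sup>2)"
  shows "(\<integral>\<^sup>+y. \<integral>\<^sup>+w. u (A *\<^sub>R w + b * y) * ennreal (exp (- (cmod w)\<^sup>2)) * ennreal (exp (- (cmod y)\<^sup>2)) \<partial>lborel \<partial>lborel)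
    = gauss_mass * (\<integral>\<^sup>+z. u (B *\<^sub>R z) * ennreal (exp (- (cmod z)\<^sup>2)) \<partial>lborel)"
proof -
  have B2: "B\<^sup>2 = A\<^sup>2 + (cmod b)\<^sup>2" unfolding B_def by simp
  have B: "B > 0" unfolding B_def using A by (intro real_sqrt_gt_zero add_pos_nonneg) auto
  have sq: "(cmod ((- (1 / A)) *\<^sub>R (b * y) + (1 / A) *\<^sub>R v))\<^sup>2 + (cmod y)\<^sup>2
      = (cmod v)\<^sup>2 / B\<^sup>2 + (cmod ((- (B / A)) *\<^sub>R (cnj b * v / of_real (B\<^sup>2)) + (B / A) *\<^sub>R y))\<^sup>2" for v y
  proof -
    \<comment> \<open>In real and imaginary parts, and after multiplication by
      \<open>A\<^sup>2 * B\<^sup>2\<close>, completing the square is a polynomial identity.\<close>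
    define b1 b2 v1 v2 y1 y2 where "b1 = Re b" "b2 = Im b" "v1 = Re v" "v2 = Im v" "y1 = Re y" "y2 = Im y"
    then have c: "b = Complex b1 b2" "v = Complex v1 v2" "y = Complex y1 y2" by simp_all
    define p where "p = b1 * y1 - b2 * y2"
    define r where "r = b1 * y2 + b2 * y1"
    have B2': "B\<^sup>2 = A\<^sup>2 + (b1\<^sup>2 + b2\<^sup>2)" using B2 by (simp add: c cmod_power2)
    have "A\<^sup>2 * B\<^sup>2 * ((cmod ((- (1 / A)) *\<^sub>R (b * y) + (1 / A) *\<^sub>R v))\<^sup>2 + (cmod y)\<^sup>2)
      = B\<^sup>2 * ((v1 - p)\<^sup>2 + (v2 - r)\<^sup>2) + A\<^sup>2 * B\<^sup>2 * (y1\<^sup>2 + y2\<^sup>2)"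
    proof -
      have "(- (1 / A)) *\<^sub>R (b * y) + (1 / A) *\<^sub>R v = (1 / A) *\<^sub>R Complex (v1 - p) (v2 - r)"
        by (simp add: c complex_eq_iff p_def r_def diff_divide_distrib add_divide_distrib)
      then have "(cmod ((- (1 / A)) *\<^sub>R (b * y) + (1 / A) *\<^sub>R v))\<^sup>2 = ((v1 - p)\<^sup>2 + (v2 - r)\<^sup>2) / A\<^sup>2"
        by (simp add: power_mult_distrib power_divide cmod_power2)
      moreover have "(cmod y)\<^sup>2 = y1\<^sup>2 + y2\<^sup>2" by (simp add: c cmod_power2)
      moreover have "A\<^sup>2 * B\<^sup>2 * (X / A\<^sup>2 + Y) = B\<^sup>2 * X + A\<^sup>2 * B\<^sup>2 * Y" for X Y using A by (simp add: field_simps)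
      ultimately show ?thesis by (simp only:)
    qed
    also have "\<dots> = A\<^sup>2 * (v1\<^sup>2 + v2\<^sup>2) + ((B\<^sup>2 * y1 - (b1 * v1 + b2 * v2))\<^sup>2 + (B\<^sup>2 * y2 - (b1 * v2 - b2 * v1))\<^sup>2)"
      unfolding B2' p_def r_def by (simp add: power2_eq_square algebra_simps)
    also have "\<dots> = A\<^sup>2 * B\<^sup>2 * ((cmod v)\<^sup>2 / B\<^sup>2 + (cmod ((- (B / A)) *\<^sub>R (cnj b * v / of_real (B\<^sup>2)) + (B / A) *\<^sub>R y))\<^sup>2)"
    proof -
      have "(- (B / A)) *\<^sub>R (cnj b * v / of_real (B\<^sup>2)) + (B / A) *\<^sub>R y
          = (1 / (A * B)) *\<^sub>R Complex (B\<^sup>2 * y1 - (b1 * v1 + b2 * v2)) (B\<^sup>2 * y2 - (b1 * v2 - b2 * v1))"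
        using A B by (simp add: c complex_eq_iff Re_divide_of_real Im_divide_of_real field_simps power2_eq_square del: of_real_power)
      then have "(cmod ((- (B / A)) *\<^sub>R (cnj b * v / of_real (B\<^sup>2)) + (B / A) *\<^sub>R y))\<^sup>2
         = ((B\<^sup>2 * y1 - (b1 * v1 + b2 * v2))\<^sup>2 + (B\<^sup>2 * y2 - (b1 * v2 - b2 * v1))\<^sup>2) / (A * B)\<^sup>2"
        by (simp add: power_mult_distrib power_divide cmod_power2)
      moreover have "(cmod v)\<^sup>2 = v1\<^sup>2 + v2\<^sup>2" by (simp add: c cmod_power2)
      moreover have "A\<^sup>2 * B\<^sup>2 * (X / B\<^sup>2 + Y / (A * B)\<^sup>2) = A\<^sup>2 * X + Y" for X Y
        using A B by (simp add: field_simps power_mult_distrib)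
      ultimately show ?thesis by (simp only:)
    qed
    finally show ?thesis using A B by simp
  qed
  have "(\<integral>\<^sup>+w. u (A *\<^sub>R w + b * y) * ennreal (exp (- (cmod w)\<^sup>2)) * ennreal (exp (- (cmod y)\<^sup>2)) \<partial>lborel)
     = ennreal ((1 / A)\<^sup>2) * (\<integral>\<^sup>+v. u v * ennreal (exp (- ((cmod ((- (1 / A)) *\<^sub>R (b * y) + (1 / A) *\<^sub>R v))\<^sup>2 + (cmod y)\<^sup>2))) \<partial>lborel)" for y
  proof -
    have e: "A *\<^sub>R ((- (1 / A)) *\<^sub>R (b * y) + (1 / A) *\<^sub>R v) + b * y = v" for v
      using A by (simp add: scaleR_diff_right)
    have "(\<integral>\<^sup>+w. u (A *\<^sub>R w + b * y) * ennreal (exp (- (cmod w)\<^sup>2)) * ennreal (exp (- (cmod y)\<^sup>2)) \<partial>lborel)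
      = ennreal ((1 / A)\<^sup>2) * (\<integral>\<^sup>+v. u (A *\<^sub>R ((- (1 / A)) *\<^sub>R (b * y) + (1 / A) *\<^sub>R v) + b * y)
         * ennreal (exp (- (cmod ((- (1 / A)) *\<^sub>R (b * y) + (1 / A) *\<^sub>R v))\<^sup>2)) * ennreal (exp (- (cmod y)\<^sup>2)) \<partial>lborel)"
      by (rule nn_integral_complex_affine) (use A in auto)
    then show ?thesis unfolding e by (simp add: mult.assoc ennreal_mult[symmetric] exp_add[symmetric])
  qed
  then have "(\<integral>\<^sup>+y. \<integral>\<^sup>+w. u (A *\<^sub>R w + b * y) * ennreal (exp (- (cmod w)\<^sup>2)) * ennreal (exp (- (cmod y)\<^sup>2)) \<partial>lborel \<partial>lborel)
    = (\<integral>\<^sup>+y. ennreal ((1 / A)\<^sup>2) * (\<integral>\<^sup>+v. u v * ennreal (exp (- ((cmod v)\<^sup>2 / B\<^sup>2 +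
        (cmod ((- (B / A)) *\<^sub>R (cnj b * v / of_real (B\<^sup>2)) + (B / A) *\<^sub>R y))\<^sup>2))) \<partial>lborel) \<partial>lborel)"
    by (simp only: sq)
  also have "\<dots> = ennreal ((1 / A)\<^sup>2) * (\<integral>\<^sup>+y. \<integral>\<^sup>+v. u v * ennreal (exp (- ((cmod v)\<^sup>2 / B\<^sup>2 +
        (cmod ((- (B / A)) *\<^sub>R (cnj b * v / of_real (B\<^sup>2)) + (B / A) *\<^sub>R y))\<^sup>2))) \<partial>lborel \<partial>lborel)"
    by (rule nn_integral_cmult) measurable
  also have "(\<integral>\<^sup>+y. \<integral>\<^sup>+v. u v * ennreal (exp (- ((cmod v)\<^sup>2 / B\<^sup>2 +
        (cmod ((- (B / A)) *\<^sub>R (cnj b * v / of_real (B\<^sup>2)) + (B / A) *\<^sub>R y))\<^sup>2))) \<partial>lborel \<partial>lborel)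
     = (\<integral>\<^sup>+v. \<integral>\<^sup>+y. u v * ennreal (exp (- ((cmod v)\<^sup>2 / B\<^sup>2 +
        (cmod ((- (B / A)) *\<^sub>R (cnj b * v / of_real (B\<^sup>2)) + (B / A) *\<^sub>R y))\<^sup>2))) \<partial>lborel \<partial>lborel)"
    by (rule lborel_pair.Fubini') measurable
  also have "\<dots> = (\<integral>\<^sup>+v. u v * ennreal (exp (- ((cmod v)\<^sup>2 / B\<^sup>2))) * (ennreal ((A / B)\<^sup>2) * gauss_mass) \<partial>lborel)"
  proof (rule nn_integral_cong)
    fix v
    let ?t = "(- (B / A)) *\<^sub>R (cnj b * v / of_real (B\<^sup>2))"
    have "gauss_mass = ennreal ((B / A)\<^sup>2) * (\<integral>\<^sup>+y. ennreal (exp (- (cmod (?t + (B / A) *\<^sub>R y))\<^sup>2)) \<partial>lborel)"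
      unfolding gauss_mass_def by (rule nn_integral_complex_affine) (use A B in auto)
    then have "ennreal ((A / B)\<^sup>2) * gauss_mass = ennreal ((A / B)\<^sup>2 * (B / A)\<^sup>2) * (\<integral>\<^sup>+y. ennreal (exp (- (cmod (?t + (B / A) *\<^sub>R y))\<^sup>2)) \<partial>lborel)"
      by (simp add: ennreal_mult mult.assoc)
    then have g: "(\<integral>\<^sup>+y. ennreal (exp (- (cmod (?t + (B / A) *\<^sub>R y))\<^sup>2)) \<partial>lborel) = ennreal ((A / B)\<^sup>2) * gauss_mass"
      using A B by (simp add: power_mult_distrib[symmetric])
    have "(\<integral>\<^sup>+y. u v * ennreal (exp (- ((cmod v)\<^sup>2 / B\<^sup>2 + (cmod (?t + (B / A) *\<^sub>R y))\<^sup>2))) \<partial>lborel)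
      = (\<integral>\<^sup>+y. (u v * ennreal (exp (- ((cmod v)\<^sup>2 / B\<^sup>2)))) * ennreal (exp (- (cmod (?t + (B / A) *\<^sub>R y))\<^sup>2)) \<partial>lborel)"
      by (intro nn_integral_cong) (simp add: mult.assoc ennreal_mult[symmetric] exp_add[symmetric])
    also have "\<dots> = (u v * ennreal (exp (- ((cmod v)\<^sup>2 / B\<^sup>2)))) * (\<integral>\<^sup>+y. ennreal (exp (- (cmod (?t + (B / A) *\<^sub>R y))\<^sup>2)) \<partial>lborel)"
      by (rule nn_integral_cmult) measurable
    finally show "(\<integral>\<^sup>+y. u v * ennreal (exp (- ((cmod v)\<^sup>2 / B\<^sup>2 + (cmod (?t + (B / A) *\<^sub>R y))\<^sup>2))) \<partial>lborel)
      = u v * ennreal (exp (- ((cmod v)\<^sup>2 / B\<^sup>2))) * (ennreal ((A / B)\<^sup>2) * gauss_mass)" unfolding g .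
  qed
  also have "\<dots> = (\<integral>\<^sup>+v. u v * ennreal (exp (- ((cmod v)\<^sup>2 / B\<^sup>2))) \<partial>lborel) * (ennreal ((A / B)\<^sup>2) * gauss_mass)"
    by (rule nn_integral_multc) measurable
  also have "(\<integral>\<^sup>+v. u v * ennreal (exp (- ((cmod v)\<^sup>2 / B\<^sup>2))) \<partial>lborel)
      = ennreal (B\<^sup>2) * (\<integral>\<^sup>+z. u (0 + B *\<^sub>R z) * ennreal (exp (- ((cmod (0 + B *\<^sub>R z))\<^sup>2 / B\<^sup>2))) \<partial>lborel)"
    by (rule nn_integral_complex_affine) (use B in auto)
  also have "\<dots> = ennreal (B\<^sup>2) * (\<integral>\<^sup>+z. u (B *\<^sub>R z) * ennreal (exp (- (cmod z)\<^sup>2)) \<partial>lborel)"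
    using B by (simp add: power_mult_distrib)
  also have "ennreal ((1 / A)\<^sup>2) * (ennreal (B\<^sup>2) * (\<integral>\<^sup>+z. u (B *\<^sub>R z) * ennreal (exp (- (cmod z)\<^sup>2)) \<partial>lborel) * (ennreal ((A / B)\<^sup>2) * gauss_mass))
     = ennreal ((1 / A)\<^sup>2 * B\<^sup>2 * (A / B)\<^sup>2) * (gauss_mass * (\<integral>\<^sup>+z. u (B *\<^sub>R z) * ennreal (exp (- (cmod z)\<^sup>2)) \<partial>lborel))"
    by (simp add: ennreal_mult mult_ac)
  also have "(1 / A)\<^sup>2 * B\<^sup>2 * (A / B)\<^sup>2 = 1" using A B by (simp add: power_divide)
  finally show ?thesis by simp
qed

text \<open>A linear form in independent complex Gaussians is again Gaussian, scaled by the norm of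
  its coefficients. Each induction step merges one more coordinate into the scale by
  \<open>gaussian_stable2\<close>; the coefficient \<open>A\<close> of \<open>w\<close> is kept
  apart because that step needs one positive real coefficient.\<close>

lemma gaussian_stable:
  fixes a :: "nat \<Rightarrow> complex"
  assumes "finite I" "A > 0" "u \<in> borel_measurable borel"
  shows "(\<integral>\<^sup>+w. \<integral>\<^sup>+x. u (A *\<^sub>R w + (\<Sum>i\<in>I. a i * x i)) * ennreal (exp (- ((cmod w)\<^sup>2 + (\<Sum>i\<in>I. (cmod (x i))\<^sup>2)))) \<partial>cborel I \<partial>lborel)
    = gauss_mass ^ card I * (\<integral>\<^sup>+z. u (sqrt (A\<^sup>2 + (\<Sum>i\<in>I. (cmod (a i))\<^sup>2)) *\<^sub>R z) * ennreal (exp (- (cmod z)\<^sup>2)) \<partial>lborel)"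
  using assms(1,2,3)
proof (induction arbitrary: u)
  case empty
  then show ?case by (simp add: PiM_empty nn_integral_count_space_finite)
next
  case (insert j I)
  note [measurable] = insert.prems(2)
  let ?B = "sqrt (A\<^sup>2 + (\<Sum>i\<in>I. (cmod (a i))\<^sup>2))"
  let ?g = "\<lambda>w x y. u (A *\<^sub>R w + (\<Sum>i\<in>I. a i * x i) + a j * y)
     * ennreal (exp (- ((cmod w)\<^sup>2 + (\<Sum>i\<in>I. (cmod (x i))\<^sup>2)))) * ennreal (exp (- (cmod y)\<^sup>2))"
  have B: "?B > 0" using insert.prems(1) by (intro real_sqrt_gt_zero add_pos_nonneg sum_nonneg) auto
  have sm: "(\<lambda>x. \<Sum>i\<in>I. a i * x i) \<in> borel_measurable (cborel I)"
    "(\<lambda>x. \<Sum>i\<in>I. (cmod (x i))\<^sup>2) \<in> borel_measurable (cborel I)"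
    by (auto intro!: borel_measurable_sum measurable_compose[OF measurable_component_singleton])
  note [measurable] = sm
  have ins: "(\<integral>\<^sup>+x. u (A *\<^sub>R w + (\<Sum>i\<in>insert j I. a i * x i)) * ennreal (exp (- ((cmod w)\<^sup>2 + (\<Sum>i\<in>insert j I. (cmod (x i))\<^sup>2)))) \<partial>cborel (insert j I))
     = (\<integral>\<^sup>+y. \<integral>\<^sup>+x. ?g w x y \<partial>cborel I \<partial>lborel)" for w
  proof -
    have sm': "(\<lambda>x. \<Sum>i\<in>insert j I. a i * x i) \<in> borel_measurable (cborel (insert j I))"
      "(\<lambda>x. \<Sum>i\<in>insert j I. (cmod (x i))\<^sup>2) \<in> borel_measurable (cborel (insert j I))"
      by (auto intro!: borel_measurable_sum measurable_compose[OF measurable_component_singleton])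
    note [measurable] = sm'
    have "(\<integral>\<^sup>+x. u (A *\<^sub>R w + (\<Sum>i\<in>insert j I. a i * x i)) * ennreal (exp (- ((cmod w)\<^sup>2 + (\<Sum>i\<in>insert j I. (cmod (x i))\<^sup>2)))) \<partial>cborel (insert j I))
       = (\<integral>\<^sup>+y. \<integral>\<^sup>+x. u (A *\<^sub>R w + (\<Sum>i\<in>insert j I. a i * (x(j := y)) i)) * ennreal (exp (- ((cmod w)\<^sup>2 + (\<Sum>i\<in>insert j I. (cmod ((x(j := y)) i))\<^sup>2)))) \<partial>cborel I \<partial>lborel)"
      by (rule cborel.product_nn_integral_insert_rev[OF insert.hyps]) measurable
    moreover have "u (A *\<^sub>R w + (\<Sum>i\<in>insert j I. a i * (x(j := y)) i)) * ennreal (exp (- ((cmod w)\<^sup>2 + (\<Sum>i\<in>insert j I. (cmod ((x(j := y)) i))\<^sup>2)))) = ?g w x y" for x y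
    proof -
      have "(\<Sum>i\<in>I. a i * (x(j := y)) i) = (\<Sum>i\<in>I. a i * x i)" "(\<Sum>i\<in>I. (cmod ((x(j := y)) i))\<^sup>2) = (\<Sum>i\<in>I. (cmod (x i))\<^sup>2)"
        using insert.hyps by (auto intro!: sum.cong)
      then have s1: "(\<Sum>i\<in>insert j I. a i * (x(j := y)) i) = (\<Sum>i\<in>I. a i * x i) + a j * y"
        "(\<Sum>i\<in>insert j I. (cmod ((x(j := y)) i))\<^sup>2) = (\<Sum>i\<in>I. (cmod (x i))\<^sup>2) + (cmod y)\<^sup>2"
        by (simp_all only: sum.insert[OF insert.hyps] fun_upd_same add.commute)
      have e: "ennreal (exp (- (p + (q + r)))) = ennreal (exp (- (p + q))) * ennreal (exp (- r))" for p q r :: real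
        by (simp add: ennreal_mult[symmetric] exp_add[symmetric] algebra_simps)
      show ?thesis unfolding s1 e by (simp only: mult.assoc add.assoc)
    qed
    ultimately show ?thesis by (simp only:)
  qed
  have fub: "(\<integral>\<^sup>+w. \<integral>\<^sup>+y. (\<integral>\<^sup>+x. ?g w x y \<partial>cborel I) \<partial>lborel \<partial>lborel) = (\<integral>\<^sup>+y. \<integral>\<^sup>+w. (\<integral>\<^sup>+x. ?g w x y \<partial>cborel I) \<partial>lborel \<partial>lborel)"
  proof (rule lborel_pair.Fubini')
    interpret I: sigma_finite_measure "cborel I" by (rule sigma_finite_cborel[OF insert.hyps(1)])
    show "(\<lambda>(y, w). \<integral>\<^sup>+x. ?g w x y \<partial>cborel I) \<in> borel_measurable (lborel \<Otimes>\<^sub>M lborel)"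
      by measurable
  qed
  have inner: "(\<integral>\<^sup>+w. \<integral>\<^sup>+x. ?g w x y \<partial>cborel I \<partial>lborel)
     = gauss_mass ^ card I * (\<integral>\<^sup>+z. u (?B *\<^sub>R z + a j * y) * ennreal (exp (- (cmod z)\<^sup>2)) * ennreal (exp (- (cmod y)\<^sup>2)) \<partial>lborel)" for y
  proof -
    have "(\<integral>\<^sup>+w. \<integral>\<^sup>+x. ?g w x y \<partial>cborel I \<partial>lborel)
      = (\<integral>\<^sup>+w. \<integral>\<^sup>+x. (\<lambda>v. u (v + a j * y) * ennreal (exp (- (cmod y)\<^sup>2))) (A *\<^sub>R w + (\<Sum>i\<in>I. a i * x i))
         * ennreal (exp (- ((cmod w)\<^sup>2 + (\<Sum>i\<in>I. (cmod (x i))\<^sup>2)))) \<partial>cborel I \<partial>lborel)"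
      by (intro nn_integral_cong) (simp add: mult_ac)
    also have "\<dots> = gauss_mass ^ card I * (\<integral>\<^sup>+z. (\<lambda>v. u (v + a j * y) * ennreal (exp (- (cmod y)\<^sup>2))) (?B *\<^sub>R z) * ennreal (exp (- (cmod z)\<^sup>2)) \<partial>lborel)"
      by (rule insert.IH[OF insert.prems(1)]) measurable
    also have "\<dots> = gauss_mass ^ card I * (\<integral>\<^sup>+z. u (?B *\<^sub>R z + a j * y) * ennreal (exp (- (cmod z)\<^sup>2)) * ennreal (exp (- (cmod y)\<^sup>2)) \<partial>lborel)"
      by (simp only: mult_ac)
    finally show ?thesis .
  qed
  have "(\<integral>\<^sup>+y. \<integral>\<^sup>+w. (\<integral>\<^sup>+x. ?g w x y \<partial>cborel I) \<partial>lborel \<partial>lborel)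
    = gauss_mass ^ card I * (\<integral>\<^sup>+y. \<integral>\<^sup>+z. u (?B *\<^sub>R z + a j * y) * ennreal (exp (- (cmod z)\<^sup>2)) * ennreal (exp (- (cmod y)\<^sup>2)) \<partial>lborel \<partial>lborel)"
    unfolding inner by (rule nn_integral_cmult) measurable
  also have "\<dots> = gauss_mass ^ card I * (gauss_mass * (\<integral>\<^sup>+z. u (sqrt (?B\<^sup>2 + (cmod (a j))\<^sup>2) *\<^sub>R z) * ennreal (exp (- (cmod z)\<^sup>2)) \<partial>lborel))"
    by (simp only: gaussian_stable2[OF insert.prems(2) B])
  also have "?B\<^sup>2 + (cmod (a j))\<^sup>2 = A\<^sup>2 + (\<Sum>i\<in>insert j I. (cmod (a i))\<^sup>2)"
    using insert.hyps by (simp add: sum_nonneg)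
  also have "gauss_mass ^ card I * (gauss_mass * X) = gauss_mass ^ card (insert j I) * X" for X
    using insert.hyps by (simp add: mult_ac)
  finally show ?case unfolding ins fub .
qed

text \<open>The quotient of the Gaussian moment of a single coordinate,
  \<open>Gamma (1 + \<alpha>)\<close>, by that of the squared radius,
  \<open>Gamma (real d + \<alpha>) / Gamma (real d)\<close>. Radius and direction of a Gaussian
  vector are independent, so the quotient is the moment of the squared overlap of a random direction
  with a fixed unit vector.\<close>

definition sphere_moment :: "nat \<Rightarrow> real \<Rightarrow> real" where
  "sphere_moment d \<alpha> = Gamma (1 + \<alpha>) * Gamma (real d) / Gamma (real d + \<alpha>)"

lemma cborel_gaussian_moment:
  fixes \<phi> :: "nat \<Rightarrow> complex"
  assumes d: "d > 0" and \<alpha>: "\<alpha> > 0"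
  shows "(\<integral>\<^sup>+z. ennreal ((cmod (\<Sum>i<d. \<phi> i * z i))\<^sup>2 powr \<alpha>) * ennreal (exp (- (\<Sum>i<d. (cmod (z i))\<^sup>2))) \<partial>cborel {..<d})
    = gauss_mass ^ d * ennreal (Gamma (1 + \<alpha>) * (\<Sum>i<d. (cmod (\<phi> i))\<^sup>2) powr \<alpha>)"
proof (cases "\<exists>j<d. \<phi> j \<noteq> 0")
  case False
  then have "\<phi> i = 0" if "i < d" for i using that by blast
  then show ?thesis by simp
next
  case True
  then obtain j where j: "j < d" "\<phi> j \<noteq> 0" by blast
  define I where "I = {..<d} - {j}"
  have I: "finite I" "j \<notin> I" "{..<d} = insert j I" "card I = d - 1" unfolding I_def using j by auto
  \<comment> \<open>A phase that makes the coefficient at \<open>j\<close> positive real, as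
    \<open>gaussian_stable\<close> demands; the modulus of the linear form is unaffected.\<close>
  define c where "c = cnj (\<phi> j) / of_real (cmod (\<phi> j))"
  have c1: "cmod c = 1" unfolding c_def using j by (simp add: norm_divide)
  have cj: "c * \<phi> j = of_real (cmod (\<phi> j))"
  proof -
    have "cnj (\<phi> j) * \<phi> j = of_real (cmod (\<phi> j)) * of_real (cmod (\<phi> j))"
      using complex_norm_square[of "\<phi> j"] by (simp add: power2_eq_square mult.commute)
    then show ?thesis unfolding c_def using j(2) by (simp add: field_simps)
  qed
  let ?u = "\<lambda>v::complex. ennreal ((cmod v)\<^sup>2 powr \<alpha>)"
  have um: "?u \<in> borel_measurable borel" by measurable
  have sm: "(\<lambda>x. \<Sum>i<d. \<phi> i * x i) \<in> borel_measurable (cborel (insert j I))"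
    "(\<lambda>x. \<Sum>i<d. (cmod (x i))\<^sup>2) \<in> borel_measurable (cborel (insert j I))"
    unfolding I(3)[symmetric] by (auto intro!: borel_measurable_sum measurable_compose[OF measurable_component_singleton])
  note [measurable] = sm
  have "(\<integral>\<^sup>+z. ?u (\<Sum>i<d. \<phi> i * z i) * ennreal (exp (- (\<Sum>i<d. (cmod (z i))\<^sup>2))) \<partial>cborel {..<d})
     = (\<integral>\<^sup>+z. ?u (\<Sum>i<d. \<phi> i * z i) * ennreal (exp (- (\<Sum>i<d. (cmod (z i))\<^sup>2))) \<partial>cborel (insert j I))"
    by (simp only: I(3))
  also have "\<dots> = (\<integral>\<^sup>+y. \<integral>\<^sup>+x. ?u (\<Sum>i<d. \<phi> i * (x(j := y)) i) * ennreal (exp (- (\<Sum>i<d. (cmod ((x(j := y)) i))\<^sup>2))) \<partial>cborel I \<partial>lborel)"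
    by (rule cborel.product_nn_integral_insert_rev[OF I(1,2)]) measurable
  also have "\<dots> = (\<integral>\<^sup>+y. \<integral>\<^sup>+x. ?u (cmod (\<phi> j) *\<^sub>R y + (\<Sum>i\<in>I. (c * \<phi> i) * x i)) * ennreal (exp (- ((cmod y)\<^sup>2 + (\<Sum>i\<in>I. (cmod (x i))\<^sup>2)))) \<partial>cborel I \<partial>lborel)"
  proof (rule nn_integral_cong, rule nn_integral_cong, rule arg_cong2[where f = "(*)"])
    fix y and x :: "nat \<Rightarrow> complex"
    have s: "(\<Sum>i\<in>I. \<phi> i * (x(j := y)) i) = (\<Sum>i\<in>I. \<phi> i * x i)" "(\<Sum>i\<in>I. (cmod ((x(j := y)) i))\<^sup>2) = (\<Sum>i\<in>I. (cmod (x i))\<^sup>2)"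
      using I(2) by (auto intro!: sum.cong)
    have "c * (\<Sum>i<d. \<phi> i * (x(j := y)) i) = c * \<phi> j * y + c * (\<Sum>i\<in>I. \<phi> i * x i)"
      unfolding I(3) sum.insert[OF I(1,2)] s by (simp add: algebra_simps)
    also have "\<dots> = cmod (\<phi> j) *\<^sub>R y + (\<Sum>i\<in>I. (c * \<phi> i) * x i)"
      unfolding cj by (simp add: scaleR_conv_of_real sum_distrib_left mult.assoc)
    finally have "cmod (\<Sum>i<d. \<phi> i * (x(j := y)) i) = cmod (cmod (\<phi> j) *\<^sub>R y + (\<Sum>i\<in>I. (c * \<phi> i) * x i))"
      using c1 norm_mult[of c "\<Sum>i<d. \<phi> i * (x(j := y)) i"] by simp
    then show "?u (\<Sum>i<d. \<phi> i * (x(j := y)) i) = ?u (cmod (\<phi> j) *\<^sub>R y + (\<Sum>i\<in>I. (c * \<phi> i) * x i))" by simp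
    have "(\<Sum>i<d. (cmod ((x(j := y)) i))\<^sup>2) = (cmod y)\<^sup>2 + (\<Sum>i\<in>I. (cmod (x i))\<^sup>2)"
      unfolding I(3) sum.insert[OF I(1,2)] s by simp
    then show "ennreal (exp (- (\<Sum>i<d. (cmod ((x(j := y)) i))\<^sup>2))) = ennreal (exp (- ((cmod y)\<^sup>2 + (\<Sum>i\<in>I. (cmod (x i))\<^sup>2))))"
      by (simp only:)
  qed
  also have "\<dots> = gauss_mass ^ card I * (\<integral>\<^sup>+z. ?u (sqrt ((cmod (\<phi> j))\<^sup>2 + (\<Sum>i\<in>I. (cmod (c * \<phi> i))\<^sup>2)) *\<^sub>R z) * ennreal (exp (- (cmod z)\<^sup>2)) \<partial>lborel)"
    by (rule gaussian_stable[OF I(1) _ um]) (use j in simp)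
  also have "(cmod (\<phi> j))\<^sup>2 + (\<Sum>i\<in>I. (cmod (c * \<phi> i))\<^sup>2) = (\<Sum>i<d. (cmod (\<phi> i))\<^sup>2)"
    unfolding I(3) sum.insert[OF I(1,2)] by (simp add: norm_mult c1)
  also have "(\<integral>\<^sup>+z. ?u (sqrt (\<Sum>i<d. (cmod (\<phi> i))\<^sup>2) *\<^sub>R z) * ennreal (exp (- (cmod z)\<^sup>2)) \<partial>lborel)
     = (\<integral>\<^sup>+z. ennreal ((\<Sum>i<d. (cmod (\<phi> i))\<^sup>2) powr \<alpha>) * (?u z * ennreal (exp (- (cmod z)\<^sup>2))) \<partial>lborel)"
    by (intro nn_integral_cong) (simp add: power_mult_distrib powr_mult sum_nonneg ennreal_mult mult_ac)
  also have "\<dots> = ennreal ((\<Sum>i<d. (cmod (\<phi> i))\<^sup>2) powr \<alpha>) * (\<integral>\<^sup>+z. ?u z * ennreal (exp (- (cmod z)\<^sup>2)) \<partial>lborel)"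
    by (rule nn_integral_cmult) measurable
  also have "\<dots> = ennreal ((\<Sum>i<d. (cmod (\<phi> i))\<^sup>2) powr \<alpha>) * (ennreal (Gamma (1 + \<alpha>)) * gauss_mass)"
    by (simp only: complex_gaussian(3)[OF \<alpha>])
  also have "gauss_mass ^ card I * \<dots> = (gauss_mass ^ card I * gauss_mass) * (ennreal (Gamma (1 + \<alpha>)) * ennreal ((\<Sum>i<d. (cmod (\<phi> i))\<^sup>2) powr \<alpha>))"
    by (simp only: mult_ac)
  also have "gauss_mass ^ card I * gauss_mass = gauss_mass ^ d"
    using d I(4) by (simp add: power_Suc2[symmetric])
  also have "ennreal (Gamma (1 + \<alpha>)) * ennreal ((\<Sum>i<d. (cmod (\<phi> i))\<^sup>2) powr \<alpha>) = ennreal (Gamma (1 + \<alpha>) * (\<Sum>i<d. (cmod (\<phi> i))\<^sup>2) powr \<alpha>)"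
    using \<alpha> by (intro ennreal_mult[symmetric]) (auto intro!: less_imp_le Gamma_real_pos)
  finally show ?thesis .
qed

lemma cborel_gaussian_mass:
  "(\<integral>\<^sup>+z. ennreal (exp (- (\<Sum>i<d. (cmod (z i))\<^sup>2))) \<partial>cborel {..<d}) = gauss_mass ^ d"
proof -
  have "(\<integral>\<^sup>+z. ennreal (exp (- (\<Sum>i<d. (cmod (z i))\<^sup>2))) \<partial>cborel {..<d})
    = (\<integral>\<^sup>+z. (\<Prod>i<d. ennreal (exp (- (cmod (z i))\<^sup>2))) \<partial>cborel {..<d})"
    by (intro nn_integral_cong) (simp only: prod_ennreal[OF exp_ge_zero] exp_sum[OF finite_lessThan, symmetric] sum_negf)
  also have "\<dots> = (\<Prod>i<d. gauss_mass)"
    unfolding gauss_mass_def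
    by (rule cborel.product_nn_integral_prod[where f = "\<lambda>_ z. ennreal (exp (- (cmod z)\<^sup>2))", OF finite_lessThan]) measurable
  also have "\<dots> = gauss_mass ^ d" by (simp only: prod_constant card_lessThan)
  finally show ?thesis .
qed

lemma cmod_sum_mult_le:
  "(cmod (\<Sum>i<d. \<phi> i * z i))\<^sup>2 \<le> (\<Sum>i<d. (cmod (\<phi> i))\<^sup>2) * (\<Sum>i<d. (cmod (z i))\<^sup>2)"
proof -
  have "cmod (\<Sum>i<d. \<phi> i * z i) \<le> (\<Sum>i<d. cmod (\<phi> i) * cmod (z i))"
    by (rule order_trans[OF norm_sum]) (simp add: norm_mult)
  then have "(cmod (\<Sum>i<d. \<phi> i * z i))\<^sup>2 \<le> (\<Sum>i<d. cmod (\<phi> i) * cmod (z i))\<^sup>2"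
    by (intro power_mono) auto
  also have "\<dots> \<le> (\<Sum>i<d. (cmod (\<phi> i))\<^sup>2) * (\<Sum>i<d. (cmod (z i))\<^sup>2)"
    by (rule Cauchy_Schwarz_ineq_sum)
  finally show ?thesis .
qed

section \<open>The uniform measure on the sphere and its moments\<close>

definition sphere_normalize :: "nat \<Rightarrow> (nat \<Rightarrow> complex) \<Rightarrow> nat \<Rightarrow> complex" where
  "sphere_normalize d z = (\<lambda>i\<in>{..<d}. z i / complex_of_real (sqrt (\<Sum>k<d. (cmod (z k))\<^sup>2)))"

lemma cborel_sums_measurable [measurable]:
  "(\<lambda>z. \<Sum>i<d. \<phi> i * z i) \<in> borel_measurable (cborel {..<d})"
  "(\<lambda>z. \<Sum>i<d. (cmod (z i))\<^sup>2) \<in> borel_measurable (cborel {..<d})"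
  by (auto intro!: borel_measurable_sum measurable_compose[OF measurable_component_singleton])

lemma sphere_normalize_measurable:
  "sphere_normalize d \<in> measurable (cborel {..<d}) (\<Pi>\<^sub>M i\<in>{..<d}. borel)"
  unfolding sphere_normalize_def
proof (rule measurable_restrict)
  fix i assume "i \<in> {..<d}"
  then have "(\<lambda>z. z i) \<in> measurable (cborel {..<d}) lborel" by (rule measurable_component_singleton)
  then have [measurable]: "(\<lambda>z. z i) \<in> borel_measurable (cborel {..<d})" by simp
  show "(\<lambda>z. z i / complex_of_real (sqrt (\<Sum>k<d. (cmod (z k))\<^sup>2))) \<in> borel_measurable (cborel {..<d})"
    by measurable
qed

definition unit_ball_set :: "nat \<Rightarrow> (nat \<Rightarrow> complex) set" where
  "unit_ball_set d = {z \<in> space (cborel {..<d}). (\<Sum>i<d. (cmod (z i))\<^sup>2) \<le> 1}"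

lemma unit_ball_set_sets [measurable]: "unit_ball_set d \<in> sets (cborel {..<d})"
  unfolding unit_ball_set_def by measurable

lemma sphere_measure_alt:
  "sphere_measure d = distr (uniform_measure (cborel {..<d}) (unit_ball_set d)) (\<Pi>\<^sub>M i\<in>{..<d}. borel) (sphere_normalize d)"
  unfolding sphere_measure_def unit_ball_set_def sphere_normalize_def[abs_def] ..

text \<open>The case where \<open>q\<close> is the squared norm. Scaling \<open>q\<close> by
  \<open>r\<close> multiplies each of the \<open>d\<close> complex coordinates by
  \<open>sqrt r\<close> and hence volumes by r to the power \<open>d\<close>, so the exponent
  \<open>k\<close> is \<open>real d\<close>.\<close>

lemma ball_radial:
  assumes d: "d > 0" and f: "f \<in> borel_measurable (cborel {..<d})"
    and fT: "\<And>r z. r > 0 \<Longrightarrow> f (\<lambda>i\<in>{..<d}. sqrt r *\<^sub>R z i) = f z"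
  shows "(\<integral>\<^sup>+z. f z * ennreal (exp (- (\<Sum>i<d. (cmod (z i))\<^sup>2))) \<partial>cborel {..<d})
      = ennreal (Gamma (real d + 1)) * (\<integral>\<^sup>+z. f z * indicator (unit_ball_set d) z \<partial>cborel {..<d})" (is ?A)
    and "\<alpha> > 0 \<Longrightarrow> (\<integral>\<^sup>+z. f z * indicator (unit_ball_set d) z \<partial>cborel {..<d}) < \<infinity> \<Longrightarrow>
      (\<integral>\<^sup>+z. f z * ennreal ((\<Sum>i<d. (cmod (z i))\<^sup>2) powr \<alpha>) * ennreal (exp (- (\<Sum>i<d. (cmod (z i))\<^sup>2))) \<partial>cborel {..<d})
      = ennreal (real d * Gamma (real d + \<alpha>)) * (\<integral>\<^sup>+z. f z * indicator (unit_ball_set d) z \<partial>cborel {..<d})" (is "_ \<Longrightarrow> _ \<Longrightarrow> ?B")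
proof -
  have sc: "(\<integral>\<^sup>+z. h z \<partial>cborel {..<d}) = ennreal (r powr real d) * (\<integral>\<^sup>+z. h (\<lambda>i\<in>{..<d}. sqrt r *\<^sub>R z i) \<partial>cborel {..<d})"
    if r: "r > 0" and h: "h \<in> borel_measurable (cborel {..<d})" for r h
  proof -
    have "sqrt r ^ (2 * card {..<d}) = r powr real d" using r by (simp add: power_mult powr_realpow)
    then show ?thesis using nn_integral_cborel_scale[of "{..<d}" "sqrt r" h] r h by simp
  qed
  have qT: "(\<Sum>i<d. (cmod ((\<lambda>i\<in>{..<d}. sqrt r *\<^sub>R z i) i))\<^sup>2) = r * (\<Sum>i<d. (cmod (z i))\<^sup>2)" if "r > 0" for r and z :: "nat \<Rightarrow> complex"
    unfolding sum_distrib_left using that by (intro sum.cong refl) (simp add: power_mult_distrib)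
  have ind: "(\<integral>\<^sup>+z. f z * indicator {z. (\<Sum>i<d. (cmod (z i))\<^sup>2) \<le> 1} z \<partial>cborel {..<d}) = (\<integral>\<^sup>+z. f z * indicator (unit_ball_set d) z \<partial>cborel {..<d})"
    by (intro nn_integral_cong) (simp add: unit_ball_set_def indicator_def)
  have dd: "real d > 0" using d by simp
  note R = radial_gaussian_moment[where q = "\<lambda>z. \<Sum>i<d. (cmod (z i))\<^sup>2" and f = f and k = "real d"
      and T = "\<lambda>r z. \<lambda>i\<in>{..<d}. sqrt r *\<^sub>R z i", OF sigma_finite_cborel[OF finite_lessThan] cborel_sums_measurable(2) f _ sc qT fT dd, unfolded ind]
  show ?A by (rule R(1)) (simp add: sum_nonneg)
  show ?B if "\<alpha> > 0" "(\<integral>\<^sup>+z. f z * indicator (unit_ball_set d) z \<partial>cborel {..<d}) < \<infinity>"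
    by (rule R(2)) (use that in \<open>simp_all add: sum_nonneg\<close>)
qed

lemma unit_ball_volume:
  assumes d: "d > 0"
  shows "gauss_mass ^ d = ennreal (Gamma (real d + 1)) * emeasure (cborel {..<d}) (unit_ball_set d)"
    "emeasure (cborel {..<d}) (unit_ball_set d) \<noteq> 0" "emeasure (cborel {..<d}) (unit_ball_set d) \<noteq> \<infinity>"
proof -
  let ?V = "emeasure (cborel {..<d}) (unit_ball_set d)"
  have "(\<integral>\<^sup>+z. 1 * ennreal (exp (- (\<Sum>i<d. (cmod (z i))\<^sup>2))) \<partial>cborel {..<d})
      = ennreal (Gamma (real d + 1)) * (\<integral>\<^sup>+z. 1 * indicator (unit_ball_set d) z \<partial>cborel {..<d})"
    by (rule ball_radial(1)[OF d]) auto
  then show *: "gauss_mass ^ d = ennreal (Gamma (real d + 1)) * ?V"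
    by (simp add: cborel_gaussian_mass)
  have G: "Gamma (real d + 1) > 0" by (intro Gamma_real_pos) simp
  have "gauss_mass ^ d \<noteq> 0" using complex_gaussian(1) by simp
  then show "?V \<noteq> 0" unfolding * by auto
  obtain r where r: "gauss_mass = ennreal r" "r \<ge> 0" using complex_gaussian(2) by (cases gauss_mass) auto
  have "gauss_mass ^ d \<noteq> \<infinity>" unfolding r(1) using r(2) by (simp add: ennreal_power)
  then show "?V \<noteq> \<infinity>" unfolding * using G by (auto simp: ennreal_mult_eq_top_iff)
qed

lemma prob_space_sphere:
  assumes d: "d > 0" shows "prob_space (sphere_measure d)"
proof -
  have "prob_space (uniform_measure (cborel {..<d}) (unit_ball_set d))"
    by (rule prob_space_uniform_measure) (use unit_ball_volume[OF d] in auto)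
  then show ?thesis unfolding sphere_measure_alt
    by (rule prob_space.prob_space_distr)
      (subst measurable_cong_sets[OF sets_uniform_measure refl], rule sphere_normalize_measurable)
qed

lemma sets_sphere_measure [measurable_cong]: "sets (sphere_measure d) = sets (\<Pi>\<^sub>M i\<in>{..<d}. borel)"
  by (simp add: sphere_measure_def)

lemma nn_integral_sphere:
  assumes g: "g \<in> borel_measurable (\<Pi>\<^sub>M i\<in>{..<d}. borel)"
  shows "(\<integral>\<^sup>+\<psi>. g \<psi> \<partial>sphere_measure d) = (\<integral>\<^sup>+z. g (sphere_normalize d z) * indicator (unit_ball_set d) z \<partial>cborel {..<d})
     / emeasure (cborel {..<d}) (unit_ball_set d)"
proof -
  have gn: "(\<lambda>z. g (sphere_normalize d z)) \<in> borel_measurable (cborel {..<d})"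
    by (rule measurable_compose[OF sphere_normalize_measurable g])
  show ?thesis unfolding sphere_measure_alt
    by (subst nn_integral_distr) (use g gn sphere_normalize_measurable in \<open>simp_all add: nn_integral_uniform_measure\<close>)
qed

lemma sphere_form_measurable:
  "(\<lambda>\<psi>. \<Sum>i<d. \<phi> i * \<psi> i) \<in> borel_measurable (\<Pi>\<^sub>M i\<in>{..<d}. (borel :: complex measure))"
  "(\<lambda>\<psi>. \<Sum>i<d. (cmod (\<psi> i))\<^sup>2) \<in> borel_measurable (\<Pi>\<^sub>M i\<in>{..<d}. (borel :: complex measure))"
  by (auto intro!: borel_measurable_sum measurable_compose[OF measurable_component_singleton])

text \<open>The integrand pulled back along normalisation is the function \<open>f\<close>,
  homogeneous of degree zero. Its ball average is compared with the Gaussian integral of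
  \<open>f\<close> times the \<alpha>-th power of the squared norm, which is the Gaussian moment of
  the linear form. Expressing the ball volume by the same \<open>gauss_mass\<close> leaves the Gamma
  quotient.\<close>

lemma nn_integral_sphere_moment:
  assumes d: "d > 0" and \<alpha>: "\<alpha> > 0"
  shows "(\<integral>\<^sup>+\<psi>. ennreal ((cmod (\<Sum>i<d. \<phi> i * \<psi> i))\<^sup>2 powr \<alpha>) \<partial>sphere_measure d)
    = ennreal (sphere_moment d \<alpha> * (\<Sum>i<d. (cmod (\<phi> i))\<^sup>2) powr \<alpha>)"
proof -
  let ?q = "\<lambda>z. \<Sum>i<d. (cmod (z i))\<^sup>2" and ?F = "\<lambda>z. (cmod (\<Sum>i<d. \<phi> i * z i))\<^sup>2"
  let ?V = "emeasure (cborel {..<d}) (unit_ball_set d)" and ?n = "(\<Sum>i<d. (cmod (\<phi> i))\<^sup>2) powr \<alpha>"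
  define f where "f z = ennreal (?F z powr \<alpha> / ?q z powr \<alpha>)" for z
  define J where "J = (\<integral>\<^sup>+z. f z * indicator (unit_ball_set d) z \<partial>cborel {..<d})"
  have fm: "f \<in> borel_measurable (cborel {..<d})" unfolding f_def by measurable
  have q0: "?q z \<ge> 0" for z :: "nat \<Rightarrow> complex" by (simp add: sum_nonneg)
  have fT: "f (\<lambda>i\<in>{..<d}. sqrt r *\<^sub>R z i) = f z" if r: "r > 0" for r z
  proof -
    have "(\<Sum>i<d. \<phi> i * (\<lambda>i\<in>{..<d}. sqrt r *\<^sub>R z i) i) = sqrt r *\<^sub>R (\<Sum>i<d. \<phi> i * z i)"
      unfolding scaleR_sum_right by (intro sum.cong refl) simp
    then have 1: "?F (\<lambda>i\<in>{..<d}. sqrt r *\<^sub>R z i) = r * ?F z" using r by (simp add: power_mult_distrib)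
    have 2: "?q (\<lambda>i\<in>{..<d}. sqrt r *\<^sub>R z i) = r * ?q z"
      unfolding sum_distrib_left using r by (intro sum.cong refl) (simp add: power_mult_distrib)
    show ?thesis unfolding f_def 1 2 using r q0[of z] by (simp add: powr_mult)
  qed
  have gn: "ennreal (?F (sphere_normalize d z) powr \<alpha>) = f z" for z
  proof -
    have "(\<Sum>i<d. \<phi> i * sphere_normalize d z i) = (\<Sum>i<d. \<phi> i * z i) / of_real (sqrt (?q z))"
      unfolding sum_divide_distrib by (intro sum.cong refl) (simp add: sphere_normalize_def)
    then have "?F (sphere_normalize d z) = ?F z / ?q z"
      using q0[of z] by (simp add: norm_divide power_divide)
    then show ?thesis unfolding f_def using q0[of z] by (simp add: powr_divide)
  qed
  \<comment> \<open>Cauchy-Schwarz bounds \<open>f\<close>, so its integral over the ball is finite,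
    as the second part of \<open>ball_radial\<close> requires.\<close>
  have fle: "f z \<le> ennreal ?n" for z
  proof -
    have "?F z powr \<alpha> \<le> ((\<Sum>i<d. (cmod (\<phi> i))\<^sup>2) * ?q z) powr \<alpha>"
      using \<alpha> by (intro powr_mono2 cmod_sum_mult_le) auto
    also have "\<dots> = ?n * ?q z powr \<alpha>" using q0[of z] by (simp add: powr_mult sum_nonneg)
    finally show ?thesis unfolding f_def by (intro ennreal_leI) (cases "?q z powr \<alpha> = 0", simp_all add: divide_le_eq)
  qed
  have fF: "f z * ennreal (?q z powr \<alpha>) = ennreal (?F z powr \<alpha>)" for z
  proof (cases "?q z = 0")
    case True
    then have "?F z \<le> 0" using cmod_sum_mult_le[of \<phi> z d] by simp
    then have "?F z = 0" using zero_le_power2[of "cmod (\<Sum>i<d. \<phi> i * z i)"] by linarith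
    then show ?thesis unfolding f_def True by simp
  next
    case False
    then show ?thesis unfolding f_def by (simp add: ennreal_mult[symmetric])
  qed
  have "J \<le> (\<integral>\<^sup>+z. ennreal ?n * indicator (unit_ball_set d) z \<partial>cborel {..<d})"
    unfolding J_def by (intro nn_integral_mono mult_right_mono fle) simp
  also have "\<dots> = ennreal ?n * ?V" by (rule nn_integral_cmult_indicator) measurable
  also have "\<dots> < \<infinity>" using unit_ball_volume(3)[OF d] by (simp add: ennreal_mult_less_top less_top)
  finally have J: "J < \<infinity>" .
  have "gauss_mass ^ d * ennreal (Gamma (1 + \<alpha>) * ?n) = ennreal (real d * Gamma (real d + \<alpha>)) * J"
    using ball_radial(2)[OF d fm fT \<alpha> J[unfolded J_def]]
    unfolding fF cborel_gaussian_moment[OF d \<alpha>] J_def .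
  then have eq: "ennreal (Gamma (real d + 1)) * ?V * ennreal (Gamma (1 + \<alpha>) * ?n) = ennreal (real d * Gamma (real d + \<alpha>)) * J"
    unfolding unit_ball_volume(1)[OF d] .
  obtain v where v: "?V = ennreal v" "v > 0"
    using unit_ball_volume(2,3)[OF d] by (cases ?V) (auto simp: less_le)
  obtain j where j: "J = ennreal j" "j \<ge> 0" using J by (cases J) auto
  have G: "Gamma (real d + 1) > 0" "Gamma (1 + \<alpha>) > 0" "Gamma (real d + \<alpha>) > 0" "real d > 0"
    using d \<alpha> by (auto intro!: Gamma_real_pos add_nonneg_pos)
  have Gd: "Gamma (real d + 1) = real d * Gamma (real d)" using Gamma_plus1[of "real d"] d by (auto simp: nonpos_Ints_def)
  have "Gamma (real d + 1) * v * (Gamma (1 + \<alpha>) * ?n) = real d * Gamma (real d + \<alpha>) * j"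
    using eq G v(2) j(2) unfolding v(1) j(1) by (simp add: ennreal_mult[symmetric])
  then have "j / v = sphere_moment d \<alpha> * ?n"
    unfolding sphere_moment_def Gd using G v by (simp add: field_simps)
  have "(\<integral>\<^sup>+\<psi>. ennreal ((cmod (\<Sum>i<d. \<phi> i * \<psi> i))\<^sup>2 powr \<alpha>) \<partial>sphere_measure d) = J / ?V"
    unfolding J_def gn[symmetric] by (rule nn_integral_sphere) (use sphere_form_measurable(1) in measurable)
  also have "\<dots> = ennreal (j / v)" unfolding v(1) j(1) using v(2) j(2) by (simp add: divide_ennreal)
  finally show ?thesis unfolding \<open>j / v = sphere_moment d \<alpha> * ?n\<close> .
qed

text \<open>Normalisation fails only at the origin, where division by zero yields the zero vector;
  the origin is a null set because \<open>d > 0\<close>.\<close>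

lemma AE_sphere_norm:
  assumes d: "d > 0" shows "AE \<psi> in sphere_measure d. (\<Sum>i<d. (cmod (\<psi> i))\<^sup>2) = 1"
proof -
  let ?q = "\<lambda>z. \<Sum>i<d. (cmod (z i))\<^sup>2"
  have "emeasure (cborel {..<d}) (\<Pi>\<^sub>E i\<in>{..<d}. {0}) = (\<Prod>i<d. emeasure lborel {0::complex})"
    by (rule cborel.emeasure_PiM) auto
  also have "\<dots> = 0" using d by simp
  finally have z: "(\<Pi>\<^sub>E i\<in>{..<d}. {0}) \<in> null_sets (cborel {..<d})"
    by (intro null_setsI sets_PiM_I_finite) auto
  have "AE z in cborel {..<d}. ?q z \<noteq> 0"
  proof (rule AE_I'[OF z], rule subsetI)
    fix z assume "z \<in> {z \<in> space (cborel {..<d}). \<not> ?q z \<noteq> 0}"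
    then have "z \<in> extensional {..<d}" "\<forall>i<d. z i = 0"
      by (auto simp: space_PiM PiE_def sum_nonneg_eq_0_iff)
    then show "z \<in> (\<Pi>\<^sub>E i\<in>{..<d}. {0})" by (auto simp: PiE_def extensional_def fun_eq_iff)
  qed
  then have "AE z in uniform_measure (cborel {..<d}) (unit_ball_set d). ?q z \<noteq> 0"
    by (intro AE_uniform_measureI) (auto elim: eventually_mono)
  moreover have "?q (sphere_normalize d z) = 1" if "?q z \<noteq> 0" for z
  proof -
    have q0: "?q z \<ge> 0" by (simp add: sum_nonneg)
    have "?q (sphere_normalize d z) = (\<Sum>i<d. (cmod (z i))\<^sup>2 / ?q z)"
      using q0 by (intro sum.cong refl) (simp add: sphere_normalize_def norm_divide power_divide)
    also have "\<dots> = ?q z / ?q z" by (rule sum_divide_distrib[symmetric])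
    finally show ?thesis using that by simp
  qed
  ultimately have "AE z in uniform_measure (cborel {..<d}) (unit_ball_set d). ?q (sphere_normalize d z) = 1"
    by (auto elim: eventually_mono)
  then show ?thesis unfolding sphere_measure_alt
    by (subst AE_distr_iff) (use sphere_normalize_measurable sphere_form_measurable(2)[of d] in auto)
qed

text \<open>Jensen for x^\<alpha> at the points \<open>b k / W k\<close> with weights proportional
  to \<open>W k\<close>. The proof sums the tangent inequality at 1, evaluated at these points
  divided by their weighted mean, so that the linear terms cancel. A vanishing weight is harmless
  since then \<open>b k\<close> vanishes too.\<close>

lemma powr_sum_le_weighted:
  fixes b W :: "nat \<Rightarrow> real"
  assumes b: "\<And>k. k < d \<Longrightarrow> b k \<ge> 0" and W: "\<And>k. k < d \<Longrightarrow> W k \<ge> 0"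
    and bW: "\<And>k. k < d \<Longrightarrow> W k = 0 \<Longrightarrow> b k = 0" and \<alpha>: "\<alpha> \<ge> 1"
  shows "(\<Sum>k<d. b k) powr \<alpha> \<le> (\<Sum>k<d. W k) powr (\<alpha> - 1) * (\<Sum>k<d. W k powr (1 - \<alpha>) * b k powr \<alpha>)"
proof -
  define m where "m = (\<Sum>k<d. b k)"
  define w where "w = (\<Sum>k<d. W k)"
  have m0: "m \<ge> 0" unfolding m_def using b by (intro sum_nonneg) auto
  show ?thesis
  proof (cases "m = 0")
    case True
    have "0 \<le> w powr (\<alpha> - 1) * (\<Sum>k<d. W k powr (1 - \<alpha>) * b k powr \<alpha>)"
      by (intro mult_nonneg_nonneg sum_nonneg) auto
    then show ?thesis unfolding m_def[symmetric] w_def[symmetric] True by simp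
  next
    case False
    then have m: "m > 0" using m0 by simp
    have w: "w > 0"
    proof (rule ccontr)
      assume "\<not> w > 0"
      moreover have "w \<ge> 0" unfolding w_def using W by (intro sum_nonneg) auto
      ultimately have "(\<Sum>k\<in>{..<d}. W k) = 0" unfolding w_def by linarith
      then have "W k = 0" if "k < d" for k
        using sum_nonneg_eq_0_iff[of "{..<d}" W] W that by auto
      then have "m = 0" unfolding m_def using bW by simp
      then show False using False by simp
    qed
    \<comment> \<open>Bernoulli's inequality, read off from Young's inequality with exponents
      \<open>1 / \<alpha>\<close> and \<open>1 - 1 / \<alpha>\<close> and second factor 1.\<close>
    have bern: "1 + \<alpha> * (x - 1) \<le> x powr \<alpha>" if x: "x \<ge> 0" for x :: real
    proof (cases "x = 0")
      case False
      have "(x powr \<alpha>) powr (1 / \<alpha>) * 1 powr (1 - 1 / \<alpha>) \<le> 1 / \<alpha> * x powr \<alpha> + (1 - 1 / \<alpha>) * 1"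
        using False x \<alpha> by (intro Youngs_inequality_0) auto
      then have "x \<le> 1 / \<alpha> * x powr \<alpha> + (1 - 1 / \<alpha>)" using False x \<alpha> by (simp add: powr_powr)
      then have "\<alpha> * x \<le> \<alpha> * (1 / \<alpha> * x powr \<alpha> + (1 - 1 / \<alpha>))" using \<alpha> by (intro mult_left_mono) auto
      also have "\<dots> = x powr \<alpha> + \<alpha> - 1" using \<alpha> by (simp add: field_simps)
      finally show ?thesis by (simp add: algebra_simps)
    qed (use \<alpha> in simp)
    have pt: "W k / w + \<alpha> * (b k / m - W k / w) \<le> w powr (\<alpha> - 1) / m powr \<alpha> * (W k powr (1 - \<alpha>) * b k powr \<alpha>)" if k: "k < d" for k
    proof (cases "W k = 0")
      case True
      then show ?thesis using bW[OF k] by simp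
    next
      case False
      then have Wk: "W k > 0" using W[OF k] by simp
      define x where "x = b k * w / (W k * m)"
      have x: "x \<ge> 0" unfolding x_def using b[OF k] Wk w m by simp
      have "W k / w * (1 + \<alpha> * (x - 1)) \<le> W k / w * x powr \<alpha>"
        using bern[OF x] Wk w by (intro mult_left_mono) auto
      moreover have "W k / w * (1 + \<alpha> * (x - 1)) = W k / w + \<alpha> * (b k / m - W k / w)"
        unfolding x_def using Wk w m by (simp add: field_simps)
      moreover have "W k / w * x powr \<alpha> = w powr (\<alpha> - 1) / m powr \<alpha> * (W k powr (1 - \<alpha>) * b k powr \<alpha>)"
        unfolding x_def using Wk w m b[OF k] by (simp add: powr_divide powr_mult powr_diff field_simps)
      ultimately show ?thesis by simp
    qed
    have "1 = (\<Sum>k<d. W k / w + \<alpha> * (b k / m - W k / w))"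
      using m w unfolding sum.distrib sum_distrib_left[symmetric] sum_subtractf sum_divide_distrib[symmetric]
        m_def[symmetric] w_def[symmetric] by simp
    also have "\<dots> \<le> (\<Sum>k<d. w powr (\<alpha> - 1) / m powr \<alpha> * (W k powr (1 - \<alpha>) * b k powr \<alpha>))"
      by (intro sum_mono pt) simp
    also have "\<dots> = w powr (\<alpha> - 1) * (\<Sum>k<d. W k powr (1 - \<alpha>) * b k powr \<alpha>) / m powr \<alpha>"
      by (simp add: sum_distrib_left sum_divide_distrib)
    finally show ?thesis unfolding m_def[symmetric] w_def[symmetric] using m by (simp add: pos_le_divide_eq)
  qed
qed

section \<open>Overlaps of random product states\<close>

lemma product_prob_space_sphere: "d > 0 \<Longrightarrow> product_prob_space (\<lambda>_::nat. sphere_measure d)"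
  by (intro product_prob_space.intro product_prob_space_axioms.intro product_sigma_finite.intro
      prob_space_imp_sigma_finite prob_space_sphere)

lemma prob_space_product_state: "d > 0 \<Longrightarrow> prob_space (product_state_measure d N)"
  unfolding product_state_measure_def by (intro prob_space_PiM prob_space_sphere)

text \<open>A bilinear pairing without conjugation, so that contracting the last spin again gives an
  \<open>amp\<close>. An overlap with an eigenvector is obtained by passing the conjugated
  eigenvector.\<close>

definition amp :: "nat \<Rightarrow> nat \<Rightarrow> (nat \<Rightarrow> complex) \<Rightarrow> (nat \<Rightarrow> nat \<Rightarrow> complex) \<Rightarrow> complex" where
  "amp d N \<phi> \<Psi> = (\<Sum>x<d ^ N. \<phi> x * (\<Prod>s<N. \<Psi> s (digit d x s)))"

lemma component_measurable:
  assumes "s < N" "d > 0"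
  shows "(\<lambda>\<Psi>. \<Psi> s (digit d x s)) \<in> borel_measurable (product_state_measure d N)"
proof -
  have 1: "(\<lambda>\<Psi>. \<Psi> s) \<in> measurable (product_state_measure d N) (sphere_measure d)"
    unfolding product_state_measure_def using assms by (intro measurable_component_singleton) simp
  have "(\<lambda>\<psi>. \<psi> (digit d x s)) \<in> borel_measurable (\<Pi>\<^sub>M i\<in>{..<d}. (borel :: complex measure))"
    using assms by (intro measurable_component_singleton) (simp add: digit_def)
  then have 2: "(\<lambda>\<psi>. \<psi> (digit d x s)) \<in> borel_measurable (sphere_measure d)"
    by (simp cong: measurable_cong_sets add: sets_sphere_measure)
  show ?thesis by (rule measurable_compose[OF 1 2])
qed

lemma amp_measurable:
  assumes "d > 0" shows "amp d N \<phi> \<in> borel_measurable (product_state_measure d N)"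
  unfolding amp_def[abs_def]
  by (intro borel_measurable_sum borel_measurable_times borel_measurable_const borel_measurable_prod component_measurable assms) simp

lemma digit_add_high:
  assumes "d > 0" "x < d ^ N"
  shows "s < N \<Longrightarrow> digit d (d ^ N * k + x) s = digit d x s" "k < d \<Longrightarrow> digit d (d ^ N * k + x) N = k"
proof -
  assume s: "s < N"
  then obtain m where m: "N = Suc (s + m)" using less_imp_Suc_add by blast
  have e: "d ^ N * k = d ^ s * (d * (d ^ m * k))" unfolding m by (simp add: power_add mult_ac)
  have "(d ^ s * (d * (d ^ m * k)) + x) div d ^ s = d * (d ^ m * k) + x div d ^ s"
    using assms(1) by (intro div_mult_self4) simp
  then show "digit d (d ^ N * k + x) s = digit d x s"
    unfolding digit_def e by (simp only: mod_mult_self4)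
next
  assume "k < d"
  then show "digit d (d ^ N * k + x) N = k" unfolding digit_def using assms by simp
qed

text \<open>The last spin is the most significant digit, so its local basis states correspond to
  consecutive blocks of length \<open>d ^ N\<close>.\<close>

lemma sum_power_Suc:
  fixes g :: "nat \<Rightarrow> 'a::comm_monoid_add"
  shows "(\<Sum>x<d ^ Suc N. g x) = (\<Sum>k<d. \<Sum>x<d ^ N. g (d ^ N * k + x))"
proof -
  have 1: "(\<Sum>x<d ^ Suc N. g x) = (\<Sum>k<d. sum g {k * d ^ N..<k * d ^ N + d ^ N})"
    using sum.nat_group[of g "d ^ N" d] by simp
  have 2: "sum g {k * d ^ N..<k * d ^ N + d ^ N} = (\<Sum>x<d ^ N. g (d ^ N * k + x))" for k
    using sum.shift_bounds_nat_ivl[of g 0 "k * d ^ N" "d ^ N"] by (simp add: atLeast0LessThan add.commute mult.commute)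
  show ?thesis unfolding 1 2 ..
qed

lemma amp_Suc:
  assumes d: "d > 0"
  shows "amp d (Suc N) \<phi> (\<Psi>(N := \<psi>)) = (\<Sum>k<d. amp d N (\<lambda>x. \<phi> (d ^ N * k + x)) \<Psi> * \<psi> k)"
proof -
  have "amp d (Suc N) \<phi> (\<Psi>(N := \<psi>)) = (\<Sum>k<d. \<Sum>x<d ^ N. \<phi> (d ^ N * k + x) * (\<Prod>s<Suc N. (\<Psi>(N := \<psi>)) s (digit d (d ^ N * k + x) s)))"
    unfolding amp_def by (rule sum_power_Suc)
  also have "\<dots> = (\<Sum>k<d. \<Sum>x<d ^ N. \<phi> (d ^ N * k + x) * (\<Prod>s<N. \<Psi> s (digit d x s)) * \<psi> k)"
  proof (intro sum.cong refl)
    fix k x assume kx: "k \<in> {..<d}" "x \<in> {..<d ^ N}"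
    have "(\<Prod>s<N. (\<Psi>(N := \<psi>)) s (digit d (d ^ N * k + x) s)) = (\<Prod>s<N. \<Psi> s (digit d x s))"
      using kx by (intro prod.cong refl) (simp add: digit_add_high(1)[OF d])
    then show "\<phi> (d ^ N * k + x) * (\<Prod>s<Suc N. (\<Psi>(N := \<psi>)) s (digit d (d ^ N * k + x) s))
      = \<phi> (d ^ N * k + x) * (\<Prod>s<N. \<Psi> s (digit d x s)) * \<psi> k"
      using kx by (simp add: digit_add_high(2)[OF d])
  qed
  finally show ?thesis by (simp add: amp_def sum_distrib_right)
qed

lemma sphere_moment_nonneg: "d > 0 \<Longrightarrow> \<alpha> > 0 \<Longrightarrow> sphere_moment d \<alpha> \<ge> 0"
  unfolding sphere_moment_def
  by (intro divide_nonneg_nonneg mult_nonneg_nonneg less_imp_le[OF Gamma_real_pos]) auto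

text \<open>Integrating out the last spin leaves the \<open>\<alpha>\<close>-th power of a sum over its local basis states, to which
  the induction hypothesis applies after a weighted Jensen inequality.\<close>

theorem nn_integral_amp_moment:
  assumes d: "d > 0" and \<alpha>: "\<alpha> \<ge> 1"
  shows "(\<integral>\<^sup>+\<Psi>. ennreal ((cmod (amp d N \<phi> \<Psi>))\<^sup>2 powr \<alpha>) \<partial>product_state_measure d N)
    \<le> ennreal (sphere_moment d \<alpha> ^ N * (\<Sum>x<d ^ N. (cmod (\<phi> x))\<^sup>2) powr \<alpha>)"
proof (induction N arbitrary: \<phi>)
  case 0
  show ?case by (simp add: product_state_measure_def PiM_empty nn_integral_count_space_finite amp_def)
next
  case (Suc N)
  interpret S: product_prob_space "\<lambda>_::nat. sphere_measure d" by (rule product_prob_space_sphere[OF d])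
  let ?C = "sphere_moment d \<alpha>"
  have C: "?C \<ge> 0" using sphere_moment_nonneg[OF d] \<alpha> by simp
  define p where "p k x = \<phi> (d ^ N * k + x)" for k x
  \<comment> \<open>The squared norm of the slice of \<open>\<phi>\<close> at local state
    \<open>k\<close> serves as Jensen weight. With this choice the powers
    \<open>1 - \<alpha>\<close> and \<open>\<alpha>\<close> of \<open>W k\<close> multiply to
    \<open>W k\<close>, and the slices add up to the squared norm of \<open>\<phi>\<close> without
    loss.\<close>
  define W where "W k = (\<Sum>x<d ^ N. (cmod (p k x))\<^sup>2)" for k
  have W0: "W k \<ge> 0" for k unfolding W_def by (intro sum_nonneg) auto
  have Wsum: "(\<Sum>k<d. W k) = (\<Sum>x<d ^ Suc N. (cmod (\<phi> x))\<^sup>2)"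
    unfolding W_def p_def by (rule sum_power_Suc[symmetric])
  have ins: "{..<Suc N} = insert N {..<N}" by auto
  have "(\<integral>\<^sup>+\<Psi>. ennreal ((cmod (amp d (Suc N) \<phi> \<Psi>))\<^sup>2 powr \<alpha>) \<partial>product_state_measure d (Suc N))
    = (\<integral>\<^sup>+\<Psi>. \<integral>\<^sup>+\<psi>. ennreal ((cmod (amp d (Suc N) \<phi> (\<Psi>(N := \<psi>))))\<^sup>2 powr \<alpha>) \<partial>sphere_measure d \<partial>product_state_measure d N)"
  proof -
    have "(\<lambda>\<Psi>. ennreal ((cmod (amp d (Suc N) \<phi> \<Psi>))\<^sup>2 powr \<alpha>)) \<in> borel_measurable (PiM (insert N {..<N}) (\<lambda>_. sphere_measure d))"
      using amp_measurable[OF d, of "Suc N" \<phi>] unfolding product_state_measure_def ins by measurable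
    then show ?thesis unfolding product_state_measure_def ins
      by (intro S.product_nn_integral_insert) auto
  qed
  also have "\<dots> = (\<integral>\<^sup>+\<Psi>. ennreal (?C * (\<Sum>k<d. (cmod (amp d N (p k) \<Psi>))\<^sup>2) powr \<alpha>) \<partial>product_state_measure d N)"
    unfolding amp_Suc[OF d] p_def[abs_def] using \<alpha> by (intro nn_integral_cong nn_integral_sphere_moment d) simp
  also have "\<dots> \<le> (\<integral>\<^sup>+\<Psi>. (\<Sum>k<d. ennreal (?C * (\<Sum>k<d. W k) powr (\<alpha> - 1) * W k powr (1 - \<alpha>)) * ennreal ((cmod (amp d N (p k) \<Psi>))\<^sup>2 powr \<alpha>)) \<partial>product_state_measure d N)"
  proof (rule nn_integral_mono)
    fix \<Psi>
    let ?b = "\<lambda>k. (cmod (amp d N (p k) \<Psi>))\<^sup>2"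
    have "?b k = 0" if "k < d" "W k = 0" for k
    proof -
      have "(cmod (p k x))\<^sup>2 = 0" if "x < d ^ N" for x
        using \<open>W k = 0\<close> that sum_nonneg_eq_0_iff[of "{..<d ^ N}" "\<lambda>x. (cmod (p k x))\<^sup>2"] unfolding W_def by auto
      then show ?thesis by (simp add: amp_def)
    qed
    then have "(\<Sum>k<d. ?b k) powr \<alpha> \<le> (\<Sum>k<d. W k) powr (\<alpha> - 1) * (\<Sum>k<d. W k powr (1 - \<alpha>) * ?b k powr \<alpha>)"
      using W0 \<alpha> by (intro powr_sum_le_weighted) auto
    then have "?C * (\<Sum>k<d. ?b k) powr \<alpha> \<le> ?C * ((\<Sum>k<d. W k) powr (\<alpha> - 1) * (\<Sum>k<d. W k powr (1 - \<alpha>) * ?b k powr \<alpha>))"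
      using C by (rule mult_left_mono)
    also have "\<dots> = (\<Sum>k<d. ?C * (\<Sum>k<d. W k) powr (\<alpha> - 1) * W k powr (1 - \<alpha>) * ?b k powr \<alpha>)"
      by (simp add: sum_distrib_left mult.assoc)
    finally have "ennreal (?C * (\<Sum>k<d. ?b k) powr \<alpha>) \<le> ennreal (\<Sum>k<d. ?C * (\<Sum>k<d. W k) powr (\<alpha> - 1) * W k powr (1 - \<alpha>) * ?b k powr \<alpha>)"
      by (rule ennreal_leI)
    also have "\<dots> = (\<Sum>k<d. ennreal (?C * (\<Sum>k<d. W k) powr (\<alpha> - 1) * W k powr (1 - \<alpha>) * ?b k powr \<alpha>))"
      using C by (intro sum_ennreal[symmetric]) auto
    also have "\<dots> = (\<Sum>k<d. ennreal (?C * (\<Sum>k<d. W k) powr (\<alpha> - 1) * W k powr (1 - \<alpha>)) * ennreal (?b k powr \<alpha>))"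
      using C by (intro sum.cong refl ennreal_mult) auto
    finally show "ennreal (?C * (\<Sum>k<d. ?b k) powr \<alpha>) \<le> (\<Sum>k<d. ennreal (?C * (\<Sum>k<d. W k) powr (\<alpha> - 1) * W k powr (1 - \<alpha>)) * ennreal (?b k powr \<alpha>))" .
  qed
  also have "\<dots> = (\<Sum>k<d. ennreal (?C * (\<Sum>k<d. W k) powr (\<alpha> - 1) * W k powr (1 - \<alpha>)) * (\<integral>\<^sup>+\<Psi>. ennreal ((cmod (amp d N (p k) \<Psi>))\<^sup>2 powr \<alpha>) \<partial>product_state_measure d N))"
  proof -
    have m: "(\<lambda>\<Psi>. ennreal ((cmod (amp d N (p k) \<Psi>))\<^sup>2 powr \<alpha>)) \<in> borel_measurable (product_state_measure d N)" for k
      using amp_measurable[OF d, of N "p k"] by measurable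
    show ?thesis
      by (subst nn_integral_sum) (use m in \<open>auto intro!: sum.cong nn_integral_cmult borel_measurable_times_ennreal\<close>)
  qed
  also have "\<dots> \<le> (\<Sum>k<d. ennreal (?C * (\<Sum>k<d. W k) powr (\<alpha> - 1) * W k powr (1 - \<alpha>)) * ennreal (?C ^ N * W k powr \<alpha>))"
    unfolding W_def by (intro sum_mono mult_left_mono Suc.IH) auto
  also have "\<dots> = (\<Sum>k<d. ennreal (?C ^ Suc N * (\<Sum>k<d. W k) powr (\<alpha> - 1) * W k))"
  proof (intro sum.cong refl)
    fix k
    have "W k powr (1 - \<alpha>) * W k powr \<alpha> = W k" using W0[of k] by (simp add: powr_add[symmetric])
    then have eq: "?C * (\<Sum>k<d. W k) powr (\<alpha> - 1) * W k powr (1 - \<alpha>) * (?C ^ N * W k powr \<alpha>) = ?C ^ Suc N * (\<Sum>k<d. W k) powr (\<alpha> - 1) * W k"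
    proof -
      have "?C * S * A * (?C ^ N * B) = ?C ^ Suc N * S * (A * B)" for S A B :: real by simp
      then show ?thesis using \<open>W k powr (1 - \<alpha>) * W k powr \<alpha> = W k\<close> by (simp only:)
    qed
    show "ennreal (?C * (\<Sum>k<d. W k) powr (\<alpha> - 1) * W k powr (1 - \<alpha>)) * ennreal (?C ^ N * W k powr \<alpha>)
      = ennreal (?C ^ Suc N * (\<Sum>k<d. W k) powr (\<alpha> - 1) * W k)"
      unfolding eq[symmetric] using C by (intro ennreal_mult[symmetric]) auto
  qed
  also have "\<dots> = ennreal (\<Sum>k<d. ?C ^ Suc N * (\<Sum>k<d. W k) powr (\<alpha> - 1) * W k)"
    using C W0 by (intro sum_ennreal) (auto intro!: mult_nonneg_nonneg)
  also have "(\<Sum>k<d. ?C ^ Suc N * (\<Sum>k<d. W k) powr (\<alpha> - 1) * W k) = ?C ^ Suc N * ((\<Sum>k<d. W k) powr (\<alpha> - 1) * (\<Sum>k<d. W k))"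
    by (simp add: sum_distrib_left[symmetric] mult.assoc)
  also have "(\<Sum>k<d. W k) powr (\<alpha> - 1) * (\<Sum>k<d. W k) = (\<Sum>k<d. W k) powr \<alpha>"
  proof -
    have "(\<Sum>k<d. W k) \<ge> 0" by (intro sum_nonneg W0)
    then show ?thesis using powr_mult_base[of "\<Sum>k<d. W k" "\<alpha> - 1"] by (simp add: mult.commute)
  qed
  finally show ?case unfolding Wsum .
qed

lemma AE_product_state_norm:
  assumes d: "d > 0"
  shows "AE \<Psi> in product_state_measure d N. \<forall>s<N. (\<Sum>i<d. (cmod (\<Psi> s i))\<^sup>2) = 1"
proof -
  have "AE \<Psi> in product_state_measure d N. (\<Sum>i<d. (cmod (\<Psi> s i))\<^sup>2) = 1" if s: "s \<in> {..<N}" for s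
    unfolding product_state_measure_def
    by (rule AE_PiM_component[OF prob_space_sphere[OF d] s AE_sphere_norm[OF d]])
  then have "AE \<Psi> in product_state_measure d N. \<forall>s\<in>{..<N}. (\<Sum>i<d. (cmod (\<Psi> s i))\<^sup>2) = 1"
    by (rule AE_finite_allI[OF finite_lessThan])
  then show ?thesis by (simp only: Ball_def lessThan_iff)
qed

lemma product_state_norm:
  assumes d: "d > 0" and "\<forall>s<N. (\<Sum>i<d. (cmod (\<Psi> s i))\<^sup>2) = 1"
  shows "(\<Sum>x<d ^ N. (cmod (vec_index (product_state d N \<Psi>) x))\<^sup>2) = 1"
proof -
  have "(\<Sum>x<d ^ M. (cmod (\<Prod>s<M. \<Psi> s (digit d x s)))\<^sup>2) = 1" if "M \<le> N" for M
    using that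
  proof (induction M)
    case (Suc M)
    have "(\<Sum>x<d ^ Suc M. (cmod (\<Prod>s<Suc M. \<Psi> s (digit d x s)))\<^sup>2)
      = (\<Sum>k<d. \<Sum>x<d ^ M. (cmod (\<Prod>s<Suc M. \<Psi> s (digit d (d ^ M * k + x) s)))\<^sup>2)"
      by (rule sum_power_Suc)
    also have "\<dots> = (\<Sum>k<d. \<Sum>x<d ^ M. (cmod (\<Prod>s<M. \<Psi> s (digit d x s)))\<^sup>2 * (cmod (\<Psi> M k))\<^sup>2)"
    proof (intro sum.cong refl)
      fix k x assume kx: "k \<in> {..<d}" "x \<in> {..<d ^ M}"
      have "(\<Prod>s<M. \<Psi> s (digit d (d ^ M * k + x) s)) = (\<Prod>s<M. \<Psi> s (digit d x s))"
        using kx by (intro prod.cong refl) (simp add: digit_add_high(1)[OF d])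
      then show "(cmod (\<Prod>s<Suc M. \<Psi> s (digit d (d ^ M * k + x) s)))\<^sup>2 = (cmod (\<Prod>s<M. \<Psi> s (digit d x s)))\<^sup>2 * (cmod (\<Psi> M k))\<^sup>2"
        using kx by (simp add: digit_add_high(2)[OF d] norm_mult power_mult_distrib)
    qed
    also have "\<dots> = (\<Sum>x<d ^ M. (cmod (\<Prod>s<M. \<Psi> s (digit d x s)))\<^sup>2) * (\<Sum>k<d. (cmod (\<Psi> M k))\<^sup>2)"
      by (subst sum.swap) (simp add: sum_product)
    also have "\<dots> = 1" using Suc assms(2) by simp
    finally show ?case .
  qed simp
  from this[of N] show ?thesis by (simp add: product_state_def)
qed

section \<open>Time averages\<close>

text \<open>In the double sum for the squared modulus a pair of equal frequencies averages to its
  coefficient, while any other pair has a bounded antiderivative and averages to 0; injectivity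
  leaves only the diagonal. Stating the result through an antiderivative \<open>G\<close> lets
  finite sums of such functions be treated by linearity.\<close>

lemma trig_mean:
  fixes z :: "'a \<Rightarrow> complex" and \<omega> :: "'a \<Rightarrow> real"
  assumes P: "finite P" and inj: "inj_on \<omega> P"
  shows "\<exists>G. (\<forall>t. (G has_real_derivative (cmod (\<Sum>l\<in>P. z l * exp (- \<i> * of_real (t * \<omega> l))))\<^sup>2) (at t)) \<and>
     ((\<lambda>\<tau>. (G \<tau> - G 0) / \<tau>) \<longlongrightarrow> (\<Sum>l\<in>P. (cmod (z l))\<^sup>2)) at_top"
proof -
  define e where "e \<delta> t = exp (- \<i> * of_real (t * \<delta>))" for \<delta> t :: real
  \<comment> \<open>An antiderivative of \<open>e \<delta>\<close>, which grows linearly when the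
    frequency vanishes and stays bounded otherwise.\<close>
  define F where "F \<delta> t = (if \<delta> = 0 then of_real t else e \<delta> t / (- \<i> * of_real \<delta>))" for \<delta> t :: real
  have dF: "(F \<delta> has_vector_derivative e \<delta> t) (at t)" for \<delta> t
  proof (cases "\<delta> = 0")
    case True
    then show ?thesis unfolding F_def[abs_def] e_def by (auto intro!: derivative_eq_intros)
  next
    case False
    have "((\<lambda>t. exp (t *\<^sub>R (- \<i> * of_real \<delta>))) has_vector_derivative (- \<i> * of_real \<delta>) * exp (t *\<^sub>R (- \<i> * of_real \<delta>))) (at t)"
      using exp_scaleR_has_vector_derivative_left by blast
    then have "((\<lambda>t. exp (t *\<^sub>R (- \<i> * of_real \<delta>)) / (- \<i> * of_real \<delta>)) has_vector_derivative
       ((- \<i> * of_real \<delta>) * exp (t *\<^sub>R (- \<i> * of_real \<delta>))) / (- \<i> * of_real \<delta>)) (at t)"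
      by (rule has_vector_derivative_divide)
    moreover have "t *\<^sub>R (- \<i> * of_real \<delta>) = - \<i> * of_real (t * \<delta>)" for t
      by (simp add: scaleR_conv_of_real mult_ac)
    ultimately show ?thesis using False unfolding F_def[abs_def] e_def by simp
  qed
  have ne: "cmod (e \<delta> t) = 1" for \<delta> t
    unfolding e_def by (simp add: norm_exp_eq_Re)
  have lim: "((\<lambda>\<tau>. (F \<delta> \<tau> - F \<delta> 0) / of_real \<tau>) \<longlongrightarrow> of_bool (\<delta> = 0)) at_top" for \<delta>
  proof (cases "\<delta> = 0")
    case True
    have "\<forall>\<^sub>F \<tau> in at_top. (1::complex) = (F \<delta> \<tau> - F \<delta> 0) / of_real \<tau>"
      using eventually_gt_at_top[of "0::real"] by eventually_elim (simp add: F_def True)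
    then show ?thesis using True by (simp add: tendsto_cong[THEN iffD1, OF _ tendsto_const])
  next
    case False
    have "((\<lambda>\<tau>::real. (2 / \<bar>\<delta>\<bar>) / \<tau>) \<longlongrightarrow> 0) at_top"
      by (intro tendsto_divide_0[OF tendsto_const] filterlim_at_top_imp_at_infinity filterlim_ident)
    moreover have "\<forall>\<^sub>F \<tau> in at_top. cmod ((F \<delta> \<tau> - F \<delta> 0) / of_real \<tau>) \<le> (2 / \<bar>\<delta>\<bar>) / \<tau>"
      using eventually_gt_at_top[of "0::real"]
    proof eventually_elim
      case (elim \<tau>)
      have "cmod (F \<delta> \<tau> - F \<delta> 0) \<le> cmod (F \<delta> \<tau>) + cmod (F \<delta> 0)" by (rule norm_triangle_ineq4)
      also have "\<dots> = 2 / \<bar>\<delta>\<bar>" using False by (simp add: F_def norm_divide norm_mult ne)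
      finally have "cmod (F \<delta> \<tau> - F \<delta> 0) / \<tau> \<le> (2 / \<bar>\<delta>\<bar>) / \<tau>"
        using elim by (intro divide_right_mono) auto
      then show ?case using elim by (simp add: norm_divide)
    qed
    ultimately have "((\<lambda>\<tau>. (F \<delta> \<tau> - F \<delta> 0) / of_real \<tau>) \<longlongrightarrow> 0) at_top"
      by (rule Lim_null_comparison[rotated])
    then show ?thesis using False by simp
  qed
  define H where "H t = (\<Sum>l\<in>P. \<Sum>m\<in>P. (z l * cnj (z m)) * F (\<omega> l - \<omega> m) t)" for t
  have sq: "complex_of_real ((cmod (\<Sum>l\<in>P. z l * e (\<omega> l) t))\<^sup>2) = (\<Sum>l\<in>P. \<Sum>m\<in>P. (z l * cnj (z m)) * e (\<omega> l - \<omega> m) t)" for t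
  proof -
    have "e (\<omega> l) t * cnj (e (\<omega> m) t) = e (\<omega> l - \<omega> m) t" for l m
      unfolding e_def by (simp add: exp_cnj exp_add[symmetric] algebra_simps)
    then have "(z l * e (\<omega> l) t) * cnj (z m * e (\<omega> m) t) = (z l * cnj (z m)) * e (\<omega> l - \<omega> m) t" for l m
      by (metis (no_types, opaque_lifting) complex_cnj_mult mult.assoc mult.left_commute)
    then show ?thesis unfolding complex_norm_square cnj_sum sum_product by (simp only:)
  qed
  have dH: "(H has_vector_derivative complex_of_real ((cmod (\<Sum>l\<in>P. z l * e (\<omega> l) t))\<^sup>2)) (at t)" for t
    unfolding H_def[abs_def] sq
    by (intro has_vector_derivative_sum has_vector_derivative_mult_right dF)
  have limH: "((\<lambda>\<tau>. (H \<tau> - H 0) / of_real \<tau>) \<longlongrightarrow> (\<Sum>l\<in>P. \<Sum>m\<in>P. (z l * cnj (z m)) * of_bool (\<omega> l - \<omega> m = 0))) at_top"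
  proof -
    have "(H \<tau> - H 0) / of_real \<tau> = (\<Sum>l\<in>P. \<Sum>m\<in>P. (z l * cnj (z m)) * ((F (\<omega> l - \<omega> m) \<tau> - F (\<omega> l - \<omega> m) 0) / of_real \<tau>))" for \<tau>
      by (simp add: H_def sum_subtractf[symmetric] sum_divide_distrib right_diff_distrib)
    then show ?thesis by (simp only:) (intro tendsto_sum tendsto_mult tendsto_const lim)
  qed
  have "(\<Sum>m\<in>P. (z l * cnj (z m)) * of_bool (\<omega> l - \<omega> m = 0)) = of_real ((cmod (z l))\<^sup>2)" if l: "l \<in> P" for l
  proof -
    have "(\<Sum>m\<in>P. (z l * cnj (z m)) * of_bool (\<omega> l - \<omega> m = 0)) = (\<Sum>m\<in>P. if m = l then z l * cnj (z l) else 0)"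
      using inj l by (intro sum.cong refl) (auto dest: inj_onD)
    then show ?thesis using P l by (simp add: complex_norm_square del: of_real_power)
  qed
  then have val: "(\<Sum>l\<in>P. \<Sum>m\<in>P. (z l * cnj (z m)) * of_bool (\<omega> l - \<omega> m = 0)) = of_real (\<Sum>l\<in>P. (cmod (z l))\<^sup>2)"
    unfolding of_real_sum by (intro sum.cong refl)
  show ?thesis
  proof (intro exI[of _ "\<lambda>t. Re (H t)"] conjI allI)
    fix t
    have "((\<lambda>t. Re (H t)) has_vector_derivative Re (complex_of_real ((cmod (\<Sum>l\<in>P. z l * e (\<omega> l) t))\<^sup>2))) (at t)"
      by (rule bounded_linear.has_vector_derivative[OF bounded_linear_Re dH])
    then show "((\<lambda>t. Re (H t)) has_real_derivative (cmod (\<Sum>l\<in>P. z l * exp (- \<i> * of_real (t * \<omega> l))))\<^sup>2) (at t)"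
      unfolding has_real_derivative_iff_has_vector_derivative e_def by (simp only: Re_complex_of_real)
  next
    have "((\<lambda>\<tau>. Re ((H \<tau> - H 0) / of_real \<tau>)) \<longlongrightarrow> Re (of_real (\<Sum>l\<in>P. (cmod (z l))\<^sup>2))) at_top"
      using limH unfolding val by (rule tendsto_Re)
    then show "((\<lambda>\<tau>. (Re (H \<tau>) - Re (H 0)) / \<tau>) \<longlongrightarrow> (\<Sum>l\<in>P. (cmod (z l))\<^sup>2)) at_top"
      by (simp only: Re_divide_of_real minus_complex.sel Re_complex_of_real)
  qed
qed

text \<open>Markov's inequality with respect to the long-time average.\<close>

lemma long_time_prob_ge:
  fixes Q G :: "real \<Rightarrow> real"
  assumes G: "\<And>t. (G has_real_derivative Q t) (at t)" and Q0: "\<And>t. Q t \<ge> 0" and Qm: "Q \<in> borel_measurable borel"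
    and lim: "((\<lambda>\<tau>. (G \<tau> - G 0) / \<tau>) \<longlongrightarrow> L) at_top" and \<kappa>: "\<kappa> > 0"
    and P: "\<And>t. Q t \<le> \<kappa> \<Longrightarrow> P t" and Pm: "Measurable.pred borel P"
  shows "long_time_prob P \<ge> ereal (1 - L / \<kappa>)"
proof -
  note [measurable] = Qm Pm
  have le: "1 - ((G \<tau> - G 0) / \<tau>) / \<kappa> \<le> measure lebesgue {t \<in> {0..\<tau>}. P t} / \<tau>" if \<tau>: "\<tau> > 0" for \<tau>
  proof -
    let ?B = "{t \<in> {0..\<tau>}. \<not> Q t \<le> \<kappa>}" and ?A = "{t \<in> {0..\<tau>}. Q t \<le> \<kappa>}"
    have int: "(Q has_integral (G \<tau> - G 0)) {0..\<tau>}"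
      using \<tau> G by (intro fundamental_theorem_of_calculus)
        (auto simp: has_real_derivative_iff_has_vector_derivative[symmetric] intro: DERIV_subset)
    have nn: "(\<integral>\<^sup>+t. ennreal (Q t) * indicator {0..\<tau>} t \<partial>lborel) = ennreal (G \<tau> - G 0)"
      by (rule nn_integral_has_integral_lebesgue'[OF Q0 int])
    have GG: "G \<tau> - G 0 \<ge> 0" by (rule has_integral_nonneg[OF int Q0])
    have f0: "{0..\<tau>} \<in> fmeasurable lborel" by (rule fmeasurableI) (simp_all add: emeasure_lborel_Icc_eq)
    have sets: "?A \<in> sets lborel" "?B \<in> sets lborel" "{t \<in> {0..\<tau>}. P t} \<in> sets lborel" by measurable
    have fmA: "?A \<in> fmeasurable lborel" by (rule fmeasurableI2[OF f0 _ sets(1)]) auto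
    have fmB: "?B \<in> fmeasurable lborel" by (rule fmeasurableI2[OF f0 _ sets(2)]) auto
    have fmP: "{t \<in> {0..\<tau>}. P t} \<in> fmeasurable lborel" by (rule fmeasurableI2[OF f0 _ sets(3)]) auto
    note fm = fmA fmB fmP
    have "ennreal \<kappa> * emeasure lborel ?B = (\<integral>\<^sup>+t. ennreal \<kappa> * indicator ?B t \<partial>lborel)"
      using sets by (simp add: nn_integral_cmult_indicator)
    also have "\<dots> \<le> (\<integral>\<^sup>+t. ennreal (Q t) * indicator {0..\<tau>} t \<partial>lborel)"
      by (intro nn_integral_mono) (auto simp: indicator_def ennreal_leI)
    finally have "ennreal (\<kappa> * measure lborel ?B) \<le> ennreal (G \<tau> - G 0)"
      using fm(2) \<kappa> unfolding nn by (simp add: emeasure_eq_measure2 ennreal_mult)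
    then have B: "measure lborel ?B \<le> (G \<tau> - G 0) / \<kappa>"
      using GG \<kappa> by (simp add: ennreal_le_iff field_simps)
    have "\<tau> = measure lborel {0..\<tau>}" using \<tau> by simp
    also have "{0..\<tau>} = ?A \<union> ?B" by auto
    also have "measure lborel (?A \<union> ?B) \<le> measure lborel ?A + measure lborel ?B"
      using fm by (intro measure_Un_le) (auto simp: fmeasurable_def)
    also have "measure lborel ?A \<le> measure lborel {t \<in> {0..\<tau>}. P t}"
      by (rule measure_mono_fmeasurable) (use P sets fm in auto)
    finally have "\<tau> \<le> measure lborel {t \<in> {0..\<tau>}. P t} + (G \<tau> - G 0) / \<kappa>" using B by linarith
    then have "\<tau> / \<tau> \<le> (measure lborel {t \<in> {0..\<tau>}. P t} + (G \<tau> - G 0) / \<kappa>) / \<tau>"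
      using \<tau> by (intro divide_right_mono) auto
    moreover have "measure lebesgue {t \<in> {0..\<tau>}. P t} = measure lborel {t \<in> {0..\<tau>}. P t}"
      using sets(3) by (rule measure_completion)
    ultimately show ?thesis using \<tau> by (simp add: add_divide_distrib mult.commute)
  qed
  have "((\<lambda>\<tau>. ereal (1 - ((G \<tau> - G 0) / \<tau>) / \<kappa>)) \<longlongrightarrow> ereal (1 - L / \<kappa>)) at_top"
    using \<kappa> by (intro tendsto_intros lim) auto
  then have "ereal (1 - L / \<kappa>) = Liminf at_top (\<lambda>\<tau>. ereal (1 - ((G \<tau> - G 0) / \<tau>) / \<kappa>))"
    by (intro lim_imp_Liminf[symmetric]) auto
  also have "\<dots> \<le> long_time_prob P"
    unfolding long_time_prob_def
    by (intro Liminf_mono eventually_mono[OF eventually_gt_at_top[of 0]]) (use le in auto)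
  finally show ?thesis .
qed

section \<open>Measurability\<close>

text \<open>Integer times suffice because the time spent in the event is monotone and at most the
  elapsed time, so the fraction hardly moves between consecutive integers. The reduction makes the
  lower limit a countable operation, as measurability in the state requires.\<close>

lemma long_time_prob_sequence:
  assumes Pm: "Measurable.pred borel P"
  shows "long_time_prob P = liminf (\<lambda>n. ereal (measure lborel {t \<in> {0..real n}. P t} / real n))"
proof -
  note [measurable] = Pm
  define \<mu> where "\<mu> \<tau> = measure lborel {t \<in> {0..\<tau>}. P t}" for \<tau>
  have sets: "{t \<in> {0..\<tau>}. P t} \<in> sets lborel" for \<tau> by measurable
  have f0: "{0..\<tau>} \<in> fmeasurable lborel" for \<tau> :: real by (rule fmeasurableI) (simp_all add: emeasure_lborel_Icc_eq)
  have fm: "{t \<in> {0..\<tau>}. P t} \<in> fmeasurable lborel" for \<tau>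
    by (rule fmeasurableI2[OF f0[of \<tau>] _ sets]) auto
  have mono: "\<mu> s \<le> \<mu> t" if "s \<le> t" for s t
    unfolding \<mu>_def using that by (intro measure_mono_fmeasurable sets fm) auto
  have bound: "\<mu> t \<le> t" if "t \<ge> 0" for t
  proof -
    have "\<mu> t \<le> measure lborel {0..t}" unfolding \<mu>_def by (intro measure_mono_fmeasurable sets f0) auto
    then show ?thesis using that by simp
  qed
  have \<mu>0: "\<mu> t \<ge> 0" for t by (simp add: \<mu>_def)
  have lt: "long_time_prob P = Liminf at_top (\<lambda>\<tau>. ereal (\<mu> \<tau> / \<tau>))"
    unfolding long_time_prob_def \<mu>_def measure_completion[OF sets] ..
  have "Liminf at_top (\<lambda>\<tau>. ereal (\<mu> \<tau> / \<tau>)) \<le> liminf (\<lambda>n. ereal (\<mu> (real n) / real n))"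
    unfolding le_Liminf_iff
  proof (intro allI impI)
    fix y assume "y < Liminf at_top (\<lambda>\<tau>. ereal (\<mu> \<tau> / \<tau>))"
    then have "\<forall>\<^sub>F \<tau> in at_top. y < ereal (\<mu> \<tau> / \<tau>)" by (rule less_LiminfD)
    then show "\<forall>\<^sub>F n in sequentially. y < ereal (\<mu> (real n) / real n)"
      by (rule eventually_compose_filterlim[OF _ filterlim_real_sequentially])
  qed
  moreover have "liminf (\<lambda>n. ereal (\<mu> (real n) / real n)) \<le> Liminf at_top (\<lambda>\<tau>. ereal (\<mu> \<tau> / \<tau>))"
    unfolding le_Liminf_iff[of _ at_top]
  proof (intro allI impI)
    fix y assume y: "y < liminf (\<lambda>n. ereal (\<mu> (real n) / real n))"
    show "\<forall>\<^sub>F \<tau> in at_top. y < ereal (\<mu> \<tau> / \<tau>)"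
    proof (cases "y < 0")
      case True
      show ?thesis using eventually_gt_at_top[of 0]
      proof eventually_elim
        case (elim \<tau>)
        then have "0 \<le> ereal (\<mu> \<tau> / \<tau>)" using \<mu>0 by simp
        then show ?case by (rule less_le_trans[OF True])
      qed
    next
      case False
      obtain z where z: "y < z" "z < liminf (\<lambda>n. ereal (\<mu> (real n) / real n))" using dense[OF y] by blast
      have "\<forall>\<^sub>F n in sequentially. z < ereal (\<mu> (real n) / real n)" by (rule less_LiminfD[OF z(2)])
      then obtain n0 where n0: "\<And>n. n \<ge> n0 \<Longrightarrow> z < ereal (\<mu> (real n) / real n)"
        unfolding eventually_sequentially by blast
      have zfin: "z < ereal (\<mu> (real n0) / real n0)" by (rule n0) simp
      have "z \<noteq> \<infinity>" "z \<noteq> -\<infinity>" using zfin z(1) by auto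
      then obtain z' where z': "z = ereal z'" by (cases z) auto
      have "y \<noteq> \<infinity>" "y \<noteq> -\<infinity>" using z(1) False by auto
      then obtain y' where y': "y = ereal y'" by (cases y) auto
      have yz: "y' < z'" using z(1) unfolding y' z' by simp
      \<comment> \<open>Beyond the second threshold \<open>real n * (z' - y')\<close> exceeds 1,
        whereas \<open>y' < z' \<le> 1\<close>; rounding \<open>\<tau>\<close> down to
        \<open>n\<close> therefore loses less than the gap between \<open>y'\<close> and
        \<open>z'\<close>.\<close>
      show ?thesis
        using eventually_gt_at_top[of "real n0 + 1"] eventually_gt_at_top[of "1 / (z' - y') + 1"]
      proof eventually_elim
        case (elim \<tau>)
        define n where "n = nat \<lfloor>\<tau>\<rfloor>"
        have \<tau>: "\<tau> > 1" using elim(1) by (simp add: add_pos_nonneg)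
        have n: "real n \<le> \<tau>" "\<tau> < real n + 1" unfolding n_def using \<tau> by linarith+
        have nn: "n \<ge> n0" "real n > 0" using n elim(1) \<tau> by linarith+
        have "z' < \<mu> (real n) / real n" using n0[OF nn(1)] unfolding z' by simp
        then have 1: "z' * real n < \<mu> (real n)" using nn(2) by (simp add: pos_less_divide_eq)
        have "1 / (z' - y') < real n" using elim(2) n by linarith
        then have "1 < real n * (z' - y')" using yz by (simp add: pos_divide_less_eq)
        moreover have "z' \<le> 1"
        proof (rule ccontr)
          assume "\<not> z' \<le> 1"
          then have "real n < z' * real n" using nn(2) by simp
          then show False using 1 bound[of "real n"] nn(2) by linarith
        qed
        moreover have "y' \<ge> 0" using False unfolding y' by simp
        ultimately have "y' * (real n + 1) < z' * real n" using yz by (simp add: algebra_simps)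
        then have "y' * \<tau> < \<mu> \<tau>"
          using 1 mono[OF n(1)] mult_left_mono[of \<tau> "real n + 1" y'] n(2) \<open>y' \<ge> 0\<close> by linarith
        then show ?case unfolding y' using \<tau> by (simp add: pos_less_divide_eq)
      qed
    qed
  qed
  ultimately show ?thesis unfolding lt unfolding \<mu>_def by (rule antisym)
qed

text \<open>Sections of a jointly measurable set have measurable length, and by
  \<open>long_time_prob_sequence\<close> the long-time fraction is a sequential lower limit of such
  lengths.\<close>

lemma long_time_prob_measurable:
  assumes P: "Measurable.pred (M \<Otimes>\<^sub>M borel) (\<lambda>(\<Psi>, t). P \<Psi> t)"
  shows "{\<Psi> \<in> space M. long_time_prob (P \<Psi>) \<ge> C} \<in> sets M"
proof -
  note [measurable] = P
  have Pm: "Measurable.pred borel (P \<Psi>)" if "\<Psi> \<in> space M" for \<Psi>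
    using measurable_compose[OF measurable_Pair1'[OF that, of borel] P] by simp
  have Pl: "Measurable.pred (M \<Otimes>\<^sub>M lborel) (\<lambda>(\<Psi>, t). P \<Psi> t)"
    by (subst measurable_cong_sets[OF sets_pair_measure_cong[OF refl sets_lborel] refl]) (rule P)
  have meas: "(\<lambda>\<Psi>. measure lborel {t \<in> {0..real n}. P \<Psi> t}) \<in> borel_measurable M" for n
  proof -
    have Q: "{x \<in> space (M \<Otimes>\<^sub>M lborel). snd x \<in> {0..real n} \<and> P (fst x) (snd x)} \<in> sets (M \<Otimes>\<^sub>M lborel)" (is "?Q \<in> _")
      using Pl by (intro sets.sets_Collect_conj measurable_sets_Collect[OF measurable_snd]) (auto simp: split_def pred_def)
    have "(\<lambda>\<Psi>. emeasure lborel (Pair \<Psi> -` ?Q)) \<in> borel_measurable M"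
      by (rule lborel.measurable_emeasure_Pair[OF Q])
    then have "(\<lambda>\<Psi>. enn2real (emeasure lborel (Pair \<Psi> -` ?Q))) \<in> borel_measurable M"
      by (rule measurable_compose) measurable
    then show ?thesis
      by (rule measurable_cong[THEN iffD1, rotated])
        (auto simp: measure_def space_pair_measure intro!: arg_cong[where f = enn2real] arg_cong2[where f = emeasure])
  qed
  have "{\<Psi> \<in> space M. long_time_prob (P \<Psi>) \<ge> C}
      = {\<Psi> \<in> space M. liminf (\<lambda>n. ereal (measure lborel {t \<in> {0..real n}. P \<Psi> t} / real n)) \<ge> C}"
    using long_time_prob_sequence[OF Pm] by auto
  moreover have "(\<lambda>\<Psi>. liminf (\<lambda>n. ereal (measure lborel {t \<in> {0..real n}. P \<Psi> t} / real n))) \<in> borel_measurable M"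
    by (intro borel_measurable_liminf borel_measurable_ereal borel_measurable_divide meas) simp
  ultimately show ?thesis by simp
qed

text \<open>A manifestly measurable expression for the entropy, from the series
  \<open>- x ln x = \<Sum>\<^sub>k x (1 - x)\<^bsup>k+1\<^esup> / (k + 1)\<close> on \<open>[0, 1]\<close>.\<close>

fun ent_term :: "'a set \<Rightarrow> ('a \<Rightarrow> 'a \<Rightarrow> complex) \<Rightarrow> nat \<Rightarrow> 'a \<Rightarrow> 'a \<Rightarrow> complex" where
  "ent_term I X 0 x y = X x y"
| "ent_term I X (Suc k) x y = ent_term I X k x y - (\<Sum>z\<in>I. ent_term I X k x z * X z y)"

text \<open>Dividing by the trace \<open>T\<close> moves a positive spectrum into the interval where
  the series converges; the term \<open>T * ln T\<close> undoes the rescaling. Unnormalised kernels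
  have to be covered, since random states have norm 1 only almost surely while measurability
  concerns every point.\<close>

definition ent_series :: "'a set \<Rightarrow> ('a \<Rightarrow> 'a \<Rightarrow> complex) \<Rightarrow> real" where
  "ent_series I M = (let T = Re (\<Sum>x\<in>I. M x x) in
     T * (\<Sum>k. Re (\<Sum>x\<in>I. ent_term I (\<lambda>x y. M x y / of_real T) (Suc k) x x) / real (Suc k)) - T * ln T)"

lemma ent_term_eigensys:
  assumes e: "eigensys I K u p X" and "x \<in> I" "y \<in> I"
  shows "ent_term I X k x y = (\<Sum>i\<in>K. of_real (p i * (1 - p i) ^ k) * u i x * cnj (u i y))"
  using assms(2,3)
proof (induction k arbitrary: x y)
  case 0
  then show ?case using eigensys_entry[OF e] by simp
next
  case (Suc k)
  have "(\<Sum>z\<in>I. ent_term I X k x z * X z y) = (\<Sum>z\<in>I. \<Sum>i\<in>K. of_real (p i * (1 - p i) ^ k) * u i x * (cnj (u i z) * X z y))"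
    using Suc by (intro sum.cong refl) (simp add: sum_distrib_right mult.assoc)
  also have "\<dots> = (\<Sum>i\<in>K. of_real (p i * (1 - p i) ^ k) * u i x * (\<Sum>z\<in>I. cnj (u i z) * X z y))"
    by (subst sum.swap) (simp add: sum_distrib_left)
  also have "\<dots> = (\<Sum>i\<in>K. of_real (p i * (1 - p i) ^ k) * u i x * (of_real (p i) * cnj (u i y)))"
    using Suc.prems by (intro sum.cong refl) (simp add: eigensys_apply_left[OF e])
  finally show ?case
    using Suc by (simp add: sum_subtractf[symmetric] algebra_simps del: of_real_power)
qed

lemma neg_xlnx_sums:
  fixes x :: real
  assumes "0 \<le> x" "x \<le> 1"
  shows "(\<lambda>k. x * (1 - x) ^ Suc k / real (Suc k)) sums (- (x * ln x))"
proof (cases "x = 0")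
  case False
  then have x: "0 < x" "x < 2" using assms by auto
  have y: "norm (1 - x) < 1" using assms False by auto
  have sm: "summable (\<lambda>k. (1 - x) ^ Suc k / real (Suc k))"
  proof (rule summable_comparison_test')
    show "summable (\<lambda>k. \<bar>1 - x\<bar> ^ k)" using y by (intro summable_geometric) simp
    show "norm ((1 - x) ^ Suc k / real (Suc k)) \<le> \<bar>1 - x\<bar> ^ k" if "k \<ge> 0" for k
    proof -
      have "\<bar>1 - x\<bar> * \<bar>1 - x\<bar> ^ k / real (Suc k) \<le> 1 * \<bar>1 - x\<bar> ^ k / 1"
        using y by (intro frac_le mult_right_mono) auto
      then show ?thesis by (simp add: norm_mult norm_power abs_mult power_abs)
    qed
  qed
  have t: "(- 1) ^ n * (1 / real (n + 1)) * (x - 1) ^ Suc n = - ((1 - x) ^ Suc n / real (Suc n))" for n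
  proof -
    have "(1 - x) ^ Suc n = ((- 1) * (x - 1)) ^ Suc n" by simp
    also have "\<dots> = (- 1) ^ Suc n * (x - 1) ^ Suc n" by (rule power_mult_distrib)
    finally show ?thesis by simp
  qed
  have "ln x = (\<Sum>n. (- 1) ^ n * (1 / real (n + 1)) * (x - 1) ^ Suc n)" by (rule ln_series[OF x])
  also have "\<dots> = - (\<Sum>n. (1 - x) ^ Suc n / real (Suc n))"
    unfolding t by (rule suminf_minus[OF sm])
  finally have "(\<lambda>k. (1 - x) ^ Suc k / real (Suc k)) sums (- ln x)" using summable_sums[OF sm] by simp
  from sums_mult[OF this, of x] show ?thesis by (simp only: times_divide_eq_right mult_minus_right)
qed simp

lemma ent_eq_series:
  assumes e: "eigensys I K u p M" and p: "\<And>i. i \<in> K \<Longrightarrow> p i \<ge> 0"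
  shows "ent I M = ent_series I M"
proof -
  define T where "T = (\<Sum>i\<in>K. p i)"
  have tr: "Re (\<Sum>x\<in>I. M x x) = T" unfolding eigensys_trace[OF e] T_def by simp
  note fin = onb_finite[OF eigensys_onb[OF e]]
  have T0: "T \<ge> 0" unfolding T_def using p by (intro sum_nonneg) auto
  show ?thesis
  proof (cases "T = 0")
    case True
    then have "p i = 0" if "i \<in> K" for i
      using sum_nonneg_eq_0_iff[of K p] fin(2) p that unfolding T_def by auto
    then show ?thesis unfolding ent_eq[OF e] ent_series_def Let_def tr True by simp
  next
    case False
    then have T: "T > 0" using T0 by simp
    have eX: "eigensys I K u (\<lambda>i. p i / T) (\<lambda>x y. M x y / of_real T)"
      unfolding eigensys_def using eigensys_onb[OF e] by (auto simp: eigensys_entry[OF e] sum_divide_distrib)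
    have x01: "0 \<le> p i / T" "p i / T \<le> 1" if "i \<in> K" for i
      using p[OF that] T member_le_sum[OF that, of p] fin(2) p by (auto simp: T_def)
    have trm: "Re (\<Sum>x\<in>I. ent_term I (\<lambda>x y. M x y / of_real T) (Suc k) x x) = (\<Sum>i\<in>K. p i / T * (1 - p i / T) ^ Suc k)" for k
    proof -
      have "(\<Sum>x\<in>I. ent_term I (\<lambda>x y. M x y / of_real T) (Suc k) x x)
          = (\<Sum>x\<in>I. \<Sum>i\<in>K. of_real (p i / T * (1 - p i / T) ^ Suc k) * (cnj (u i x) * u i x))"
        by (intro sum.cong refl) (simp only: ent_term_eigensys[OF eX] mult.assoc mult.commute[of "u _ _"])
      also have "\<dots> = (\<Sum>i\<in>K. of_real (p i / T * (1 - p i / T) ^ Suc k) * (\<Sum>x\<in>I. cnj (u i x) * u i x))"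
        by (subst sum.swap) (simp only: sum_distrib_left)
      also have "\<dots> = of_real (\<Sum>i\<in>K. p i / T * (1 - p i / T) ^ Suc k)"
        unfolding of_real_sum by (intro sum.cong refl) (simp only: onb_ortho[OF eigensys_onb[OF e]] simp_thms of_bool_eq mult_1_right)
      finally show ?thesis by (simp only: Re_complex_of_real)
    qed
    have "(\<lambda>k. \<Sum>i\<in>K. p i / T * (1 - p i / T) ^ Suc k / real (Suc k)) sums (\<Sum>i\<in>K. - (p i / T * ln (p i / T)))"
      by (intro sums_sum neg_xlnx_sums x01)
    then have S: "(\<Sum>k. (\<Sum>i\<in>K. p i / T * (1 - p i / T) ^ Suc k) / real (Suc k)) = (\<Sum>i\<in>K. - (p i / T * ln (p i / T)))"
      unfolding sum_divide_distrib by (rule sums_unique[symmetric])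
    have "T * - (p i / T * ln (p i / T)) = - (p i * ln (p i)) + p i * ln T" if "i \<in> K" for i
      using p[OF that] T by (cases "p i = 0") (simp_all add: ln_div algebra_simps)
    then have "T * (\<Sum>i\<in>K. - (p i / T * ln (p i / T))) = (\<Sum>i\<in>K. - (p i * ln (p i)) + p i * ln T)"
      unfolding sum_distrib_left by (intro sum.cong refl)
    also have "\<dots> = ent I M + T * ln T"
      unfolding ent_eq[OF e] T_def by (simp add: sum_subtractf sum_distrib_right)
    finally show ?thesis unfolding ent_series_def Let_def tr trm S by simp
  qed
qed

lemma ent_series_measurable:
  assumes I: "finite I" and f: "\<And>x y. x \<in> I \<Longrightarrow> y \<in> I \<Longrightarrow> (\<lambda>w. f w x y) \<in> borel_measurable M"
  shows "(\<lambda>w. ent_series I (f w)) \<in> borel_measurable M"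
proof -
  have ReM: "(\<lambda>w. Re (g w)) \<in> borel_measurable M" if "g \<in> borel_measurable M" for g
    using that by measurable
  have ofM: "(\<lambda>w. complex_of_real (g w)) \<in> borel_measurable M" if "g \<in> borel_measurable M" for g
    using that by measurable
  have T: "(\<lambda>w. Re (\<Sum>x\<in>I. f w x x)) \<in> borel_measurable M"
    by (intro ReM borel_measurable_sum f)
  have X: "(\<lambda>w. f w x y / of_real (Re (\<Sum>x\<in>I. f w x x))) \<in> borel_measurable M" if "x \<in> I" "y \<in> I" for x y
    by (intro borel_measurable_divide f that ofM T)
  have t: "(\<lambda>w. ent_term I (\<lambda>x y. f w x y / of_real (Re (\<Sum>x\<in>I. f w x x))) k x y) \<in> borel_measurable M" if "x \<in> I" "y \<in> I" for k x y
    using that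
  proof (induction k arbitrary: x y)
    case 0
    then show ?case using X by simp
  next
    case (Suc k)
    show ?case unfolding ent_term.simps
      by (intro borel_measurable_diff borel_measurable_sum borel_measurable_times Suc X)
  qed
  show ?thesis unfolding ent_series_def Let_def
    by (intro borel_measurable_diff borel_measurable_times T borel_measurable_suminf borel_measurable_divide
        ReM borel_measurable_sum t borel_measurable_const borel_measurable_ln)
qed

section \<open>Equilibration\<close>

text \<open>The list \<open>Es\<close> in the gap condition and the eigenvalues \<open>E\<close>
  must be matched. Every root of the characteristic polynomial occurs among the \<open>E j\<close>;
  the roots are distinct and as numerous as \<open>K\<close>, so the two families coincide and
  \<open>E\<close> is injective. The condition on \<open>Es\<close> then transfers to
  \<open>E\<close>.\<close>

lemma gaps_inj:
  assumes H: "H \<in> carrier_mat n n" and e: "eigensys {..<n} K u E (\<lambda>x y. H $$ (x, y))" and g: "nondegenerate_gaps H"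
  shows "inj_on (\<lambda>(j, k). E j - E k) {(j, k). j \<in> K \<and> k \<in> K \<and> j \<noteq> k}"
proof -
  note u = eigensys_onb[OF e]
  note fin = onb_finite[OF u]
  obtain Es where cp: "char_poly H = (\<Prod>E\<leftarrow>Es. [:- E, 1:])"
    and gap: "\<And>j k j' k'. j < length Es \<Longrightarrow> k < length Es \<Longrightarrow> j' < length Es \<Longrightarrow> k' < length Es \<Longrightarrow>
           j \<noteq> k \<Longrightarrow> Es ! j - Es ! k = Es ! j' - Es ! k' \<Longrightarrow> j = j' \<and> k = k'"
    using g unfolding nondegenerate_gaps_def by blast
  have len: "length Es = n"
    using degree_monic_char_poly[OF H] degree_linear_factors[of uminus Es] unfolding cp by simp
  have dist: "distinct Es"
    unfolding distinct_conv_nth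
  proof (intro allI impI)
    fix i j assume ij: "i < length Es" "j < length Es" "i \<noteq> j"
    show "Es ! i \<noteq> Es ! j"
    proof
      assume "Es ! i = Es ! j"
      \<comment> \<open>The gap condition with equal primed indices: a repeated eigenvalue would
        give a vanishing gap, forcing \<open>i\<close> and \<open>j\<close> to coincide.\<close>
      then have "Es ! i - Es ! j = Es ! i - Es ! i" by simp
      then show False using gap[of i j i i] ij by simp
    qed
  qed
  have "set Es \<subseteq> (\<lambda>j. complex_of_real (E j)) ` K"
  proof
    fix z assume "z \<in> set Es"
    then have "poly (char_poly H) z = 0" unfolding cp poly_prod_list prod_list_zero_iff by (auto simp: image_iff)
    then obtain v where "eigenvector H v z" using eigenvalue_root_char_poly[OF H] unfolding eigenvalue_def by blast
    then have v: "v \<in> carrier_vec n" "v \<noteq> 0\<^sub>v n" and Hv: "H *\<^sub>v v = z \<cdot>\<^sub>v v" using H by (auto simp: eigenvector_def)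
    have ent: "(\<Sum>y<n. H $$ (x, y) * vec_index v y) = z * vec_index v x" if "x < n" for x
    proof -
      have "vec_index (H *\<^sub>v v) x = vec_index (z \<cdot>\<^sub>v v) x" by (simp add: Hv)
      then show ?thesis using that v(1) H by (simp add: scalar_prod_def atLeast0LessThan)
    qed
    have "\<exists>j\<in>K. (\<Sum>y<n. cnj (u j y) * vec_index v y) \<noteq> 0"
    proof (rule ccontr)
      assume no: "\<not> ?thesis"
      have "vec_index v x = 0" if "x < n" for x
        using onb_expand[OF u, of x "vec_index v"] that no by simp
      then have "v = 0\<^sub>v n" using v(1) by (intro eq_vecI) auto
      then show False using v(2) by simp
    qed
    then obtain j where j: "j \<in> K" "(\<Sum>y<n. cnj (u j y) * vec_index v y) \<noteq> 0" by blast
    have "z * (\<Sum>x<n. cnj (u j x) * vec_index v x) = (\<Sum>x<n. cnj (u j x) * (\<Sum>y<n. H $$ (x, y) * vec_index v y))"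
      unfolding sum_distrib_left by (intro sum.cong refl) (simp add: ent sum_distrib_left[symmetric])
    also have "\<dots> = of_real (E j) * (\<Sum>x<n. cnj (u j x) * vec_index v x)"
      using eigensys_melem_left[OF e j(1), of "\<lambda>_. vec_index v" undefined] unfolding overlap_def by simp
    finally show "z \<in> (\<lambda>j. complex_of_real (E j)) ` K" using j by auto
  qed
  moreover have card: "card ((\<lambda>j. complex_of_real (E j)) ` K) \<le> card (set Es)"
    using card_image_le[OF fin(2), of "\<lambda>j. complex_of_real (E j)"] onb_card[OF u] distinct_card[OF dist] len by simp
  ultimately have im: "set Es = (\<lambda>j. complex_of_real (E j)) ` K" using fin(2) by (intro card_seteq) auto
  have "card ((\<lambda>j. complex_of_real (E j)) ` K) = card K"
    using onb_card[OF u] distinct_card[OF dist] len im by simp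
  then have inj: "inj_on (\<lambda>j. complex_of_real (E j)) K" using fin(2) by (rule eq_card_imp_inj_on[rotated])
  have idx: "\<exists>i<length Es. Es ! i = of_real (E j)" if "j \<in> K" for j
  proof -
    have "complex_of_real (E j) \<in> set Es" unfolding im using that by blast
    then show ?thesis unfolding in_set_conv_nth .
  qed
  show ?thesis
  proof (rule inj_onI)
    fix a b assume a: "a \<in> {(j, k). j \<in> K \<and> k \<in> K \<and> j \<noteq> k}" and b: "b \<in> {(j, k). j \<in> K \<and> k \<in> K \<and> j \<noteq> k}"
      and eq: "(case a of (j, k) \<Rightarrow> E j - E k) = (case b of (j, k) \<Rightarrow> E j - E k)"
    obtain j k j' k' where ab: "a = (j, k)" "b = (j', k')" by (cases a; cases b) auto
    have K: "j \<in> K" "k \<in> K" "j \<noteq> k" "j' \<in> K" "k' \<in> K" using a b unfolding ab by auto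
    obtain i1 i2 i3 i4 where i: "i1 < length Es" "Es ! i1 = of_real (E j)" "i2 < length Es" "Es ! i2 = of_real (E k)"
      "i3 < length Es" "Es ! i3 = of_real (E j')" "i4 < length Es" "Es ! i4 = of_real (E k')"
      using idx[OF K(1)] idx[OF K(2)] idx[OF K(4)] idx[OF K(5)] by blast
    have "complex_of_real (E j) \<noteq> of_real (E k)" using inj_onD[OF inj _ K(1,2)] K(3) by argo
    then have ne: "i1 \<noteq> i2" using i by auto
    have "E j - E k = E j' - E k'" using eq unfolding ab by simp
    then have "complex_of_real (E j - E k) = of_real (E j' - E k')" by (rule arg_cong)
    then have "Es ! i1 - Es ! i2 = Es ! i3 - Es ! i4" unfolding i(2,4,6,8) of_real_diff .
    then have "i1 = i3 \<and> i2 = i4" by (rule gap[OF i(1,3,5,7) ne])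
    then have "complex_of_real (E j) = of_real (E j')" "complex_of_real (E k) = of_real (E k')" using i by auto
    then show "a = b" unfolding ab using inj_onD[OF inj _ K(1,4)] inj_onD[OF inj _ K(2,5)] by simp
  qed
qed

definition pure :: "('a \<Rightarrow> complex) \<Rightarrow> 'a \<Rightarrow> 'a \<Rightarrow> complex" where
  "pure \<psi> x y = \<psi> x * cnj (\<psi> y)"

definition evol :: "'b set \<Rightarrow> ('b \<Rightarrow> 'a \<Rightarrow> complex) \<Rightarrow> ('b \<Rightarrow> real) \<Rightarrow> ('b \<Rightarrow> complex) \<Rightarrow> real \<Rightarrow> 'a \<Rightarrow> complex" where
  "evol K U E c t x = (\<Sum>j\<in>K. exp (- \<i> * of_real (t * E j)) * c j * U j x)"

text \<open>What remains of the evolving pure state after infinite time averaging when the energies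
  are distinct: the populations of the energy eigenvectors, without coherences.\<close>

definition dephased :: "'b set \<Rightarrow> ('b \<Rightarrow> 'a \<Rightarrow> complex) \<Rightarrow> ('b \<Rightarrow> complex) \<Rightarrow> 'a \<Rightarrow> 'a \<Rightarrow> complex" where
  "dephased K U c x y = (\<Sum>j\<in>K. of_real ((cmod (c j))\<^sup>2) * U j x * cnj (U j y))"

text \<open>The entry \<open>(a, b)\<close> of the partial trace over \<open>S - A\<close> of the
  transition operator from eigenvector \<open>k\<close> to eigenvector \<open>j\<close>.\<close>

definition trans_elem :: "nat \<Rightarrow> nat set \<Rightarrow> nat set \<Rightarrow> ('b \<Rightarrow> (nat \<Rightarrow> nat) \<Rightarrow> complex) \<Rightarrow> (nat \<Rightarrow> nat) \<Rightarrow> (nat \<Rightarrow> nat) \<Rightarrow> 'b \<Rightarrow> 'b \<Rightarrow> complex" where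
  "trans_elem d S A U a b j k = (\<Sum>e\<in>conf d (S - A). U j (glue A a e) * cnj (U k (glue A b e)))"

lemma marg_evol_expand:
  assumes K: "finite K"
  shows "marg d S A (pure (evol K U E c t)) a b - marg d S A (dephased K U c) a b
    = (\<Sum>(j, k)\<in>{(j, k). j \<in> K \<and> k \<in> K \<and> j \<noteq> k}. (c j * cnj (c k) * trans_elem d S A U a b j k) * exp (- \<i> * of_real (t * (E j - E k))))"
proof -
  let ?g = "\<lambda>j k. (c j * cnj (c k) * trans_elem d S A U a b j k) * exp (- \<i> * of_real (t * (E j - E k)))"
  have ex: "exp (- \<i> * of_real (t * E j)) * cnj (exp (- \<i> * of_real (t * E k))) = exp (- \<i> * of_real (t * (E j - E k)))" for j k
    by (simp add: exp_cnj exp_add[symmetric] algebra_simps)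
  have "marg d S A (pure (evol K U E c t)) a b
     = (\<Sum>e\<in>conf d (S - A). \<Sum>j\<in>K. \<Sum>k\<in>K. (c j * cnj (c k)) * (U j (glue A a e) * cnj (U k (glue A b e)))
         * (exp (- \<i> * of_real (t * E j)) * cnj (exp (- \<i> * of_real (t * E k)))))"
    unfolding marg_def pure_def evol_def cnj_sum sum_product
    by (intro sum.cong refl) (simp only: complex_cnj_mult mult_ac)
  also have "\<dots> = (\<Sum>j\<in>K. \<Sum>e\<in>conf d (S - A). \<Sum>k\<in>K. (c j * cnj (c k)) * (U j (glue A a e) * cnj (U k (glue A b e)))
         * exp (- \<i> * of_real (t * (E j - E k))))"
    unfolding ex by (rule sum.swap)
  also have "\<dots> = (\<Sum>j\<in>K. \<Sum>k\<in>K. \<Sum>e\<in>conf d (S - A). (c j * cnj (c k)) * (U j (glue A a e) * cnj (U k (glue A b e)))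
         * exp (- \<i> * of_real (t * (E j - E k))))"
    by (intro sum.cong refl sum.swap)
  also have "\<dots> = (\<Sum>j\<in>K. \<Sum>k\<in>K. ?g j k)"
    unfolding trans_elem_def sum_distrib_left sum_distrib_right by simp
  also have "\<dots> = (\<Sum>(j, k)\<in>K \<times> K. ?g j k)" by (rule sum.cartesian_product)
  also have "K \<times> K = {(j, k). j \<in> K \<and> k \<in> K \<and> j \<noteq> k} \<union> (\<lambda>j. (j, j)) ` K" by auto
  also have "(\<Sum>(j, k)\<in>\<dots>. ?g j k) = (\<Sum>(j, k)\<in>{(j, k). j \<in> K \<and> k \<in> K \<and> j \<noteq> k}. ?g j k) + (\<Sum>(j, k)\<in>(\<lambda>j. (j, j)) ` K. ?g j k)"
    by (rule sum.union_disjoint) (use K in \<open>auto intro: finite_subset[of _ "K \<times> K"]\<close>)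
  also have "(\<Sum>(j, k)\<in>(\<lambda>j. (j, j)) ` K. ?g j k) = (\<Sum>j\<in>K. ?g j j)"
    by (subst sum.reindex) (auto simp: inj_on_def)
  also have "\<dots> = marg d S A (dephased K U c) a b"
  proof -
    have "marg d S A (dephased K U c) a b = (\<Sum>j\<in>K. \<Sum>e\<in>conf d (S - A). of_real ((cmod (c j))\<^sup>2) * U j (glue A a e) * cnj (U j (glue A b e)))"
      unfolding marg_def dephased_def by (rule sum.swap)
    also have "\<dots> = (\<Sum>j\<in>K. ?g j j)"
      unfolding trans_elem_def sum_distrib_left sum_distrib_right
      by (intro sum.cong refl) (simp add: complex_norm_square del: of_real_power)
    finally show ?thesis by simp
  qed
  finally show ?thesis by simp
qed

text \<open>For fixed \<open>a\<close> and \<open>b\<close> the numbers over \<open>k\<close> are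
  conjugated expansion coefficients of a single vector, so Parseval replaces their sum by the
  squared norm of the slice of \<open>U j\<close> at \<open>a\<close>. Summing over \<open>a\<close>
  gives 1, and summing over \<open>b\<close> gives the dimension of the subsystem.\<close>

lemma trans_elem_sum_right:
  assumes u: "onb (conf d S) K U" and A: "A \<subseteq> S" and S: "finite S" and j: "j \<in> K"
  shows "(\<Sum>a\<in>conf d A. \<Sum>b\<in>conf d A. \<Sum>k\<in>K. (cmod (trans_elem d S A U a b j k))\<^sup>2) = real (card (conf d A))"
proof -
  have fin: "finite (conf d A)" "finite (conf d (S - A))" using S A finite_subset by (auto intro!: finite_conf)
  have row: "(\<Sum>k\<in>K. (cmod (trans_elem d S A U a b j k))\<^sup>2) = (\<Sum>e\<in>conf d (S - A). (cmod (U j (glue A a e)))\<^sup>2)"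
    if ab: "a \<in> conf d A" "b \<in> conf d A" for a b
  proof -
    \<comment> \<open>The slice of \<open>U j\<close> at \<open>a\<close>, transplanted to the slice
      at \<open>b\<close> and extended by zero.\<close>
    define w where "w x = (if restrict x A = b then U j (glue A a (restrict x (S - A))) else 0)" for x
    have r: "restrict (glue A b' e) A = b'" "restrict (glue A b' e) (S - A) = e" if "b' \<in> conf d A" "e \<in> conf d (S - A)" for b' e
      using that A by (auto simp: conf_def glue_def restrict_def PiE_def extensional_def fun_eq_iff)
    have ws: "(\<Sum>b'\<in>conf d A. \<Sum>e\<in>conf d (S - A). h (w (glue A b' e)) b' e) = (\<Sum>e\<in>conf d (S - A). h (U j (glue A a e)) b e)"
      if h0: "\<And>b' e. h 0 b' e = 0" for h :: "complex \<Rightarrow> (nat \<Rightarrow> nat) \<Rightarrow> (nat \<Rightarrow> nat) \<Rightarrow> 'z::comm_monoid_add"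
    proof -
      have "(\<Sum>b'\<in>conf d A. \<Sum>e\<in>conf d (S - A). h (w (glue A b' e)) b' e)
        = (\<Sum>b'\<in>conf d A. if b' = b then (\<Sum>e\<in>conf d (S - A). h (U j (glue A a e)) b e) else 0)"
        by (intro sum.cong refl) (auto simp: w_def r h0 intro!: sum.cong)
      then show ?thesis using fin(1) ab(2) by simp
    qed
    have "cnj (trans_elem d S A U a b j k) = cnj (\<Sum>x\<in>conf d S. cnj (U k x) * w x)" for k
    proof -
      have "(\<Sum>x\<in>conf d S. cnj (U k x) * w x) = (\<Sum>b'\<in>conf d A. \<Sum>e\<in>conf d (S - A). cnj (U k (glue A b' e)) * w (glue A b' e))"
        by (rule sum_glue[OF A])
      also have "\<dots> = (\<Sum>e\<in>conf d (S - A). cnj (U k (glue A b e)) * U j (glue A a e))"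
        using ws[of "\<lambda>v b' e. cnj (U k (glue A b' e)) * v"] by simp
      finally show ?thesis by (simp add: trans_elem_def mult.commute)
    qed
    then have "(\<Sum>k\<in>K. (cmod (trans_elem d S A U a b j k))\<^sup>2) = (\<Sum>k\<in>K. (cmod (\<Sum>x\<in>conf d S. cnj (U k x) * w x))\<^sup>2)"
      by (intro sum.cong refl) (simp only: complex_cnj_cancel_iff)
    also have "\<dots> = (\<Sum>x\<in>conf d S. (cmod (w x))\<^sup>2)" by (rule onb_parseval[OF u])
    also have "\<dots> = (\<Sum>b'\<in>conf d A. \<Sum>e\<in>conf d (S - A). (cmod (w (glue A b' e)))\<^sup>2)" by (rule sum_glue[OF A])
    also have "\<dots> = (\<Sum>e\<in>conf d (S - A). (cmod (U j (glue A a e)))\<^sup>2)"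
      using ws[of "\<lambda>v b' e. (cmod v)\<^sup>2"] by simp
    finally show ?thesis .
  qed
  have "(\<Sum>a\<in>conf d A. \<Sum>b\<in>conf d A. \<Sum>k\<in>K. (cmod (trans_elem d S A U a b j k))\<^sup>2)
      = (\<Sum>a\<in>conf d A. \<Sum>b\<in>conf d A. \<Sum>e\<in>conf d (S - A). (cmod (U j (glue A a e)))\<^sup>2)"
    by (intro sum.cong refl row)
  also have "\<dots> = real (card (conf d A)) * (\<Sum>a\<in>conf d A. \<Sum>e\<in>conf d (S - A). (cmod (U j (glue A a e)))\<^sup>2)"
    by (simp add: sum_distrib_left)
  also have "(\<Sum>a\<in>conf d A. \<Sum>e\<in>conf d (S - A). (cmod (U j (glue A a e)))\<^sup>2) = 1"
    using onb_norm[OF u j] unfolding sum_glue[OF A] .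
  finally show ?thesis by simp
qed

lemma trans_elem_swap: "cmod (trans_elem d S A U a b j k) = cmod (trans_elem d S A U b a k j)"
proof -
  have "trans_elem d S A U a b j k = cnj (trans_elem d S A U b a k j)"
    by (simp add: trans_elem_def mult.commute)
  then show ?thesis by (simp only: complex_mod_cnj)
qed

text \<open>The product of two populations is at most the mean of their squares, and exchanging
  \<open>j\<close> with \<open>k\<close> and \<open>a\<close> with \<open>b\<close> makes both
  halves equal. \<open>trans_elem_sum_right\<close> then sums out the other index, leaving the
  dimension times the purity of the dephased state.\<close>

lemma fluctuation_bound:
  assumes u: "onb (conf d S) K U" and A: "A \<subseteq> S" and S: "finite S"
  shows "(\<Sum>a\<in>conf d A. \<Sum>b\<in>conf d A. \<Sum>(j, k)\<in>{(j, k). j \<in> K \<and> k \<in> K \<and> j \<noteq> k}.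
      (cmod (c j * cnj (c k) * trans_elem d S A U a b j k))\<^sup>2) \<le> real (card (conf d A)) * (\<Sum>j\<in>K. ((cmod (c j))\<^sup>2)\<^sup>2)"
proof -
  note fin = onb_finite[OF u]
  let ?p = "\<lambda>j. (cmod (c j))\<^sup>2" and ?m = "\<lambda>a b j k. (cmod (trans_elem d S A U a b j k))\<^sup>2"
  let ?D = "real (card (conf d A))"
  have "(\<Sum>(j, k)\<in>{(j, k). j \<in> K \<and> k \<in> K \<and> j \<noteq> k}. (cmod (c j * cnj (c k) * trans_elem d S A U a b j k))\<^sup>2)
     \<le> (\<Sum>j\<in>K. \<Sum>k\<in>K. (?p j)\<^sup>2 / 2 * ?m a b j k + (?p k)\<^sup>2 / 2 * ?m b a k j)" for a b
  proof -
    have "(\<Sum>(j, k)\<in>{(j, k). j \<in> K \<and> k \<in> K \<and> j \<noteq> k}. (cmod (c j * cnj (c k) * trans_elem d S A U a b j k))\<^sup>2)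
      \<le> (\<Sum>(j, k)\<in>K \<times> K. (cmod (c j * cnj (c k) * trans_elem d S A U a b j k))\<^sup>2)"
      using fin by (intro sum_mono2) auto
    also have "\<dots> = (\<Sum>j\<in>K. \<Sum>k\<in>K. (cmod (c j * cnj (c k) * trans_elem d S A U a b j k))\<^sup>2)"
      by (rule sum.cartesian_product[symmetric])
    also have "\<dots> \<le> (\<Sum>j\<in>K. \<Sum>k\<in>K. (?p j)\<^sup>2 / 2 * ?m a b j k + (?p k)\<^sup>2 / 2 * ?m b a k j)"
    proof (intro sum_mono)
      fix j k
      have "0 \<le> (?p j - ?p k)\<^sup>2" by simp
      then have "?p j * ?p k \<le> (?p j)\<^sup>2 / 2 + (?p k)\<^sup>2 / 2" by (simp add: power2_diff)
      then have "?p j * ?p k * ?m a b j k \<le> ((?p j)\<^sup>2 / 2 + (?p k)\<^sup>2 / 2) * ?m a b j k" by (rule mult_right_mono) simp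
      also have "\<dots> = (?p j)\<^sup>2 / 2 * ?m a b j k + (?p k)\<^sup>2 / 2 * ?m b a k j"
        unfolding trans_elem_swap[of d S A U b a k j] by (rule distrib_right)
      finally show "(cmod (c j * cnj (c k) * trans_elem d S A U a b j k))\<^sup>2 \<le> (?p j)\<^sup>2 / 2 * ?m a b j k + (?p k)\<^sup>2 / 2 * ?m b a k j"
        by (simp add: norm_mult power_mult_distrib)
    qed
    finally show ?thesis .
  qed
  then have "(\<Sum>a\<in>conf d A. \<Sum>b\<in>conf d A. \<Sum>(j, k)\<in>{(j, k). j \<in> K \<and> k \<in> K \<and> j \<noteq> k}. (cmod (c j * cnj (c k) * trans_elem d S A U a b j k))\<^sup>2)
    \<le> (\<Sum>a\<in>conf d A. \<Sum>b\<in>conf d A. (\<Sum>j\<in>K. \<Sum>k\<in>K. (?p j)\<^sup>2 / 2 * ?m a b j k + (?p k)\<^sup>2 / 2 * ?m b a k j))"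
    by (intro sum_mono)
  also have "\<dots> = (\<Sum>a\<in>conf d A. \<Sum>b\<in>conf d A. \<Sum>j\<in>K. \<Sum>k\<in>K. (?p j)\<^sup>2 / 2 * ?m a b j k)
     + (\<Sum>a\<in>conf d A. \<Sum>b\<in>conf d A. \<Sum>j\<in>K. \<Sum>k\<in>K. (?p k)\<^sup>2 / 2 * ?m b a k j)"
    by (simp only: sum.distrib)
  also have "(\<Sum>a\<in>conf d A. \<Sum>b\<in>conf d A. \<Sum>j\<in>K. \<Sum>k\<in>K. (?p k)\<^sup>2 / 2 * ?m b a k j)
     = (\<Sum>a\<in>conf d A. \<Sum>b\<in>conf d A. \<Sum>j\<in>K. \<Sum>k\<in>K. (?p j)\<^sup>2 / 2 * ?m a b j k)"
  proof -
    have "(\<Sum>a\<in>conf d A. \<Sum>b\<in>conf d A. \<Sum>j\<in>K. \<Sum>k\<in>K. (?p k)\<^sup>2 / 2 * ?m b a k j)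
      = (\<Sum>a\<in>conf d A. \<Sum>b\<in>conf d A. \<Sum>k\<in>K. \<Sum>j\<in>K. (?p k)\<^sup>2 / 2 * ?m b a k j)"
      by (intro sum.cong refl sum.swap)
    also have "\<dots> = (\<Sum>b\<in>conf d A. \<Sum>a\<in>conf d A. \<Sum>k\<in>K. \<Sum>j\<in>K. (?p k)\<^sup>2 / 2 * ?m b a k j)" by (rule sum.swap)
    finally show ?thesis .
  qed
  also have "(\<Sum>a\<in>conf d A. \<Sum>b\<in>conf d A. \<Sum>j\<in>K. \<Sum>k\<in>K. (?p j)\<^sup>2 / 2 * ?m a b j k) = (\<Sum>j\<in>K. (?p j)\<^sup>2 / 2 * ?D)"
  proof -
    have "(\<Sum>a\<in>conf d A. \<Sum>b\<in>conf d A. \<Sum>j\<in>K. \<Sum>k\<in>K. (?p j)\<^sup>2 / 2 * ?m a b j k)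
      = (\<Sum>a\<in>conf d A. \<Sum>j\<in>K. \<Sum>b\<in>conf d A. \<Sum>k\<in>K. (?p j)\<^sup>2 / 2 * ?m a b j k)"
      by (intro sum.cong refl sum.swap)
    also have "\<dots> = (\<Sum>j\<in>K. \<Sum>a\<in>conf d A. \<Sum>b\<in>conf d A. \<Sum>k\<in>K. (?p j)\<^sup>2 / 2 * ?m a b j k)" by (rule sum.swap)
    also have "\<dots> = (\<Sum>j\<in>K. (?p j)\<^sup>2 / 2 * (\<Sum>a\<in>conf d A. \<Sum>b\<in>conf d A. \<Sum>k\<in>K. ?m a b j k))"
      by (simp only: sum_distrib_left)
    also have "\<dots> = (\<Sum>j\<in>K. (?p j)\<^sup>2 / 2 * ?D)"
      by (intro sum.cong refl) (simp only: trans_elem_sum_right[OF u A S])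
    finally show ?thesis .
  qed
  also have "(\<Sum>j\<in>K. (?p j)\<^sup>2 / 2 * ?D) + (\<Sum>j\<in>K. (?p j)\<^sup>2 / 2 * ?D) = ?D * (\<Sum>j\<in>K. (?p j)\<^sup>2)"
    unfolding sum.distrib[symmetric] sum_distrib_left by (intro sum.cong refl) simp
  finally show ?thesis .
qed

lemma trig_mean_sum:
  fixes z :: "'c \<Rightarrow> 'd \<Rightarrow> 'a \<Rightarrow> complex" and \<omega> :: "'a \<Rightarrow> real"
  assumes P: "finite P" and inj: "inj_on \<omega> P"
  shows "\<exists>G. (\<forall>t. (G has_real_derivative (\<Sum>a\<in>A. \<Sum>b\<in>B. (cmod (\<Sum>l\<in>P. z a b l * exp (- \<i> * of_real (t * \<omega> l))))\<^sup>2)) (at t)) \<and>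
     ((\<lambda>\<tau>. (G \<tau> - G 0) / \<tau>) \<longlongrightarrow> (\<Sum>a\<in>A. \<Sum>b\<in>B. \<Sum>l\<in>P. (cmod (z a b l))\<^sup>2)) at_top"
proof -
  define \<Phi> where "\<Phi> z G \<longleftrightarrow> (\<forall>t. (G has_real_derivative (cmod (\<Sum>l\<in>P. z l * exp (- \<i> * of_real (t * \<omega> l))))\<^sup>2) (at t)) \<and>
     ((\<lambda>\<tau>. (G \<tau> - G 0) / \<tau>) \<longlongrightarrow> (\<Sum>l\<in>P. (cmod (z l))\<^sup>2)) at_top" for z G
  have ex: "\<exists>G. \<Phi> z G" for z
    unfolding \<Phi>_def by (rule trig_mean[OF P inj])
  define G where "G a b = (SOME G. \<Phi> (z a b) G)" for a b
  have \<Phi>: "\<Phi> (z a b) (G a b)" for a b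
    unfolding G_def by (rule someI_ex[OF ex])
  have G: "(G a b has_real_derivative (cmod (\<Sum>l\<in>P. z a b l * exp (- \<i> * of_real (t * \<omega> l))))\<^sup>2) (at t)" for a b t
    using \<Phi>[of a b] unfolding \<Phi>_def by (rule conjunct1[THEN spec])
  have lim: "((\<lambda>\<tau>. (G a b \<tau> - G a b 0) / \<tau>) \<longlongrightarrow> (\<Sum>l\<in>P. (cmod (z a b l))\<^sup>2)) at_top" for a b
    using \<Phi>[of a b] unfolding \<Phi>_def by (rule conjunct2)
  have 1: "((\<lambda>t. \<Sum>a\<in>A. \<Sum>b\<in>B. G a b t) has_real_derivative (\<Sum>a\<in>A. \<Sum>b\<in>B. (cmod (\<Sum>l\<in>P. z a b l * exp (- \<i> * of_real (t * \<omega> l))))\<^sup>2)) (at t)" for t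
    by (rule DERIV_sum, rule DERIV_sum, rule G)
  have eq: "((\<Sum>a\<in>A. \<Sum>b\<in>B. G a b \<tau>) - (\<Sum>a\<in>A. \<Sum>b\<in>B. G a b 0)) / \<tau>
       = (\<Sum>a\<in>A. \<Sum>b\<in>B. (G a b \<tau> - G a b 0) / \<tau>)" for \<tau>
    by (simp only: sum_subtractf sum_divide_distrib diff_divide_distrib)
  have "((\<lambda>\<tau>. ((\<Sum>a\<in>A. \<Sum>b\<in>B. G a b \<tau>) - (\<Sum>a\<in>A. \<Sum>b\<in>B. G a b 0)) / \<tau>) \<longlongrightarrow> (\<Sum>a\<in>A. \<Sum>b\<in>B. \<Sum>l\<in>P. (cmod (z a b l))\<^sup>2)) at_top"
    unfolding eq by (rule tendsto_sum, rule tendsto_sum, rule lim)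
  with 1 show ?thesis by (intro exI[of _ "\<lambda>t. \<Sum>a\<in>A. \<Sum>b\<in>B. G a b t"] conjI allI)
qed

text \<open>Distinct gaps are distinct frequencies, so in every squared entry of the deviation the
  cross terms between different pairs of levels average out. \<open>fluctuation_bound\<close>
  estimates what is left.\<close>

lemma fluctuation_mean:
  assumes u: "onb (conf d S) K U" and A: "A \<subseteq> S" and S: "finite S"
    and inj: "inj_on (\<lambda>(j, k). E j - E k) {(j, k). j \<in> K \<and> k \<in> K \<and> j \<noteq> k}"
  shows "\<exists>G L. (\<forall>t. (G has_real_derivative (\<Sum>a\<in>conf d A. \<Sum>b\<in>conf d A.
        (cmod (marg d S A (pure (evol K U E c t)) a b - marg d S A (dephased K U c) a b))\<^sup>2)) (at t)) \<and>
     ((\<lambda>\<tau>. (G \<tau> - G 0) / \<tau>) \<longlongrightarrow> L) at_top \<and> L \<le> real (card (conf d A)) * (\<Sum>j\<in>K. ((cmod (c j))\<^sup>2)\<^sup>2)"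
proof -
  note fin = onb_finite[OF u]
  let ?P = "{(j, k). j \<in> K \<and> k \<in> K \<and> j \<noteq> k}"
  define z where "z a b l = c (fst l) * cnj (c (snd l)) * trans_elem d S A U a b (fst l) (snd l)" for a b l
  define w where "w l = E (fst l) - E (snd l)" for l
  have P: "finite ?P" by (rule finite_subset[of _ "K \<times> K"]) (use fin in auto)
  have w: "inj_on w ?P" using inj unfolding w_def[abs_def] case_prod_unfold .
  have ex: "marg d S A (pure (evol K U E c t)) a b - marg d S A (dephased K U c) a b
     = (\<Sum>l\<in>?P. z a b l * exp (- \<i> * of_real (t * w l)))" for a b t
    unfolding marg_evol_expand[OF fin(2)] z_def w_def by (rule sum.cong[OF refl]) (simp only: case_prod_unfold)
  obtain G where G: "\<And>t. (G has_real_derivative (\<Sum>a\<in>conf d A. \<Sum>b\<in>conf d A. (cmod (\<Sum>l\<in>?P. z a b l * exp (- \<i> * of_real (t * w l))))\<^sup>2)) (at t)"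
    and lim: "((\<lambda>\<tau>. (G \<tau> - G 0) / \<tau>) \<longlongrightarrow> (\<Sum>a\<in>conf d A. \<Sum>b\<in>conf d A. \<Sum>l\<in>?P. (cmod (z a b l))\<^sup>2)) at_top"
    using trig_mean_sum[OF P w, where A = "conf d A" and B = "conf d A" and z = z] by (elim exE conjE) (rule that, erule spec, assumption)
  have L: "(\<Sum>a\<in>conf d A. \<Sum>b\<in>conf d A. \<Sum>l\<in>?P. (cmod (z a b l))\<^sup>2) \<le> real (card (conf d A)) * (\<Sum>j\<in>K. ((cmod (c j))\<^sup>2)\<^sup>2)"
    using fluctuation_bound[OF u A S, of c] unfolding z_def case_prod_unfold .
  show ?thesis unfolding ex
    by (rule exI[of _ G], rule exI, rule conjI, rule allI, rule G, rule conjI, rule lim, rule L)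
qed

section \<open>The average entropy of an equilibrated state\<close>

lemma ent_cong:
  assumes I: "finite I" and h: "hermitian_on I M" and N: "\<And>x y. x \<in> I \<Longrightarrow> y \<in> I \<Longrightarrow> N x y = M x y"
  shows "ent I N = ent I M"
proof -
  obtain K :: "nat set" and u p where e: "eigensys I K u p M" using hermitian_eigensys[OF I h] by (elim exE)
  show ?thesis by (rule ent_reindex[OF e bij_betw_id]) (simp add: N)
qed

lemma marg_cong:
  assumes "R \<subseteq> S" "a \<in> conf d R" "b \<in> conf d R" and "\<And>x y. x \<in> conf d S \<Longrightarrow> y \<in> conf d S \<Longrightarrow> \<rho> x y = \<sigma> x y"
  shows "marg d S R \<rho> a b = marg d S R \<sigma> a b"
  unfolding marg_def by (rule sum.cong[OF refl]) (rule assms(4); rule glue_conf[OF assms(1)]; (rule assms | assumption))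

lemma pure_hermitian: "hermitian_on I (pure \<psi>)"
  by (simp add: hermitian_on_def pure_def)

lemma pure_psd: "psd_on I (pure \<psi>)"
  unfolding psd_on_def
proof
  fix f
  have "(\<Sum>x\<in>I. \<Sum>y\<in>I. cnj (f x) * pure \<psi> x y * f y) = (\<Sum>x\<in>I. cnj (f x) * \<psi> x) * (\<Sum>y\<in>I. cnj (\<psi> y) * f y)"
    unfolding sum_product pure_def by (simp only: mult_ac)
  also have "(\<Sum>y\<in>I. cnj (\<psi> y) * f y) = cnj (\<Sum>x\<in>I. cnj (f x) * \<psi> x)"
    by (simp add: mult.commute)
  also have "(\<Sum>x\<in>I. cnj (f x) * \<psi> x) * \<dots> = of_real ((cmod (\<Sum>x\<in>I. cnj (f x) * \<psi> x))\<^sup>2)"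
    by (rule complex_norm_square[symmetric])
  finally show "0 \<le> Re (\<Sum>x\<in>I. \<Sum>y\<in>I. cnj (f x) * pure \<psi> x y * f y)" by simp
qed

lemma pure_trace: "(\<Sum>x\<in>I. pure \<psi> x x) = of_real (\<Sum>x\<in>I. (cmod (\<psi> x))\<^sup>2)"
  by (simp add: pure_def complex_norm_square del: of_real_power)

lemma evol_norm:
  assumes u: "onb I K U"
  shows "(\<Sum>x\<in>I. (cmod (evol K U E c t x))\<^sup>2) = (\<Sum>j\<in>K. (cmod (c j))\<^sup>2)"
proof -
  have "(\<Sum>x\<in>I. (cmod (evol K U E c t x))\<^sup>2) = (\<Sum>x\<in>I. (cmod (\<Sum>j\<in>K. cnj (cnj (U j x)) * (exp (- \<i> * of_real (t * E j)) * c j)))\<^sup>2)"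
    unfolding evol_def complex_cnj_cnj by (simp only: mult_ac)
  also have "\<dots> = (\<Sum>j\<in>K. (cmod (exp (- \<i> * of_real (t * E j)) * c j))\<^sup>2)"
    by (rule onb_parseval[OF onb_swap[OF u]])
  finally show ?thesis by (simp add: norm_mult norm_exp_eq_Re)
qed

lemma eigensys_dephased:
  assumes "onb I K U" shows "eigensys I K U (\<lambda>j. (cmod (c j))\<^sup>2) (dephased K U c)"
  using assms unfolding eigensys_def dephased_def by simp

lemma marg_eigensys:
  assumes S: "finite S" and R: "R \<subseteq> S" and h: "hermitian_on (conf d S) \<rho>" and p: "psd_on (conf d S) \<rho>" and tr: "(\<Sum>x\<in>conf d S. \<rho> x x) = 1"
  shows "\<exists>(K::nat set) u p. eigensys (conf d R) K u p (marg d S R \<rho>) \<and> (\<forall>i\<in>K. p i \<ge> 0) \<and> (\<Sum>i\<in>K. p i) = 1"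
proof -
  have "finite (conf d R)" using finite_subset[OF R S] by simp
  from hermitian_eigensys[OF this marg_hermitian[OF R h]]
  obtain K :: "nat set" and u p where e: "eigensys (conf d R) K u p (marg d S R \<rho>)" by (elim exE)
  have "complex_of_real (\<Sum>i\<in>K. p i) = 1" unfolding eigensys_trace[OF e, symmetric] marg_trace[OF R] by (rule tr)
  then have "(\<Sum>i\<in>K. p i) = 1" by (simp only: of_real_eq_1_iff)
  with e psd_on_eigenvalue[OF marg_psd[OF R S p] e] show ?thesis by blast
qed

lemma sum_error_terms:
  fixes X W :: "nat \<Rightarrow> real"
  shows "(\<Sum>j<m. X j - (b * (D * W j) + c) / 2 - D * W j / \<eta> + k)
    = (\<Sum>j<m. X j) - (b * (D * (\<Sum>j<m. W j)) + real m * c) / 2 - D * (\<Sum>j<m. W j) / \<eta> + real m * k"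
  by (induction m) (simp_all add: algebra_simps add_divide_distrib)

text \<open>Each reduced state is compared with the corresponding reduction of the dephased state by
  \<open>ent_mix_continuity\<close>. Mixing commutes with partial traces, so Shearer's inequality
  applies to the positive definite mixture of the global dephased state, and
  \<open>ent_mix_ge\<close> removes the mixing there. The error is affine in the squared distances,
  so it enters the sum over subsystems only through their total \<open>Q\<close>.\<close>

lemma average_entropy_bound:
  fixes A :: "nat \<Rightarrow> nat set" and m n N r :: nat
  assumes u: "onb (conf d {..<N}) K U" and d: "d > 0" and c: "(\<Sum>j\<in>K. (cmod (c j))\<^sup>2) = 1"
    and A: "\<And>j. j < m \<Longrightarrow> A j \<subseteq> {..<N}" "\<And>j. j < m \<Longrightarrow> card (A j) = n"
    and r: "\<And>s. s < N \<Longrightarrow> card {j. j < m \<and> s \<in> A j} = r"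
    and \<psi>: "(\<Sum>x\<in>conf d {..<N}. (cmod (\<psi> x))\<^sup>2) = 1"
    and \<eta>: "0 < \<eta>" "\<eta> < 1" and b: "b > 0"
  defines "Q \<equiv> (\<Sum>j<m. \<Sum>x\<in>conf d (A j). \<Sum>y\<in>conf d (A j). (cmod (marg d {..<N} (A j) (pure \<psi>) x y - marg d {..<N} (A j) (dephased K U c) x y))\<^sup>2)"
  shows "(\<Sum>j<m. ent (conf d (A j)) (marg d {..<N} (A j) (pure \<psi>)))
     \<ge> real r * ((1 - \<eta>) * ent (conf d {..<N}) (dephased K U c))
       - ((b * (real (d ^ n) * Q) + real m * ((ln (real (d ^ n) / \<eta>))\<^sup>2 / b)) / 2 + real (d ^ n) * Q / \<eta>
          - real m * ((1 - \<eta>) * ln (1 - \<eta>) + \<eta> * ln \<eta> - \<eta> * ln (real (d ^ n))))"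
proof -
  let ?S = "{..<N}" and ?\<sigma> = "dephased K U c"
  let ?W = "\<lambda>j. \<Sum>x\<in>conf d (A j). \<Sum>y\<in>conf d (A j). (cmod (marg d ?S (A j) (pure \<psi>) x y - marg d ?S (A j) ?\<sigma> x y))\<^sup>2"
  let ?X = "\<lambda>j. ent (conf d (A j)) (mix (conf d (A j)) \<eta> (marg d ?S (A j) ?\<sigma>))"
  let ?k = "(1 - \<eta>) * ln (1 - \<eta>) + \<eta> * ln \<eta> - \<eta> * ln (real (d ^ n))"
  note e\<sigma> = eigensys_dephased[OF u, of c]
  note em = eigensys_mix[OF e\<sigma>, of \<eta>]
  have cne: "conf d R \<noteq> {}" for R by (rule conf_nonempty[OF d])
  have h\<sigma>: "hermitian_on (conf d ?S) ?\<sigma>" unfolding hermitian_on_def by (intro ballI eigensys_hermitian[OF e\<sigma>])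
  have p\<sigma>: "psd_on (conf d ?S) ?\<sigma>"
    unfolding psd_on_def eigensys_quadratic_form[OF e\<sigma>] by (auto intro!: sum_nonneg)
  have t\<sigma>: "(\<Sum>x\<in>conf d ?S. ?\<sigma> x x) = 1" unfolding eigensys_trace[OF e\<sigma>] c by simp
  have t\<psi>: "(\<Sum>x\<in>conf d ?S. pure \<psi> x x) = 1" unfolding pure_trace \<psi> by simp
  have cm: "0 < \<eta> / real (card (conf d ?S))" using \<eta> d by (simp add: card_conf)
  have pos: "(1 - \<eta>) * (cmod (c j))\<^sup>2 + \<eta> / real (card (conf d ?S)) > 0" for j
    by (rule add_nonneg_pos[OF mult_nonneg_nonneg cm]) (use \<eta> in auto)
  have hm: "hermitian_on (conf d ?S) (mix (conf d ?S) \<eta> ?\<sigma>)" unfolding hermitian_on_def by (intro ballI eigensys_hermitian[OF em])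
  have pm: "pd_on (conf d ?S) (mix (conf d ?S) \<eta> ?\<sigma>)" by (rule eigensys_pd_on[OF em pos])
  have tm: "(\<Sum>x\<in>conf d ?S. mix (conf d ?S) \<eta> ?\<sigma> x x) = 1"
    unfolding eigensys_trace[OF em] eigensys_sum_mix[OF e\<sigma> c cne] by simp
  have term_bound: "ent (conf d (A j)) (marg d ?S (A j) (pure \<psi>)) \<ge> ?X j
      - (b * (real (d ^ n) * ?W j) + (ln (real (d ^ n) / \<eta>))\<^sup>2 / b) / 2 - real (d ^ n) * ?W j / \<eta> + ?k" if j: "j < m" for j
  proof -
    have cc: "card (conf d (A j)) = d ^ n" using A(2)[OF j] finite_subset[OF A(1)[OF j]] by (simp add: card_conf)
    obtain L1 :: "nat set" and v1 q1 where 1: "eigensys (conf d (A j)) L1 v1 q1 (marg d ?S (A j) (pure \<psi>)) \<and> (\<forall>i\<in>L1. q1 i \<ge> 0) \<and> (\<Sum>i\<in>L1. q1 i) = 1"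
      using marg_eigensys[OF finite_lessThan A(1)[OF j] pure_hermitian pure_psd t\<psi>] by (elim exE)
    obtain L2 :: "nat set" and v2 q2 where 2: "eigensys (conf d (A j)) L2 v2 q2 (marg d ?S (A j) (?\<sigma>)) \<and> (\<forall>i\<in>L2. q2 i \<ge> 0) \<and> (\<Sum>i\<in>L2. q2 i) = 1"
      using marg_eigensys[OF finite_lessThan A(1)[OF j] h\<sigma> p\<sigma> t\<sigma>] by (elim exE)
    show ?thesis
      using ent_mix_continuity[OF 1[THEN conjunct1] 2[THEN conjunct1] bspec[OF 1[THEN conjunct2, THEN conjunct1]] 1[THEN conjunct2, THEN conjunct2]
          bspec[OF 2[THEN conjunct2, THEN conjunct1]] 2[THEN conjunct2, THEN conjunct2] cne \<eta> b] unfolding cc by linarith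
  qed
  have sh: "real r * ent (conf d ?S) (mix (conf d ?S) \<eta> ?\<sigma>) \<le> (\<Sum>j<m. ?X j)"
  proof -
    have "real r * ent (conf d ?S) (mix (conf d ?S) \<eta> ?\<sigma>) \<le> (\<Sum>j<m. ent (conf d (A j)) (marg d ?S (A j) (mix (conf d ?S) \<eta> ?\<sigma>)))"
      by (rule quantum_shearer[OF hm pm tm d A(1) r])
    also have "\<dots> = (\<Sum>j<m. ?X j)"
    proof (rule sum.cong[OF refl])
      fix j assume "j \<in> {..<m}"
      then have j: "A j \<subseteq> ?S" using A(1) by simp
      have "ent (conf d (A j)) (mix (conf d (A j)) \<eta> (marg d ?S (A j) ?\<sigma>)) = ent (conf d (A j)) (marg d ?S (A j) (mix (conf d ?S) \<eta> ?\<sigma>))"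
        by (rule ent_cong[OF finite_conf[OF finite_subset[OF j]] marg_hermitian[OF j hm]]) (simp_all add: marg_mix[OF j _ d])
      then show "ent (conf d (A j)) (marg d ?S (A j) (mix (conf d ?S) \<eta> ?\<sigma>)) = ?X j" ..
    qed
    finally show ?thesis .
  qed
  have "(1 - \<eta>) * ent (conf d ?S) ?\<sigma> \<le> ent (conf d ?S) (mix (conf d ?S) \<eta> ?\<sigma>)"
    by (rule ent_mix_ge[OF e\<sigma> _ cne \<eta>]) simp
  then have 1: "real r * ((1 - \<eta>) * ent (conf d ?S) ?\<sigma>) \<le> (\<Sum>j<m. ?X j)"
    using sh mult_left_mono[of "(1 - \<eta>) * ent (conf d ?S) ?\<sigma>" "ent (conf d ?S) (mix (conf d ?S) \<eta> ?\<sigma>)" "real r"] by linarith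
  have "(\<Sum>j<m. ?X j - (b * (real (d ^ n) * ?W j) + (ln (real (d ^ n) / \<eta>))\<^sup>2 / b) / 2 - real (d ^ n) * ?W j / \<eta> + ?k)
     \<le> (\<Sum>j<m. ent (conf d (A j)) (marg d ?S (A j) (pure \<psi>)))"
    by (rule sum_mono) (rule term_bound, simp)
  also have "(\<Sum>j<m. ?X j - (b * (real (d ^ n) * ?W j) + (ln (real (d ^ n) / \<eta>))\<^sup>2 / b) / 2 - real (d ^ n) * ?W j / \<eta> + ?k)
     = (\<Sum>j<m. ?X j) - (b * (real (d ^ n) * Q) + real m * ((ln (real (d ^ n) / \<eta>))\<^sup>2 / b)) / 2 - real (d ^ n) * Q / \<eta> + real m * ?k"
    unfolding Q_def by (rule sum_error_terms)
  finally show ?thesis using 1 by linarith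
qed

lemma ent_dephased_ge:
  assumes u: "onb I K U" and c: "(\<Sum>j\<in>K. (cmod (c j))\<^sup>2) = 1" and \<delta>: "\<delta> > 0"
  shows "ent I (dephased K U c) \<ge> - ln (\<Sum>j\<in>K. (cmod (c j))\<^sup>2 powr (1 + \<delta>)) / \<delta>"
  unfolding ent_eq[OF eigensys_dephased[OF u]]
  by (rule shannon_ge_renyi[OF onb_finite(2)[OF u] _ c \<delta>]) simp

lemma reduced_evolved_entropy:
  assumes H: "H \<in> carrier_mat (d ^ N) (d ^ N)" and e: "eigensys {..<d ^ N} K u E (\<lambda>x y. H $$ (x, y))"
    and v: "v \<in> carrier_vec (d ^ N)" and A: "A \<subseteq> {..<N}" and d: "d > 0"
  shows "von_neumann_entropy (reduced_state d N A (evolved_state H v t))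
    = ent (conf d A) (marg d {..<N} A (pure (evol K (\<lambda>j x. u j (enc d N x)) E (\<lambda>j. \<Sum>y<d ^ N. cnj (u j y) * vec_index v y) t)))"
proof -
  note idx = evolved_state_index[OF H e v]
  have "hermitian_on {..<d ^ N} (\<lambda>x y. evolved_state H v t $$ (x, y))"
    unfolding hermitian_on_def by (simp add: idx)
  then have "von_neumann_entropy (reduced_state d N A (evolved_state H v t))
     = ent (conf d A) (marg d {..<N} A (\<lambda>x y. evolved_state H v t $$ (enc d N x, enc d N y)))"
    by (rule reduced_state_entropy[OF A d])
  also have "\<dots> = ent (conf d A) (marg d {..<N} A (pure (evol K (\<lambda>j x. u j (enc d N x)) E (\<lambda>j. \<Sum>y<d ^ N. cnj (u j y) * vec_index v y) t)))"
  proof (rule ent_cong[OF finite_conf[OF finite_subset[OF A]] marg_hermitian[OF A pure_hermitian]])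
    fix a b assume ab: "a \<in> conf d A" "b \<in> conf d A"
    show "marg d {..<N} A (\<lambda>x y. evolved_state H v t $$ (enc d N x, enc d N y)) a b
      = marg d {..<N} A (pure (evol K (\<lambda>j x. u j (enc d N x)) E (\<lambda>j. \<Sum>y<d ^ N. cnj (u j y) * vec_index v y) t)) a b"
    proof (rule marg_cong[OF A ab])
      fix x y assume "x \<in> conf d {..<N}" "y \<in> conf d {..<N}"
      then have xy: "enc d N x < d ^ N" "enc d N y < d ^ N" using bij_betwE[OF enc_bij[OF d, of N]] by auto
      show "evolved_state H v t $$ (enc d N x, enc d N y)
        = pure (evol K (\<lambda>j x. u j (enc d N x)) E (\<lambda>j. \<Sum>y<d ^ N. cnj (u j y) * vec_index v y) t) x y"
        unfolding pure_def evol_def idx[OF xy] evolved_amp_def ..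
    qed
  qed simp
  finally show ?thesis .
qed

lemma evol_measurable:
  assumes c: "\<And>j. j \<in> K \<Longrightarrow> (\<lambda>\<Psi>. c \<Psi> j) \<in> borel_measurable M"
  shows "(\<lambda>(\<Psi>, t). evol K U E (c \<Psi>) t x) \<in> borel_measurable (M \<Otimes>\<^sub>M borel)"
proof -
  have "(\<lambda>t::real. exp (- \<i> * of_real (t * E j))) \<in> borel_measurable borel" for j
    by (intro borel_measurable_continuous_onI continuous_intros)
  from measurable_compose[OF measurable_snd this]
  have ex: "(\<lambda>w. exp (- \<i> * of_real (snd w * E j))) \<in> borel_measurable (M \<Otimes>\<^sub>M borel)" for j .
  show ?thesis
    unfolding evol_def case_prod_unfold
    by (intro borel_measurable_sum borel_measurable_times ex borel_measurable_const measurable_compose[OF measurable_fst c])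
qed

text \<open>\<open>ent\<close> involves a choice of eigensystem, but on positive kernels it agrees
  with \<open>ent_series\<close>, which is built from the entries by measurable operations.\<close>

lemma marg_entropy_measurable:
  assumes c: "\<And>j. j \<in> K \<Longrightarrow> (\<lambda>\<Psi>. c \<Psi> j) \<in> borel_measurable M" and A: "A \<subseteq> S" and S: "finite S"
  shows "(\<lambda>(\<Psi>, t). ent (conf d A) (marg d S A (pure (evol K U E (c \<Psi>) t)))) \<in> borel_measurable (M \<Otimes>\<^sub>M borel)"
proof -
  have fin: "finite (conf d A)" using finite_subset[OF A S] by simp
  have eq: "ent (conf d A) (marg d S A (pure \<psi>)) = ent_series (conf d A) (marg d S A (pure \<psi>))" for \<psi>
  proof -
    obtain K :: "nat set" and u p where e: "eigensys (conf d A) K u p (marg d S A (pure \<psi>))"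
      using hermitian_eigensys[OF fin marg_hermitian[OF A pure_hermitian[of _ \<psi>]]] by (elim exE)
    show ?thesis by (rule ent_eq_series[OF e psd_on_eigenvalue[OF marg_psd[OF A S pure_psd] e]])
  qed
  have cnjm: "cnj \<in> borel_measurable borel" by (intro borel_measurable_continuous_onI continuous_intros)
  have ev: "(\<lambda>w. evol K U E (c (fst w)) (snd w) x) \<in> borel_measurable (M \<Otimes>\<^sub>M borel)" for x
    using evol_measurable[OF c] unfolding case_prod_unfold .
  show ?thesis
    unfolding eq case_prod_unfold
    by (rule ent_series_measurable[OF fin])
       (unfold marg_def pure_def, intro borel_measurable_sum borel_measurable_times ev measurable_compose[OF ev cnjm])
qed

section \<open>Tail bounds and the theorem\<close>

text \<open>Markov's inequality in time for the distances averaged over the subsystems. One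
  dimension factor comes from continuity of the entropy and one from
  \<open>fluctuation_bound\<close>, hence the square of \<open>d ^ n\<close> multiplying the purity.
  Outside the exceptional times \<open>average_entropy_bound\<close> holds with total error at most
  \<open>real m\<close> times the error for \<open>\<kappa>\<close>.\<close>

lemma long_time_entropy:
  fixes A :: "nat \<Rightarrow> nat set" and m n N r :: nat
  assumes H: "H \<in> carrier_mat (d ^ N) (d ^ N)" and e: "eigensys {..<d ^ N} K u E (\<lambda>x y. H $$ (x, y))"
    and inj: "inj_on (\<lambda>(j, k). E j - E k) {(j, k). j \<in> K \<and> k \<in> K \<and> j \<noteq> k}"
    and v: "v \<in> carrier_vec (d ^ N)" and v1: "(\<Sum>x<d ^ N. (cmod (vec_index v x))\<^sup>2) = 1"
    and d: "d > 0" and m: "m > 0"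
    and A: "\<And>j. j < m \<Longrightarrow> A j \<subseteq> {..<N}" "\<And>j. j < m \<Longrightarrow> card (A j) = n"
    and r: "\<And>s. s < N \<Longrightarrow> card {j. j < m \<and> s \<in> A j} = r"
    and \<eta>: "0 < \<eta>" "\<eta> < 1" and b: "b > 0" and \<kappa>: "\<kappa> > 0" and \<delta>: "\<delta> > 0"
  defines "c \<equiv> (\<lambda>j. \<Sum>y<d ^ N. cnj (u j y) * vec_index v y)"
  assumes \<theta>: "\<theta> \<le> (real r * ((1 - \<eta>) * (- ln (\<Sum>j\<in>K. (cmod (c j))\<^sup>2 powr (1 + \<delta>)) / \<delta>))) / real m
       - ((b * \<kappa> + (ln (real (d ^ n) / \<eta>))\<^sup>2 / b) / 2 + \<kappa> / \<eta>
          - ((1 - \<eta>) * ln (1 - \<eta>) + \<eta> * ln \<eta> - \<eta> * ln (real (d ^ n))))"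
    and Pm: "Measurable.pred borel (\<lambda>t. (1 / real m) * (\<Sum>j<m. von_neumann_entropy (reduced_state d N (A j) (evolved_state H v t))) \<ge> \<theta>)"
  shows "long_time_prob (\<lambda>t. (1 / real m) * (\<Sum>j<m. von_neumann_entropy (reduced_state d N (A j) (evolved_state H v t))) \<ge> \<theta>)
     \<ge> ereal (1 - (real (d ^ n))\<^sup>2 * (\<Sum>j\<in>K. ((cmod (c j))\<^sup>2)\<^sup>2) / \<kappa>)"
proof -
  let ?S = "{..<N}" and ?D = "real (d ^ n)"
  define U where "U j x = u j (enc d N x)" for j x
  define W where "W j t = (\<Sum>x\<in>conf d (A j). \<Sum>y\<in>conf d (A j).
    (cmod (marg d ?S (A j) (pure (evol K U E c t)) x y - marg d ?S (A j) (dephased K U c) x y))\<^sup>2)" for j t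
  define s2 where "s2 = (\<Sum>j\<in>K. ((cmod (c j))\<^sup>2)\<^sup>2)"
  have "eigensys (conf d ?S) K (\<lambda>i x. u (id i) (enc d N x)) (\<lambda>i. E (id i)) (\<lambda>x y. H $$ (enc d N x, enc d N y))"
    by (rule eigensys_reindex[OF e enc_bij[OF d] bij_betw_id refl])
  then have U: "onb (conf d ?S) K U" unfolding id_apply U_def[abs_def] by (rule eigensys_onb)
  have c1: "(\<Sum>j\<in>K. (cmod (c j))\<^sup>2) = 1"
    using onb_parseval[OF eigensys_onb[OF e], of "vec_index v"] unfolding v1 c_def .
  have cc: "card (conf d (A j)) = d ^ n" if "j < m" for j
    using A(2)[OF that] finite_subset[OF A(1)[OF that]] by (simp add: card_conf)
  have vn: "von_neumann_entropy (reduced_state d N (A j) (evolved_state H v t)) = ent (conf d (A j)) (marg d ?S (A j) (pure (evol K U E c t)))"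
    if "j < m" for j t
    unfolding U_def[abs_def] c_def by (rule reduced_evolved_entropy[OF H e v A(1)[OF that] d])
  define \<Phi> where "\<Phi> j G L \<longleftrightarrow> (\<forall>t. (G has_real_derivative W j t) (at t)) \<and> ((\<lambda>\<tau>. (G \<tau> - G 0) / \<tau>) \<longlongrightarrow> L) at_top \<and> L \<le> ?D * s2" for j G L
  have "\<exists>G L. \<Phi> j G L" if "j < m" for j
    using fluctuation_mean[OF U A(1)[OF that] finite_lessThan inj, of c] unfolding \<Phi>_def W_def s2_def cc[OF that] .
  then have "\<exists>G. \<forall>j<m. \<exists>L. \<Phi> j (G j) L" by metis
  then obtain G where "\<forall>j<m. \<exists>L. \<Phi> j (G j) L" ..
  then have "\<exists>L. \<forall>j<m. \<Phi> j (G j) (L j)" by metis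
  then obtain L where \<Phi>: "\<And>j. j < m \<Longrightarrow> \<Phi> j (G j) (L j)" by blast
  \<comment> \<open>Scaled so that \<open>Q t \<le> \<kappa>\<close> says exactly that the
    dimension-weighted total distance in \<open>average_entropy_bound\<close> is at most
    \<open>real m * \<kappa>\<close>.\<close>
  define Q where "Q t = ?D / real m * (\<Sum>j<m. W j t)" for t
  define F where "F t = ?D / real m * (\<Sum>j<m. G j t)" for t
  define M where "M = ?D / real m * (\<Sum>j<m. L j)"
  have dF: "(F has_real_derivative Q t) (at t)" for t
    unfolding F_def[abs_def] Q_def by (intro DERIV_cmult DERIV_sum) (use \<Phi> in \<open>simp add: \<Phi>_def\<close>)
  have eq: "(F \<tau> - F 0) / \<tau> = ?D / real m * (\<Sum>j<m. (G j \<tau> - G j 0) / \<tau>)" for \<tau>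
    unfolding F_def sum_divide_distrib[symmetric] sum_subtractf right_diff_distrib[symmetric] by simp
  have lim: "((\<lambda>\<tau>. (F \<tau> - F 0) / \<tau>) \<longlongrightarrow> M) at_top"
    unfolding eq M_def by (intro tendsto_mult tendsto_const tendsto_sum) (use \<Phi> in \<open>simp add: \<Phi>_def\<close>)
  have W0: "W j t \<ge> 0" for j t unfolding W_def by (intro sum_nonneg zero_le_power2)
  have Q0: "Q t \<ge> 0" for t unfolding Q_def by (intro mult_nonneg_nonneg sum_nonneg W0 divide_nonneg_nonneg) auto
  have Qm: "Q \<in> borel_measurable borel"
    unfolding Q_def[abs_def] W_def marg_def pure_def evol_def
    by (intro borel_measurable_continuous_onI continuous_intros)
  have P: "(1 / real m) * (\<Sum>j<m. von_neumann_entropy (reduced_state d N (A j) (evolved_state H v t))) \<ge> \<theta>" if "Q t \<le> \<kappa>" for t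
  proof -
    define B where "B = ?D * (\<Sum>j<m. W j t)"
    define k where "k = (1 - \<eta>) * ln (1 - \<eta>) + \<eta> * ln \<eta> - \<eta> * ln ?D"
    define l where "l = (ln (?D / \<eta>))\<^sup>2 / b"
    define X where "X = (1 - \<eta>) * ent (conf d ?S) (dephased K U c)"
    define X0 where "X0 = (1 - \<eta>) * (- ln (\<Sum>j\<in>K. (cmod (c j))\<^sup>2 powr (1 + \<delta>)) / \<delta>)"
    define T where "T = (\<Sum>j<m. von_neumann_entropy (reduced_state d N (A j) (evolved_state H v t)))"
    have "T = (\<Sum>j<m. ent (conf d (A j)) (marg d ?S (A j) (pure (evol K U E c t))))"
      unfolding T_def by (intro sum.cong refl vn) simp
    moreover have "(\<Sum>x\<in>conf d ?S. (cmod (evol K U E c t x))\<^sup>2) = 1" unfolding evol_norm[OF U] c1 ..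
    ultimately have T: "T \<ge> real r * X - ((b * B + real m * l) / 2 + B / \<eta> - real m * k)"
      using average_entropy_bound[OF U d c1 A r _ \<eta> b, of "evol K U E c t"] unfolding B_def X_def l_def k_def W_def by simp
    have X: "real r * X \<ge> real r * X0"
      unfolding X_def X0_def using ent_dephased_ge[OF U c1 \<delta>] \<eta> by (intro mult_left_mono) auto
    have B: "B \<le> real m * \<kappa>" using that m unfolding Q_def B_def by (simp add: field_simps)
    have "real r * X0 - ((b * (real m * \<kappa>) + real m * l) / 2 + real m * \<kappa> / \<eta> - real m * k)
      \<le> real r * X - ((b * B + real m * l) / 2 + B / \<eta> - real m * k)"
      by (intro diff_mono X add_mono divide_right_mono mult_left_mono B order_refl) (use b \<eta> in auto)
    then have "T \<ge> real r * X0 - ((b * (real m * \<kappa>) + real m * l) / 2 + real m * \<kappa> / \<eta> - real m * k)"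
      using T by (rule order_trans)
    also have "real r * X0 - ((b * (real m * \<kappa>) + real m * l) / 2 + real m * \<kappa> / \<eta> - real m * k)
      = real m * (real r * X0 / real m - ((b * \<kappa> + l) / 2 + \<kappa> / \<eta> - k))"
      using m by (simp add: field_simps)
    finally have T': "real m * (real r * X0 / real m - ((b * \<kappa> + l) / 2 + \<kappa> / \<eta> - k)) \<le> T" .
    have "\<theta> \<le> real r * X0 / real m - ((b * \<kappa> + l) / 2 + \<kappa> / \<eta> - k)"
      using \<theta> unfolding X0_def l_def k_def .
    then have "real m * \<theta> \<le> T" using T' mult_left_mono[of \<theta> _ "real m"] by fastforce
    then show ?thesis using m unfolding T_def[symmetric] by (simp add: field_simps)
  qed
  have "(\<Sum>j<m. L j) \<le> (\<Sum>j<m. ?D * s2)" by (rule sum_mono) (use \<Phi> in \<open>simp add: \<Phi>_def\<close>)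
  then have "M \<le> ?D / real m * (real m * (?D * s2))" unfolding M_def by (intro mult_left_mono) auto
  also have "\<dots> = ?D\<^sup>2 * s2" using m by (simp add: power2_eq_square)
  finally have "M / \<kappa> \<le> ?D\<^sup>2 * s2 / \<kappa>" using \<kappa> by (intro divide_right_mono) auto
  then have "ereal (1 - ?D\<^sup>2 * s2 / \<kappa>) \<le> ereal (1 - M / \<kappa>)" by simp
  also have "\<dots> \<le> long_time_prob (\<lambda>t. (1 / real m) * (\<Sum>j<m. von_neumann_entropy (reduced_state d N (A j) (evolved_state H v t))) \<ge> \<theta>)"
    by (rule long_time_prob_ge[OF dF Q0 Qm lim \<kappa> P Pm])
  finally show ?thesis unfolding s2_def .
qed

section \<open>Values of the moments and tail bounds\<close>

lemma Gamma_plus1_real: "x > 0 \<Longrightarrow> Gamma (x + 1) = x * Gamma (x::real)"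
  by (rule Gamma_plus1) (auto elim!: nonpos_Ints_cases)

lemma sphere_moment_two:
  assumes d: "d > 0" shows "real d * sphere_moment d 2 = 2 / (real d + 1)"
proof -
  have G3: "Gamma (3::real) = 2" using Gamma_fact[of 2, where 'a = real] by (simp add: numeral_2_eq_2)
  have Gd: "Gamma (real d) > 0" using d by (intro Gamma_real_pos) simp
  have "Gamma (real d + 2) = (real d + 1) * (real d * Gamma (real d))"
    using Gamma_plus1_real[of "real d + 1"] Gamma_plus1_real[of "real d"] d by (simp add: add.assoc)
  then have "real d * sphere_moment d 2 = (2 * (real d * Gamma (real d))) / ((real d + 1) * (real d * Gamma (real d)))"
    using G3 unfolding sphere_moment_def by simp
  also have "\<dots> = 2 / (real d + 1)"
    by (rule nonzero_mult_divide_mult_cancel_right, rule no_zero_divisors[OF _ less_imp_neq[OF Gd, symmetric]]) (use d in simp)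
  finally show ?thesis .
qed

text \<open>Passing from \<open>d\<close> to \<open>d + 1\<close> multiplies the left side by 1 -
  \<delta> / (d + 1 + \<delta>), which is at most the exponential of -(\<delta> / (1 + \<delta>)) /
  (d + 1). The product starts from the value 1 at \<open>d = 1\<close>, so the harmonic sum starts
  at 2.\<close>

lemma sphere_moment_harmonic:
  assumes d: "d \<ge> 1" and \<delta>: "\<delta> > 0"
  shows "real d * sphere_moment d (1 + \<delta>) \<le> exp (- (\<delta> / (1 + \<delta>)) * (\<Sum>k=2..d. 1 / real k))"
  using d
proof (induction d rule: nat_induct_at_least)
  case base
  have "Gamma (2 + \<delta>) > 0" using \<delta> by (intro Gamma_real_pos) simp
  then show ?case by (simp add: sphere_moment_def add.assoc)
next
  case (Suc d)
  have g: "Gamma (real d + (1 + \<delta>)) > 0" using \<delta> by (intro Gamma_real_pos) simp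
  have 1: "Gamma (real (Suc d) + (1 + \<delta>)) = (real d + 1 + \<delta>) * Gamma (real d + (1 + \<delta>))"
    using Gamma_plus1_real[of "real d + (1 + \<delta>)"] \<delta> by (simp add: add_ac)
  have 2: "Gamma (real (Suc d)) = real d * Gamma (real d)"
    using Gamma_plus1_real[of "real d"] Suc.hyps by (simp add: add_ac)
  have "real (Suc d) * sphere_moment (Suc d) (1 + \<delta>) = (real d * sphere_moment d (1 + \<delta>)) * ((real d + 1) / (real d + 1 + \<delta>))"
    unfolding sphere_moment_def 1 2 using g \<delta> by (simp add: field_simps)
  also have "\<dots> \<le> exp (- (\<delta> / (1 + \<delta>)) * (\<Sum>k=2..d. 1 / real k)) * exp (- (\<delta> / (1 + \<delta>)) * (1 / real (Suc d)))"
  proof (rule mult_mono[OF Suc.IH])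
    have "(\<delta> / (1 + \<delta>)) * (1 / real (Suc d)) \<le> \<delta> / (real d + 1 + \<delta>)"
    proof -
      have "real d + 1 + \<delta> \<le> (1 + \<delta>) * real (Suc d)" using \<delta> by (simp add: algebra_simps)
      then have "\<delta> / ((1 + \<delta>) * real (Suc d)) \<le> \<delta> / (real d + 1 + \<delta>)" using \<delta> by (intro divide_left_mono) auto
      then show ?thesis by simp
    qed
    moreover have "(real d + 1) / (real d + 1 + \<delta>) = 1 - \<delta> / (real d + 1 + \<delta>)" using \<delta> by (simp add: field_simps)
    ultimately have "(real d + 1) / (real d + 1 + \<delta>) \<le> 1 + (- (\<delta> / (1 + \<delta>)) * (1 / real (Suc d)))" by simp
    also have "\<dots> \<le> exp (- (\<delta> / (1 + \<delta>)) * (1 / real (Suc d)))" by (rule exp_ge_add_one_self)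
    finally show "(real d + 1) / (real d + 1 + \<delta>) \<le> exp (- (\<delta> / (1 + \<delta>)) * (1 / real (Suc d)))" .
  qed (use \<delta> in auto)
  also have "\<dots> = exp (- (\<delta> / (1 + \<delta>)) * (\<Sum>k=2..Suc d. 1 / real k))"
    using Suc.hyps unfolding exp_add[symmetric] distrib_left[symmetric] by simp
  finally show ?case .
qed

text \<open>Markov's inequality for the sum over a whole eigenbasis: every unit eigenvector obeys
  the same moment bound, and the number \<open>d ^ N\<close> of eigenvectors merges with the power
  of the single-spin moment.\<close>

lemma amp_moment_tail:
  assumes d: "d > 0" and \<alpha>: "\<alpha> \<ge> 1" and u: "onb {..<d ^ N} K u" and T: "T > 0"
  shows "measure (product_state_measure d N) {\<Psi> \<in> space (product_state_measure d N).
      T \<le> (\<Sum>j\<in>K. (cmod (amp d N (\<lambda>y. cnj (u j y)) \<Psi>))\<^sup>2 powr \<alpha>)} \<le> (real d * sphere_moment d \<alpha>) ^ N / T"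
proof -
  let ?M = "product_state_measure d N"
  let ?f = "\<lambda>j \<Psi>. (cmod (amp d N (\<lambda>y. cnj (u j y)) \<Psi>))\<^sup>2 powr \<alpha>"
  interpret prob_space ?M by (rule prob_space_product_state[OF d])
  have fm: "(\<lambda>\<Psi>. ennreal (?f j \<Psi>)) \<in> borel_measurable ?M" for j
    using amp_measurable[OF d, of N "\<lambda>y. cnj (u j y)"] by measurable
  have sm: "sphere_moment d \<alpha> \<ge> 0" using sphere_moment_nonneg[OF d, of \<alpha>] \<alpha> by simp
  let ?Z = "\<lambda>\<Psi>. \<Sum>j\<in>K. ennreal (?f j \<Psi>)"
  have Z: "?Z \<Psi> = ennreal (\<Sum>j\<in>K. ?f j \<Psi>)" for \<Psi> by (rule sum_ennreal) simp
  have "(\<integral>\<^sup>+\<Psi>. ?Z \<Psi> \<partial>?M) = (\<Sum>j\<in>K. \<integral>\<^sup>+\<Psi>. ennreal (?f j \<Psi>) \<partial>?M)" by (rule nn_integral_sum[OF fm])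
  also have "\<dots> \<le> (\<Sum>j\<in>K. ennreal (sphere_moment d \<alpha> ^ N))"
  proof (rule sum_mono)
    fix j assume j: "j \<in> K"
    have "(\<Sum>x<d ^ N. (cmod (cnj (u j x)))\<^sup>2) = 1" using onb_norm[OF u j] by simp
    then show "(\<integral>\<^sup>+\<Psi>. ennreal (?f j \<Psi>) \<partial>?M) \<le> ennreal (sphere_moment d \<alpha> ^ N)"
      using nn_integral_amp_moment[OF d \<alpha>, of N "\<lambda>y. cnj (u j y)"] by (simp only: powr_one_eq_one mult_1_right)
  qed
  also have "\<dots> = ennreal (\<Sum>j\<in>K. sphere_moment d \<alpha> ^ N)" by (rule sum_ennreal) (use sm in simp)
  also have "(\<Sum>j\<in>K. sphere_moment d \<alpha> ^ N) = (real d * sphere_moment d \<alpha>) ^ N"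
    using onb_card[OF u] by (simp add: power_mult_distrib)
  finally have int: "(\<integral>\<^sup>+\<Psi>. ?Z \<Psi> \<partial>?M) \<le> ennreal ((real d * sphere_moment d \<alpha>) ^ N)" .
  have "emeasure ?M ({\<Psi> \<in> space ?M. 1 \<le> ennreal (1 / T) * ?Z \<Psi>}) \<le> ennreal (1 / T) * (\<integral>\<^sup>+\<Psi>. ?Z \<Psi> * indicator (space ?M) \<Psi> \<partial>?M)"
    by (rule nn_integral_Markov_inequality) (use fm in auto)
  also have "(\<integral>\<^sup>+\<Psi>. ?Z \<Psi> * indicator (space ?M) \<Psi> \<partial>?M) = (\<integral>\<^sup>+\<Psi>. ?Z \<Psi> \<partial>?M)"
    by (rule nn_integral_cong) simp
  also have "ennreal (1 / T) * \<dots> \<le> ennreal (1 / T) * ennreal ((real d * sphere_moment d \<alpha>) ^ N)"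
    by (rule mult_left_mono[OF int]) simp
  also have "\<dots> = ennreal ((real d * sphere_moment d \<alpha>) ^ N / T)"
    using T sm by (simp add: ennreal_mult[symmetric])
  finally have em: "emeasure ?M {\<Psi> \<in> space ?M. 1 \<le> ennreal (1 / T) * ?Z \<Psi>} \<le> ennreal ((real d * sphere_moment d \<alpha>) ^ N / T)" .
  have "1 \<le> ennreal (1 / T) * ?Z \<Psi> \<longleftrightarrow> T \<le> (\<Sum>j\<in>K. ?f j \<Psi>)" for \<Psi>
  proof -
    have "ennreal (1 / T) * ?Z \<Psi> = ennreal ((\<Sum>j\<in>K. ?f j \<Psi>) / T)"
      unfolding Z using T by (simp add: ennreal_mult[symmetric] sum_nonneg)
    then show ?thesis using T by (simp add: sum_nonneg pos_le_divide_eq)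
  qed
  with em show ?thesis
    using T sm by (simp add: emeasure_eq_measure)
qed

text \<open>A union bound over two bad events. Outside the first, the Renyi sum is below
  \<open>T\<^sub>1\<close> and the dephased entropy is large; outside the second, the purity is
  below \<open>T\<^sub>2\<close> and exceptional times are rare. For a normalised state in neither
  event the conclusion is the deterministic \<open>long_time_entropy\<close>.\<close>

lemma high_probability_entropy:
  fixes A :: "nat \<Rightarrow> nat set" and m n N r :: nat
  assumes d: "d > 0" and m: "m > 0" and H: "H \<in> carrier_mat (d ^ N) (d ^ N)" "hermitian_mat H" "nondegenerate_gaps H"
    and A: "\<And>j. j < m \<Longrightarrow> A j \<subseteq> {..<N}" "\<And>j. j < m \<Longrightarrow> card (A j) = n"
    and r: "\<And>s. s < N \<Longrightarrow> card {j. j < m \<and> s \<in> A j} = r"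
    and \<eta>: "0 < \<eta>" "\<eta> < 1" and b: "b > 0" and \<kappa>: "\<kappa> > 0" and \<delta>: "\<delta> > 0" and T: "T\<^sub>1 > 0" "T\<^sub>2 > 0"
    and \<theta>: "\<theta> \<le> (real r * ((1 - \<eta>) * (- ln T\<^sub>1 / \<delta>))) / real m
       - ((b * \<kappa> + (ln (real (d ^ n) / \<eta>))\<^sup>2 / b) / 2 + \<kappa> / \<eta>
          - ((1 - \<eta>) * ln (1 - \<eta>) + \<eta> * ln \<eta> - \<eta> * ln (real (d ^ n))))"
    and C: "C \<le> 1 - (real (d ^ n))\<^sup>2 * T\<^sub>2 / \<kappa>"
  shows "measure (product_state_measure d N)
      {\<Psi> \<in> space (product_state_measure d N).
        long_time_prob (\<lambda>t. (1 / real m) * (\<Sum>j<m. von_neumann_entropy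
              (reduced_state d N (A j) (evolved_state H (product_state d N \<Psi>) t))) \<ge> \<theta>) \<ge> ereal C}
    \<ge> 1 - (real d * sphere_moment d (1 + \<delta>)) ^ N / T\<^sub>1 - (real d * sphere_moment d 2) ^ N / T\<^sub>2"
proof -
  let ?M = "product_state_measure d N"
  interpret prob_space ?M by (rule prob_space_product_state[OF d])
  have "hermitian_on {..<d ^ N} (\<lambda>x y. H $$ (x, y))"
    unfolding hermitian_on_def
  proof (intro ballI)
    fix x y assume xy: "x \<in> {..<d ^ N}" "y \<in> {..<d ^ N}"
    have "mat_adjoint H $$ (y, x) = cnj (H $$ (x, y))" by (rule mat_adjoint_index) (use xy H in auto)
    then show "cnj (H $$ (x, y)) = H $$ (y, x)" using H(2) unfolding hermitian_mat_def by simp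
  qed
  then obtain u :: "nat \<Rightarrow> nat \<Rightarrow> complex" and E where e: "eigensys {..<d ^ N} {..<d ^ N} u E (\<lambda>x y. H $$ (x, y))"
    using hermitian_eigensys_lessThan by blast
  let ?K = "{..<d ^ N}"
  note u = eigensys_onb[OF e]
  define c where "c \<Psi> j = amp d N (\<lambda>y. cnj (u j y)) \<Psi>" for \<Psi> j
  have v: "product_state d N \<Psi> \<in> carrier_vec (d ^ N)" for \<Psi> by (simp add: product_state_def)
  have c_eq: "(\<Sum>y<d ^ N. cnj (u j y) * vec_index (product_state d N \<Psi>) y) = c \<Psi> j" for j \<Psi>
    unfolding c_def amp_def product_state_def by (intro sum.cong refl) simp
  let ?avg = "\<lambda>\<Psi> t. (1 / real m) * (\<Sum>j<m. von_neumann_entropy (reduced_state d N (A j) (evolved_state H (product_state d N \<Psi>) t)))"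
  have "(\<lambda>(\<Psi>, t). von_neumann_entropy (reduced_state d N (A j) (evolved_state H (product_state d N \<Psi>) t))) \<in> borel_measurable (?M \<Otimes>\<^sub>M borel)"
    if "j < m" for j
    unfolding reduced_evolved_entropy[OF H(1) e v A(1)[OF that] d] c_eq
    by (rule marg_entropy_measurable[OF _ A(1)[OF that] finite_lessThan]) (simp add: c_def amp_measurable[OF d])
  then have "(\<lambda>w. ?avg (fst w) (snd w)) \<in> borel_measurable (?M \<Otimes>\<^sub>M borel)"
    unfolding case_prod_unfold by (intro borel_measurable_times borel_measurable_const borel_measurable_sum) simp
  then have avg: "Measurable.pred (?M \<Otimes>\<^sub>M borel) (\<lambda>(\<Psi>, t). \<theta> \<le> ?avg \<Psi> t)"
    unfolding case_prod_unfold pred_def by (rule borel_measurable_le[OF borel_measurable_const])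
  let ?E = "{\<Psi> \<in> space ?M. long_time_prob (\<lambda>t. \<theta> \<le> ?avg \<Psi> t) \<ge> ereal C}"
  have E: "?E \<in> sets ?M" by (rule long_time_prob_measurable[OF avg])
  have avg_t: "Measurable.pred borel (\<lambda>t. \<theta> \<le> ?avg \<Psi> t)" if "\<Psi> \<in> space ?M" for \<Psi>
    using measurable_compose[OF measurable_Pair1'[OF that] avg] by simp
  define B where "B \<alpha> T = {\<Psi> \<in> space ?M. T \<le> (\<Sum>j\<in>?K. (cmod (c \<Psi> j))\<^sup>2 powr \<alpha>)}" for \<alpha> T :: real
  have cm: "(\<lambda>\<Psi>. c \<Psi> j) \<in> borel_measurable ?M" for j unfolding c_def by (rule amp_measurable[OF d])
  have B: "B \<alpha> T \<in> sets ?M" for \<alpha> T unfolding B_def using cm by measurable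
  have B1: "prob (B (1 + \<delta>) T\<^sub>1) \<le> (real d * sphere_moment d (1 + \<delta>)) ^ N / T\<^sub>1"
    unfolding B_def c_def by (rule amp_moment_tail[OF d _ u T(1)]) (use \<delta> in simp)
  have B2: "prob (B 2 T\<^sub>2) \<le> (real d * sphere_moment d 2) ^ N / T\<^sub>2"
    unfolding B_def c_def by (rule amp_moment_tail[OF d _ u T(2)]) simp
  have good: "\<Psi> \<in> ?E" if \<Psi>: "\<Psi> \<in> space ?M" "\<Psi> \<notin> B (1 + \<delta>) T\<^sub>1" "\<Psi> \<notin> B 2 T\<^sub>2" and nrm: "\<forall>s<N. (\<Sum>i<d. (cmod (\<Psi> s i))\<^sup>2) = 1" for \<Psi>
  proof -
    let ?Z = "\<Sum>j\<in>?K. (cmod (c \<Psi> j))\<^sup>2 powr (1 + \<delta>)" and ?Y = "\<Sum>j\<in>?K. ((cmod (c \<Psi> j))\<^sup>2)\<^sup>2"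
    have v1: "(\<Sum>x<d ^ N. (cmod (vec_index (product_state d N \<Psi>) x))\<^sup>2) = 1" by (rule product_state_norm[OF d nrm])
    have c1: "(\<Sum>j\<in>?K. (cmod (c \<Psi> j))\<^sup>2) = 1"
      using onb_parseval[OF u, of "vec_index (product_state d N \<Psi>)"] unfolding v1 c_eq .
    have "\<exists>j\<in>?K. cmod (c \<Psi> j) \<noteq> 0"
    proof (rule ccontr)
      assume "\<not> ?thesis"
      then have "(\<Sum>j\<in>?K. (cmod (c \<Psi> j))\<^sup>2) = 0" by (intro sum.neutral) simp
      then show False using c1 by simp
    qed
    then obtain j where "j \<in> ?K" "cmod (c \<Psi> j) \<noteq> 0" by blast
    then have Z: "?Z > 0" by (intro sum_pos2[of _ j]) auto
    have "?Z < T\<^sub>1" using \<Psi> unfolding B_def by simp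
    then have ln_le: "- ln T\<^sub>1 / \<delta> \<le> - ln ?Z / \<delta>" using Z \<delta> by (intro divide_right_mono) auto
    have "(real r * ((1 - \<eta>) * (- ln T\<^sub>1 / \<delta>))) / real m \<le> (real r * ((1 - \<eta>) * (- ln ?Z / \<delta>))) / real m"
      by (rule divide_right_mono[OF mult_left_mono[OF mult_left_mono[OF ln_le]]]) (use \<eta> in simp_all)
    then have th: "\<theta> \<le> (real r * ((1 - \<eta>) * (- ln ?Z / \<delta>))) / real m
       - ((b * \<kappa> + (ln (real (d ^ n) / \<eta>))\<^sup>2 / b) / 2 + \<kappa> / \<eta>
          - ((1 - \<eta>) * ln (1 - \<eta>) + \<eta> * ln \<eta> - \<eta> * ln (real (d ^ n))))"
      using \<theta> by linarith
    have "?Y = (\<Sum>j\<in>?K. (cmod (c \<Psi> j))\<^sup>2 powr 2)" by (intro sum.cong refl) (simp add: powr_numeral)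
    then have "?Y < T\<^sub>2" using \<Psi> unfolding B_def by simp
    then have "(real (d ^ n))\<^sup>2 * ?Y / \<kappa> \<le> (real (d ^ n))\<^sup>2 * T\<^sub>2 / \<kappa>"
      using \<kappa> by (intro divide_right_mono mult_left_mono) auto
    then have "ereal C \<le> ereal (1 - (real (d ^ n))\<^sup>2 * ?Y / \<kappa>)" using C by simp
    also have "\<dots> \<le> long_time_prob (\<lambda>t. \<theta> \<le> ?avg \<Psi> t)"
      using long_time_entropy[OF H(1) e gaps_inj[OF H(1) e H(3)] v v1 d m A r \<eta> b \<kappa> \<delta> _ avg_t[OF \<Psi>(1)]] th
      unfolding c_eq by simp
    finally show ?thesis using \<Psi>(1) by simp
  qed
  \<comment> \<open>The inclusion holds only almost everywhere, since \<open>good\<close> needs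
    normalised spins; the comparison is sound because \<open>?E\<close> is known to be
    measurable.\<close>
  have "prob (space ?M - (B (1 + \<delta>) T\<^sub>1 \<union> B 2 T\<^sub>2)) \<le> prob ?E"
  proof (rule finite_measure_mono_AE[OF _ E])
    show "AE \<Psi> in ?M. \<Psi> \<in> space ?M - (B (1 + \<delta>) T\<^sub>1 \<union> B 2 T\<^sub>2) \<longrightarrow> \<Psi> \<in> ?E"
      using AE_product_state_norm[OF d, of N] by eventually_elim (use good in blast)
  qed
  moreover have "prob (space ?M - (B (1 + \<delta>) T\<^sub>1 \<union> B 2 T\<^sub>2)) = 1 - prob (B (1 + \<delta>) T\<^sub>1 \<union> B 2 T\<^sub>2)"
    by (rule prob_compl) (use B in blast)
  moreover have "prob (B (1 + \<delta>) T\<^sub>1 \<union> B 2 T\<^sub>2) \<le> prob (B (1 + \<delta>) T\<^sub>1) + prob (B 2 T\<^sub>2)"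
    by (rule measure_Un_le[OF B B])
  ultimately show ?thesis using B1 B2 by linarith
qed

theorem theorem1:
  fixes d :: nat and \<epsilon> :: real
  assumes "d \<ge> 2" and "0 < \<epsilon>" and "\<epsilon> < 1"
  shows "\<exists>c>0. \<exists>N\<^sub>0::nat. \<forall>N\<ge>N\<^sub>0. \<forall>(m::nat) (n::nat) (A :: nat \<Rightarrow> nat set) (H :: complex mat).
    m > 0 \<and> n > 0 \<and> N dvd m * n \<and>
    real n \<le> (1 - \<epsilon>) * real N * ln ((real d + 1) / 2) / (2 * ln (real d)) \<and>
    (\<forall>j<m. A j \<subseteq> {..<N} \<and> card (A j) = n) \<and>
    (\<forall>s<N. card {j. j < m \<and> s \<in> A j} = m * n div N) \<and>
    H \<in> carrier_mat (d ^ N) (d ^ N) \<and> hermitian_mat H \<and> nondegenerate_gaps H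
    \<longrightarrow>
    measure (product_state_measure d N)
      {\<Psi> \<in> space (product_state_measure d N).
        long_time_prob (\<lambda>t.
          (1 / real m) * (\<Sum>j<m. von_neumann_entropy
              (reduced_state d N (A j) (evolved_state H (product_state d N \<Psi>) t)))
          \<ge> (1 - \<epsilon>) * real n * (\<Sum>k=2..d. 1 / real k))
        \<ge> ereal (1 - exp (- c * real N))}
    \<ge> 1 - exp (- c * real N)"
proof -
  define h where "h = (\<Sum>k=2..d. 1 / real k)"
  define \<Lambda> where "\<Lambda> = ln ((real d + 1) / 2)"
  define D where "D = ln (real d)"
  have d0: "d > 0" using assms(1) by simp
  have h: "h > 0" unfolding h_def by (intro sum_pos) (use assms(1) in auto)
  have \<Lambda>: "\<Lambda> > 0" unfolding \<Lambda>_def using assms(1) by simp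
  have D: "D > 0" unfolding D_def using assms(1) by simp
  \<comment> \<open>The cost of mixing is a binary entropy plus \<open>n * \<eta> * D\<close>. Both
    vanish relative to \<open>n\<close> as \<open>\<eta>\<close> tends to 0, so
    \<open>\<eta>\<close> can be fixed from \<open>d\<close> and \<open>\<epsilon>\<close>
    alone.\<close>
  have "((\<lambda>\<eta>::real. \<eta> * D - ((1 - \<eta>) * ln (1 - \<eta>) + \<eta> * ln \<eta>)) \<longlongrightarrow> 0) (at_right 0)"
    using D by real_asymp
  then have "eventually (\<lambda>\<eta>. \<eta> * D - ((1 - \<eta>) * ln (1 - \<eta>) + \<eta> * ln \<eta>) < \<epsilon> * h / 8) (at_right 0)"
    by (rule order_tendstoD(2)) (use h assms in simp)
  moreover have "eventually (\<lambda>\<eta>. \<eta> \<in> {0<..<\<epsilon> / 8}) (at_right (0::real))"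
    by (rule eventually_at_right_real) (use assms in simp)
  ultimately have ev0: "eventually (\<lambda>\<eta>. \<eta> * D - ((1 - \<eta>) * ln (1 - \<eta>) + \<eta> * ln \<eta>) < \<epsilon> * h / 8 \<and> \<eta> \<in> {0<..<\<epsilon> / 8}) (at_right 0)"
    by (rule eventually_conj)
  obtain \<eta> where \<eta>h: "\<eta> * D - ((1 - \<eta>) * ln (1 - \<eta>) + \<eta> * ln \<eta>) < \<epsilon> * h / 8" and \<eta>': "\<eta> \<in> {0<..<\<epsilon> / 8}"
    using eventually_happens'[OF trivial_limit_at_right_real ev0] by (elim exE conjE) (rule that)
  have \<eta>: "0 < \<eta>" "\<eta> < 1" "\<eta> \<le> \<epsilon> / 8" using \<eta>' assms by auto
  define \<delta> where "\<delta> = \<epsilon> / 8"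
  \<comment> \<open>The first entry keeps the loss \<open>c\<^sub>1 / \<delta>\<close> of entropy
    per spin, caused by the slack in \<open>T\<^sub>1\<close>, below
    \<open>\<epsilon> * h / 8\<close>. The second leaves room for
    \<open>c\<^sub>1 + c\<^sub>1 / 2 + c\<^sub>3\<close> within the spare exponent
    \<open>\<epsilon> * \<Lambda>\<close>.\<close>
  define c\<^sub>1 where "c\<^sub>1 = min (\<delta> * \<epsilon> * h / 8) (\<epsilon> * \<Lambda> / 8)"
  define c\<^sub>3 where "c\<^sub>3 = \<epsilon> * \<Lambda> / 4"
  \<comment> \<open>Since \<open>n \<le> N\<close>, the product \<open>real N * B\<close> bounds
    \<open>ln (real (d ^ n) / \<eta>)\<close> for every admissible \<open>n\<close>, so
    \<open>N\<^sub>0\<close> can be chosen before \<open>n\<close>.\<close>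
  define B where "B = D - ln \<eta>"
  have \<delta>: "\<delta> > 0" unfolding \<delta>_def using assms by simp
  have c\<^sub>1: "c\<^sub>1 > 0" "c\<^sub>1 \<le> \<delta> * \<epsilon> * h / 8" "c\<^sub>1 \<le> \<epsilon> * \<Lambda> / 8" unfolding c\<^sub>1_def using \<delta> h \<Lambda> assms by auto
  have c\<^sub>3: "c\<^sub>3 > 0" unfolding c\<^sub>3_def using \<Lambda> assms by simp
  have B: "B > 0" unfolding B_def using D \<eta> ln_less_zero[of \<eta>] by linarith
  have "((\<lambda>N::nat. (exp (- (c\<^sub>3 / 2) * real N) + (real N * B)\<^sup>2 * exp (- (c\<^sub>3 / 2) * real N)) / 2 + exp (- c\<^sub>3 * real N) / \<eta>) \<longlongrightarrow> 0) at_top"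
    using c\<^sub>3 B \<eta>(1) by real_asymp
  then have ev1: "eventually (\<lambda>N::nat. (exp (- (c\<^sub>3 / 2) * real N) + (real N * B)\<^sup>2 * exp (- (c\<^sub>3 / 2) * real N)) / 2 + exp (- c\<^sub>3 * real N) / \<eta> < \<epsilon> * h / 8) at_top"
    by (rule order_tendstoD(2)) (use h assms in simp)
  \<comment> \<open>Halving the rate absorbs the factor 2 of the union bound.\<close>
  have ev2: "eventually (\<lambda>N::nat. 2 * exp (- c\<^sub>1 * real N) \<le> exp (- (c\<^sub>1 / 2) * real N)) at_top"
    using c\<^sub>1(1) by real_asymp
  obtain N\<^sub>0 where N\<^sub>0: "\<forall>N\<ge>N\<^sub>0. 1 \<le> N \<and> 2 * exp (- c\<^sub>1 * real N) \<le> exp (- (c\<^sub>1 / 2) * real N) \<and>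
      (exp (- (c\<^sub>3 / 2) * real N) + (real N * B)\<^sup>2 * exp (- (c\<^sub>3 / 2) * real N)) / 2 + exp (- c\<^sub>3 * real N) / \<eta> < \<epsilon> * h / 8"
    using eventually_conj[OF eventually_ge_at_top[of 1] eventually_conj[OF ev2 ev1]] unfolding eventually_sequentially by (rule exE)
  show ?thesis
  proof (rule exI[of _ "c\<^sub>1 / 2"], rule conjI, use c\<^sub>1(1) in simp, rule exI[of _ N\<^sub>0], intro allI impI)
    fix N m n A H
    assume N: "N\<^sub>0 \<le> N" and asm: "m > 0 \<and> n > 0 \<and> N dvd m * n \<and>
      real n \<le> (1 - \<epsilon>) * real N * ln ((real d + 1) / 2) / (2 * ln (real d)) \<and>
      (\<forall>j<m. A j \<subseteq> {..<N} \<and> card (A j) = n) \<and>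
      (\<forall>s<N. card {j. j < m \<and> s \<in> A j} = m * n div N) \<and>
      H \<in> carrier_mat (d ^ N) (d ^ N) \<and> hermitian_mat H \<and> nondegenerate_gaps (H :: complex mat)"
    have m: "m > 0" and n: "n > 0" and dvd: "N dvd m * n" and nN: "real n \<le> (1 - \<epsilon>) * real N * \<Lambda> / (2 * D)"
      and A': "\<forall>j<m. A j \<subseteq> {..<N} \<and> card (A j) = n"
      and r': "\<forall>s<N. card {j. j < m \<and> s \<in> A j} = m * n div N"
      and H: "H \<in> carrier_mat (d ^ N) (d ^ N)" "hermitian_mat H" "nondegenerate_gaps H"
      using asm unfolding \<Lambda>_def D_def by - (elim conjE, assumption)+
    have A: "A j \<subseteq> {..<N}" "card (A j) = n" if "j < m" for j using A' that by auto
    have r: "card {j. j < m \<and> s \<in> A j} = m * n div N" if "s < N" for s using r'[rule_format, OF that] .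
    have N1: "N \<ge> 1" and small: "2 * exp (- c\<^sub>1 * real N) \<le> exp (- (c\<^sub>1 / 2) * real N)"
      and err: "(exp (- (c\<^sub>3 / 2) * real N) + (real N * B)\<^sup>2 * exp (- (c\<^sub>3 / 2) * real N)) / 2 + exp (- c\<^sub>3 * real N) / \<eta> < \<epsilon> * h / 8"
      using N\<^sub>0[rule_format, OF N] by - (elim conjE, assumption)+
    have n_le: "n \<le> N" using card_mono[OF finite_lessThan A(1)[OF m]] A(2)[OF m] by simp
    define T\<^sub>1 where "T\<^sub>1 = exp (c\<^sub>1 * real N - \<delta> / (1 + \<delta>) * h * real N)"
    define T\<^sub>2 where "T\<^sub>2 = exp (c\<^sub>1 * real N - \<Lambda> * real N)"
    \<comment> \<open>\<open>\<kappa>\<close> decays at rate \<open>c\<^sub>3\<close> and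
      \<open>b\<close> grows at half that rate, so \<open>b * \<kappa>\<close> and the squared
      logarithm divided by \<open>b\<close> are both exponentially small up to a polynomial
      factor.\<close>
    define b where "b = exp (c\<^sub>3 / 2 * real N)"
    define \<kappa> where "\<kappa> = exp (- c\<^sub>3 * real N)"
    let ?X = "- ln T\<^sub>1 / \<delta>"
    let ?err = "(b * \<kappa> + (ln (real (d ^ n) / \<eta>))\<^sup>2 / b) / 2 + \<kappa> / \<eta>
          - ((1 - \<eta>) * ln (1 - \<eta>) + \<eta> * ln \<eta> - \<eta> * ln (real (d ^ n)))"
    have X: "?X \<ge> real N * h * (1 - \<epsilon> / 4)"
    proof -
      have "1 - \<delta> \<le> 1 / (1 + \<delta>)" using \<delta> by (simp add: field_simps)
      then have 1: "h * real N * (1 - \<delta>) \<le> h * real N * (1 / (1 + \<delta>))" using h by (intro mult_left_mono) auto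
      have "c\<^sub>1 / \<delta> \<le> \<epsilon> * h / 8" using c\<^sub>1(2) \<delta> by (simp add: field_simps)
      then have 2: "c\<^sub>1 / \<delta> * real N \<le> \<epsilon> * h / 8 * real N" by (rule mult_right_mono) simp
      have "?X = (\<delta> / (1 + \<delta>) * h * real N) / \<delta> - (c\<^sub>1 * real N) / \<delta>"
        unfolding T\<^sub>1_def ln_exp minus_diff_eq diff_divide_distrib ..
      also have "\<dots> = h * real N * (1 / (1 + \<delta>)) - c\<^sub>1 / \<delta> * real N" using \<delta> by simp
      also have "\<dots> \<ge> h * real N * (1 - \<delta>) - \<epsilon> * h / 8 * real N" using 1 2 by linarith
      also have "h * real N * (1 - \<delta>) - \<epsilon> * h / 8 * real N = real N * h * (1 - \<epsilon> / 4)"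
        unfolding \<delta>_def by (simp add: algebra_simps)
      finally show ?thesis .
    qed
    \<comment> \<open>The loss \<open>3 * \<epsilon> / 8\<close> consists of
      \<open>\<epsilon> / 4\<close> from \<open>X\<close>, shared equally between
      \<open>\<delta>\<close> and \<open>c\<^sub>1\<close>, and at most
      \<open>\<epsilon> / 8\<close> from the factor \<open>1 - \<eta>\<close>. Together with the
      error \<open>\<epsilon> / 4\<close> below it stays within \<open>\<epsilon>\<close>.\<close>
    have main: "(real (m * n div N) * ((1 - \<eta>) * ?X)) / real m \<ge> real n * h * (1 - 3 * \<epsilon> / 8)"
    proof -
      have "(real (m * n div N) * ((1 - \<eta>) * ?X)) / real m = real n / real N * ((1 - \<eta>) * ?X)"
        using m unfolding real_of_nat_div[OF dvd] of_nat_mult by (simp only: times_divide_eq_left times_divide_eq_right mult.assoc divide_divide_eq_left' nonzero_mult_divide_mult_cancel_left of_nat_eq_0_iff not_gr_zero less_imp_neq[OF m, symmetric] simp_thms)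
      also have "\<dots> \<ge> real n / real N * ((1 - \<eta>) * (real N * h * (1 - \<epsilon> / 4)))"
        by (rule mult_left_mono[OF mult_left_mono[OF X]]) (use \<eta> in simp_all)
      also have "real n / real N * ((1 - \<eta>) * (real N * h * (1 - \<epsilon> / 4))) = real n * h * ((1 - \<eta>) * (1 - \<epsilon> / 4))"
        using N1 by simp
      also have "\<dots> \<ge> real n * h * (1 - 3 * \<epsilon> / 8)"
      proof (rule mult_left_mono)
        have "\<eta> * (\<epsilon> / 4) \<ge> 0" using \<eta> assms by simp
        moreover have "(1 - \<eta>) * (1 - \<epsilon> / 4) = 1 - \<epsilon> / 4 - \<eta> + \<eta> * (\<epsilon> / 4)"
          unfolding left_diff_distrib right_diff_distrib by simp
        ultimately show "1 - 3 * \<epsilon> / 8 \<le> (1 - \<eta>) * (1 - \<epsilon> / 4)" using \<eta>(3) by linarith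
      qed (use h in simp)
      finally show ?thesis .
    qed
    have err_le: "?err \<le> real n * h * (\<epsilon> / 4)"
    proof -
      have ln_dn: "ln (real (d ^ n)) = real n * D" unfolding D_def using d0 by (simp add: ln_realpow)
      have "ln (real (d ^ n) / \<eta>) = real n * D - ln \<eta>" using d0 \<eta> by (subst ln_div) (simp_all only: ln_dn, simp_all)
      moreover have "ln \<eta> < 0" using \<eta> by simp
      moreover have "real n * D \<le> real N * D" using n_le D by (intro mult_right_mono) auto
      moreover have "- ln \<eta> \<le> real N * - ln \<eta>" using mult_right_mono[of 1 "real N" "- ln \<eta>"] N1 \<open>ln \<eta> < 0\<close> by simp
      moreover have "0 \<le> real n * D" using D by simp
      ultimately have "0 \<le> ln (real (d ^ n) / \<eta>)" "ln (real (d ^ n) / \<eta>) \<le> real N * B"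
        unfolding B_def right_diff_distrib by linarith+
      then have "(ln (real (d ^ n) / \<eta>))\<^sup>2 \<le> (real N * B)\<^sup>2" by (intro power_mono)
      then have s1: "(ln (real (d ^ n) / \<eta>))\<^sup>2 * exp (- (c\<^sub>3 / 2) * real N) \<le> (real N * B)\<^sup>2 * exp (- (c\<^sub>3 / 2) * real N)"
        by (rule mult_right_mono) simp
      have s2: "b * \<kappa> = exp (- (c\<^sub>3 / 2) * real N)" unfolding b_def \<kappa>_def exp_add[symmetric] by (simp add: algebra_simps)
      have s3: "(ln (real (d ^ n) / \<eta>))\<^sup>2 / b = (ln (real (d ^ n) / \<eta>))\<^sup>2 * exp (- (c\<^sub>3 / 2) * real N)"
        unfolding b_def mult_minus_left exp_minus by (rule divide_inverse)
      have "(b * \<kappa> + (ln (real (d ^ n) / \<eta>))\<^sup>2 / b) / 2 + \<kappa> / \<eta>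
        \<le> (exp (- (c\<^sub>3 / 2) * real N) + (real N * B)\<^sup>2 * exp (- (c\<^sub>3 / 2) * real N)) / 2 + exp (- c\<^sub>3 * real N) / \<eta>"
        unfolding s2 s3 unfolding \<kappa>_def by (rule add_right_mono, rule divide_right_mono, rule add_left_mono, rule s1) simp
      then have 1: "(b * \<kappa> + (ln (real (d ^ n) / \<eta>))\<^sup>2 / b) / 2 + \<kappa> / \<eta> \<le> \<epsilon> * h / 8"
        by (rule order_trans[OF _ less_imp_le[OF err]])
      have ent0: "- ((1 - \<eta>) * ln (1 - \<eta>) + \<eta> * ln \<eta>) \<ge> 0"
      proof -
        have "(1 - \<eta>) * ln (1 - \<eta>) \<le> 0" "\<eta> * ln \<eta> \<le> 0" using \<eta> by (auto intro!: mult_nonneg_nonpos)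
        then show ?thesis by linarith
      qed
      \<comment> \<open>The binary entropy and the distance errors do not scale with
        \<open>n\<close>; \<open>n \<ge> 1\<close> allows them to be charged against multiples of
        \<open>real n\<close>.\<close>
      have n1: "1 \<le> real n" using n by simp
      have "- ((1 - \<eta>) * ln (1 - \<eta>) + \<eta> * ln \<eta> - \<eta> * (real n * D)) \<le> real n * (\<eta> * D - ((1 - \<eta>) * ln (1 - \<eta>) + \<eta> * ln \<eta>))"
        using mult_right_mono[OF n1 ent0] by (simp add: algebra_simps)
      also have "\<dots> \<le> real n * (\<epsilon> * h / 8)" using \<eta>h by (intro mult_left_mono) auto
      finally have 2: "- ((1 - \<eta>) * ln (1 - \<eta>) + \<eta> * ln \<eta> - \<eta> * (real n * D)) \<le> real n * (\<epsilon> * h / 8)" .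
      have "\<epsilon> * h / 8 \<le> real n * (\<epsilon> * h / 8)" using mult_right_mono[OF n1, of "\<epsilon> * h / 8"] h assms by simp
      then have "?err \<le> real n * (\<epsilon> * h / 8) + real n * (\<epsilon> * h / 8)" using 1 2 unfolding ln_dn by linarith
      also have "\<dots> = real n * h * (\<epsilon> / 4)" by simp
      finally show ?thesis .
    qed
    have "(1 - \<epsilon>) * real n * h = real n * h * (1 - \<epsilon>)" by simp
    also have "\<dots> \<le> real n * h * (1 - 3 * \<epsilon> / 8 - \<epsilon> / 4)"
      using h assms by (intro mult_left_mono) auto
    also have "\<dots> = real n * h * (1 - 3 * \<epsilon> / 8) - real n * h * (\<epsilon> / 4)" by (simp add: algebra_simps)
    also have "\<dots> \<le> (real (m * n div N) * ((1 - \<eta>) * ?X)) / real m - ?err"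
      by (rule diff_mono[OF main err_le])
    finally have \<theta>: "(1 - \<epsilon>) * real n * h \<le> (real (m * n div N) * ((1 - \<eta>) * ?X)) / real m - ?err"
      .
    have C: "1 - exp (- (c\<^sub>1 / 2) * real N) \<le> 1 - (real (d ^ n))\<^sup>2 * T\<^sub>2 / \<kappa>"
    proof -
      have dn: "real (d ^ n) = exp (real n * D)" unfolding D_def using d0 by (simp add: exp_of_nat_mult)
      have k: "x / \<kappa> = x * exp (c\<^sub>3 * real N)" for x
        unfolding \<kappa>_def mult_minus_left exp_minus divide_inverse inverse_inverse_eq ..
      have "(real (d ^ n))\<^sup>2 * T\<^sub>2 / \<kappa> = exp (real n * D + real n * D + (c\<^sub>1 * real N - \<Lambda> * real N) + c\<^sub>3 * real N)"
        unfolding dn k T\<^sub>2_def power2_eq_square exp_add ..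
      also have "\<dots> \<le> exp (- (c\<^sub>1 / 2) * real N)"
        unfolding exp_le_cancel_iff
      proof -
        \<comment> \<open>The size bound on the subsystems enters here: the squared dimension grows
          at most at rate \<open>(1 - \<epsilon>) * \<Lambda>\<close>, leaving the exponent
          \<open>\<epsilon> * \<Lambda>\<close> to pay for the slack in \<open>T\<^sub>2\<close>,
          for \<open>\<kappa>\<close>, and for the final decay.\<close>
        have "real n * (2 * D) \<le> (1 - \<epsilon>) * real N * \<Lambda>" using nN D by (simp add: pos_le_divide_eq)
        then have 1: "real n * D + real n * D \<le> \<Lambda> * real N - \<epsilon> * \<Lambda> * real N" by (simp add: algebra_simps)
        have "c\<^sub>1 + c\<^sub>1 / 2 + c\<^sub>3 \<le> \<epsilon> * \<Lambda>"
          using c\<^sub>1(3) mult_pos_pos[OF assms(2) \<Lambda>] unfolding c\<^sub>3_def by linarith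
        then have "(c\<^sub>1 + c\<^sub>1 / 2 + c\<^sub>3) * real N \<le> \<epsilon> * \<Lambda> * real N" by (rule mult_right_mono) simp
        then have 2: "c\<^sub>1 * real N + c\<^sub>1 / 2 * real N + c\<^sub>3 * real N \<le> \<epsilon> * \<Lambda> * real N" unfolding distrib_right .
        show "real n * D + real n * D + (c\<^sub>1 * real N - \<Lambda> * real N) + c\<^sub>3 * real N \<le> - (c\<^sub>1 / 2) * real N"
          using 1 2 unfolding mult_minus_left by linarith
      qed
      finally show ?thesis by simp
    qed
    have R1: "(real d * sphere_moment d (1 + \<delta>)) ^ N / T\<^sub>1 \<le> exp (- c\<^sub>1 * real N)"
    proof -
      have "(real d * sphere_moment d (1 + \<delta>)) ^ N \<le> exp (- (\<delta> / (1 + \<delta>)) * h) ^ N"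
        unfolding h_def using sphere_moment_harmonic[OF _ \<delta>, of d] sphere_moment_nonneg[OF d0, of "1 + \<delta>"] d0 \<delta>
        by (intro power_mono) auto
      also have "\<dots> = exp (real N * (- (\<delta> / (1 + \<delta>)) * h))" by (rule exp_of_nat_mult[symmetric])
      also have "real N * (- (\<delta> / (1 + \<delta>)) * h) = - c\<^sub>1 * real N + (c\<^sub>1 * real N - \<delta> / (1 + \<delta>) * h * real N)" by simp
      also have "exp \<dots> = exp (- c\<^sub>1 * real N) * T\<^sub>1" unfolding T\<^sub>1_def by (rule exp_add)
      finally show ?thesis unfolding T\<^sub>1_def by (simp only: pos_divide_le_eq exp_gt_zero)
    qed
    have R2: "(real d * sphere_moment d 2) ^ N / T\<^sub>2 \<le> exp (- c\<^sub>1 * real N)"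
    proof -
      have "real d * sphere_moment d 2 = exp (- \<Lambda>)"
        unfolding sphere_moment_two[OF d0] \<Lambda>_def exp_minus by simp
      then have "(real d * sphere_moment d 2) ^ N = exp (real N * - \<Lambda>)"
        unfolding exp_of_nat_mult by (rule arg_cong)
      also have "real N * - \<Lambda> = - c\<^sub>1 * real N + (c\<^sub>1 * real N - \<Lambda> * real N)" by simp
      finally show ?thesis unfolding T\<^sub>2_def exp_add by simp
    qed
    have "1 - exp (- (c\<^sub>1 / 2) * real N) \<le> 1 - (real d * sphere_moment d (1 + \<delta>)) ^ N / T\<^sub>1 - (real d * sphere_moment d 2) ^ N / T\<^sub>2"
      using R1 R2 small by linarith
    also have "\<dots> \<le> measure (product_state_measure d N)
      {\<Psi> \<in> space (product_state_measure d N).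
        long_time_prob (\<lambda>t. (1 / real m) * (\<Sum>j<m. von_neumann_entropy
              (reduced_state d N (A j) (evolved_state H (product_state d N \<Psi>) t))) \<ge> (1 - \<epsilon>) * real n * h) \<ge> ereal (1 - exp (- (c\<^sub>1 / 2) * real N))}"
    proof (rule high_probability_entropy[OF d0 m H A r \<eta>(1,2) _ _ \<delta> _ _ \<theta> C])
      show "b > 0" "\<kappa> > 0" "T\<^sub>1 > 0" "T\<^sub>2 > 0" unfolding b_def \<kappa>_def T\<^sub>1_def T\<^sub>2_def by simp_all
    qed
    finally show "1 - exp (- (c\<^sub>1 / 2) * real N) \<le> measure (product_state_measure d N)
      {\<Psi> \<in> space (product_state_measure d N).
        long_time_prob (\<lambda>t. (1 / real m) * (\<Sum>j<m. von_neumann_entropy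
              (reduced_state d N (A j) (evolved_state H (product_state d N \<Psi>) t))) \<ge> (1 - \<epsilon>) * real n * (\<Sum>k=2..d. 1 / real k)) \<ge> ereal (1 - exp (- (c\<^sub>1 / 2) * real N))}"
      unfolding h_def .
  qed
qed

end
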